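(* Let $k\ge 0$ be an integer and let $T\subset\mathbb R^3$ be a polyhedron. Denoting by $i_T:\mathcal P^k(T)\to\mathcal P^k(T)$ the identity operator, the following diagram commutes: $$\begin{array}{ccccccc} \mathcal P^{k+1}(T)&\xrightarrow{\mathbf{grad}}&\boldsymbol{\mathcal N}^k(T)&\xrightarrow{\mathbf{curl}}&\boldsymbol{\mathcal{RT}}^k(T)&\xrightarrow{\mathrm{div}}&\mathcal P^k(T)\\ \downarrow{\scriptstyle \underline I_{\mathbf{grad},T}^k}&&\downarrow{\scriptstyle \underline{\mathbf I}_{\mathbf{curl},T}^k}&&\downarrow{\scriptstyle \underline{\mathbf I}_{\mathrm{div},T}^k}&&\downarrow{\scriptstyle i_T}\\ \underline X_{\mathbf{grad},T}^k&\xrightarrow{\underline{\mathbf G}_T^k}&\underline{\mathbf X}_{\mathbf{curl},T}^k&\xrightarrow{\underline{\mathbf C}_T^k}&\underline{\mathbf X}_{\mathrm{div},T}^k&\xrightarrow{D_T^k}&\mathcal P^k(T) \end{array}$$ that is, $\underline{\mathbf G}_T^k(\underline I_{\mathbf{grad},T}^kq)=\underline{\mathbf I}_{\mathbf{curl},T}^k(\mathbf{grad}\,q)$ for all $q\in\mathcal P^{k+1}(T)$, $\underline{\mathbf C}_T^k(\underline{\mathbf I}_{\mathbf{curl},T}^k\mathbf v)=\underline{\mathbf I}_{\mathrm{div},T}^k(\mathbf{curl}\,\mathbf v)$ for all $\mathbf v\in\boldsymbol{\mathcal N}^k(T)$, and $D_T^k(\underline{\mathbf I}_{\mathrm{div},T}^k\mathbf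 v)=i_T(\mathrm{div}\,\mathbf v)$ for all $\mathbf v\in\boldsymbol{\mathcal{RT}}^k(T)$.
   Context: Geometry. A polyhedron $T$ is a connected set that is the interior of a finite union of tetrahedra; $T$ is assumed simply connected with connected Lipschitz-continuous boundary. $\mathcal F_T$, $\mathcal E_T$, $\mathcal V_T$ are its sets of planar polygonal faces, edges and vertices; $\partial^2T=\bigcup_{E\in\mathcal E_T}\overline E$; each edge is shared by exactly two faces. Each face $F$ is a polygon (connected interior, in its plane, of a finite union of triangles), simply connected with connected Lipschitz boundary, with edges $\mathcal E_F$, vertices $\mathcal V_F$ and a fixed unit normal $\mathbf n_F$; $\omega_{TF}=1$ if $\mathbf n_F$ points out of $T$, $-1$ otherwise. Tangent fields on $F$ are regarded as $\mathbb R^2$-valued. Each edge $E$ has a fixed unit tangent $\mathbf t_E$, and $'$ denotes derivative along $\mathbf t_E$. For $E\in\mathcal E_F$, $\mathbf n_{FE}$ is the unit normal to $E$ in the plane of $F$ such that $(\mathbf t_E,\mathbf n_{FE},\mathbf n_F)$ is right-handed; $\partial F$ is oriented counter-clockwise with respect to $\mathbf n_F$ and $\omega_{FE}=1$ if $\mathbf t_E$ is opposite to the orientation of $\partial F$, $-1$ otherwise (so $\omega_{FE}\mathbf n_{FE}$ points out of $F$). $\mathbf x_V$ is the coordinate vector of the vertex $V$. Polynomials. $\mathcal P^\ell(X)$: restrictions to $X$ (edge, face, polyhedron) of polynomials of total degree $\le\ell$, $\mathcal P^{-1}(X)=\{0\}$; $\mathcal P^{0,\ell}(X)$: its zero-average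 subspace; $\pi_{\mathcal P,X}^\ell$: $L^2$-orthogonal projector on $\mathcal P^\ell(X)$. $\mathcal P^\ell(\mathcal F_T)$, $\mathcal P^\ell(\mathcal E_T)$, $\mathcal P^\ell(\mathcal E_F)$: functions on $\partial T$, $\partial^2T$, $\partial F$ that are in $\mathcal P^\ell$ on each face (resp. edge), without continuity; $\mathcal P_c^\ell(\partial^2T)=\mathcal P^\ell(\mathcal E_T)\cap C^0(\partial^2T)$, $\mathcal P_c^\ell(\partial F)=\mathcal P^\ell(\mathcal E_F)\cap C^0(\partial F)$. $\mathbf{grad}_F,\mathrm{div}_F$: tangential gradient and divergence on $F$; $\mathbf{rot}_Fr=\varrho_{-\pi/2}(\mathbf{grad}_Fr)$ with $\varrho_{-\pi/2}$ the rotation of angle $-\pi/2$ in the oriented plane of $F$. $\boldsymbol{\mathcal R}^\ell(F)=\mathbf{rot}_F\mathcal P^{\ell+1}(F)$, $\boldsymbol{\mathcal R}^\ell(T)=\mathbf{curl}\,\mathcal P^{\ell+1}(T)^3$, $\boldsymbol{\mathcal G}^\ell(T)=\mathbf{grad}\,\mathcal P^{\ell+1}(T)$; $\boldsymbol{\mathcal R}^\ell(F)^\perp$, $\boldsymbol{\mathcal R}^\ell(T)^\perp$, $\boldsymbol{\mathcal G}^\ell(T)^\perp$ are their $L^2$-orthogonal complements in $\mathcal P^\ell(F)^2$, $\mathcal P^\ell(T)^3$, $\mathcal P^\ell(T)^3$. The $L^2$-orthogonal projectors on $\boldsymbol{\mathcal R}^\ell(X)$, $\boldsymbol{\mathcal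 R}^\ell(X)^\perp$, $\boldsymbol{\mathcal G}^\ell(T)$, $\boldsymbol{\mathcal G}^\ell(T)^\perp$ are $\boldsymbol\pi_{\mathcal R,X}^\ell$, $\boldsymbol\pi_{\mathcal R,X}^{\perp,\ell}$, $\boldsymbol\pi_{\mathcal G,T}^\ell$, $\boldsymbol\pi_{\mathcal G,T}^{\perp,\ell}$. With $\overline{\mathbf x}_T=\frac1{|T|}\int_T\mathbf x\,d\mathbf x$ the centroid of $T$, the Nédélec space is $\boldsymbol{\mathcal N}^k(T)=\mathcal P^k(T)^3+(\mathbf x-\overline{\mathbf x}_T)\times\mathcal P^k(T)^3$ and the Raviart–Thomas–Nédélec space is $\boldsymbol{\mathcal{RT}}^k(T)=\mathcal P^k(T)^3+(\mathbf x-\overline{\mathbf x}_T)\mathcal P^k(T)$. Spaces. $\underline X_{\mathbf{grad},T}^k=\mathcal P^{k-1}(T)\times\mathcal P^{k-1}(\mathcal F_T)\times\mathcal P_c^{k+1}(\partial^2T)$, elements $\underline q_T=(q_T,q_{\partial T},q_{\partial^2T})$, $q_F=(q_{\partial T})_{|F}$, $q_E=(q_{\partial^2T})_{|E}$. $\underline{\mathbf X}_{\mathbf{curl},T}^k=\big(\boldsymbol{\mathcal R}^{k-1}(T)\oplus\boldsymbol{\mathcal R}^k(T)^\perp\big)\times\prod_{F\in\mathcal F_T}\big(\boldsymbol{\mathcal R}^{k-1}(F)\oplus\boldsymbol{\mathcal R}^k(F)^\perp\big)\times\mathcal P^k(\mathcal E_T)$, elements $\underline{\mathbf v}_T=(\mathbf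 v_T=\mathbf v_{\mathcal R,T}+\mathbf v_{\mathcal R,T}^\perp,(\mathbf v_F=\mathbf v_{\mathcal R,F}+\mathbf v_{\mathcal R,F}^\perp)_{F\in\mathcal F_T},v_{\partial^2T})$. $\underline{\mathbf X}_{\mathrm{div},T}^k=\big(\boldsymbol{\mathcal G}^{k-1}(T)\oplus\boldsymbol{\mathcal G}^k(T)^\perp\big)\times\mathcal P^k(\mathcal F_T)$, elements $\underline{\mathbf v}_T=(\mathbf v_T=\mathbf v_{\mathcal G,T}+\mathbf v_{\mathcal G,T}^\perp,v_{\partial T})$, $v_F=(v_{\partial T})_{|F}$. Face spaces: $\underline X_{\mathbf{grad},F}^k=\mathcal P^{k-1}(F)\times\mathcal P_c^{k+1}(\partial F)$, elements $\underline q_F=(q_F,q_{\partial F})$; $\underline{\mathbf X}_{\mathrm{rot},F}^k=(\boldsymbol{\mathcal R}^{k-1}(F)\oplus\boldsymbol{\mathcal R}^k(F)^\perp)\times\mathcal P^k(\mathcal E_F)$, elements $\underline{\mathbf v}_F=(\mathbf v_F=\mathbf v_{\mathcal R,F}+\mathbf v_{\mathcal R,F}^\perp,v_{\partial F})$. The restrictions of $\underline q_T$ and $\underline{\mathbf v}_T\in\underline{\mathbf X}_{\mathbf{curl},T}^k$ to a face $F$ are $\underline q_F=(q_F,(q_{\partial^2T})_{|\partial F})$ and $\underline{\mathbf v}_F=(\mathbf v_F,(v_{\partial^2T})_{|\partial F})$; face operators are applied to elements of the spaces on $T$ through these restrictions. Interpolators. For $q\in C^0(\overline T)$, $\underline I_{\mathbf{grad},T}^kq=(q_T,q_{\partial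 T},q_{\partial^2T})$ with $q_T=\pi_{\mathcal P,T}^{k-1}q$, $q_F=\pi_{\mathcal P,F}^{k-1}q_{|F}$ for all $F\in\mathcal F_T$, $\pi_{\mathcal P,E}^{k-1}q_E=\pi_{\mathcal P,E}^{k-1}q_{|E}$ for all $E\in\mathcal E_T$, $q_{\partial^2T}(\mathbf x_V)=q(\mathbf x_V)$ for all $V\in\mathcal V_T$. For $q\in C^0(\overline F)$, $\underline I_{\mathbf{grad},F}^kq=(q_F,q_{\partial F})$ with $q_F=\pi_{\mathcal P,F}^{k-1}q$, $\pi_{\mathcal P,E}^{k-1}(q_{\partial F})_{|E}=\pi_{\mathcal P,E}^{k-1}q_{|E}$ for all $E\in\mathcal E_F$, $q_{\partial F}(\mathbf x_V)=q(\mathbf x_V)$ for all $V\in\mathcal V_F$. For $\mathbf v\in C^0(\overline T)^3$, with $\mathbf v_{\tau,F}=\mathbf n_F\times(\mathbf v_{|F}\times\mathbf n_F)$ (the orthogonal projection of $\mathbf v_{|F}$ on the plane of $F$), $\underline{\mathbf I}_{\mathbf{curl},T}^k\mathbf v=\big(\boldsymbol\pi_{\mathcal R,T}^{k-1}\mathbf v+\boldsymbol\pi_{\mathcal R,T}^{\perp,k}\mathbf v,(\boldsymbol\pi_{\mathcal R,F}^{k-1}\mathbf v_{\tau,F}+\boldsymbol\pi_{\mathcal R,F}^{\perp,k}\mathbf v_{\tau,F})_{F\in\mathcal F_T},(\pi_{\mathcal P,E}^k(\mathbf v\cdot\mathbf t_E))_{E\in\mathcal E_T}\big)$ and $\underline{\mathbf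 I}_{\mathrm{div},T}^k\mathbf v=\big(\boldsymbol\pi_{\mathcal G,T}^{k-1}\mathbf v+\boldsymbol\pi_{\mathcal G,T}^{\perp,k}\mathbf v,(\pi_{\mathcal P,F}^k(\mathbf v\cdot\mathbf n_F))_{F\in\mathcal F_T}\big)$. Edge and face operators. $G_E^k\underline q_T=(q_E)'$. The full face gradient $\mathring{\mathbf G}_F^k\underline q_F\in\mathcal P^k(F)^2$ satisfies $\int_F\mathring{\mathbf G}_F^k\underline q_F\cdot\mathbf w_F=-\int_Fq_F\,\mathrm{div}_F\mathbf w_F+\sum_{E\in\mathcal E_F}\omega_{FE}\int_Eq_{\partial F}(\mathbf w_F\cdot\mathbf n_{FE})$ for all $\mathbf w_F\in\mathcal P^k(F)^2$; $\mathbf G_{\mathcal R,F}^{k-1}=\boldsymbol\pi_{\mathcal R,F}^{k-1}\mathring{\mathbf G}_F^k$ and $\mathbf G_{\mathcal R,F}^{\perp,k}=\boldsymbol\pi_{\mathcal R,F}^{\perp,k}\mathring{\mathbf G}_F^k$. The face curl $C_F^k\underline{\mathbf v}_F\in\mathcal P^k(F)$ satisfies $\int_FC_F^k\underline{\mathbf v}_F\,r_F=\int_F\mathbf v_{\mathcal R,F}\cdot\mathbf{rot}_Fr_F-\sum_{E\in\mathcal E_F}\omega_{FE}\int_Ev_{\partial F}r_F$ for all $r_F\in\mathcal P^k(F)$. Scalar traces: for each $F$, $\gamma_F^{k+1}:\underline X_{\mathbf{grad},F}^k\to\mathcal P^{k+1}(F)$ is any fixed linear operator such that $\gamma_F^{k+1}(\underline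 I_{\mathbf{grad},F}^kq)=q$ for all $q\in\mathcal P^{k+1}(F)$ and $\pi_{\mathcal P,F}^{k-1}(\gamma_F^{k+1}\underline q_F)=q_F$ for all $\underline q_F$. Tangential traces: $\boldsymbol\gamma_{\mathrm t,F}^k\underline{\mathbf v}_F\in\mathcal P^k(F)^2$ is the unique polynomial such that $\int_F\boldsymbol\gamma_{\mathrm t,F}^k\underline{\mathbf v}_F\cdot\mathbf{rot}_Fr_F=\int_FC_F^k\underline{\mathbf v}_F\,r_F+\sum_{E\in\mathcal E_F}\omega_{FE}\int_Ev_{\partial F}r_F$ for all $r_F\in\mathcal P^{0,k+1}(F)$ and $\int_F\boldsymbol\gamma_{\mathrm t,F}^k\underline{\mathbf v}_F\cdot\mathbf w_F=\int_F\mathbf v_{\mathcal R,F}^\perp\cdot\mathbf w_F$ for all $\mathbf w_F\in\boldsymbol{\mathcal R}^k(F)^\perp$. Volume operators. Full gradient $\mathring{\mathbf G}_T^k\underline q_T\in\mathcal P^k(T)^3$: $\int_T\mathring{\mathbf G}_T^k\underline q_T\cdot\mathbf v_T=-\int_Tq_T\,\mathrm{div}\,\mathbf v_T+\sum_{F\in\mathcal F_T}\omega_{TF}\int_F\gamma_F^{k+1}\underline q_F(\mathbf v_T\cdot\mathbf n_F)$ for all $\mathbf v_T\in\mathcal P^k(T)^3$. Discrete gradient: $\underline{\mathbf G}_T^k\underline q_T=\big(\boldsymbol\pi_{\mathcal R,T}^{k-1}\mathring{\mathbf G}_T^k\underline q_T+\boldsymbol\pi_{\mathcal R,T}^{\perp,k}\mathring{\mathbf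 G}_T^k\underline q_T,(\mathbf G_{\mathcal R,F}^{k-1}\underline q_F+\mathbf G_{\mathcal R,F}^{\perp,k}\underline q_F)_{F\in\mathcal F_T},(G_E^k\underline q_T)_{E\in\mathcal E_T}\big)$. Full curl $\mathring{\mathbf C}_T^k\underline{\mathbf v}_T\in\mathcal P^k(T)^3$: $\int_T\mathring{\mathbf C}_T^k\underline{\mathbf v}_T\cdot\mathbf w_T=\int_T\mathbf v_T\cdot\mathbf{curl}\,\mathbf w_T+\sum_{F\in\mathcal F_T}\omega_{TF}\int_F\boldsymbol\gamma_{\mathrm t,F}^k\underline{\mathbf v}_F\cdot(\mathbf w_T\times\mathbf n_F)$ for all $\mathbf w_T\in\mathcal P^k(T)^3$. Discrete curl: $\underline{\mathbf C}_T^k\underline{\mathbf v}_T=\big(\boldsymbol\pi_{\mathcal G,T}^{k-1}\mathring{\mathbf C}_T^k\underline{\mathbf v}_T+\boldsymbol\pi_{\mathcal G,T}^{\perp,k}\mathring{\mathbf C}_T^k\underline{\mathbf v}_T,(C_F^k\underline{\mathbf v}_F)_{F\in\mathcal F_T}\big)$. Discrete divergence $D_T^k:\underline{\mathbf X}_{\mathrm{div},T}^k\to\mathcal P^k(T)$: $\int_TD_T^k\underline{\mathbf v}_T\,q_T=-\int_T\mathbf v_T\cdot\mathbf{grad}\,q_T+\sum_{F\in\mathcal F_T}\omega_{TF}\int_Fv_Fq_T$ for all $q_T\in\mathcal P^k(T)$. *)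

theory Defs
  imports "HOL-Analysis.Analysis"
begin

type_synonym point = "real^3"
type_synonym sfield = "point \<Rightarrow> real"
type_synonym vfield = "point \<Rightarrow> point"


section \<open>Polyhedra\<close>

definition direction :: "point set \<Rightarrow> point set" where
  "direction X = {u - v | u v. u \<in> affine hull X \<and> v \<in> affine hull X}"

text \<open>Near each boundary point, \<open>X\<close> is the strict epigraph (in the direction \<open>u\<close>, inside its own
  affine hull) of a Lipschitz function of the component orthogonal to \<open>u\<close>.\<close>

definition lipschitz_boundary :: "point set \<Rightarrow> bool" where
  "lipschitz_boundary X \<longleftrightarrow>
     (\<forall>x\<in>rel_frontier X. \<exists>u\<in>direction X. \<exists>r>0. \<exists>L g. norm u = 1 \<and> L-lipschitz_on UNIV g \<and>
        (\<forall>y\<in>affine hull X \<inter> ball x r. y \<in> X \<longleftrightarrow> g (y - (y \<bullet> u) *\<^sub>R u) < y \<bullet> u))"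

text \<open>For \<open>d = 3\<close> these are the polyhedra, for \<open>d = 2\<close> the polygons (the interior being taken in the
  plane of the polygon); for \<open>d = 3\<close>, \<^const>\<open>rel_interior\<close> and \<^const>\<open>rel_frontier\<close> coincide with
  \<^const>\<open>interior\<close> and \<^const>\<open>frontier\<close>.\<close>

definition polytopal_domain :: "int \<Rightarrow> point set \<Rightarrow> bool" where
  "polytopal_domain d X \<longleftrightarrow>
     (\<exists>\<S>. finite \<S> \<and> (\<forall>S\<in>\<S>. d simplex S) \<and> aff_dim (\<Union>\<S>) = d \<and> X = rel_interior (\<Union>\<S>)) \<and>
     connected X \<and> simply_connected X \<and> connected (rel_frontier X) \<and> lipschitz_boundary X"

text \<open>The faces and edges are part of the data, so that coplanar adjacent faces and collinear
  adjacent edges are allowed. Faces and edges are relatively open.\<close>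

record element =
  body :: "point set"
  faces :: "point set set"
  edges :: "point set set"
  normal :: "point set \<Rightarrow> point"
  tangent :: "point set \<Rightarrow> point"

definition face_edges :: "element \<Rightarrow> point set \<Rightarrow> point set set" where
  "face_edges T F = {E \<in> edges T. E \<subseteq> rel_frontier F}"

definition vertices :: "point set set \<Rightarrow> point set" where
  "vertices \<E> = (\<Union>E\<in>\<E>. closure E - E)"

definition skeleton :: "point set set \<Rightarrow> point set" where
  "skeleton \<E> = (\<Union>E\<in>\<E>. closure E)"

definition polyhedral :: "element \<Rightarrow> bool" where
  "polyhedral T \<longleftrightarrow>
     polytopal_domain 3 (body T) \<and> finite (faces T) \<and> finite (edges T) \<and>
     disjoint (faces T \<union> edges T \<union> (\<lambda>V. {V}) ` vertices (edges T)) \<and>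
     frontier (body T) = (\<Union>F\<in>faces T. closure F) \<and>
     (\<forall>F\<in>faces T. polytopal_domain 2 F \<and> rel_frontier F = skeleton (face_edges T F) \<and>
        norm (normal T F) = 1 \<and> (\<forall>v\<in>direction F. normal T F \<bullet> v = 0)) \<and>
     (\<forall>E\<in>edges T. (\<exists>a b. a \<noteq> b \<and> E = open_segment a b) \<and>
        norm (tangent T E) = 1 \<and> tangent T E \<in> direction E \<and>
        card {F \<in> faces T. E \<in> face_edges T F} = 2)"

definition points_out :: "point set \<Rightarrow> point set \<Rightarrow> point \<Rightarrow> bool" where
  "points_out X Y v \<longleftrightarrow>
     (\<forall>x\<in>Y. \<forall>\<^sub>F s in at_right 0. x - s *\<^sub>R v \<in> X \<and> x + s *\<^sub>R v \<notin> X)"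

definition \<omega>\<^sub>T :: "element \<Rightarrow> point set \<Rightarrow> real" where
  "\<omega>\<^sub>T T F = (if points_out (body T) F (normal T F) then 1 else -1)"

text \<open>Travelling counter-clockwise along the boundary of \<open>F\<close>, as seen from the tip of the normal, one
  has \<open>F\<close> on the left and its exterior on the right, where \<open>\<tau> \<times> n\<close> points.\<close>

definition counterclockwise :: "element \<Rightarrow> point set \<Rightarrow> point set \<Rightarrow> point \<Rightarrow> bool" where
  "counterclockwise T F E \<tau> \<longleftrightarrow> points_out F E (cross3 \<tau> (normal T F))"

definition \<omega>\<^sub>F :: "element \<Rightarrow> point set \<Rightarrow> point set \<Rightarrow> real" where
  "\<omega>\<^sub>F T F E = (if counterclockwise T F E (- tangent T E) then 1 else -1)"

definition edge_normal :: "element \<Rightarrow> point set \<Rightarrow> point set \<Rightarrow> point" where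
  "edge_normal T F E = cross3 (normal T F) (tangent T E)"


section \<open>Integration and orthogonal projection\<close>

text \<open>Lebesgue measure on the affine hull of an edge, a face or a polyhedron, transported by an
  arbitrary isometric parametrization (on which it does not depend).\<close>

definition isometric_lborel :: "'a::euclidean_space itself \<Rightarrow> point set \<Rightarrow> point measure" where
  "isometric_lborel _ X = distr (lborel :: 'a measure) borel
     (SOME \<phi>. (\<forall>x y. dist (\<phi> x) (\<phi> y) = dist x y) \<and> range \<phi> = affine hull X)"

definition hull_measure :: "point set \<Rightarrow> point measure" where
  "hull_measure X =
     (if aff_dim X = 1 then isometric_lborel TYPE(real) X
      else if aff_dim X = 2 then isometric_lborel TYPE(real^2) X
      else lborel)"

definition integ :: "point set \<Rightarrow> sfield \<Rightarrow> real" where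
  "integ X f = (LINT x:X|hull_measure X. f x)"

definition ip :: "point set \<Rightarrow> (point \<Rightarrow> 'b::real_inner) \<Rightarrow> (point \<Rightarrow> 'b) \<Rightarrow> real" where
  "ip X f g = integ X (\<lambda>x. f x \<bullet> g x)"

definition representer ::
  "point set \<Rightarrow> (point \<Rightarrow> 'b::real_inner) set \<Rightarrow> ((point \<Rightarrow> 'b) \<Rightarrow> real) \<Rightarrow> point \<Rightarrow> 'b" where
  "representer X W L = (THE p. p \<in> W \<and> (\<forall>w\<in>W. ip X p w = L w))"

definition proj ::
  "point set \<Rightarrow> (point \<Rightarrow> 'b::real_inner) set \<Rightarrow> (point \<Rightarrow> 'b) \<Rightarrow> point \<Rightarrow> 'b" where
  "proj X W f = representer X W (ip X f)"

definition orth_compl ::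
  "point set \<Rightarrow> (point \<Rightarrow> 'b::real_inner) set \<Rightarrow> (point \<Rightarrow> 'b) set \<Rightarrow> (point \<Rightarrow> 'b) set" where
  "orth_compl X U W = {u \<in> U. \<forall>w\<in>W. ip X u w = 0}"

definition sum_space ::
  "(point \<Rightarrow> 'b::real_inner) set \<Rightarrow> (point \<Rightarrow> 'b) set \<Rightarrow> (point \<Rightarrow> 'b) set" where
  "sum_space U W = {\<lambda>x. u x + w x | u w. u \<in> U \<and> w \<in> W}"

text \<open>The component in \<open>U\<close> of an element of the direct sum of \<open>U\<close> and \<open>W\<close>.\<close>

definition component ::
  "(point \<Rightarrow> 'b::real_inner) set \<Rightarrow> (point \<Rightarrow> 'b) set \<Rightarrow> (point \<Rightarrow> 'b) \<Rightarrow> point \<Rightarrow> 'b" where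
  "component U W v = (THE u. u \<in> U \<and> (\<exists>w\<in>W. v = (\<lambda>x. u x + w x)))"


section \<open>Fields, polynomials and differential operators\<close>

text \<open>A field on \<open>X\<close> is represented by its extension by zero outside \<open>X\<close>. Since the sets \<open>X\<close> below
  are relatively open, boundary values of a field have to be taken through \<open>ext\<close>, its continuous
  extension to the closure.\<close>

definition restr :: "point set \<Rightarrow> (point \<Rightarrow> 'b::zero) \<Rightarrow> point \<Rightarrow> 'b" where
  "restr X f = (\<lambda>x. if x \<in> X then f x else 0)"

definition ext :: "point set \<Rightarrow> (point \<Rightarrow> 'b::real_normed_vector) \<Rightarrow> point \<Rightarrow> 'b" where
  "ext X f = restr (closure X) (\<lambda>x. Lim (at x within X) f)"

text \<open>The field equal to \<open>f X\<close> on each member \<open>X\<close> of a finite disjoint family.\<close>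

definition glue :: "point set set \<Rightarrow> (point set \<Rightarrow> sfield) \<Rightarrow> sfield" where
  "glue \<X> f = (\<lambda>x. \<Sum>X\<in>\<X>. restr X (f X) x)"

definition polys :: "int \<Rightarrow> sfield set" where
  "polys l = {p. \<exists>c. p = (\<lambda>x. \<Sum>\<alpha> | int (\<Sum>i\<in>UNIV. \<alpha> i) \<le> l. c \<alpha> * (\<Prod>i\<in>UNIV. (x $ i) ^ \<alpha> i))}"

definition pol :: "point set \<Rightarrow> int \<Rightarrow> sfield set" where
  "pol X l = restr X ` polys l"

definition pol0 :: "point set \<Rightarrow> int \<Rightarrow> sfield set" where
  "pol0 X l = {p \<in> pol X l. integ X p = 0}"

text \<open>On a polyhedron the condition on the direction is void; on a face this is the space of tangent
  polynomial fields, that is, of \<open>\<real>\<^sup>2\<close>-valued polynomials in coordinates of its plane.\<close>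

definition vpol :: "point set \<Rightarrow> int \<Rightarrow> vfield set" where
  "vpol X l = {v. (\<forall>i. (\<lambda>x. v x $ i) \<in> pol X l) \<and> (\<forall>x. v x \<in> direction X)}"

definition pw_pol :: "point set set \<Rightarrow> int \<Rightarrow> sfield set" where
  "pw_pol \<X> l = {f. (\<forall>X\<in>\<X>. restr X f \<in> pol X l) \<and> (\<forall>x. x \<notin> \<Union>\<X> \<longrightarrow> f x = 0)}"

definition cont_pol :: "point set set \<Rightarrow> int \<Rightarrow> sfield set" where
  "cont_pol \<E> l = {f. (\<forall>E\<in>\<E>. restr E f \<in> pol E l) \<and> continuous_on (skeleton \<E>) f \<and>
     (\<forall>x. x \<notin> skeleton \<E> \<longrightarrow> f x = 0)}"

text \<open>The gradient on a polyhedron, the tangential gradient on a face or an edge; \<open>dvg\<close> is likewise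
  the divergence or the tangential divergence.\<close>

definition grad :: "point set \<Rightarrow> sfield \<Rightarrow> vfield" where
  "grad X f = restr X (\<lambda>x. THE g. g \<in> direction X \<and>
     (f has_derivative (\<lambda>h. g \<bullet> h)) (at x within X))"

definition dvg :: "point set \<Rightarrow> vfield \<Rightarrow> sfield" where
  "dvg X v = (\<lambda>x. \<Sum>i\<in>UNIV. grad X (\<lambda>y. v y $ i) x $ i)"

definition curl :: "point set \<Rightarrow> vfield \<Rightarrow> vfield" where
  "curl X v = (\<lambda>x. let D = (\<lambda>i j. grad X (\<lambda>y. v y $ j) x $ i)
     in vector [D 2 3 - D 3 2, D 3 1 - D 1 3, D 1 2 - D 2 1])"

text \<open>Rotation by \<open>-\<pi>/2\<close> in the plane oriented by \<open>n\<close> is the map \<open>v \<mapsto> v \<times> n\<close>.\<close>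

definition rot :: "element \<Rightarrow> point set \<Rightarrow> sfield \<Rightarrow> vfield" where
  "rot T F r = (\<lambda>x. cross3 (grad F r x) (normal T F))"

definition R\<^sub>F :: "element \<Rightarrow> point set \<Rightarrow> int \<Rightarrow> vfield set" where
  "R\<^sub>F T F l = rot T F ` pol F (l + 1)"

definition R\<^sub>F_perp :: "element \<Rightarrow> point set \<Rightarrow> int \<Rightarrow> vfield set" where
  "R\<^sub>F_perp T F l = orth_compl F (vpol F l) (R\<^sub>F T F l)"

definition R\<^sub>T :: "element \<Rightarrow> int \<Rightarrow> vfield set" where
  "R\<^sub>T T l = curl (body T) ` vpol (body T) (l + 1)"

definition R\<^sub>T_perp :: "element \<Rightarrow> int \<Rightarrow> vfield set" where
  "R\<^sub>T_perp T l = orth_compl (body T) (vpol (body T) l) (R\<^sub>T T l)"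

definition G\<^sub>T :: "element \<Rightarrow> int \<Rightarrow> vfield set" where
  "G\<^sub>T T l = grad (body T) ` pol (body T) (l + 1)"

definition G\<^sub>T_perp :: "element \<Rightarrow> int \<Rightarrow> vfield set" where
  "G\<^sub>T_perp T l = orth_compl (body T) (vpol (body T) l) (G\<^sub>T T l)"

definition centroid :: "point set \<Rightarrow> point" where
  "centroid X = (1 / measure lborel X) *\<^sub>R (LINT x:X|lborel. x)"

definition Nedelec :: "element \<Rightarrow> nat \<Rightarrow> vfield set" where
  "Nedelec T k = {\<lambda>x. v x + cross3 (x - centroid (body T)) (w x) | v w.
     v \<in> vpol (body T) (int k) \<and> w \<in> vpol (body T) (int k)}"

definition RTN :: "element \<Rightarrow> nat \<Rightarrow> vfield set" where
  "RTN T k = {\<lambda>x. v x + r x *\<^sub>R (x - centroid (body T)) | v r.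
     v \<in> vpol (body T) (int k) \<and> r \<in> pol (body T) (int k)}"


section \<open>Discrete spaces\<close>

definition X_grad :: "element \<Rightarrow> nat \<Rightarrow> (sfield \<times> sfield \<times> sfield) set" where
  "X_grad T k = pol (body T) (int k - 1) \<times> pw_pol (faces T) (int k - 1) \<times>
     cont_pol (edges T) (int k + 1)"

definition X_curl :: "element \<Rightarrow> nat \<Rightarrow> (vfield \<times> (point set \<Rightarrow> vfield) \<times> sfield) set" where
  "X_curl T k = sum_space (R\<^sub>T T (int k - 1)) (R\<^sub>T_perp T (int k)) \<times>
     (\<Pi>\<^sub>E F\<in>faces T. sum_space (R\<^sub>F T F (int k - 1)) (R\<^sub>F_perp T F (int k))) \<times>
     pw_pol (edges T) (int k)"

definition X_div :: "element \<Rightarrow> nat \<Rightarrow> (vfield \<times> sfield) set" where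
  "X_div T k = sum_space (G\<^sub>T T (int k - 1)) (G\<^sub>T_perp T (int k)) \<times> pw_pol (faces T) (int k)"

definition X_grad\<^sub>F :: "element \<Rightarrow> nat \<Rightarrow> point set \<Rightarrow> (sfield \<times> sfield) set" where
  "X_grad\<^sub>F T k F = pol F (int k - 1) \<times> cont_pol (face_edges T F) (int k + 1)"

definition face_restr_grad :: "element \<Rightarrow> point set \<Rightarrow> sfield \<times> sfield \<times> sfield \<Rightarrow> sfield \<times> sfield" where
  "face_restr_grad T F = (\<lambda>(q_T, q_bd, q_sk). (restr F q_bd, restr (rel_frontier F) q_sk))"

definition face_restr_curl ::
  "element \<Rightarrow> point set \<Rightarrow> vfield \<times> (point set \<Rightarrow> vfield) \<times> sfield \<Rightarrow> vfield \<times> sfield" where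
  "face_restr_curl T F = (\<lambda>(v_T, v_F, v_sk). (v_F F, restr (\<Union>(face_edges T F)) v_sk))"


section \<open>Interpolators\<close>

definition skeleton_interp :: "point set set \<Rightarrow> nat \<Rightarrow> sfield \<Rightarrow> sfield" where
  "skeleton_interp \<E> k q = (THE p. p \<in> cont_pol \<E> (int k + 1) \<and>
     (\<forall>E\<in>\<E>. proj E (pol E (int k - 1)) (restr E p) = proj E (pol E (int k - 1)) (restr E q)) \<and>
     (\<forall>V\<in>vertices \<E>. p V = q V))"

definition I_grad :: "element \<Rightarrow> nat \<Rightarrow> sfield \<Rightarrow> sfield \<times> sfield \<times> sfield" where
  "I_grad T k q =
     (proj (body T) (pol (body T) (int k - 1)) q,
      glue (faces T) (\<lambda>F. proj F (pol F (int k - 1)) (restr F q)),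
      skeleton_interp (edges T) k q)"

definition I_grad\<^sub>F :: "element \<Rightarrow> nat \<Rightarrow> point set \<Rightarrow> sfield \<Rightarrow> sfield \<times> sfield" where
  "I_grad\<^sub>F T k F q = (proj F (pol F (int k - 1)) q, skeleton_interp (face_edges T F) k q)"

definition tangential_part :: "element \<Rightarrow> point set \<Rightarrow> vfield \<Rightarrow> vfield" where
  "tangential_part T F v = restr F (\<lambda>x. cross3 (normal T F) (cross3 (v x) (normal T F)))"

definition I_curl :: "element \<Rightarrow> nat \<Rightarrow> vfield \<Rightarrow> vfield \<times> (point set \<Rightarrow> vfield) \<times> sfield" where
  "I_curl T k v =
     (\<lambda>x. proj (body T) (R\<^sub>T T (int k - 1)) v x + proj (body T) (R\<^sub>T_perp T (int k)) v x,
      \<lambda>F\<in>faces T. \<lambda>x. proj F (R\<^sub>F T F (int k - 1)) (tangential_part T F v) x +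
                       proj F (R\<^sub>F_perp T F (int k)) (tangential_part T F v) x,
      glue (edges T) (\<lambda>E. proj E (pol E (int k)) (restr E (\<lambda>x. v x \<bullet> tangent T E))))"

definition I_div :: "element \<Rightarrow> nat \<Rightarrow> vfield \<Rightarrow> vfield \<times> sfield" where
  "I_div T k v =
     (\<lambda>x. proj (body T) (G\<^sub>T T (int k - 1)) v x + proj (body T) (G\<^sub>T_perp T (int k)) v x,
      glue (faces T) (\<lambda>F. proj F (pol F (int k)) (restr F (\<lambda>x. v x \<bullet> normal T F))))"


section \<open>Edge and face operators\<close>

definition edge_grad :: "element \<Rightarrow> point set \<Rightarrow> sfield \<times> sfield \<times> sfield \<Rightarrow> sfield" where
  "edge_grad T E = (\<lambda>(q_T, q_bd, q_sk) x. grad E (restr E q_sk) x \<bullet> tangent T E)"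

definition full_grad\<^sub>F :: "element \<Rightarrow> nat \<Rightarrow> point set \<Rightarrow> sfield \<times> sfield \<Rightarrow> vfield" where
  "full_grad\<^sub>F T k F = (\<lambda>(q_F, q_bd). representer F (vpol F (int k)) (\<lambda>w.
     - integ F (\<lambda>x. q_F x * dvg F w x) +
     (\<Sum>E\<in>face_edges T F. \<omega>\<^sub>F T F E * integ E (\<lambda>x. q_bd x * (ext F w x \<bullet> edge_normal T F E)))))"

definition curl\<^sub>F :: "element \<Rightarrow> nat \<Rightarrow> point set \<Rightarrow> vfield \<times> sfield \<Rightarrow> sfield" where
  "curl\<^sub>F T k F = (\<lambda>(v_F, v_bd). representer F (pol F (int k)) (\<lambda>r.
     ip F (component (R\<^sub>F T F (int k - 1)) (R\<^sub>F_perp T F (int k)) v_F) (rot T F r) -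
     (\<Sum>E\<in>face_edges T F. \<omega>\<^sub>F T F E * integ E (\<lambda>x. v_bd x * ext F r x))))"

definition scalar_trace ::
  "element \<Rightarrow> nat \<Rightarrow> point set \<Rightarrow> (sfield \<times> sfield \<Rightarrow> sfield) \<Rightarrow> bool" where
  "scalar_trace T k F \<gamma> \<longleftrightarrow>
     \<gamma> \<in> X_grad\<^sub>F T k F \<rightarrow> pol F (int k + 1) \<and>
     (\<forall>(p, p')\<in>X_grad\<^sub>F T k F. \<forall>(q, q')\<in>X_grad\<^sub>F T k F. \<forall>a b.
        \<gamma> (\<lambda>x. a * p x + b * q x, \<lambda>x. a * p' x + b * q' x) =
        (\<lambda>x. a * \<gamma> (p, p') x + b * \<gamma> (q, q') x)) \<and>
     (\<forall>q\<in>pol F (int k + 1). \<gamma> (I_grad\<^sub>F T k F (ext F q)) = q) \<and>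
     (\<forall>(q, q')\<in>X_grad\<^sub>F T k F. proj F (pol F (int k - 1)) (\<gamma> (q, q')) = q)"

definition tangential_trace :: "element \<Rightarrow> nat \<Rightarrow> point set \<Rightarrow> vfield \<times> sfield \<Rightarrow> vfield" where
  "tangential_trace T k F = (\<lambda>(v_F, v_bd). THE g. g \<in> vpol F (int k) \<and>
     (\<forall>r\<in>pol0 F (int k + 1). ip F g (rot T F r) =
        ip F (curl\<^sub>F T k F (v_F, v_bd)) r +
        (\<Sum>E\<in>face_edges T F. \<omega>\<^sub>F T F E * integ E (\<lambda>x. v_bd x * ext F r x))) \<and>
     (\<forall>w\<in>R\<^sub>F_perp T F (int k). ip F g w =
        ip F (component (R\<^sub>F_perp T F (int k)) (R\<^sub>F T F (int k - 1)) v_F) w))"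


section \<open>Volume operators\<close>

definition full_grad ::
  "element \<Rightarrow> nat \<Rightarrow> (point set \<Rightarrow> sfield \<times> sfield \<Rightarrow> sfield) \<Rightarrow> sfield \<times> sfield \<times> sfield \<Rightarrow> vfield" where
  "full_grad T k \<gamma> q = representer (body T) (vpol (body T) (int k)) (\<lambda>v.
     - integ (body T) (\<lambda>x. fst q x * dvg (body T) v x) +
     (\<Sum>F\<in>faces T. \<omega>\<^sub>T T F *
        integ F (\<lambda>x. \<gamma> F (face_restr_grad T F q) x * (ext (body T) v x \<bullet> normal T F))))"

definition discrete_grad ::
  "element \<Rightarrow> nat \<Rightarrow> (point set \<Rightarrow> sfield \<times> sfield \<Rightarrow> sfield) \<Rightarrow> sfield \<times> sfield \<times> sfield \<Rightarrow>
   vfield \<times> (point set \<Rightarrow> vfield) \<times> sfield" where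
  "discrete_grad T k \<gamma> q =
     (\<lambda>x. proj (body T) (R\<^sub>T T (int k - 1)) (full_grad T k \<gamma> q) x +
          proj (body T) (R\<^sub>T_perp T (int k)) (full_grad T k \<gamma> q) x,
      \<lambda>F\<in>faces T. \<lambda>x.
        proj F (R\<^sub>F T F (int k - 1)) (full_grad\<^sub>F T k F (face_restr_grad T F q)) x +
        proj F (R\<^sub>F_perp T F (int k)) (full_grad\<^sub>F T k F (face_restr_grad T F q)) x,
      glue (edges T) (\<lambda>E. edge_grad T E q))"

definition full_curl ::
  "element \<Rightarrow> nat \<Rightarrow> vfield \<times> (point set \<Rightarrow> vfield) \<times> sfield \<Rightarrow> vfield" where
  "full_curl T k v = representer (body T) (vpol (body T) (int k)) (\<lambda>w.
     ip (body T) (fst v) (curl (body T) w) +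
     (\<Sum>F\<in>faces T. \<omega>\<^sub>T T F *
        ip F (tangential_trace T k F (face_restr_curl T F v))
             (\<lambda>x. cross3 (ext (body T) w x) (normal T F))))"

definition discrete_curl ::
  "element \<Rightarrow> nat \<Rightarrow> vfield \<times> (point set \<Rightarrow> vfield) \<times> sfield \<Rightarrow> vfield \<times> sfield" where
  "discrete_curl T k v =
     (\<lambda>x. proj (body T) (G\<^sub>T T (int k - 1)) (full_curl T k v) x +
          proj (body T) (G\<^sub>T_perp T (int k)) (full_curl T k v) x,
      glue (faces T) (\<lambda>F. curl\<^sub>F T k F (face_restr_curl T F v)))"

definition discrete_div :: "element \<Rightarrow> nat \<Rightarrow> vfield \<times> sfield \<Rightarrow> sfield" where
  "discrete_div T k = (\<lambda>(v_T, v_bd). representer (body T) (pol (body T) (int k)) (\<lambda>q.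
     - ip (body T) v_T (grad (body T) q) +
     (\<Sum>F\<in>faces T. \<omega>\<^sub>T T F * integ F (\<lambda>x. restr F v_bd x * ext (body T) q x))))"

end

theory Submission
  imports Defs
begin

text \<open>The commutation properties follow from the uniqueness of Riesz representers in finite-dimensional
  polynomial spaces, once the formulas that define the discrete operators are recognized as
  integrations by parts on the element and on its faces. The integration by parts formulas rest on
  the identity \<open>\<integral>\<^bsub>X\<^esub> \<partial>\<^sub>e f = \<Sum>\<^bsub>Y\<^esub> \<sigma>\<^bsub>Y\<^esub> (n\<^bsub>Y\<^esub> \<bullet> e) \<integral>\<^bsub>Y\<^esub> f\<close> for a domain \<open>X\<close> whose boundary is covered by flat
  pieces \<open>Y\<close>. For almost every \<open>x\<close>, the indicator function of \<open>X\<close> at \<open>x\<close> is the signed number of pieces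
  hit by the ray from \<open>x\<close> in direction \<open>e\<close>; fibring the domain of integration by lines of
  direction \<open>e\<close> over each piece then reduces the identity to the fundamental theorem of calculus.
  No triangulation of \<open>X\<close> is needed, and polyhedra and polygons are treated alike.\<close>

section \<open>Isometries and Lebesgue measure\<close>

text \<open>The commutation laws rest on the exactness of every projection that the discrete
  operators see. Test fields have degree k, so their divergence, curl or gradient has degree k - 1
  and lies in the space on which the interpolator projects; the complement is taken against the
  space of degree k, which contains that of degree k - 1, and drops out. The critical place is the
  curl: a Nedelec field has degree k + 1, but its component along an edge has degree k, since t x (x
  - c) is constant on a line in direction t; so the edge projections lose nothing. Faces and edges
  are data that may be coplanar or collinear with their neighbours, and the domain may be nonconvex;
  hence the geometry is reduced to local one-sidedness, and one locale,
  \<open>hull_boundary\<close>, serves the pairs polyhedron/faces and face/edges. Representers,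
  components and traces are definite descriptions: to place the images of the horizontal arrows in
  their spaces, existence and uniqueness are proved for arbitrary discrete arguments and not only
  for interpolates.\<close>

lemma basis_bij_inner:
  fixes b :: "'c::euclidean_space \<Rightarrow> 'a::euclidean_space"
  assumes b: "bij_betw b Basis Basis" and j: "j \<in> Basis"
  shows "(\<Sum>i\<in>Basis. (x \<bullet> i) *\<^sub>R b i) \<bullet> b j = x \<bullet> j"
proof -
  have "(\<Sum>i\<in>Basis. (x \<bullet> i) *\<^sub>R b i) \<bullet> b j = (\<Sum>i\<in>Basis. if i = j then x \<bullet> i else 0)"
    unfolding inner_sum_left
  proof (intro sum.cong refl)
    fix i :: 'c assume i: "i \<in> Basis"
    then have "b i \<in> Basis" "b j \<in> Basis" "b i = b j \<longleftrightarrow> i = j"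
      using b j by (auto simp: bij_betw_def inj_on_def)
    then show "(x \<bullet> i) *\<^sub>R b i \<bullet> b j = (if i = j then x \<bullet> i else 0)"
      by (simp add: inner_Basis)
  qed
  then show ?thesis using j by simp
qed

lemma distr_lborel_basis_bij:
  fixes b :: "'c::euclidean_space \<Rightarrow> 'a::euclidean_space"
  assumes b: "bij_betw b Basis Basis"
  shows "distr lborel borel (\<lambda>x. \<Sum>i\<in>Basis. (x \<bullet> i) *\<^sub>R b i) = lborel" (is "distr _ _ ?S = _")
proof (rule lborel_eqI[symmetric])
  fix l u :: 'a assume le: "\<And>b. b \<in> Basis \<Longrightarrow> l \<bullet> b \<le> u \<bullet> b"
  have inB: "i \<in> Basis \<Longrightarrow> b i \<in> Basis" for i using b by (auto simp: bij_betw_def)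
  note comp = basis_bij_inner[OF b]
  define l' u' where "l' = (\<Sum>i\<in>Basis. (l \<bullet> b i) *\<^sub>R i)" and "u' = (\<Sum>i\<in>Basis. (u \<bullet> b i) *\<^sub>R i)"
  have pre: "?S -` box l u = box l' u'"
  proof -
    have "(\<forall>i\<in>Basis. l \<bullet> i < ?S x \<bullet> i \<and> ?S x \<bullet> i < u \<bullet> i) \<longleftrightarrow>
      (\<forall>i\<in>Basis. l \<bullet> b i < ?S x \<bullet> b i \<and> ?S x \<bullet> b i < u \<bullet> b i)" for x
    proof -
      have "(\<forall>i\<in>Basis. P i) \<longleftrightarrow> (\<forall>i\<in>Basis. P (b i))" for P
        using b by (metis bij_betw_def imageE imageI)
      then show ?thesis .
    qed
    then show ?thesis unfolding box_def l'_def u'_def by (auto simp: comp)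
  qed
  have "emeasure (distr lborel borel ?S) (box l u) = emeasure lborel (box l' u')"
    using pre by (subst emeasure_distr) auto
  also have "\<dots> = (\<Prod>i\<in>Basis. (u' - l') \<bullet> i)"
    using le inB by (subst emeasure_lborel_box) (auto simp: l'_def u'_def)
  also have "(\<Prod>i\<in>Basis. (u' - l') \<bullet> i) = (\<Prod>i\<in>Basis. (u - l) \<bullet> b i)"
    by (intro prod.cong) (auto simp: l'_def u'_def inner_diff_left)
  also have "\<dots> = (\<Prod>j\<in>Basis. (u - l) \<bullet> j)"
    using prod.reindex_bij_betw[OF b] by simp
  finally show "emeasure (distr lborel borel ?S) (box l u) = (\<Prod>b\<in>Basis. (u - l) \<bullet> b)" .
qed simp

text \<open>A measure that gives every box its volume is Lebesgue measure. The preimage of a box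
  under \<open>f\<close> is its image under the inverse, again orthogonal, so
  \<open>measure_orthogonal_image\<close> applies; it also dictates the sort of the index
  type.\<close>

lemma distr_lborel_orthogonal:
  fixes f :: "real^'n::{finite,wellorder} \<Rightarrow> real^'n::_"
  assumes f: "orthogonal_transformation f"
  shows "distr lborel borel f = lborel"
proof (rule lborel_eqI[symmetric])
  fix l u :: "real^'n::_" assume le: "\<And>b. b \<in> Basis \<Longrightarrow> l \<bullet> b \<le> u \<bullet> b"
  have [measurable]: "f \<in> borel_measurable borel"
    using f orthogonal_transformation_linear
    by (intro borel_measurable_continuous_onI linear_continuous_on linear_conv_bounded_linear[THEN iffD1]) auto
  have "bij f" using f orthogonal_transformation_bij by blast
  have g: "orthogonal_transformation (inv f)"
    using f orthogonal_transformation_inv by blast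
  have pre: "f -` box l u = inv f ` box l u"
    by (simp add: bij_vimage_eq_inv_image \<open>bij f\<close>)
  have m: "box l u \<in> lmeasurable" by simp
  have eq: "measure lebesgue (f -` box l u) = measure lebesgue (box l u)"
    unfolding pre using measure_orthogonal_image[OF g m] .
  have lm: "f -` box l u \<in> lmeasurable" unfolding pre by (rule measurable_orthogonal_image[OF g m])
  have bor: "f -` box l u \<in> sets borel" using measurable_sets[of f borel borel "box l u"] by simp
  have "emeasure (distr lborel borel f) (box l u) = emeasure lborel (f -` box l u)"
    by (subst emeasure_distr) auto
  also have "\<dots> = emeasure lebesgue (f -` box l u)" using bor by simp
  also have "\<dots> = emeasure lebesgue (box l u)"
    using eq lm m by (simp add: emeasure_eq_measure2)
  also have "\<dots> = (\<Prod>b\<in>Basis. (u - l) \<bullet> b)" using le by simp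
  finally show "emeasure (distr lborel borel f) (box l u) = (\<Prod>b\<in>Basis. (u - l) \<bullet> b)" .
qed simp

text \<open>Source and target have equal dimension but may have different types, such as a product
  with the real line on one side. \<open>S\<close> relabels the basis of the source by that of the
  target, \<open>R\<close> undoes it, and \<open>L = (L \<circ> R) \<circ> S\<close> is an
  orthogonal transformation after a relabelling of coordinates.\<close>

lemma distr_lborel_isometry:
  fixes L :: "'c::euclidean_space \<Rightarrow> real^'n::{finite,wellorder}"
  assumes lin: "linear L" and nrm: "\<And>x. norm (L x) = norm x" and surj: "surj L"
  shows "distr lborel borel L = lborel"
proof -
  have inj: "inj L"
    using nrm lin by (metis linear_injective_0 norm_eq_zero)
  have dim: "DIM('c) = DIM(real^'n::_)"
    by (metis dim_UNIV dim_image_eq inj lin span_UNIV surj)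
  then obtain b where b: "bij_betw b (Basis::'c set) (Basis :: (real^'n::_) set)"
    using finite_same_card_bij by (metis finite_Basis)
  define S where "S = (\<lambda>x::'c. \<Sum>i\<in>Basis. (x \<bullet> i) *\<^sub>R b i)"
  define R where "R = (\<lambda>x::real^'n::_. \<Sum>i\<in>Basis. (x \<bullet> b i) *\<^sub>R i)"
  have inB: "i \<in> Basis \<Longrightarrow> b i \<in> Basis" for i using b by (auto simp: bij_betw_def)
  have comp: "S x \<bullet> b j = x \<bullet> j" if "j \<in> Basis" for x j
    unfolding S_def by (rule basis_bij_inner[OF b that])
  have RS: "R (S x) = x" for x
    unfolding R_def using comp by (simp add: euclidean_representation cong: sum.cong)
  have linS: "linear S" and linR: "linear R"
    unfolding S_def R_def by (auto intro!: linearI simp: inner_add_left scaleR_add_left sum.distrib scaleR_right.sum)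
  have normR: "norm (R x) = norm x" for x
  proof -
    have "(norm (R x))\<^sup>2 = (\<Sum>i\<in>Basis. (x \<bullet> b i)\<^sup>2)"
      unfolding R_def by (subst norm_sum_Pythagorean)
        (auto simp: pairwise_def orthogonal_def inner_Basis)
    also have "\<dots> = (\<Sum>i\<in>Basis. (x \<bullet> i)\<^sup>2)"
      using sum.reindex_bij_betw[OF b, of "\<lambda>i. (x \<bullet> i)\<^sup>2"] by simp
    also have "\<dots> = (norm x)\<^sup>2"
      by (simp add: norm_eq_sqrt_inner euclidean_inner[of x x] power2_eq_square sum_nonneg)
    finally show ?thesis by (simp add: power2_eq_iff_nonneg)
  qed
  have "orthogonal_transformation (L \<circ> R)"
    unfolding orthogonal_transformation using linear_compose[OF linR lin] by (simp add: nrm normR)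
  from distr_lborel_orthogonal[OF this] have 1: "distr lborel borel (L \<circ> R) = lborel" .
  have meas: "f \<in> borel_measurable borel" if "linear f" for f :: "'u::euclidean_space \<Rightarrow> 'v::euclidean_space"
    using that by (intro borel_measurable_continuous_onI linear_continuous_on linear_conv_bounded_linear[THEN iffD1]) auto
  have "distr lborel borel L = distr lborel borel ((L \<circ> R) \<circ> S)" using RS by (simp add: comp_def)
  also have "\<dots> = distr (distr lborel borel S) borel (L \<circ> R)"
    using meas[OF linS] meas[OF linear_compose[OF linR lin]] by (subst distr_distr) auto
  also have "distr lborel borel S = lborel" unfolding S_def by (rule distr_lborel_basis_bij[OF b])
  finally show ?thesis using 1 by (simp add: comp_def)
qed

text \<open>Polarization turns preservation of distances into preservation of inner products for
  \<open>A\<close>. The defects of additivity and homogeneity, once expanded, then have squared norm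
  zero.\<close>

lemma isometry_affine:
  fixes \<phi> :: "'a::euclidean_space \<Rightarrow> 'b::euclidean_space"
  assumes "\<forall>x y. dist (\<phi> x) (\<phi> y) = dist x y"
  obtains A where "linear A" "\<And>x. norm (A x) = norm x" "\<And>x. \<phi> x = \<phi> 0 + A x"
proof
  define A where "A = (\<lambda>x. \<phi> x - \<phi> 0)"
  have d: "dist (A x) (A y) = dist x y" for x y using assms by (simp add: A_def dist_norm)
  have nrm: "norm (A x) = norm x" for x
    using assms[rule_format, of x 0] by (simp add: A_def dist_norm)
  have inner: "A v \<bullet> A w = v \<bullet> w" for v w
    unfolding dot_norm_neg dist_norm[symmetric] using d nrm by simp
  show "linear A"
  proof (rule linearI)
    fix x y show "A (x + y) = A x + A y"
    proof -
      have "(A (x + y) - A x - A y) \<bullet> (A (x + y) - A x - A y) = 0"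
        by (simp add: inner_diff_left inner_diff_right inner inner_add_left inner_add_right inner_commute)
      then show ?thesis by (simp only: inner_eq_zero_iff) (simp add: algebra_simps)
    qed
  next
    fix c x show "A (c *\<^sub>R x) = c *\<^sub>R A x"
    proof -
      have "(A (c *\<^sub>R x) - c *\<^sub>R A x) \<bullet> (A (c *\<^sub>R x) - c *\<^sub>R A x) = 0"
        by (simp add: inner_diff_left inner_diff_right inner)
      then show ?thesis by simp
    qed
  qed
  show "\<And>x. norm (A x) = norm x" by (rule nrm)
  show "\<And>x. \<phi> x = \<phi> 0 + A x" by (simp add: A_def)
qed

lemma isometry_continuous:
  fixes h :: "'u::metric_space \<Rightarrow> 'v::metric_space"
  assumes "\<forall>x y. dist (h x) (h y) = dist x y" shows "continuous_on UNIV h"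
  unfolding continuous_on_iff using assms by auto

lemma linear_borel:
  fixes f :: "'u::euclidean_space \<Rightarrow> 'v::euclidean_space"
  assumes "linear f" shows "f \<in> borel_measurable borel"
  using assms by (intro borel_measurable_continuous_onI linear_continuous_on linear_conv_bounded_linear[THEN iffD1])

text \<open>The map \<open>K\<close> is an isometry composed with a shear along the hyperplane, which preserves the measure, and
  a scaling along its normal, which produces the Jacobian.\<close>

lemma hull_fibration:
  fixes \<phi> :: "real^'n::{finite,wellorder} \<Rightarrow> 'p::euclidean_space" and \<psi> :: "'b::euclidean_space \<Rightarrow> 'p"
  assumes \<phi>: "\<forall>x y. dist (\<phi> x) (\<phi> y) = dist x y" and \<psi>: "\<forall>x y. dist (\<psi> x) (\<psi> y) = dist x y"
    and n: "norm n = 1" "n \<in> {u - v |u v. u \<in> range \<phi> \<and> v \<in> range \<phi>}"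
    and e: "e \<in> {u - v |u v. u \<in> range \<phi> \<and> v \<in> range \<phi>}" "e \<bullet> n \<noteq> 0"
    and rng: "range \<psi> = {x \<in> range \<phi>. (x - p) \<bullet> n = 0}"
  obtains K :: "'b \<times> real \<Rightarrow> real^'n::_" where "K \<in> borel_measurable borel" "\<And>y s. \<phi> (K (y, s)) = \<psi> y + s *\<^sub>R e"
    "lborel = density (distr lborel borel K) (\<lambda>_. ennreal \<bar>e \<bullet> n\<bar>)"
proof -
  obtain A where A: "linear A" "\<And>x. norm (A x) = norm x" "\<And>x. \<phi> x = \<phi> 0 + A x"
    using isometry_affine[OF \<phi>] by metis
  obtain B where B: "linear B" "\<And>x. norm (B x) = norm x" "\<And>x. \<psi> x = \<psi> 0 + B x"
    using isometry_affine[OF \<psi>] by metis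
  \<comment> \<open>The adjoint is a left inverse of the isometry \<open>A\<close> and a two-sided
    one on its range; it carries directions of the hull back to coordinates.\<close>
  define A' where "A' = adjoint A"
  have linA': "linear A'" unfolding A'_def by (rule adjoint_linear[OF A(1)])
  have A'A: "A' (A x) = x" for x
  proof -
    have orth: "A v \<bullet> A w = v \<bullet> w" for v w
      using dot_norm[of "A v" "A w"] dot_norm[of v w] A(2) linear_add[OF A(1), of v w] by metis
    then have "A' (A x) \<bullet> w = x \<bullet> w" for w
      unfolding A'_def using adjoint_clauses(1,2)[OF A(1)] by simp
    then show ?thesis using vector_eq_rdot by blast
  qed
  have AA': "A (A' v) = v" if "v \<in> range A" for v using that A'A by auto
  have dir: "{u - v |u v. u \<in> range \<phi> \<and> v \<in> range \<phi>} = range A"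
  proof -
    have "\<phi> u - \<phi> v = A (u - v)" for u v using A(3)[of u] A(3)[of v] linear_diff[OF A(1)] by simp
    moreover have "A u = \<phi> u - \<phi> 0" for u using A(3)[of u] by simp
    ultimately show ?thesis by blast
  qed
  have nA: "n \<in> range A" and eA: "e \<in> range A" using n e dir by auto
  have \<psi>R: "\<psi> y \<in> range \<phi>" "(\<psi> y - p) \<bullet> n = 0" for y using rng by blast+
  obtain a0 where a0: "\<psi> 0 = \<phi> a0" using \<psi>R(1) by blast
  have BA: "B y \<in> range A" for y
    using dir \<psi>R(1)[of y] \<psi>R(1)[of 0] B(3)[of y] by (metis (mono_tags, lifting) add_diff_cancel_left' mem_Collect_eq)
  have Bn: "B y \<bullet> n = 0" for y
    using \<psi>R(2)[of y] \<psi>R(2)[of 0] B(3)[of y] by (simp add: inner_diff_left inner_add_left)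
  have subA: "subspace (range A)" using A(1) by (simp add: linear_subspace_image)
  define c where "c = e \<bullet> n"
  have nn: "n \<bullet> n = 1" using n(1) by (simp add: norm_eq_1)
  have ran: "v \<in> range \<psi>" if u: "v = \<psi> 0 + u" "u \<in> range A" "u \<bullet> n = 0" for v u
  proof -
    obtain w where "u = A w" using u(2) by blast
    then have "v = \<phi> (a0 + w)" using u(1) a0 A(3)[of a0] A(3)[of "a0+w"] linear_add[OF A(1)] by simp
    moreover have "(v - p) \<bullet> n = 0" using u \<psi>R(2)[of 0] by (simp add: inner_diff_left inner_add_left)
    ultimately show ?thesis unfolding rng by blast
  qed
  \<comment> \<open>Removing from \<open>e\<close> its normal component leaves a direction of the
    hyperplane; \<open>d\<close> is its coordinate vector. Moving along \<open>e\<close> is thus a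
    shear by \<open>d\<close> combined with a motion of speed \<open>c\<close> along the
    normal.\<close>
  have "e - c *\<^sub>R n \<in> range A" using eA nA subA by (simp add: subspace_diff subspace_scale)
  moreover have "(e - c *\<^sub>R n) \<bullet> n = 0" by (simp add: inner_diff_left c_def nn)
  ultimately have "\<psi> 0 + (e - c *\<^sub>R n) \<in> range \<psi>" by (rule ran[OF refl])
  then obtain d where "\<psi> 0 + (e - c *\<^sub>R n) = \<psi> d" by blast
  then have d: "e = B d + c *\<^sub>R n" using B(3)[of d] by (simp add: algebra_simps)
  define L where "L = (\<lambda>(y, s). A' (B y) + s *\<^sub>R A' n)"
  have linL: "linear L"
    unfolding L_def by (rule linearI) (auto simp: linear_add[OF B(1)] linear_add[OF linA'] linear_cmul[OF B(1)]
        linear_cmul[OF linA'] algebra_simps)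
  have AL: "A (L (y, s)) = B y + s *\<^sub>R n" for y s
    using BA nA by (simp add: L_def linear_add[OF A(1)] linear_cmul[OF A(1)] AA')
  have normL: "norm (L z) = norm z" for z
  proof -
    obtain y s where z: "z = (y, s)" by (cases z)
    have "(norm (B y + s *\<^sub>R n))\<^sup>2 = (norm (B y))\<^sup>2 + (norm (s *\<^sub>R n))\<^sup>2"
      by (rule norm_add_Pythagorean) (simp add: orthogonal_def Bn)
    also have "\<dots> = (norm y)\<^sup>2 + s\<^sup>2" by (simp add: B(2) n(1))
    finally have "(norm (L z))\<^sup>2 = (norm z)\<^sup>2"
      using A(2)[of "L z"] AL by (simp add: z norm_prod_def)
    then show ?thesis by (simp add: power2_eq_iff_nonneg)
  qed
  have surjL: "surj L"
  proof (rule surjI)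
    fix x
    define s where "s = A x \<bullet> n"
    have "A x - s *\<^sub>R n \<in> range A" using nA subA by (simp add: subspace_diff subspace_scale)
    moreover have "(A x - s *\<^sub>R n) \<bullet> n = 0" by (simp add: inner_diff_left s_def nn)
    ultimately have "\<psi> 0 + (A x - s *\<^sub>R n) \<in> range \<psi>" by (rule ran[OF refl])
    then obtain y where "\<psi> 0 + (A x - s *\<^sub>R n) = \<psi> y" by blast
    then have "A x = B y + s *\<^sub>R n" using B(3)[of y] by (simp add: algebra_simps)
    then have "L (y, s) = x" using AL A'A by metis
    then show "L (SOME z. L z = x) = x" by (rule someI)
  qed
  have dL: "distr lborel borel L = lborel"
    by (rule distr_lborel_isometry[OF linL normL surjL])
  have [measurable]: "L \<in> borel_measurable borel" by (rule linear_borel[OF linL])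
  define K where "K = (\<lambda>(y, s). a0 + L (y + s *\<^sub>R d, c * s))"
  have contL: "continuous_on UNIV L" using linL by (simp add: linear_continuous_on linear_conv_bounded_linear)
  have contK: "continuous_on UNIV K"
    unfolding K_def case_prod_beta by (intro continuous_intros continuous_on_compose2[OF contL]) auto
  have mK[measurable]: "K \<in> borel_measurable borel"
    by (rule borel_measurable_continuous_onI[OF contK])
  have \<phi>K: "\<phi> (K (y, s)) = \<psi> y + s *\<^sub>R e" for y s
  proof -
    have "\<phi> (K (y, s)) = \<phi> a0 + A (L (y + s *\<^sub>R d, c * s))"
      using A(3)[of a0] A(3)[of "K (y,s)"] linear_add[OF A(1)] by (simp add: K_def)
    also have "\<dots> = \<psi> y + s *\<^sub>R e"
      using B(3)[of y] by (simp add: a0 AL d linear_add[OF B(1)] linear_cmul[OF B(1)] algebra_simps)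
    finally show ?thesis .
  qed
  have c0: "c \<noteq> 0" using e by (simp add: c_def)
  \<comment> \<open>Change of variables in four moves: translation by \<open>a0\<close>, the
    isometry \<open>L\<close>, scaling of the last variable by \<open>c\<close>, and, for each fixed
    value of that variable, a translation of the hyperplane by \<open>s *\<^sub>R d\<close>. The
    order of integration is switched for the last move and then switched back.\<close>
  have nn: "(\<integral>\<^sup>+a. h a \<partial>lborel) = ennreal \<bar>c\<bar> * (\<integral>\<^sup>+z. h (K z) \<partial>lborel)"
    if [measurable]: "h \<in> borel_measurable borel" for h
  proof -
    have "(\<integral>\<^sup>+a. h a \<partial>lborel) = (\<integral>\<^sup>+a. h (a0 + a) \<partial>lborel)"
      by (subst lborel_distr_plus[symmetric, of a0]) (simp add: nn_integral_distr)
    also have "\<dots> = (\<integral>\<^sup>+z. h (a0 + L z) \<partial>lborel)"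
      by (subst dL[symmetric]) (simp add: nn_integral_distr)
    also have "\<dots> = (\<integral>\<^sup>+y. (\<integral>\<^sup>+s. h (a0 + L (y, s)) \<partial>lborel) \<partial>lborel)"
      unfolding lborel_prod[symmetric]
      by (rule lborel.nn_integral_fst[symmetric, of "\<lambda>z. h (a0 + L z)"]) (simp add: lborel_prod)
    also have "\<dots> = (\<integral>\<^sup>+y. ennreal \<bar>c\<bar> * (\<integral>\<^sup>+s. h (a0 + L (y, 0 + c * s)) \<partial>lborel) \<partial>lborel)"
      by (intro nn_integral_cong nn_integral_real_affine[OF _ c0]) measurable
    also have "\<dots> = ennreal \<bar>c\<bar> * (\<integral>\<^sup>+y. (\<integral>\<^sup>+s. h (a0 + L (y, c * s)) \<partial>lborel) \<partial>lborel)"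
      by (subst nn_integral_cmult) auto
    also have "(\<integral>\<^sup>+y. (\<integral>\<^sup>+s. h (a0 + L (y, c * s)) \<partial>lborel) \<partial>lborel) =
        (\<integral>\<^sup>+s. (\<integral>\<^sup>+y. h (a0 + L (y, c * s)) \<partial>lborel) \<partial>lborel)"
      by (rule lborel_pair.Fubini'[symmetric]) measurable
    also have "\<dots> = (\<integral>\<^sup>+s. (\<integral>\<^sup>+y. h (a0 + L (y + s *\<^sub>R d, c * s)) \<partial>lborel) \<partial>lborel)"
    proof (rule nn_integral_cong)
      fix s
      show "(\<integral>\<^sup>+y. h (a0 + L (y, c * s)) \<partial>lborel) = (\<integral>\<^sup>+y. h (a0 + L (y + s *\<^sub>R d, c * s)) \<partial>lborel)"
        by (subst lborel_distr_plus[symmetric, of "s *\<^sub>R d"]) (simp add: nn_integral_distr add.commute)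
    qed
    also have "\<dots> = (\<integral>\<^sup>+y. (\<integral>\<^sup>+s. h (a0 + L (y + s *\<^sub>R d, c * s)) \<partial>lborel) \<partial>lborel)"
      by (rule lborel_pair.Fubini') measurable
    also have "\<dots> = (\<integral>\<^sup>+y. (\<integral>\<^sup>+s. h (K (y, s)) \<partial>lborel) \<partial>lborel)"
      by (simp add: K_def)
    also have "\<dots> = (\<integral>\<^sup>+z. h (K z) \<partial>lborel)"
      unfolding lborel_prod[symmetric]
      by (rule lborel.nn_integral_fst[of "\<lambda>z. h (K z)"]) (simp add: lborel_prod)
    finally show ?thesis .
  qed
  have "lborel = density (distr lborel borel K) (\<lambda>_. ennreal \<bar>c\<bar>)"
  proof (rule measure_eqI)
    fix S :: "(real^'n::_) set" assume "S \<in> sets lborel"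
    then have S[measurable]: "S \<in> sets borel" by simp
    have "emeasure lborel S = (\<integral>\<^sup>+a. indicator S a \<partial>lborel)" by simp
    also have "\<dots> = ennreal \<bar>c\<bar> * (\<integral>\<^sup>+z. indicator S (K z) \<partial>lborel)" by (rule nn) simp
    also have "\<dots> = emeasure (density (distr lborel borel K) (\<lambda>_. ennreal \<bar>c\<bar>)) S"
      by (subst emeasure_density) (simp_all add: nn_integral_cmult nn_integral_distr
          del: nn_integral_cmult_indicator nn_integral_indicator)
    finally show "emeasure lborel S = emeasure (density (distr lborel borel K) (\<lambda>_. ennreal \<bar>c\<bar>)) S" .
  qed simp
  then show thesis using that mK \<phi>K unfolding c_def by blast
qed

section \<open>Domains bounded by flat faces\<close>

lemma direction_add:
  assumes x: "x \<in> affine hull X" and "v \<in> direction X" shows "x + v \<in> affine hull X"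
proof -
  obtain a b where v: "v = a - b" "a \<in> affine hull X" "b \<in> affine hull X"
    using assms by (auto simp: direction_def)
  then show ?thesis using mem_affine_3_minus[OF affine_affine_hull x v(2,3), of 1] by simp
qed

lemma direction_diff: "x \<in> affine hull X \<Longrightarrow> y \<in> affine hull X \<Longrightarrow> x - y \<in> direction X"
  by (auto simp: direction_def)

lemma direction_image: "p \<in> affine hull X \<Longrightarrow> direction X = (+) (- p) ` (affine hull X)"
proof
  assume p: "p \<in> affine hull X"
  show "direction X \<subseteq> (+) (- p) ` (affine hull X)"
  proof
    fix v assume "v \<in> direction X"
    then have "p + v \<in> affine hull X" by (rule direction_add[OF p])
    then show "v \<in> (+) (- p) ` (affine hull X)" by (rule rev_image_eqI) simp
  qed
  show "(+) (- p) ` (affine hull X) \<subseteq> direction X" using direction_diff[OF _ p] by auto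
qed

lemma subspace_direction: "X \<noteq> {} \<Longrightarrow> subspace (direction X)"
proof -
  assume "X \<noteq> {}"
  then obtain p where p: "p \<in> affine hull X" by (meson all_not_in_conv hull_inc)
  show ?thesis using affine_diffs_subspace[OF affine_affine_hull p] direction_image[OF p] by simp
qed

text \<open>\<open>\<N>\<close> collects affine sets of codimension at least two that cover the
  relative boundaries of the pieces: the lines of the edges of a polyhedron, the vertices of a
  polygon. The condition \<open>regular\<close> excludes slits, that is, pieces with the domain on
  both sides.\<close>

locale hull_boundary =
  fixes X :: "point set" and \<Y> :: "point set set" and \<nu> :: "point set \<Rightarrow> point" and \<N> :: "point set set"
  assumes bounded: "bounded X" and nonempty: "X \<noteq> {}"
    and rel_open: "openin (top_of_set (affine hull X)) X"
    and regular: "rel_interior (closure X) \<subseteq> X"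
    and rel_frontier_eq: "rel_frontier X = (\<Union>Y\<in>\<Y>. closure Y)"
    and finite_Y: "finite \<Y>"
    and Y_connected: "\<And>Y. Y \<in> \<Y> \<Longrightarrow> connected Y" and Y_nonempty: "\<And>Y. Y \<in> \<Y> \<Longrightarrow> Y \<noteq> {}"
    and Y_rel_open: "\<And>Y. Y \<in> \<Y> \<Longrightarrow> openin (top_of_set (affine hull Y)) Y"
    and norm_nu: "\<And>Y. Y \<in> \<Y> \<Longrightarrow> norm (\<nu> Y) = 1" and nu_direction: "\<And>Y. Y \<in> \<Y> \<Longrightarrow> \<nu> Y \<in> direction X"
    and Y_hull: "\<And>Y p. Y \<in> \<Y> \<Longrightarrow> p \<in> Y \<Longrightarrow> affine hull Y = {x \<in> affine hull X. (x - p) \<bullet> \<nu> Y = 0}"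
    and Y_disjoint: "\<And>Y Y'. Y \<in> \<Y> \<Longrightarrow> Y' \<in> \<Y> \<Longrightarrow> Y \<noteq> Y' \<Longrightarrow> Y \<inter> closure Y' = {}"
    and finite_N: "finite \<N>"
    and N: "\<And>A. A \<in> \<N> \<Longrightarrow> affine A \<and> aff_dim A + 2 \<le> aff_dim X"
    and Y_closure: "\<And>Y. Y \<in> \<Y> \<Longrightarrow> closure Y - Y \<subseteq> \<Union>\<N>"
begin

abbreviation "H \<equiv> affine hull X"

text \<open>Has the form of \<open>\<omega>\<^sub>T\<close> and \<open>\<omega>\<^sub>F\<close>, so
  that both signs are instances. The value -1 is a default; that it really means pointing inwards is
  proved in \<open>side_orient\<close>.\<close>

definition orient :: "point set \<Rightarrow> real" where
  "orient Y = (if points_out X Y (\<nu> Y) then 1 else -1)"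

lemma H_scale: "x \<in> H \<Longrightarrow> v \<in> direction X \<Longrightarrow> x + t *\<^sub>R v \<in> H"
  by (simp add: direction_add nonempty subspace_direction subspace_scale)

lemma Y_subset_H: "Y \<in> \<Y> \<Longrightarrow> Y \<subseteq> H"
  using Y_hull hull_inc by fastforce

lemma Y_frontier: "Y \<in> \<Y> \<Longrightarrow> Y \<subseteq> rel_frontier X"
  using rel_frontier_eq closure_subset by blast

lemma rel_interior_eq: "rel_interior X = X"
  using rel_open by (simp add: rel_interior_openin)

lemma frontier_disjoint: "x \<in> rel_frontier X \<Longrightarrow> x \<notin> X"
  by (simp add: rel_frontier_def rel_interior_eq)

lemma frontier_if: "x \<in> closure X \<Longrightarrow> x \<notin> X \<Longrightarrow> x \<in> rel_frontier X"
  by (simp add: rel_frontier_def rel_interior_eq)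

text \<open>Off the frontier, membership in \<open>X\<close> and in its closure coincide, so
  \<open>X\<close> cuts \<open>C\<close> in a set both open and closed.\<close>

lemma connected_side:
  assumes "connected C" "C \<subseteq> H" "C \<inter> rel_frontier X = {}"
  shows "C \<subseteq> X \<or> C \<inter> closure X = {}"
proof -
  have eq: "C \<inter> X = C \<inter> closure X" using assms(3) frontier_if closure_subset by blast
  have "openin (top_of_set C) (C \<inter> X)"
  proof -
    obtain U where "open U" "X = H \<inter> U" using rel_open by (auto simp: openin_open)
    then have "C \<inter> X = C \<inter> U" using assms(2) by auto
    then show ?thesis using \<open>open U\<close> by (auto simp: openin_open)
  qed
  moreover have "closedin (top_of_set C) (C \<inter> X)" unfolding eq by (simp add: closedin_closed_Int)
  ultimately have "C \<inter> X = {} \<or> C \<inter> X = C"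
    using assms(1) by (simp add: connected_clopen)
  then show ?thesis using eq by auto
qed

text \<open>The other pieces form a closed set avoiding \<open>y\<close>, so in a small ball the
  frontier lies in the hyperplane of \<open>Y\<close>. Each of the two half balls is convex and
  misses the frontier; hence it lies in \<open>X\<close> or away from its closure.\<close>

lemma one_sided:
  assumes Y: "Y \<in> \<Y>" and y: "y \<in> Y"
  obtains r s where "r > 0" "s \<in> {1, -1::real}"
    "\<And>x. x \<in> H \<Longrightarrow> dist x y < r \<Longrightarrow> s * ((x - y) \<bullet> \<nu> Y) < 0 \<Longrightarrow> x \<in> X"
    "\<And>x. x \<in> H \<Longrightarrow> dist x y < r \<Longrightarrow> s * ((x - y) \<bullet> \<nu> Y) > 0 \<Longrightarrow> x \<notin> X"
proof -
  have yH: "y \<in> H" using Y y Y_subset_H by auto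
  obtain r1 where r1: "r1 > 0" "ball y r1 \<inter> affine hull Y \<subseteq> Y"
    using Y_rel_open[OF Y] y by (auto simp: openin_contains_ball)
  define Z where "Z = (\<Union>Y'\<in>\<Y> - {Y}. closure Y')"
  have "closed Z" unfolding Z_def using finite_Y by auto
  moreover have "y \<notin> Z" unfolding Z_def using Y y Y_disjoint by fastforce
  ultimately obtain r2 where r2: "r2 > 0" "ball y r2 \<inter> Z = {}"
    using open_contains_ball[of "- Z"] by (auto simp: disjoint_eq_subset_Compl)
  define r where "r = min r1 r2"
  have r: "r > 0" using r1 r2 by (simp add: r_def)
  have fr: "x \<in> Y" "(x - y) \<bullet> \<nu> Y = 0" if x: "x \<in> rel_frontier X" "dist x y < r" for x
  proof -
    have "x \<notin> Z" using x r2 by (auto simp: r_def dist_commute disjoint_iff)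
    then have "x \<in> closure Y" using x(1) rel_frontier_eq by (auto simp: Z_def)
    then have h: "x \<in> affine hull Y" using closure_affine_hull by blast
    then show "x \<in> Y" using r1 x by (auto simp: r_def dist_commute)
    show "(x - y) \<bullet> \<nu> Y = 0" using h Y_hull[OF Y y] by auto
  qed
  define C where "C = (\<lambda>s. {x \<in> H \<inter> ball y r. s * ((x - y) \<bullet> \<nu> Y) > 0})"
  have conv: "convex (C s)" for s
  proof -
    have "C s = H \<inter> ball y r \<inter> {x. (s *\<^sub>R \<nu> Y) \<bullet> x > s * (y \<bullet> \<nu> Y)}"
      by (auto simp: C_def inner_diff_left inner_commute algebra_simps)
    then show ?thesis
      using affine_imp_convex[OF affine_affine_hull]
      by (simp only:) (intro convex_Int convex_halfspace_gt convex_ball)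
  qed
  have side: "C s \<subseteq> X \<or> C s \<inter> closure X = {}" for s
  proof (rule connected_side)
    show "connected (C s)" using conv convex_connected by blast
    show "C s \<inter> rel_frontier X = {}" using fr(2) by (fastforce simp: C_def dist_commute)
  qed (auto simp: C_def)
  \<comment> \<open>Pushing a point of the dividing hyperplane along the normal shows that it is a
    limit of either half ball.\<close>
  have near: "x \<in> closure (C s)" if x: "x \<in> H" "dist x y < r" "(x - y) \<bullet> \<nu> Y = 0" and s: "s \<in> {1, -1}" for x s
  proof -
    have nn: "\<nu> Y \<bullet> \<nu> Y = 1" using norm_nu[OF Y] by (simp add: norm_eq_1)
    have lim: "((\<lambda>t. x + (t * s) *\<^sub>R \<nu> Y) \<longlongrightarrow> x + (0 * s) *\<^sub>R \<nu> Y) (at_right 0)"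
      by (intro tendsto_intros)
    then have "\<forall>\<^sub>F t in at_right 0. x + (t * s) *\<^sub>R \<nu> Y \<in> ball y r"
      by (rule topological_tendstoD) (use x in \<open>auto simp: dist_commute\<close>)
    moreover have "\<forall>\<^sub>F t in at_right (0::real). t > 0" by (simp add: eventually_at_right_less)
    ultimately have "\<forall>\<^sub>F t in at_right 0. x + (t * s) *\<^sub>R \<nu> Y \<in> C s"
    proof eventually_elim
      case (elim t)
      have "s * ((x + (t * s) *\<^sub>R \<nu> Y - y) \<bullet> \<nu> Y) = t * (s * s)"
        using x(3) nn by (simp add: inner_diff_left inner_add_left algebra_simps)
      then show ?case using elim s H_scale[OF x(1) nu_direction[OF Y]] by (auto simp: C_def)
    qed
    then have "\<forall>\<^sub>F t in at_right 0. x + (t * s) *\<^sub>R \<nu> Y \<in> closure (C s)"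
      by eventually_elim (use closure_subset in blast)
    from Lim_in_closed_set[OF closed_closure this _ lim] show ?thesis by simp
  qed
  txt \<open>If \<open>X\<close> contained both half-balls, \<open>y\<close> would be interior to the closure of \<open>X\<close>, against \<open>regular\<close>; if it
    met neither, \<open>y\<close> would not be a limit of points of \<open>X\<close>.\<close>
  have "\<exists>s\<in>{1,-1}. C (- s) \<subseteq> X \<and> C s \<inter> closure X = {}"
  proof -
    have ycl: "y \<in> closure X" "y \<notin> X" using Y_frontier[OF Y] y frontier_disjoint by (auto simp: rel_frontier_def)
    have part: "x \<in> C 1 \<or> x \<in> C (-1) \<or> (x - y) \<bullet> \<nu> Y = 0" if "x \<in> H" "dist x y < r" for x
      using that by (auto simp: C_def dist_commute)
    have "\<not> (C 1 \<subseteq> X \<and> C (-1) \<subseteq> X)"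
    proof
      assume a: "C 1 \<subseteq> X \<and> C (-1) \<subseteq> X"
      have "ball y r \<inter> H \<subseteq> closure X"
      proof
        fix x assume x: "x \<in> ball y r \<inter> H"
        consider "x \<in> C 1 \<or> x \<in> C (-1)" | "(x - y) \<bullet> \<nu> Y = 0" using part x by (auto simp: dist_commute)
        then show "x \<in> closure X"
        proof cases
          case 1 then show ?thesis using a closure_subset by blast
        next
          case 2 then have "x \<in> closure (C 1)" using near[of x 1] x by (auto simp: dist_commute)
          then show ?thesis using a closure_mono by blast
        qed
      qed
      then have "y \<in> rel_interior (closure X)"
        using ycl r by (auto simp: mem_rel_interior_ball closure_same_affine_hull)
      then show False using regular ycl by auto
    qed
    moreover have "\<not> (C 1 \<inter> closure X = {} \<and> C (-1) \<inter> closure X = {})"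
    proof
      assume a: "C 1 \<inter> closure X = {} \<and> C (-1) \<inter> closure X = {}"
      obtain x where x: "x \<in> X" "dist x y < r" using ycl r by (auto simp: closure_approachable)
      then have xH: "x \<in> H" by (simp add: hull_inc)
      have xc: "x \<in> closure X" using x closure_subset by blast
      have "(x - y) \<bullet> \<nu> Y = 0" using part[OF xH x(2)] a xc by auto
      then have "x \<in> affine hull Y" using Y_hull[OF Y y] xH by auto
      then have "x \<in> Y" using r1 x by (auto simp: r_def dist_commute)
      then show False using Y_frontier[OF Y] frontier_disjoint x by blast
    qed
    ultimately show ?thesis using side[of 1] side[of "-1"] by auto
  qed
  then obtain s where s: "s \<in> {1,-1::real}" "C (- s) \<subseteq> X" "C s \<inter> closure X = {}" by blast
  show thesis
  proof (rule that[OF r s(1)])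
    fix x assume x: "x \<in> H" "dist x y < r"
    show "s * ((x - y) \<bullet> \<nu> Y) < 0 \<Longrightarrow> x \<in> X" using x s(2) by (auto simp: C_def dist_commute)
    show "s * ((x - y) \<bullet> \<nu> Y) > 0 \<Longrightarrow> x \<notin> X" using x s(3) closure_subset by (auto simp: C_def dist_commute)
  qed
qed

text \<open>The sign is a parameter so that its constancy along a piece can be stated and proved by
  connectedness.\<close>

definition side :: "point set \<Rightarrow> point \<Rightarrow> real \<Rightarrow> bool" where
  "side Y y s \<longleftrightarrow> (\<exists>r>0. \<forall>x\<in>H. dist x y < r \<longrightarrow>
     (s * ((x - y) \<bullet> \<nu> Y) < 0 \<longrightarrow> x \<in> X) \<and> (s * ((x - y) \<bullet> \<nu> Y) > 0 \<longrightarrow> x \<notin> X))"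

lemma side_exists: "Y \<in> \<Y> \<Longrightarrow> y \<in> Y \<Longrightarrow> side Y y 1 \<or> side Y y (-1)"
  using one_sided[of Y y "side Y y 1 \<or> side Y y (-1)"] unfolding side_def by blast

lemma side_ray:
  assumes Y: "Y \<in> \<Y>" and y: "y \<in> Y" and s: "side Y y s" "s \<in> {1,-1}"
  shows "\<forall>\<^sub>F t in at_right 0. y - (t * s) *\<^sub>R \<nu> Y \<in> X \<and> y + (t * s) *\<^sub>R \<nu> Y \<notin> X"
proof -
  obtain r where r: "r > 0" "\<And>x. x\<in>H \<Longrightarrow> dist x y < r \<Longrightarrow>
     (s * ((x - y) \<bullet> \<nu> Y) < 0 \<longrightarrow> x \<in> X) \<and> (s * ((x - y) \<bullet> \<nu> Y) > 0 \<longrightarrow> x \<notin> X)"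
    using s(1) unfolding side_def by blast
  have nn: "\<nu> Y \<bullet> \<nu> Y = 1" using norm_nu[OF Y] by (simp add: norm_eq_1)
  have yH: "y \<in> H" using Y y Y_subset_H by auto
  have "\<forall>\<^sub>F t in at_right (0::real). t > 0" "\<forall>\<^sub>F t in at_right (0::real). t < r"
    using r by (auto simp: eventually_at_right_less eventually_at_right)
  then show ?thesis
  proof eventually_elim
    case (elim t)
    have "y + (t * u) *\<^sub>R \<nu> Y \<in> H" for u by (rule H_scale[OF yH nu_direction[OF Y]])
    note h = this[of s] this[of "- s"]
    have 1: "dist (y + (t * s) *\<^sub>R \<nu> Y) y < r" "dist (y - (t * s) *\<^sub>R \<nu> Y) y < r"
      using elim s norm_nu[OF Y] by (auto simp: dist_norm)
    show ?case using r(2)[OF h(1) 1(1)] r(2)[of "y - (t * s) *\<^sub>R \<nu> Y"] h(2) 1(2) elim s nn by auto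
  qed
qed

lemma side_unique:
  assumes Y: "Y \<in> \<Y>" and y: "y \<in> Y" shows "\<not> (side Y y 1 \<and> side Y y (-1))"
proof
  assume "side Y y 1 \<and> side Y y (-1)"
  then have "\<forall>\<^sub>F t in at_right (0::real). y - (t * 1) *\<^sub>R \<nu> Y \<in> X \<and> y + (t * 1) *\<^sub>R \<nu> Y \<notin> X"
    "\<forall>\<^sub>F t in at_right (0::real). y - (t * -1) *\<^sub>R \<nu> Y \<in> X \<and> y + (t * -1) *\<^sub>R \<nu> Y \<notin> X"
    using side_ray[OF Y y] by blast+
  then have "\<forall>\<^sub>F t in at_right (0::real). False" by eventually_elim auto
  then show False by simp
qed

text \<open>All points of \<open>Y\<close> lie at the same height, so the condition at
  \<open>y\<close> passes to a nearby \<open>z\<close> with the radius reduced by their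
  distance.\<close>

lemma side_open:
  assumes Y: "Y \<in> \<Y>" shows "openin (top_of_set Y) {y \<in> Y. side Y y s}"
proof -
  have "\<exists>r>0. ball y r \<inter> Y \<subseteq> {y \<in> Y. side Y y s}" if y: "y \<in> Y" "side Y y s" for y
  proof -
    obtain r where r: "r > 0" "\<And>x. x\<in>H \<Longrightarrow> dist x y < r \<Longrightarrow>
       (s * ((x - y) \<bullet> \<nu> Y) < 0 \<longrightarrow> x \<in> X) \<and> (s * ((x - y) \<bullet> \<nu> Y) > 0 \<longrightarrow> x \<notin> X)"
      using y(2) unfolding side_def by blast
    have "side Y z s" if z: "z \<in> Y" "dist z y < r" for z
    proof -
      have "(x - z) \<bullet> \<nu> Y = (x - y) \<bullet> \<nu> Y" for x
        using Y_hull[OF Y y(1)] z hull_inc[of z Y] by (auto simp: inner_diff_left)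
      moreover have "dist x y < r" if "dist x z < r - dist z y" for x
        using dist_triangle[of x y z] that by simp
      ultimately show ?thesis unfolding side_def using r(2) z
        by (intro exI[of _ "r - dist z y"]) auto
    qed
    then show ?thesis using r(1) by (intro exI[of _ r]) (auto simp: dist_commute)
  qed
  then show ?thesis by (auto simp: openin_contains_ball)
qed

text \<open>The two sign classes are open in the connected set \<open>Y\<close> and complementary.
  Without constancy, \<open>points_out\<close>, which quantifies over all points of the piece, could
  fail for both choices of the normal.\<close>

lemma side_const:
  assumes Y: "Y \<in> \<Y>"
  shows "(\<forall>y\<in>Y. side Y y 1) \<or> (\<forall>y\<in>Y. side Y y (-1))"
proof -
  have "{y\<in>Y. side Y y 1} = Y - {y\<in>Y. side Y y (-1)}"
    using side_exists[OF Y] side_unique[OF Y] by blast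
  then have "closedin (top_of_set Y) {y\<in>Y. side Y y 1}"
    using closedin_diff[OF closedin_subtopology_refl[THEN iffD2] side_open[OF Y, of "-1"]] by simp
  then have "{y\<in>Y. side Y y 1} = {} \<or> {y\<in>Y. side Y y 1} = Y"
    using side_open[OF Y, of 1] Y_connected[OF Y] unfolding connected_clopen by blast
  then show ?thesis using side_exists[OF Y] by blast
qed

lemma side_orient:
  assumes Y: "Y \<in> \<Y>" and y: "y \<in> Y"
  shows "side Y y (orient Y)"
proof (cases "\<forall>y\<in>Y. side Y y 1")
  case True
  then have "points_out X Y (\<nu> Y)" using side_ray[OF Y, of _ 1] by (auto simp: points_out_def)
  then show ?thesis using True y by (simp add: orient_def)
next
  \<comment> \<open>The default value -1 is justified here: the sign is constant and not 1, and
    outward pointing at the single point \<open>y\<close> would already contradict it.\<close>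
  case False
  then have all: "\<forall>y\<in>Y. side Y y (-1)" using side_const[OF Y] by blast
  have "\<not> points_out X Y (\<nu> Y)"
  proof
    assume "points_out X Y (\<nu> Y)"
    then have "\<forall>\<^sub>F t in at_right 0. y - t *\<^sub>R \<nu> Y \<in> X \<and> y + t *\<^sub>R \<nu> Y \<notin> X"
      using y by (auto simp: points_out_def)
    moreover have "\<forall>\<^sub>F t in at_right 0. y - (t * -1) *\<^sub>R \<nu> Y \<in> X \<and> y + (t * -1) *\<^sub>R \<nu> Y \<notin> X"
      using side_ray[OF Y y, of "-1"] all y by auto
    ultimately have "\<forall>\<^sub>F t in at_right (0::real). False" by eventually_elim auto
    then show False by simp
  qed
  then show ?thesis using all y by (simp add: orient_def)
qed

lemma orient_cases: "orient Y \<in> {1, -1}" by (simp add: orient_def)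

end

section \<open>Crossings along a ray\<close>

text \<open>Punctured neighbourhoods are used because nothing is claimed at the crossing times
  themselves. The times with punctured germ zero and those with nonzero germ form disjoint open sets
  covering the line, and the former set is nonempty by the behaviour at infinity.\<close>

lemma locally_constant_vanishes:
  fixes D :: "real \<Rightarrow> real"
  assumes loc: "\<And>t. \<exists>c. \<forall>\<^sub>F s in at t. D s = c" and top: "\<forall>\<^sub>F t in at_top. D t = 0"
  shows "\<forall>\<^sub>F s in at t. D s = 0"
proof -
  have op: "open {t. \<forall>\<^sub>F s in at t. P s}" for P :: "real \<Rightarrow> bool"
  proof (subst open_subopen, safe)
    fix t assume "\<forall>\<^sub>F s in at t. P s"
    then obtain S where S: "open S" "t \<in> S" "\<And>s. s \<in> S \<Longrightarrow> s \<noteq> t \<Longrightarrow> P s"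
      by (auto simp: eventually_at_topological)
    have "\<forall>\<^sub>F s in at u. P s" if "u \<in> S" for u
    proof (cases "u = t")
      case False
      then show ?thesis unfolding eventually_at_topological
        using S that by (intro exI[of _ "S - {t}"]) auto
    qed (use \<open>\<forall>\<^sub>F s in at t. P s\<close> in simp)
    then show "\<exists>T. open T \<and> t \<in> T \<and> T \<subseteq> {t. \<forall>\<^sub>F s in at t. P s}" using S by blast
  qed
  define A where "A = {t. \<forall>\<^sub>F s in at t. D s = 0}"
  define B where "B = {t. \<forall>\<^sub>F s in at t. D s \<noteq> 0}"
  have "open A" "open B" unfolding A_def B_def by (rule op)+
  moreover have "A \<inter> B = {}"
  proof (rule ccontr)
    assume "A \<inter> B \<noteq> {}"
    then obtain t where "\<forall>\<^sub>F s in at t. D s = 0" "\<forall>\<^sub>F s in at t. D s \<noteq> 0" by (auto simp: A_def B_def)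
    then have "\<forall>\<^sub>F s in at t. False" by eventually_elim simp
    then show False by simp
  qed
  moreover have "UNIV \<subseteq> A \<union> B"
  proof
    fix t
    obtain c where "\<forall>\<^sub>F s in at t. D s = c" using loc by blast
    then have "c = 0 \<Longrightarrow> t \<in> A" "c \<noteq> 0 \<Longrightarrow> t \<in> B" unfolding A_def B_def by (auto elim: eventually_mono)
    then show "t \<in> A \<union> B" by blast
  qed
  moreover have "A \<noteq> {}"
  proof -
    obtain b where b: "\<And>t. t \<ge> b \<Longrightarrow> D t = 0" using top by (auto simp: eventually_at_top_linorder)
    have "\<forall>\<^sub>F s in at (b + 1). s \<in> {b<..}" by (rule eventually_at_in_open') auto
    then have "b + 1 \<in> A" unfolding A_def by (auto elim!: eventually_mono intro: b)
    then show ?thesis by blast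
  qed
  ultimately have "B = {}" "A = UNIV" using connectedD[OF connected_UNIV, of A B] by auto
  then show ?thesis by (auto simp: A_def)
qed

text \<open>An isometry is affine, so the preimage is affine; being proper, it has empty interior,
  and a convex set with empty interior is negligible.\<close>

lemma negligible_affine_vimage:
  fixes \<phi> :: "'a::euclidean_space \<Rightarrow> 'b::euclidean_space"
  assumes \<phi>: "\<forall>x y. dist (\<phi> x) (\<phi> y) = dist x y" and A: "affine A" and sub: "\<not> range \<phi> \<subseteq> A"
  shows "\<phi> -` A \<in> null_sets lborel"
proof -
  obtain L where L: "linear L" "\<And>x. \<phi> x = \<phi> 0 + L x" using isometry_affine[OF \<phi>] by metis
  have aff: "\<phi> (u *\<^sub>R x + v *\<^sub>R y) = u *\<^sub>R \<phi> x + v *\<^sub>R \<phi> y" if "u + v = 1" for u v x y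
  proof -
    have "\<phi> (u *\<^sub>R x + v *\<^sub>R y) = (u + v) *\<^sub>R \<phi> 0 + L (u *\<^sub>R x + v *\<^sub>R y)"
      using L(2)[of "u *\<^sub>R x + v *\<^sub>R y"] that by simp
    also have "\<dots> = u *\<^sub>R (\<phi> 0 + L x) + v *\<^sub>R (\<phi> 0 + L y)"
      by (simp add: linear_add[OF L(1)] linear_cmul[OF L(1)] algebra_simps)
    finally show ?thesis using L(2) by metis
  qed
  have affv: "affine (\<phi> -` A)"
    using A aff unfolding affine_def by auto
  have "interior (\<phi> -` A) = {}"
  proof (rule ccontr)
    assume "interior (\<phi> -` A) \<noteq> {}"
    then have "\<phi> -` A = UNIV" using affine_hull_nonempty_interior affv by (metis affine_hull_eq)
    then show False using sub by auto
  qed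
  then have "negligible (\<phi> -` A)"
    using negligible_convex_interior affine_imp_convex[OF affv] by blast
  moreover have "\<phi> -` A \<in> sets lborel" using affine_closed[OF affv] by simp
  ultimately show ?thesis
    by (simp add: negligible_iff_null_sets null_sets_completion_iff)
qed

context hull_boundary
begin

text \<open>The time at which the line through \<open>x\<close> meets the hyperplane of
  \<open>Y\<close>; the choice of the point of \<open>Y\<close> does not influence it. For a piece
  parallel to \<open>e\<close>, division by zero gives 0, which leaves the \<open>shadow\<close>
  empty.\<close>

definition hit_time :: "point \<Rightarrow> point set \<Rightarrow> point \<Rightarrow> real" where
  "hit_time e Y x = (((SOME p. p \<in> Y) - x) \<bullet> \<nu> Y) / (e \<bullet> \<nu> Y)"

definition shadow :: "point \<Rightarrow> point set \<Rightarrow> point set" where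
  "shadow e Y = {x. 0 < hit_time e Y x \<and> x + hit_time e Y x *\<^sub>R e \<in> Y}"

text \<open>Excludes starting points on a piece, and those whose line meets the relative boundary of
  a piece or a piece parallel to \<open>e\<close>, where a hit has no well-defined sign.\<close>

definition generic :: "point \<Rightarrow> point \<Rightarrow> bool" where
  "generic e x \<longleftrightarrow> x \<in> H \<and> (\<forall>A\<in>\<N>. \<forall>t. x + t *\<^sub>R e \<notin> A) \<and> (\<forall>Y\<in>\<Y>. x \<notin> Y) \<and>
     (\<forall>Y\<in>\<Y>. e \<bullet> \<nu> Y = 0 \<longrightarrow> (\<forall>t. x + t *\<^sub>R e \<notin> Y))"

lemma hit_time_eq:
  assumes Y: "Y \<in> \<Y>" and e: "e \<bullet> \<nu> Y \<noteq> 0" and x: "x + t *\<^sub>R e \<in> affine hull Y"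
  shows "hit_time e Y x = t"
proof -
  have "(SOME p. p \<in> Y) \<in> Y" using Y_nonempty[OF Y] by (simp add: some_in_eq)
  then have "(x + t *\<^sub>R e - (SOME p. p \<in> Y)) \<bullet> \<nu> Y = 0" using Y_hull[OF Y] x by blast
  then show ?thesis using e by (simp add: hit_time_def inner_diff_left inner_add_left field_simps)
qed

text \<open>Let the starting point travel along the ray. The difference \<open>D\<close> between the
  indicator of \<open>X\<close> and the signed number of hits still ahead is locally constant,
  because both jump by the same amount at a hit; it vanishes far out, where neither domain nor hits
  remain.\<close>

lemma ray_crossing:
  assumes e: "e \<in> direction X" "e \<noteq> 0" and x: "generic e x"
  shows "indicator X x = (\<Sum>Y\<in>\<Y>. sgn (orient Y * (e \<bullet> \<nu> Y)) * (indicator (shadow e Y) x :: real))"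
proof -
  define P where "P = (\<lambda>Y t. if t < hit_time e Y x \<and> x + hit_time e Y x *\<^sub>R e \<in> Y then 1 else 0 :: real)"
  define D where "D = (\<lambda>t. indicator X (x + t *\<^sub>R e) - (\<Sum>Y\<in>\<Y>. sgn (orient Y * (e \<bullet> \<nu> Y)) * P Y t))"
  have line: "x + t *\<^sub>R e \<in> H" for t using H_scale e x by (auto simp: generic_def)
  have fr: "\<exists>Y\<in>\<Y>. x + t *\<^sub>R e \<in> Y" if fr: "x + t *\<^sub>R e \<in> rel_frontier X" for t
  proof -
    obtain Y where "Y \<in> \<Y>" "x + t *\<^sub>R e \<in> closure Y" using fr rel_frontier_eq by auto
    then show ?thesis using Y_closure[of Y] x by (auto simp: generic_def)
  qed
  have tend: "((\<lambda>t. x + t *\<^sub>R e) \<longlongrightarrow> x + t0 *\<^sub>R e) (nhds t0)" for t0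
    by (intro tendsto_intros filterlim_ident)
  have locP: "\<forall>\<^sub>F t in nhds t0. P Y t = P Y t0" if Y: "x + t0 *\<^sub>R e \<notin> Y" for Y t0
  proof (cases "x + hit_time e Y x *\<^sub>R e \<in> Y")
    case True
    then have "hit_time e Y x \<noteq> t0" using Y by auto
    then consider "t0 < hit_time e Y x" | "t0 > hit_time e Y x" by linarith
    then show ?thesis
    proof cases
      case 1
      then have "\<forall>\<^sub>F t in nhds t0. t \<in> {..<hit_time e Y x}" by (intro eventually_nhds_in_open) auto
      then show ?thesis by eventually_elim (use 1 in \<open>auto simp: P_def\<close>)
    next
      case 2
      then have "\<forall>\<^sub>F t in nhds t0. t \<in> {hit_time e Y x<..}" by (intro eventually_nhds_in_open) auto
      then show ?thesis by eventually_elim (use 2 in \<open>auto simp: P_def\<close>)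
    qed
  qed (simp add: P_def)
  have sumP: "\<forall>\<^sub>F t in nhds t0. (\<Sum>Y\<in>\<Z>. sgn (orient Y * (e \<bullet> \<nu> Y)) * P Y t) =
      (\<Sum>Y\<in>\<Z>. sgn (orient Y * (e \<bullet> \<nu> Y)) * P Y t0)"
    if "\<Z> \<subseteq> \<Y>" "\<And>Y. Y \<in> \<Z> \<Longrightarrow> x + t0 *\<^sub>R e \<notin> Y" for \<Z> t0
  proof -
    have "\<forall>\<^sub>F t in nhds t0. \<forall>Y\<in>\<Z>. P Y t = P Y t0"
      using finite_subset[OF that(1) finite_Y] that(2) by (auto intro!: eventually_ball_finite locP)
    then show ?thesis by eventually_elim simp
  qed
  have off: "\<forall>\<^sub>F t in nhds t0. D t = D t0" if t0: "x + t0 *\<^sub>R e \<notin> rel_frontier X" for t0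
  proof -
    have "\<forall>\<^sub>F t in nhds t0. (indicator X (x + t *\<^sub>R e) :: real) = indicator X (x + t0 *\<^sub>R e)"
    proof (cases "x + t0 *\<^sub>R e \<in> X")
      case True
      obtain U where U: "open U" "X = H \<inter> U" using rel_open by (auto simp: openin_open)
      have "\<forall>\<^sub>F t in nhds t0. x + t *\<^sub>R e \<in> U"
        using True U by (intro topological_tendstoD[OF tend]) auto
      then have "\<forall>\<^sub>F t in nhds t0. x + t *\<^sub>R e \<in> X"
        by eventually_elim (use U(2) line in blast)
      then show ?thesis by eventually_elim (use True in simp)
    next
      case False
      then have "x + t0 *\<^sub>R e \<notin> closure X" using t0 frontier_if by blast
      then have "\<forall>\<^sub>F t in nhds t0. x + t *\<^sub>R e \<in> - closure X"
        by (intro topological_tendstoD[OF tend]) auto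
      then show ?thesis by eventually_elim (use False closure_subset in \<open>auto simp: indicator_def\<close>)
    qed
    moreover have "\<forall>\<^sub>F t in nhds t0. (\<Sum>Y\<in>\<Y>. sgn (orient Y * (e \<bullet> \<nu> Y)) * P Y t) =
      (\<Sum>Y\<in>\<Y>. sgn (orient Y * (e \<bullet> \<nu> Y)) * P Y t0)"
      using t0 Y_frontier by (intro sumP) auto
    ultimately show ?thesis unfolding D_def by eventually_elim simp
  qed
  have "\<exists>c. \<forall>\<^sub>F t in at t0. D t = c" for t0
  proof (cases "x + t0 *\<^sub>R e \<in> rel_frontier X")
    case False
    then show ?thesis using off[OF False] eventually_nhds_conv_at by blast
  next
    case True
    then obtain Y where Y: "Y \<in> \<Y>" "x + t0 *\<^sub>R e \<in> Y" using fr by blast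
    then have eY: "e \<bullet> \<nu> Y \<noteq> 0" using x by (auto simp: generic_def)
    have hit: "hit_time e Y x = t0" by (rule hit_time_eq[OF Y(1) eY hull_inc[OF Y(2)]])
    obtain r where r: "r > 0" "\<And>z. z \<in> H \<Longrightarrow> dist z (x + t0 *\<^sub>R e) < r \<Longrightarrow>
        (orient Y * ((z - (x + t0 *\<^sub>R e)) \<bullet> \<nu> Y) < 0 \<longrightarrow> z \<in> X) \<and>
        (orient Y * ((z - (x + t0 *\<^sub>R e)) \<bullet> \<nu> Y) > 0 \<longrightarrow> z \<notin> X)"
      using side_orient[OF Y] unfolding side_def by blast
    define s where "s = orient Y * (e \<bullet> \<nu> Y)"
    have s0: "s \<noteq> 0" using eY orient_cases[of Y] by (auto simp: s_def)
    have others: "x + t0 *\<^sub>R e \<notin> Z" if "Z \<in> \<Y> - {Y}" for Z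
      using that Y Y_disjoint[of Z Y] closure_subset[of Y] by auto
    have "\<forall>\<^sub>F t in nhds t0. x + t *\<^sub>R e \<in> ball (x + t0 *\<^sub>R e) r"
      by (rule topological_tendstoD[OF tend]) (use r(1) in auto)
    then have "\<forall>\<^sub>F t in at t0. x + t *\<^sub>R e \<in> ball (x + t0 *\<^sub>R e) r"
      using eventually_nhds_conv_at by blast
    moreover have "\<forall>\<^sub>F t in at t0. t \<noteq> t0" by (rule eventually_neq_at_within)
    moreover have "\<forall>\<^sub>F t in at t0. (\<Sum>Z\<in>\<Y>-{Y}. sgn (orient Z * (e \<bullet> \<nu> Z)) * P Z t) =
      (\<Sum>Z\<in>\<Y>-{Y}. sgn (orient Z * (e \<bullet> \<nu> Z)) * P Z t0)"
      using sumP[of "\<Y> - {Y}" t0] others eventually_nhds_conv_at by blast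
    \<comment> \<open>If the ray leaves \<open>X\<close> here (\<open>s > 0\<close>), the indicator
      and the hit of \<open>Y\<close> contribute 1 - 1 before and 0 - 0 after; if it enters, 0 + 1
      before and 1 - 0 after. This is the constant 0 or 1, the same on both sides.\<close>
    ultimately have "\<forall>\<^sub>F t in at t0. D t = (if s > 0 then 0 else 1) -
        (\<Sum>Z\<in>\<Y>-{Y}. sgn (orient Z * (e \<bullet> \<nu> Z)) * P Z t0)"
    proof eventually_elim
      case (elim t)
      have "D t = indicator X (x + t *\<^sub>R e) - sgn s * P Y t - (\<Sum>Z\<in>\<Y>-{Y}. sgn (orient Z * (e \<bullet> \<nu> Z)) * P Z t)"
        unfolding D_def s_def by (subst sum.remove[OF finite_Y Y(1)]) simp
      moreover have "P Y t = (if t < t0 then 1 else 0)" using Y(2) by (simp add: P_def hit)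
      moreover have "orient Y * ((x + t *\<^sub>R e - (x + t0 *\<^sub>R e)) \<bullet> \<nu> Y) = (t - t0) * s"
        by (simp add: s_def inner_diff_left inner_add_left algebra_simps)
      then have "((t - t0) * s < 0 \<longrightarrow> x + t *\<^sub>R e \<in> X) \<and> ((t - t0) * s > 0 \<longrightarrow> x + t *\<^sub>R e \<notin> X)"
        using r(2)[OF line, of t] elim(1) by (simp add: dist_commute)
      then have "(indicator X (x + t *\<^sub>R e) :: real) = (if (t - t0) * s < 0 then 1 else 0)"
        using elim(2) s0 by (auto simp: indicator_def linorder_neq_iff mult_less_0_iff zero_less_mult_iff)
      moreover have "(if (t - t0) * s < 0 then 1 else 0) - sgn s * (if t < t0 then 1 else 0) = (if s > 0 then 0 else 1 :: real)"
        using elim(2) s0 by (auto simp: sgn_if mult_less_0_iff)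
      ultimately show ?case unfolding elim(3)[symmetric] by simp
    qed
    then show ?thesis by blast
  qed
  moreover have "\<forall>\<^sub>F t in at_top. D t = 0"
  proof -
    obtain B where B: "\<And>z. z \<in> X \<Longrightarrow> norm z \<le> B" using bounded bounded_iff by blast
    have "\<forall>\<^sub>F t in at_top. t > (B + norm x) / norm e" by (rule eventually_gt_at_top)
    moreover have "\<forall>\<^sub>F t in at_top. \<forall>Y\<in>\<Y>. t > hit_time e Y x"
      using finite_Y by (auto intro!: eventually_ball_finite eventually_gt_at_top)
    ultimately show ?thesis
    proof eventually_elim
      case (elim t)
      have "B + norm x < t * norm e" using elim(1) e(2) by (simp add: field_simps)
      also have "t * norm e \<le> norm (t *\<^sub>R e)" by (simp add: mult_right_mono)
      also have "norm (t *\<^sub>R e) \<le> norm (x + t *\<^sub>R e) + norm x"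
        using norm_triangle_ineq4[of "x + t *\<^sub>R e" x] by simp
      finally have "x + t *\<^sub>R e \<notin> X" using B by fastforce
      moreover have "P Y t = 0" if "Y \<in> \<Y>" for Y using elim(2) that by (auto simp: P_def)
      ultimately show ?case by (simp add: D_def)
    qed
  qed
  ultimately have "\<forall>\<^sub>F t in at 0. D t = 0" by (rule locally_constant_vanishes)
  \<comment> \<open>The starting point is off the frontier, so \<open>D\<close> is constant on a
    full neighbourhood of 0, and its punctured germ determines the value at 0.\<close>
  moreover have "x + 0 *\<^sub>R e \<notin> rel_frontier X" using fr[of 0] x by (auto simp: generic_def)
  then have "\<forall>\<^sub>F t in at 0. D t = D 0" using off[of 0] eventually_nhds_conv_at by blast
  ultimately have "\<forall>\<^sub>F t in at (0::real). D 0 = 0" by eventually_elim simp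
  then have "D 0 = 0" by simp
  then show ?thesis by (simp add: D_def P_def shadow_def indicator_def of_bool_def)
qed

text \<open>The lines in direction \<open>e\<close> through a set of \<open>\<N>\<close> fill an
  affine set of at most one dimension more, still proper in the hull; this is where codimension two
  enters. A line that meets a piece parallel to it starts in the hull of that piece, again a null
  set.\<close>

lemma generic_AE:
  fixes \<phi> :: "'a::euclidean_space \<Rightarrow> point"
  assumes \<phi>: "\<forall>x y. dist (\<phi> x) (\<phi> y) = dist x y" and rng: "range \<phi> = H" and e: "e \<in> direction X"
  shows "AE a in lborel. generic e (\<phi> a)"
proof -
  have aeN: "AE a in lborel. \<forall>t. \<phi> a + t *\<^sub>R e \<notin> A" if A: "A \<in> \<N>" for A
  proof (cases "A = {}")
    case False
    then obtain p where p: "p \<in> A" by blast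
    define B where "B = affine hull (insert (p + e) A)"
    have "aff_dim B \<le> aff_dim A + 1" unfolding B_def by (simp add: aff_dim_insert)
    then have "aff_dim B < aff_dim H" using N[OF A] by simp
    then have "\<not> range \<phi> \<subseteq> B" using rng aff_dim_subset[of H B] by auto
    then have "\<phi> -` B \<in> null_sets lborel"
      by (intro negligible_affine_vimage[OF \<phi>]) (auto simp: B_def)
    then have "AE a in lborel. a \<notin> \<phi> -` B" by (rule AE_not_in)
    then show ?thesis
    proof eventually_elim
      case (elim a)
      show ?case
      proof (intro allI notI)
        fix t assume t: "\<phi> a + t *\<^sub>R e \<in> A"
        have i: "\<phi> a + t *\<^sub>R e \<in> B" "p + e \<in> B" "p \<in> B" using t p by (auto simp: B_def hull_inc)
        have "\<phi> a + t *\<^sub>R e + (- t) *\<^sub>R ((p + e) - p) \<in> B"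
          using mem_affine_3_minus[OF _ i, of "- t"] by (simp add: B_def)
        then show False using elim by simp
      qed
    qed
  qed simp
  have nullY: "AE a in lborel. \<phi> a \<notin> affine hull Y" if Y: "Y \<in> \<Y>" for Y
  proof -
    obtain p where p: "p \<in> Y" using Y_nonempty[OF Y] by blast
    have "p + \<nu> Y \<in> H" using Y_subset_H[OF Y] p nu_direction[OF Y] direction_add by blast
    moreover have "p + \<nu> Y \<notin> affine hull Y" using Y_hull[OF Y p] norm_nu[OF Y] by auto
    ultimately have "\<not> range \<phi> \<subseteq> affine hull Y" using rng by auto
    then have "\<phi> -` (affine hull Y) \<in> null_sets lborel"
      by (intro negligible_affine_vimage[OF \<phi>]) auto
    then have "AE a in lborel. a \<notin> \<phi> -` (affine hull Y)" by (rule AE_not_in)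
    then show ?thesis by simp
  qed
  have "AE a in lborel. \<forall>A\<in>\<N>. \<forall>t. \<phi> a + t *\<^sub>R e \<notin> A"
    using finite_N aeN by (simp add: AE_finite_all)
  moreover have "AE a in lborel. \<forall>Y\<in>\<Y>. \<phi> a \<notin> affine hull Y"
    using finite_Y nullY by (simp add: AE_finite_all)
  ultimately show ?thesis
  proof eventually_elim
    case (elim a)
    have aH: "\<phi> a \<in> H" using rng by blast
    have "\<phi> a + t *\<^sub>R e \<notin> Y" if Y: "Y \<in> \<Y>" "e \<bullet> \<nu> Y = 0" for Y t
    proof
      assume t: "\<phi> a + t *\<^sub>R e \<in> Y"
      have "(\<phi> a - (\<phi> a + t *\<^sub>R e)) \<bullet> \<nu> Y = 0" using Y(2) by simp
      then show False using Y_hull[OF Y(1) t] aH elim(2) Y(1) by blast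
    qed
    moreover have "\<phi> a \<notin> Y" if "Y \<in> \<Y>" for Y using elim(2) that hull_inc[of "\<phi> a" Y] by auto
    ultimately show ?case unfolding generic_def using elim(1) aH by auto
  qed
qed

end

section \<open>The divergence formula in parametrized form\<close>

lemma borel_openin_affine:
  fixes S :: "'a::euclidean_space set"
  assumes "openin (top_of_set (affine hull T)) S" shows "S \<in> sets borel"
proof -
  obtain U where "open U" "S = affine hull T \<inter> U" using assms by (auto simp: openin_open)
  then show ?thesis by (auto intro!: sets.Int borel_closed affine_closed)
qed

text \<open>The finite exceptional set accommodates the kinks of a piecewise linear cutoff; the
  vanishing below \<open>a\<close> reduces the half-line to a compact interval.\<close>

lemma set_integral_FTC_cutoff:
  fixes w g :: "real \<Rightarrow> real"
  assumes S: "finite S" and a: "a \<le> 0"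
    and der: "\<And>s. s \<notin> S \<Longrightarrow> (w has_real_derivative g s) (at s)"
    and cont: "continuous_on UNIV w" and van: "\<And>s. s \<le> a \<Longrightarrow> g s = 0" "w a = 0"
    and g: "g \<in> borel_measurable borel" and bd: "\<And>s. s \<in> {a..0} \<Longrightarrow> \<bar>g s\<bar> \<le> C"
  shows "(LINT s|lborel. indicator {..<0} s * g s) = w 0"
proof -
  have "(g has_integral w 0 - w a) {a..0}"
  proof (rule fundamental_theorem_of_calculus_interior_strong[OF S a])
    show "(w has_vector_derivative g s) (at s)" if "s \<in> {a<..<0} - S" for s
      using der that by (simp add: has_real_derivative_iff_has_vector_derivative)
    show "continuous_on {a..0} w" using cont continuous_on_subset by blast
  qed
  then have "integral {a..0} g = w 0" using van(2) by (simp add: integral_unique)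
  moreover have "set_integrable lborel {a..0} g"
    unfolding set_integrable_def
  proof (rule Bochner_Integration.integrable_bound)
    show "integrable lborel (\<lambda>s. indicator {a..0} s *\<^sub>R C)"
      by (rule borel_integrable_compact) (auto intro: continuous_intros)
    show "AE s in lborel. norm (indicator {a..0} s *\<^sub>R g s) \<le> norm (indicator {a..0} s *\<^sub>R C)"
      using order_trans[OF bd abs_ge_self] by (auto intro!: AE_I2 simp: indicator_def)
  qed (use g in simp)
  then have "(LINT s:{a..0}|lborel. g s) = integral {a..0} g"
    by (rule set_borel_integral_eq_integral)
  moreover have "(LINT s|lborel. indicator {..<0} s * g s) = (LINT s:{a..0}|lborel. g s)"
    unfolding set_lebesgue_integral_def
  proof (rule integral_cong_AE)
    have "AE s in lborel. s \<noteq> (0::real)" by (rule AE_lborel_singleton)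
    then show "AE s in lborel. indicator {..<0} s * g s = indicator {a..0} s *\<^sub>R g s"
      by eventually_elim (use van(1) in \<open>auto simp: indicator_def\<close>)
  qed (use g in auto)
  ultimately show ?thesis by simp
qed

context hull_boundary
begin

lemma Y_in_closure: "Y \<in> \<Y> \<Longrightarrow> y \<in> Y \<Longrightarrow> y \<in> closure X"
  using Y_frontier by (auto simp: rel_frontier_def)

lemma shadow_borel: "Y \<in> \<Y> \<Longrightarrow> shadow e Y \<in> sets borel"
proof -
  assume Y: "Y \<in> \<Y>"
  have [measurable]: "Y \<in> sets borel" using Y_rel_open[OF Y] by (rule borel_openin_affine)
  have [measurable]: "hit_time e Y \<in> borel_measurable borel" unfolding hit_time_def by measurable
  show ?thesis unfolding shadow_def by measurable
qed

lemma shadow_fibre: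
  assumes Y: "Y \<in> \<Y>" and e: "e \<bullet> \<nu> Y \<noteq> 0" and y: "y \<in> affine hull Y"
  shows "y + s *\<^sub>R e \<in> shadow e Y \<longleftrightarrow> s < 0 \<and> y \<in> Y"
proof -
  have "hit_time e Y (y + s *\<^sub>R e) = - s"
    by (rule hit_time_eq[OF Y e]) (use y in simp)
  then show ?thesis by (simp add: shadow_def)
qed

text \<open>The shadow of a single piece is unbounded, although the signed sum of the shadows is the
  bounded set \<open>X\<close>. To integrate piece by piece, \<open>G x \<bullet> e\<close> is
  replaced by a function that equals it on \<open>X\<close> and vanishes far back.\<close>

lemma directional_divergence_param:
  fixes \<phi> :: "real^'n::{finite,wellorder} \<Rightarrow> point" and \<psi> :: "point set \<Rightarrow> 'b::euclidean_space \<Rightarrow> point"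
  assumes \<phi>: "\<forall>x y. dist (\<phi> x) (\<phi> y) = dist x y" and \<phi>H: "range \<phi> = H"
    and \<psi>: "\<And>Y. Y \<in> \<Y> \<Longrightarrow> \<forall>x y. dist (\<psi> Y x) (\<psi> Y y) = dist x y"
    and \<psi>H: "\<And>Y. Y \<in> \<Y> \<Longrightarrow> range (\<psi> Y) = affine hull Y"
    and der: "\<And>x. (f has_derivative (\<lambda>h. G x \<bullet> h)) (at x)" and contG: "continuous_on UNIV G"
    and e: "e \<in> direction X"
  shows "(LINT a|lborel. indicator X (\<phi> a) * (G (\<phi> a) \<bullet> e)) =
    (\<Sum>Y\<in>\<Y>. orient Y * (\<nu> Y \<bullet> e) * (LINT b|lborel. indicator Y (\<psi> Y b) * f (\<psi> Y b)))"
proof (cases "e = 0")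
  case False
  have contf: "continuous_on UNIV f" using der has_derivative_continuous
    by (simp add: continuous_on_eq_continuous_at) blast
  have m\<phi>[measurable]: "\<phi> \<in> borel_measurable borel" by (rule borel_measurable_continuous_onI[OF isometry_continuous[OF \<phi>]])
  have [measurable]: "f \<in> borel_measurable borel" "G \<in> borel_measurable borel"
    using contf contG by (auto intro: borel_measurable_continuous_onI)
  obtain B where B: "\<And>x. x \<in> closure X \<Longrightarrow> norm x \<le> B" "B \<ge> 0"
    using bounded_closure[OF bounded] by (meson bounded_pos less_imp_le)
  \<comment> \<open>The height along \<open>e\<close>, normalized so that adding \<open>s\<close>
    times \<open>e\<close> raises it by \<open>s\<close>.\<close>
  define ht where "ht = (\<lambda>x. (x \<bullet> e) / (e \<bullet> e))"
  have ee: "e \<bullet> e > 0" using False by simp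
  have ht_line: "ht (y + s *\<^sub>R e) = ht y + s" for y s
    using ee by (simp add: ht_def inner_add_left field_simps)
  \<comment> \<open>The summand 1 makes the bound strict: the closure of \<open>X\<close> lies at
    heights above \<open>-M\<close>, beyond the ramp of \<open>\<theta>\<close> between
    \<open>-M - 1\<close> and \<open>-M\<close>.\<close>
  define M where "M = B / norm e + 1"
  have htB: "\<bar>ht x\<bar> < M" if "x \<in> closure X" for x
  proof -
    have "\<bar>x \<bullet> e\<bar> \<le> norm x * norm e" by (rule Cauchy_Schwarz_ineq2)
    also have "\<dots> \<le> B * norm e" using B(1)[OF that] by (simp add: mult_right_mono)
    finally have "\<bar>ht x\<bar> \<le> B * norm e / (e \<bullet> e)" using ee by (simp add: ht_def abs_divide divide_right_mono)
    also have "\<dots> = B / norm e" using False by (simp add: dot_square_norm power2_eq_square)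
    finally show ?thesis by (simp add: M_def)
  qed
  txt \<open>The function \<open>w\<close> vanishes far below \<open>X\<close> and agrees with \<open>f\<close> near \<open>X\<close>, so that the integral of its
    derivative \<open>g\<close> along the half-line that ends in a boundary point is the value of \<open>f\<close> there.\<close>
  define \<theta> where "\<theta> = (\<lambda>t::real. min 1 (max 0 (t + M + 1)))"
  define w where "w = (\<lambda>x. f x * \<theta> (ht x))"
  \<comment> \<open>Away from the two kinks of \<open>\<theta>\<close>, this is the derivative of
    \<open>w\<close> in direction \<open>e\<close>; the second summand is \<open>f\<close> times the
    slope 1 of the ramp.\<close>
  define g where "g = (\<lambda>x. (G x \<bullet> e) * \<theta> (ht x) + (if - M - 1 < ht x \<and> ht x < - M then f x else 0))"
  have [measurable]: "ht \<in> borel_measurable borel" unfolding ht_def by measurable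
  have [measurable]: "\<theta> \<in> borel_measurable borel" unfolding \<theta>_def by measurable
  have mg[measurable]: "g \<in> borel_measurable borel" unfolding g_def by measurable
  have gX: "g x = G x \<bullet> e" if "x \<in> X" for x
    using htB[OF subsetD[OF closure_subset that]] by (auto simp: g_def \<theta>_def)
  have \<theta>_cont: "continuous_on UNIV \<theta>" unfolding \<theta>_def by (intro continuous_intros)
  have ht_cont: "continuous_on UNIV ht" unfolding ht_def by (intro continuous_intros) (use False in auto)
  obtain bnd where bnd: "\<And>R x. norm x \<le> R \<Longrightarrow> \<bar>g x\<bar> \<le> bnd R"
  proof -
    have "\<exists>b. \<forall>x. norm x \<le> R \<longrightarrow> \<bar>g x\<bar> \<le> b" for R
    proof -
      have "compact (cball (0::point) R)" by simp
      then have "bounded (G ` cball 0 R)" "bounded (f ` cball 0 R)"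
        using contG contf continuous_on_subset compact_continuous_image compact_imp_bounded by (metis subset_UNIV)+
      then obtain b1 b2 where "\<forall>y\<in>G ` cball 0 R. norm y \<le> b1" "\<forall>y\<in>f ` cball 0 R. norm y \<le> b2"
        unfolding bounded_iff by blast
      then have b: "norm (G x) \<le> b1" "\<bar>f x\<bar> \<le> b2" if "norm x \<le> R" for x
        using that by auto
      have "\<bar>g x\<bar> \<le> b1 * norm e + b2" if x: "norm x \<le> R" for x
      proof -
        have "\<bar>g x\<bar> \<le> \<bar>G x \<bullet> e\<bar> * \<bar>\<theta> (ht x)\<bar> + \<bar>f x\<bar>"
          unfolding g_def using abs_triangle_ineq[of "(G x \<bullet> e) * \<theta> (ht x)" "f x"] by (auto simp: abs_mult)
        also have "\<dots> \<le> \<bar>G x \<bullet> e\<bar> * 1 + \<bar>f x\<bar>" by (intro add_mono mult_left_mono) (auto simp: \<theta>_def)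
        also have "\<bar>G x \<bullet> e\<bar> \<le> norm (G x) * norm e" by (rule Cauchy_Schwarz_ineq2)
        also have "norm (G x) * norm e \<le> b1 * norm e" using b(1)[OF x] by (simp add: mult_right_mono)
        finally show ?thesis using b(2)[OF x] by simp
      qed
      then show ?thesis by blast
    qed
    then show ?thesis using that by metis
  qed
  define s where "s = (\<lambda>Y. sgn (orient Y * (e \<bullet> \<nu> Y)))"
  define u where "u = (\<lambda>Y a. indicator (shadow e Y) (\<phi> a) * g (\<phi> a))"
  have ray: "(LINT y|lborel. indicator {..<0} y * g (z + y *\<^sub>R e)) = f z" if z: "z \<in> closure X" for z
  proof -
    let ?w = "\<lambda>y. w (z + y *\<^sub>R e)"
    have "(LINT y|lborel. indicator {..<0} y * g (z + y *\<^sub>R e)) = ?w 0"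
    proof (rule set_integral_FTC_cutoff)
      show "finite {- M - 1 - ht z, - M - ht z}" by simp
      show "- M - 1 - ht z \<le> 0" using htB[OF z] by simp
      have contl: "continuous_on UNIV (\<lambda>y. z + y *\<^sub>R e)" by (intro continuous_intros)
      show "continuous_on UNIV ?w" unfolding w_def
        by (intro continuous_intros continuous_on_compose2[OF contf contl] continuous_on_compose2[OF \<theta>_cont]
            continuous_on_compose2[OF ht_cont contl]) auto
      show "g (z + y *\<^sub>R e) = 0" if "y \<le> - M - 1 - ht z" for y
        using that by (auto simp: g_def ht_line \<theta>_def)
      show "w (z + (- M - 1 - ht z) *\<^sub>R e) = 0" by (simp add: w_def ht_line \<theta>_def)
      show "(\<lambda>y. g (z + y *\<^sub>R e)) \<in> borel_measurable borel" by measurable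
      show "\<bar>g (z + y *\<^sub>R e)\<bar> \<le> bnd (norm z + (\<bar>M\<bar> + 1 + \<bar>ht z\<bar>) * norm e)" if "y \<in> {- M - 1 - ht z..0}" for y
      proof (rule bnd)
        have "norm (z + y *\<^sub>R e) \<le> norm z + \<bar>y\<bar> * norm e" using norm_triangle_ineq[of z "y *\<^sub>R e"] by simp
        also have "\<bar>y\<bar> * norm e \<le> (\<bar>M\<bar> + 1 + \<bar>ht z\<bar>) * norm e" using that by (intro mult_right_mono) auto
        finally show "norm (z + y *\<^sub>R e) \<le> norm z + (\<bar>M\<bar> + 1 + \<bar>ht z\<bar>) * norm e" by simp
      qed
      fix y assume y: "y \<notin> {- M - 1 - ht z, - M - ht z}"
      have line: "((\<lambda>y. z + y *\<^sub>R e) has_derivative (\<lambda>h. h *\<^sub>R e)) (at y)"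
        by (auto intro!: derivative_eq_intros)
      have "((\<lambda>y. f (z + y *\<^sub>R e)) has_derivative (\<lambda>h. G (z + y *\<^sub>R e) \<bullet> (h *\<^sub>R e))) (at y)"
        using has_derivative_compose[OF line der] .
      then have f': "((\<lambda>y. f (z + y *\<^sub>R e)) has_real_derivative G (z + y *\<^sub>R e) \<bullet> e) (at y)"
        by (simp add: has_field_derivative_def mult_commute_abs)
      define c where "c = (if - M - 1 < ht z + y \<and> ht z + y < - M then 1 else 0 :: real)"
      have \<theta>': "(\<theta> has_real_derivative c) (at (ht z + y))"
      proof -
        consider "ht z + y < - M - 1" | "- M - 1 < ht z + y" "ht z + y < - M" | "ht z + y > - M"
          using y by fastforce
        then show ?thesis
        proof cases
          case 1
          have ev: "\<forall>\<^sub>F t in nhds (ht z + y). t \<in> {..<- M - 1}" using 1 by (intro eventually_nhds_in_open) auto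
          have "\<forall>\<^sub>F t in nhds (ht z + y). \<theta> t = 0" using ev by eventually_elim (auto simp: \<theta>_def)
          then show ?thesis using 1 by (subst DERIV_cong_ev[OF refl _ refl]) (auto simp: c_def)
        next
          case 2
          have ev: "\<forall>\<^sub>F t in nhds (ht z + y). t \<in> {- M - 1<..<- M}" using 2 by (intro eventually_nhds_in_open) auto
          have "\<forall>\<^sub>F t in nhds (ht z + y). \<theta> t = t + M + 1" using ev by eventually_elim (auto simp: \<theta>_def)
          then show ?thesis using 2 by (subst DERIV_cong_ev[OF refl _ refl]) (auto simp: c_def intro!: derivative_eq_intros)
        next
          case 3
          have ev: "\<forall>\<^sub>F t in nhds (ht z + y). t \<in> {- M<..}" using 3 by (intro eventually_nhds_in_open) auto
          have "\<forall>\<^sub>F t in nhds (ht z + y). \<theta> t = 1" using ev by eventually_elim (auto simp: \<theta>_def)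
          then show ?thesis using 3 by (subst DERIV_cong_ev[OF refl _ refl]) (auto simp: c_def)
        qed
      qed
      have "((\<lambda>y. \<theta> (ht z + y)) has_real_derivative c) (at y)"
        using \<theta>' DERIV_shift[of \<theta> c y "ht z"] by (simp add: add.commute)
      from DERIV_mult[OF f' this]
      have "(?w has_real_derivative (G (z + y *\<^sub>R e) \<bullet> e) * \<theta> (ht z + y) + c * f (z + y *\<^sub>R e)) (at y)"
        by (simp add: w_def ht_line)
      also have "(G (z + y *\<^sub>R e) \<bullet> e) * \<theta> (ht z + y) + c * f (z + y *\<^sub>R e) = g (z + y *\<^sub>R e)"
        by (simp add: g_def ht_line c_def)
      finally show "(?w has_real_derivative g (z + y *\<^sub>R e)) (at y)" .
    qed
    then show ?thesis using htB[OF z] by (simp add: w_def \<theta>_def)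
  qed
  have int: "integrable lborel (u Y)" if Y: "Y \<in> \<Y>" for Y
  proof -
    note [measurable] = shadow_borel[OF Y]
    define R where "R = B + (2 * M + 1) * norm e"
    \<comment> \<open>Where \<open>g\<close> is nonzero the height exceeds \<open>-M - 1\<close>,
      and at the hit point it is below \<open>M\<close>; so the hit occurs within time
      \<open>2 * M + 1\<close> and the point stays in a fixed ball. Boundedness of \<open>g\<close>
      there gives integrability.\<close>
    have *: "norm (\<phi> a) \<le> R" if a: "\<phi> a \<in> shadow e Y" "g (\<phi> a) \<noteq> 0" for a
    proof -
      define \<tau> where "\<tau> = hit_time e Y (\<phi> a)"
      have y: "\<phi> a + \<tau> *\<^sub>R e \<in> closure X" and \<tau>: "\<tau> > 0"
        using a(1) Y_in_closure[OF Y] by (auto simp: shadow_def \<tau>_def)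
      have "ht (\<phi> a) > - M - 1" using a(2) by (auto simp: g_def \<theta>_def split: if_splits)
      then have "\<tau> \<le> 2 * M + 1" using htB[OF y] by (simp add: ht_line)
      have "norm (\<phi> a) \<le> norm (\<phi> a + \<tau> *\<^sub>R e) + norm (\<tau> *\<^sub>R e)"
        using norm_triangle_ineq4[of "\<phi> a + \<tau> *\<^sub>R e" "\<tau> *\<^sub>R e"] by simp
      also have "\<dots> \<le> B + (2 * M + 1) * norm e"
        using B(1)[OF y] \<tau> \<open>\<tau> \<le> 2 * M + 1\<close> by (intro add_mono) (auto intro: mult_right_mono)
      finally show ?thesis by (simp add: R_def)
    qed
    show ?thesis
    proof (rule Bochner_Integration.integrable_bound)
      show "integrable lborel (\<lambda>a::real^'n::_. indicator (cball 0 (R + norm (\<phi> 0))) a *\<^sub>R bnd R)"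
        by (rule borel_integrable_compact) (auto intro: continuous_intros)
      show "AE a in lborel. norm (u Y a) \<le> norm (indicator (cball 0 (R + norm (\<phi> 0))) a *\<^sub>R bnd R)"
      proof (rule AE_I2)
        fix a
        have "norm a = norm (\<phi> a - \<phi> 0)" using \<phi>[rule_format, of a 0] by (simp add: dist_norm)
        also have "\<dots> \<le> norm (\<phi> a) + norm (\<phi> 0)" by (rule norm_triangle_ineq4)
        finally have "norm a \<le> R + norm (\<phi> 0)" if "norm (\<phi> a) \<le> R" using that by simp
        then show "norm (u Y a) \<le> norm (indicator (cball 0 (R + norm (\<phi> 0))) a *\<^sub>R bnd R)"
          using * [of a] order_trans[OF bnd abs_ge_self, of "\<phi> a" R]
          by (cases "g (\<phi> a) = 0") (auto simp: u_def indicator_def)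
      qed
      show "u Y \<in> borel_measurable lborel" unfolding u_def by measurable
    qed
  qed
  have main: "s Y * (LINT a|lborel. u Y a) =
      orient Y * (\<nu> Y \<bullet> e) * (LINT b|lborel. indicator Y (\<psi> Y b) * f (\<psi> Y b))" if Y: "Y \<in> \<Y>" for Y
  proof (cases "e \<bullet> \<nu> Y = 0")
    case True then show ?thesis by (simp add: s_def inner_commute)
  next
    case eY: False
    note [measurable] = shadow_borel[OF Y]
    obtain p where p: "p \<in> Y" using Y_nonempty[OF Y] by blast
    have dir: "{u - v |u v. u \<in> range \<phi> \<and> v \<in> range \<phi>} = direction X" by (simp add: \<phi>H direction_def)
    obtain K :: "'b \<times> real \<Rightarrow> real^'n::_" where mK[measurable]: "K \<in> borel_measurable borel"
      and K: "\<And>y t. \<phi> (K (y, t)) = \<psi> Y y + t *\<^sub>R e"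
      and dK: "lborel = density (distr lborel borel K) (\<lambda>_. ennreal \<bar>e \<bullet> \<nu> Y\<bar>)"
    proof (rule hull_fibration[OF \<phi> \<psi>[OF Y] norm_nu[OF Y], of e p])
      show "\<nu> Y \<in> {u - v |u v. u \<in> range \<phi> \<and> v \<in> range \<phi>}" "e \<in> {u - v |u v. u \<in> range \<phi> \<and> v \<in> range \<phi>}"
        using nu_direction[OF Y] e unfolding dir by auto
      show "range (\<psi> Y) = {x \<in> range \<phi>. (x - p) \<bullet> \<nu> Y = 0}" using \<psi>H[OF Y] Y_hull[OF Y p] \<phi>H by simp
    qed (use eY in auto)
    have uK: "u Y (K (y, t)) = indicator Y (\<psi> Y y) * (indicator {..<0} t * g (\<psi> Y y + t *\<^sub>R e))" for y t
      using shadow_fibre[OF Y eY, of "\<psi> Y y" t] \<psi>H[OF Y] by (auto simp: u_def K indicator_def)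
    have mu[measurable]: "u Y \<in> borel_measurable borel" unfolding u_def by measurable
    have "integrable (density (distr lborel borel K) (\<lambda>_. ennreal \<bar>e \<bullet> \<nu> Y\<bar>)) (u Y)"
      using int[OF Y] dK by metis
    then have "integrable lborel (\<lambda>z. \<bar>e \<bullet> \<nu> Y\<bar> * u Y (K z))"
      by (simp add: integrable_density integrable_distr_eq)
    then have iK: "integrable lborel (\<lambda>z. u Y (K z))" using eY by simp
    have "(LINT a|lborel. u Y a) = (LINT a|density (distr lborel borel K) (\<lambda>_. ennreal \<bar>e \<bullet> \<nu> Y\<bar>). u Y a)"
      using dK by metis
    also have "\<dots> = (LINT z|lborel. \<bar>e \<bullet> \<nu> Y\<bar> * u Y (K z))"
      by (simp add: integral_density integral_distr)
    also have "\<dots> = \<bar>e \<bullet> \<nu> Y\<bar> * (LINT z|lborel. u Y (K z))" by simp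
    also have "(LINT z|lborel. u Y (K z)) = (LINT y|lborel. LINT t|lborel. u Y (K (y, t)))"
      using lborel_pair.integral_fst'[of "\<lambda>z. u Y (K z)"] iK by (simp add: lborel_prod)
    also have "\<dots> = (LINT y|lborel. indicator Y (\<psi> Y y) * f (\<psi> Y y))"
      using ray Y_in_closure[OF Y] by (intro Bochner_Integration.integral_cong) (auto simp: uK indicator_def)
    \<comment> \<open>The sign \<open>s Y\<close> of the crossing times the Jacobian
      \<open>\<bar>e \<bullet> \<nu> Y\<bar>\<close> is the factor
      \<open>orient Y * (\<nu> Y \<bullet> e)\<close>.\<close>
    finally show ?thesis
      using orient_cases[of Y] eY by (auto simp: s_def inner_commute sgn_mult abs_mult abs_sgn sgn_if)
  qed
  have "(LINT a|lborel. indicator X (\<phi> a) * (G (\<phi> a) \<bullet> e)) = (LINT a|lborel. (\<Sum>Y\<in>\<Y>. s Y * u Y a))"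
  proof (rule integral_cong_AE)
    have "X \<in> sets borel" using borel_openin_affine[OF rel_open] .
    then show "(\<lambda>a. indicator X (\<phi> a) * (G (\<phi> a) \<bullet> e)) \<in> borel_measurable lborel" by measurable
    show "(\<lambda>a. \<Sum>Y\<in>\<Y>. s Y * u Y a) \<in> borel_measurable lborel"
      using int by (auto intro!: borel_measurable_sum borel_measurable_times borel_measurable_integrable)
    show "AE a in lborel. indicator X (\<phi> a) * (G (\<phi> a) \<bullet> e) = (\<Sum>Y\<in>\<Y>. s Y * u Y a)"
      using generic_AE[OF \<phi> \<phi>H e]
    proof eventually_elim
      case (elim a)
      have "indicator X (\<phi> a) * (G (\<phi> a) \<bullet> e) = indicator X (\<phi> a) * g (\<phi> a)"
        using gX by (auto simp: indicator_def)
      also have "\<dots> = (\<Sum>Y\<in>\<Y>. s Y * u Y a)"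
        unfolding ray_crossing[OF e False elim] by (simp add: s_def u_def sum_distrib_right mult.assoc)
      finally show ?case .
    qed
  qed
  also have "\<dots> = (\<Sum>Y\<in>\<Y>. s Y * (LINT a|lborel. u Y a))"
    using int by (subst Bochner_Integration.integral_sum) auto
  also have "\<dots> = (\<Sum>Y\<in>\<Y>. orient Y * (\<nu> Y \<bullet> e) * (LINT b|lborel. indicator Y (\<psi> Y b) * f (\<psi> Y b)))"
    using main by (rule sum.cong[OF refl])
  finally show ?thesis .
qed simp

end

section \<open>Integration on cells\<close>

lemma hull_isometry_exists:
  "aff_dim X = int (DIM('a::euclidean_space)) \<Longrightarrow>
    \<exists>\<phi> :: 'a \<Rightarrow> point. (\<forall>x y. dist (\<phi> x) (\<phi> y) = dist x y) \<and> range \<phi> = affine hull X"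
proof -
  assume assms: "aff_dim X = int (DIM('a))"
  have "X \<noteq> {}" using assms by auto
  then obtain p where p: "p \<in> affine hull X" by (meson all_not_in_conv hull_inc)
  have sub: "subspace ((\<lambda>x. - p + x) ` (affine hull X))" using affine_diffs_subspace[OF affine_affine_hull p] by simp
  have "int (dim ((\<lambda>x. - p + x) ` (affine hull X))) = aff_dim (affine hull X)"
    using aff_dim_eq_dim[of p "affine hull X"] p by (simp add: hull_hull del: uminus_add_conv_diff)
  then have "dim (UNIV :: 'a set) = dim ((\<lambda>x. - p + x) ` (affine hull X))" using assms by simp
  then obtain f :: "'a \<Rightarrow> point" where f: "linear f" "f ` UNIV = (\<lambda>x. - p + x) ` (affine hull X)" "\<And>x. norm (f x) = norm x"
    using isometries_subspaces[OF subspace_UNIV sub] by (metis UNIV_I)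
  show ?thesis
  proof (intro exI conjI)
    show "\<forall>x y. dist (p + f x) (p + f y) = dist x y"
      by (simp add: dist_norm f(3) linear_diff[OF f(1), symmetric])
    have "range (\<lambda>x. p + f x) = (+) p ` range f" by auto
    then show "range (\<lambda>x. p + f x) = affine hull X" unfolding f(2) by (simp add: image_image)
  qed
qed

text \<open>The \<open>SOME\<close> behind \<open>hull_measure\<close> picks a genuine isometry once
  one exists; \<open>hull_param\<close> records such a choice together with the measure that it
  produces.\<close>

definition hull_param :: "point set \<Rightarrow> ('a::euclidean_space \<Rightarrow> point) \<Rightarrow> bool" where
  "hull_param X \<phi> \<longleftrightarrow> (\<forall>x y. dist (\<phi> x) (\<phi> y) = dist x y) \<and> range \<phi> = affine hull X \<and>
     hull_measure X = distr lborel borel \<phi>"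

lemma isometric_lborel_param:
  "aff_dim X = int (DIM('a::euclidean_space)) \<Longrightarrow> \<exists>\<phi> :: 'a \<Rightarrow> point.
    (\<forall>x y. dist (\<phi> x) (\<phi> y) = dist x y) \<and> range \<phi> = affine hull X \<and>
    isometric_lborel TYPE('a) X = distr lborel borel \<phi>"
proof -
  assume assms: "aff_dim X = int (DIM('a))"
  obtain \<phi> :: "'a \<Rightarrow> point" where "(\<forall>x y. dist (\<phi> x) (\<phi> y) = dist x y) \<and> range \<phi> = affine hull X"
    using hull_isometry_exists[OF assms] by blast
  from someI[of "\<lambda>\<phi> :: 'a \<Rightarrow> point. (\<forall>x y. dist (\<phi> x) (\<phi> y) = dist x y) \<and> range \<phi> = affine hull X", OF this]
  show ?thesis unfolding isometric_lborel_def by blast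
qed

lemma hull_param_1: "aff_dim X = 1 \<Longrightarrow> \<exists>\<phi> :: real \<Rightarrow> point. hull_param X \<phi>"
  using isometric_lborel_param[where 'a=real, of X] unfolding hull_param_def hull_measure_def
  by (metis DIM_real of_nat_1)

lemma hull_param_2: "aff_dim X = 2 \<Longrightarrow> \<exists>\<phi> :: real^2 \<Rightarrow> point. hull_param X \<phi>"
proof -
  assume X: "aff_dim X = 2"
  then have "aff_dim X = int DIM(real^2)" by simp
  then show ?thesis using isometric_lborel_param[where 'a="real^2", of X] X unfolding hull_param_def hull_measure_def
    by (metis numeral_eq_one_iff semiring_norm(85))
qed

lemma hull_param_3: "aff_dim X = 3 \<Longrightarrow> hull_param X (\<lambda>x. x)"
proof -
  assume X: "aff_dim X = 3"
  then have "aff_dim X = int DIM(point)" by simp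
  then have "affine hull X = UNIV" by (simp only: aff_dim_eq_full)
  then show ?thesis using X by (simp add: hull_param_def hull_measure_def distr_id2)
qed

text \<open>The features shared by edges, faces and polyhedra on which integration and
  differentiation rely.\<close>

definition cell :: "point set \<Rightarrow> bool" where
  "cell X \<longleftrightarrow> X \<noteq> {} \<and> bounded X \<and> openin (top_of_set (affine hull X)) X \<and> aff_dim X \<in> {1, 2, 3}"

text \<open>The fields that are integrated below have a continuous extension to the whole space.\<close>

definition regular_on :: "point set \<Rightarrow> (point \<Rightarrow> 'b::real_normed_vector) \<Rightarrow> bool" where
  "regular_on X f \<longleftrightarrow> (\<exists>g. continuous_on UNIV g \<and> (\<forall>x\<in>X. f x = g x))"

lemma regular_onI: "continuous_on UNIV f \<Longrightarrow> regular_on X f"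
  by (auto simp: regular_on_def)

lemma regular_on_cong: "regular_on X f \<Longrightarrow> (\<And>x. x \<in> X \<Longrightarrow> f x = g x) \<Longrightarrow> regular_on X g"
  by (fastforce simp: regular_on_def)

lemma regular_on_bilinear:
  assumes "bounded_bilinear h" "regular_on X f" "regular_on X g"
  shows "regular_on X (\<lambda>x. h (f x) (g x))"
proof -
  obtain f' g' where "continuous_on UNIV f'" "\<forall>x\<in>X. f x = f' x" "continuous_on UNIV g'" "\<forall>x\<in>X. g x = g' x"
    using assms by (auto simp: regular_on_def)
  then show ?thesis unfolding regular_on_def
    by (intro exI[of _ "\<lambda>x. h (f' x) (g' x)"]) (simp add: bounded_bilinear.continuous_on[OF assms(1)])
qed

lemma regular_on_add [intro]:
  assumes "regular_on X f" "regular_on X g" shows "regular_on X (\<lambda>x. f x + g x)"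
proof -
  obtain f' g' where "continuous_on UNIV f'" "\<forall>x\<in>X. f x = f' x" "continuous_on UNIV g'" "\<forall>x\<in>X. g x = g' x"
    using assms by (auto simp: regular_on_def)
  then show ?thesis unfolding regular_on_def
    by (intro exI[of _ "\<lambda>x. f' x + g' x"]) (simp add: continuous_on_add)
qed

lemma regular_on_const [intro, simp]: "regular_on X (\<lambda>x. c)"
  by (intro regular_onI continuous_intros)
lemma regular_on_sum [intro]: "(\<And>i. i \<in> I \<Longrightarrow> regular_on X (f i)) \<Longrightarrow> regular_on X (\<lambda>x. \<Sum>i\<in>I. f i x)"
  by (induction I rule: infinite_finite_induct) auto
lemmas regular_on_mult [intro] = regular_on_bilinear[OF bounded_bilinear_mult]
lemmas regular_on_inner [intro] = regular_on_bilinear[OF bounded_bilinear_inner]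
lemmas regular_on_scaleR [intro] = regular_on_bilinear[OF bounded_bilinear_scaleR]
lemmas regular_on_cross [intro] = regular_on_bilinear[OF bilinear_conv_bounded_bilinear[THEN iffD1, OF bilinear_cross]]
text \<open>The parameter space is a type and cannot be quantified inside a statement; facts are
  proved for an arbitrary parameter type and instantiated in the three dimensions.\<close>

lemma cell_param_cases:
  assumes "cell X"
    and "\<And>\<phi> :: real \<Rightarrow> point. hull_param X \<phi> \<Longrightarrow> P"
    and "\<And>\<phi> :: real^2 \<Rightarrow> point. hull_param X \<phi> \<Longrightarrow> P"
    and "\<And>\<phi> :: real^3 \<Rightarrow> point. hull_param X \<phi> \<Longrightarrow> P"
  shows P
  using assms hull_param_1[of X] hull_param_2[of X] hull_param_3[of X] unfolding cell_def by blast

lemma cell_borel: "cell X \<Longrightarrow> X \<in> sets borel"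
  unfolding cell_def using borel_openin_affine by blast

lemma cell_integrable_param:
  fixes \<phi> :: "'a::euclidean_space \<Rightarrow> point" and g :: "point \<Rightarrow> real"
  assumes X: "cell X" and \<phi>: "hull_param X \<phi>" and g: "continuous_on UNIV g"
  shows "integrable lborel (\<lambda>a. indicator X (\<phi> a) * g (\<phi> a))"
    and "set_integrable (hull_measure X) X g"
    and "integ X g = (LINT a|lborel. indicator X (\<phi> a) * g (\<phi> a))"
proof -
  note [measurable] = cell_borel[OF X] borel_measurable_continuous_onI[OF g]
  have iso: "\<forall>x y. dist (\<phi> x) (\<phi> y) = dist x y" using \<phi> by (simp add: hull_param_def)
  have [measurable]: "\<phi> \<in> borel_measurable borel"
    by (rule borel_measurable_continuous_onI[OF isometry_continuous[OF iso]])
  obtain B where B: "\<And>x. x \<in> X \<Longrightarrow> norm x \<le> B" using X bounded_iff unfolding cell_def by blast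
  have "compact (cball (0::point) B)" by simp
  then have "bounded (g ` cball 0 B)"
    using continuous_on_subset[OF g] compact_continuous_image compact_imp_bounded by blast
  then obtain C where C: "\<And>x. x \<in> X \<Longrightarrow> \<bar>g x\<bar> \<le> C" unfolding bounded_iff using B by force
  show i: "integrable lborel (\<lambda>a. indicator X (\<phi> a) * g (\<phi> a))"
  proof (rule Bochner_Integration.integrable_bound)
    show "integrable lborel (\<lambda>a::'a. indicator (cball 0 (B + norm (\<phi> 0))) a *\<^sub>R C)"
      by (rule borel_integrable_compact) (auto intro: continuous_intros)
    show "AE a in lborel. norm (indicator X (\<phi> a) * g (\<phi> a)) \<le> norm (indicator (cball 0 (B + norm (\<phi> 0))) a *\<^sub>R C)"
    proof (rule AE_I2)
      fix a
      have "norm a = norm (\<phi> a - \<phi> 0)" using iso[rule_format, of a 0] by (simp add: dist_norm)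
      also have "\<dots> \<le> norm (\<phi> a) + norm (\<phi> 0)" by (rule norm_triangle_ineq4)
      finally have "norm a \<le> B + norm (\<phi> 0)" if "\<phi> a \<in> X" using B that by fastforce
      then show "norm (indicator X (\<phi> a) * g (\<phi> a)) \<le> norm (indicator (cball 0 (B + norm (\<phi> 0))) a *\<^sub>R C)"
        using order_trans[OF C abs_ge_self, of "\<phi> a"] by (auto simp: indicator_def)
    qed
  qed measurable
  have M: "hull_measure X = distr lborel borel \<phi>" using \<phi> by (simp add: hull_param_def)
  show "set_integrable (hull_measure X) X g"
    using i unfolding set_integrable_def M by (subst integrable_distr_eq) auto
  show "integ X g = (LINT a|lborel. indicator X (\<phi> a) * g (\<phi> a))"
    unfolding integ_def set_lebesgue_integral_def M by (subst integral_distr) auto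
qed

lemma integ_cong: "(\<And>x. x \<in> X \<Longrightarrow> f x = g x) \<Longrightarrow> integ X f = integ X g"
  unfolding integ_def set_lebesgue_integral_def
  by (intro Bochner_Integration.integral_cong) (auto simp: indicator_def)

lemma cell_set_integrable:
  fixes f :: sfield
  assumes X: "cell X" and f: "regular_on X f"
  shows "set_integrable (hull_measure X) X f"
proof -
  obtain g where g: "continuous_on UNIV g" "\<forall>x\<in>X. f x = g x" using f by (auto simp: regular_on_def)
  have "set_integrable (hull_measure X) X g"
    using X by (rule cell_param_cases) (rule cell_integrable_param(2)[OF X _ g(1)], assumption)+
  moreover have "(\<lambda>x. indicator X x *\<^sub>R g x) = (\<lambda>x. indicator X x *\<^sub>R f x)"
    using g(2) by (auto simp: indicator_def fun_eq_iff)
  ultimately show ?thesis by (simp only: set_integrable_def)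
qed

lemma integ_add: "cell X \<Longrightarrow> regular_on X f \<Longrightarrow> regular_on X g \<Longrightarrow> integ X (\<lambda>x. f x + g x) = integ X f + integ X g"
  unfolding integ_def by (intro set_integral_add cell_set_integrable)
lemma integ_diff: "cell X \<Longrightarrow> regular_on X f \<Longrightarrow> regular_on X g \<Longrightarrow> integ X (\<lambda>x. f x - g x) = integ X f - integ X g"
  unfolding integ_def by (intro set_integral_diff cell_set_integrable)
lemma integ_cmult: "integ X (\<lambda>x. c * f x) = c * integ X f"
  unfolding integ_def by (rule set_integral_mult_right)
lemma integ_uminus: "integ X (\<lambda>x. - f x) = - integ X f"
  using integ_cmult[of X "-1" f] by simp
lemma integ_zero [simp]: "integ X (\<lambda>x. 0) = 0"
  using integ_cmult[of X 0 "\<lambda>x. 0"] by simp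
lemma integ_sum:
  "cell X \<Longrightarrow> (\<And>i. i \<in> I \<Longrightarrow> regular_on X (f i)) \<Longrightarrow> integ X (\<lambda>x. \<Sum>i\<in>I. f i x) = (\<Sum>i\<in>I. integ X (f i))"
  by (induction I rule: infinite_finite_induct) (simp_all add: integ_add regular_on_sum)

text \<open>The parameters at which the integrand is nonzero form an open set, since
  \<open>X\<close> is relatively open and the integrand extends continuously; a nonempty open set is
  not null.\<close>

lemma integ_definite:
  assumes X: "cell X" and f: "regular_on X f" and nonneg: "\<And>x. x \<in> X \<Longrightarrow> f x \<ge> 0" and zero: "integ X f = 0"
    and x: "x \<in> X"
  shows "f x = 0"
proof -
  obtain g where g: "continuous_on UNIV g" "\<forall>x\<in>X. f x = g x" using f by (auto simp: regular_on_def)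
  have "integ X g = 0" using zero integ_cong[of X f g] g(2) by auto
  have param: "f x = 0" if \<phi>: "hull_param X \<phi>" for \<phi> :: "'a::euclidean_space \<Rightarrow> point"
  proof (rule ccontr)
    assume fx: "f x \<noteq> 0"
    have iso: "\<forall>x y. dist (\<phi> x) (\<phi> y) = dist x y" and rng: "range \<phi> = affine hull X"
      using \<phi> by (simp_all add: hull_param_def)
    have cont: "continuous_on UNIV \<phi>" by (rule isometry_continuous[OF iso])
    note int = cell_integrable_param[OF X \<phi> g(1)]
    have ae: "AE a in lborel. indicator X (\<phi> a) * g (\<phi> a) = 0"
      using int(1) int(3) \<open>integ X g = 0\<close> nonneg g(2)
      by (subst integral_nonneg_eq_0_iff_AE[symmetric]) (auto simp: indicator_def)
    obtain U where U: "open U" "X = affine hull X \<inter> U" using X by (auto simp: cell_def openin_open)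
    have mem: "\<phi> a \<in> X \<longleftrightarrow> \<phi> a \<in> U" for a using U(2) rng by blast
    define V where "V = \<phi> -` U \<inter> (\<lambda>a. g (\<phi> a)) -` (- {0})"
    have cg: "continuous_on UNIV (\<lambda>a. g (\<phi> a))" by (rule continuous_on_compose2[OF g(1) cont]) simp
    have "open V" unfolding V_def
      using cont cg U(1) by (intro open_Int) (auto intro: open_vimage)
    moreover have "V \<noteq> {}"
    proof -
      have "x \<in> range \<phi>" unfolding rng using x by (rule hull_inc)
      then obtain a where "x = \<phi> a" by blast
      then have "a \<in> V" using x fx g(2) mem by (auto simp: V_def)
      then show ?thesis by blast
    qed
    moreover have "AE a in lborel. a \<notin> V" using ae by eventually_elim (auto simp: V_def mem[symmetric])
    then have "V \<in> null_sets lborel" using \<open>open V\<close> by (simp add: AE_iff_null_sets)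
    then have "negligible V" by (simp add: negligible_iff_null_sets null_sets_completionI)
    ultimately show False using open_not_negligible by blast
  qed
  show ?thesis using X by (rule cell_param_cases) (erule param)+
qed

lemma (in hull_boundary) cells:
  assumes dims: "(aff_dim X = 3 \<and> (\<forall>Y\<in>\<Y>. aff_dim Y = 2)) \<or> (aff_dim X = 2 \<and> (\<forall>Y\<in>\<Y>. aff_dim Y = 1))"
  shows "cell X" and "Y \<in> \<Y> \<Longrightarrow> cell Y"
proof -
  show "cell X" using nonempty bounded rel_open dims by (auto simp: cell_def)
  assume Y: "Y \<in> \<Y>"
  have "bounded Y" using bounded_closure[OF bounded] Y_in_closure[OF Y] by (meson bounded_subset subsetI)
  then show "cell Y" using Y dims Y_nonempty Y_rel_open by (auto simp: cell_def)
qed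

lemma (in hull_boundary) directional_divergence:
  assumes dims: "(aff_dim X = 3 \<and> (\<forall>Y\<in>\<Y>. aff_dim Y = 2)) \<or> (aff_dim X = 2 \<and> (\<forall>Y\<in>\<Y>. aff_dim Y = 1))"
    and der: "\<And>x. (f has_derivative (\<lambda>h. G x \<bullet> h)) (at x)" and contG: "continuous_on UNIV G"
    and e: "e \<in> direction X"
  shows "integ X (\<lambda>x. G x \<bullet> e) = (\<Sum>Y\<in>\<Y>. orient Y * (\<nu> Y \<bullet> e) * integ Y f)"
proof -
  have contf: "continuous_on UNIV f" using der has_derivative_continuous
    by (simp add: continuous_on_eq_continuous_at) blast
  have contGe: "continuous_on UNIV (\<lambda>x. G x \<bullet> e)" using contG by (intro continuous_intros)
  note X = cells(1)[OF dims] and Y = cells(2)[OF dims]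
  \<comment> \<open>The parameter types stay general here, because polyhedron with faces and face
    with edges need different ones.\<close>
  have gen: "integ X (\<lambda>x. G x \<bullet> e) = (\<Sum>Y\<in>\<Y>. orient Y * (\<nu> Y \<bullet> e) * integ Y f)"
    if \<phi>: "hull_param X \<phi>" and \<psi>: "\<And>Y. Y \<in> \<Y> \<Longrightarrow> hull_param Y (\<psi> Y)"
    for \<phi> :: "real^'n::{finite,wellorder} \<Rightarrow> point" and \<psi> :: "point set \<Rightarrow> 'b::euclidean_space \<Rightarrow> point"
  proof -
    have "integ X (\<lambda>x. G x \<bullet> e) = (LINT a|lborel. indicator X (\<phi> a) * (G (\<phi> a) \<bullet> e))"
      by (rule cell_integrable_param(3)[OF X \<phi> contGe])
    also have "\<dots> = (\<Sum>Y\<in>\<Y>. orient Y * (\<nu> Y \<bullet> e) * (LINT b|lborel. indicator Y (\<psi> Y b) * f (\<psi> Y b)))"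
      using \<phi> \<psi> by (intro directional_divergence_param der contG e) (auto simp: hull_param_def)
    also have "\<dots> = (\<Sum>Y\<in>\<Y>. orient Y * (\<nu> Y \<bullet> e) * integ Y f)"
      using cell_integrable_param(3)[OF Y \<psi> contf] by (intro sum.cong) auto
    finally show ?thesis .
  qed
  from dims show ?thesis
  proof
    assume d: "aff_dim X = 3 \<and> (\<forall>Y\<in>\<Y>. aff_dim Y = 2)"
    then have "\<forall>Y\<in>\<Y>. \<exists>\<psi> :: real^2 \<Rightarrow> point. hull_param Y \<psi>" using hull_param_2 by blast
    then obtain \<psi> :: "point set \<Rightarrow> real^2 \<Rightarrow> point" where "\<And>Y. Y \<in> \<Y> \<Longrightarrow> hull_param Y (\<psi> Y)" by metis
    then show ?thesis using gen[of "\<lambda>x. x" \<psi>] hull_param_3 d by blast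
  next
    assume d: "aff_dim X = 2 \<and> (\<forall>Y\<in>\<Y>. aff_dim Y = 1)"
    then have "\<forall>Y\<in>\<Y>. \<exists>\<psi> :: real \<Rightarrow> point. hull_param Y \<psi>" using hull_param_1 by blast
    then obtain \<psi> :: "point set \<Rightarrow> real \<Rightarrow> point" where \<psi>: "\<And>Y. Y \<in> \<Y> \<Longrightarrow> hull_param Y (\<psi> Y)" by metis
    obtain \<phi> :: "real^2 \<Rightarrow> point" where "hull_param X \<phi>" using hull_param_2 d by blast
    then show ?thesis using gen[of \<phi> \<psi>] \<psi> by blast
  qed
qed

section \<open>Finite-dimensional spaces of fields\<close>

definition lincomb :: "nat \<Rightarrow> (nat \<Rightarrow> 'a \<Rightarrow> 'b::real_vector) \<Rightarrow> (nat \<Rightarrow> real) \<Rightarrow> 'a \<Rightarrow> 'b" where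
  "lincomb n b c = (\<lambda>x. \<Sum>i<n. c i *\<^sub>R b i x)"

text \<open>A finite spanning family, not necessarily independent: images under linear maps are then
  easily spanned, and inductions run over the length of the family.\<close>

definition findim :: "('a \<Rightarrow> 'b::real_vector) set \<Rightarrow> bool" where
  "findim W \<longleftrightarrow> (\<exists>n b. W = range (lincomb n b))"

text \<open>Linearity is demanded on \<open>W\<close> only: operators built on limits, derivatives
  and integrals are additive on regular fields, not on all functions.\<close>

definition lin_on :: "('a \<Rightarrow> 'b::real_vector) set \<Rightarrow> (('a \<Rightarrow> 'b) \<Rightarrow> 'c::real_vector) \<Rightarrow> bool" where
  "lin_on W L \<longleftrightarrow> (\<forall>u\<in>W. \<forall>v\<in>W. L (\<lambda>x. u x + v x) = L u + L v) \<and> (\<forall>u\<in>W. \<forall>c. L (\<lambda>x. c *\<^sub>R u x) = c *\<^sub>R L u)"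

lemma findim_finite_sum:
  assumes "finite A"
  shows "findim {u. \<exists>c. u = (\<lambda>x. \<Sum>a\<in>A. c a *\<^sub>R b a x)}"
proof -
  obtain h where h: "bij_betw h {0..<card A} A" using ex_bij_betw_nat_finite[OF assms] by blast
  have eq: "(\<Sum>a\<in>A. c a *\<^sub>R b a x) = (\<Sum>i<card A. c (h i) *\<^sub>R b (h i) x)" for c x
    using sum.reindex_bij_betw[OF h, of "\<lambda>a. c a *\<^sub>R b a x"] by (simp add: atLeast0LessThan)
  have "{u. \<exists>c. u = (\<lambda>x. \<Sum>a\<in>A. c a *\<^sub>R b a x)} = range (lincomb (card A) (\<lambda>i. b (h i)))"
  proof (intro equalityI subsetI)
    fix u assume "u \<in> range (lincomb (card A) (\<lambda>i. b (h i)))"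
    then obtain c where c: "u = (\<lambda>x. \<Sum>i<card A. c i *\<^sub>R b (h i) x)" by (auto simp: lincomb_def)
    have "u = (\<lambda>x. \<Sum>a\<in>A. c (inv_into {0..<card A} h a) *\<^sub>R b a x)"
      unfolding c eq using h by (intro ext sum.cong) (auto simp: bij_betw_def inv_into_f_f)
    then show "u \<in> {u. \<exists>c. u = (\<lambda>x. \<Sum>a\<in>A. c a *\<^sub>R b a x)}"
      by (auto intro: exI[of _ "\<lambda>a. c (inv_into {0..<card A} h a)"])
  next
    fix u assume "u \<in> {u. \<exists>c. u = (\<lambda>x. \<Sum>a\<in>A. c a *\<^sub>R b a x)}"
    then obtain c where "u = lincomb (card A) (\<lambda>i. b (h i)) (\<lambda>i. c (h i))" by (auto simp: eq lincomb_def)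
    then show "u \<in> range (lincomb (card A) (\<lambda>i. b (h i)))" by blast
  qed
  then show ?thesis unfolding findim_def by blast
qed

lemma lincomb_add: "(\<lambda>x. lincomb n b c x + lincomb n b d x) = lincomb n b (\<lambda>i. c i + d i)"
  by (simp add: lincomb_def scaleR_add_left sum.distrib)

lemma lincomb_scale: "(\<lambda>x. a *\<^sub>R lincomb n b c x) = lincomb n b (\<lambda>i. a * c i)"
  by (simp add: lincomb_def scaleR_sum_right)

lemma findim_add: "findim W \<Longrightarrow> u \<in> W \<Longrightarrow> v \<in> W \<Longrightarrow> (\<lambda>x. u x + v x) \<in> W"
  unfolding findim_def by (auto simp: lincomb_add)

lemma findim_scale: "findim W \<Longrightarrow> u \<in> W \<Longrightarrow> (\<lambda>x. a *\<^sub>R u x) \<in> W"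
  unfolding findim_def by (auto simp: lincomb_scale)

lemma findim_zero: "findim W \<Longrightarrow> (\<lambda>x. 0) \<in> W"
proof -
  have "(\<lambda>x. 0) = lincomb n b (\<lambda>i. 0)" for n and b :: "nat \<Rightarrow> 'a \<Rightarrow> 'b::real_vector" by (simp add: lincomb_def)
  then show "findim W \<Longrightarrow> (\<lambda>x. 0) \<in> W" unfolding findim_def by blast
qed

lemma lin_on_zero:
  fixes W :: "('a \<Rightarrow> 'b::real_vector) set"
  assumes "findim W" "lin_on W L" shows "L (\<lambda>x. 0) = 0"
proof -
  have "\<forall>u\<in>W. \<forall>c. L (\<lambda>x. c *\<^sub>R u x) = c *\<^sub>R L u" using assms(2) by (simp add: lin_on_def)
  from this[rule_format, OF findim_zero[OF assms(1)], of 0] show ?thesis by simp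
qed

lemma lincomb_unit: "i < n \<Longrightarrow> lincomb n b (\<lambda>j. if j = i then 1 else 0) = b i"
proof
  fix x assume "i < n"
  have "lincomb n b (\<lambda>j. if j = i then 1 else 0) x = (\<Sum>j<n. if j = i then b j x else 0)"
    unfolding lincomb_def by (intro sum.cong) auto
  then show "lincomb n b (\<lambda>j. if j = i then 1 else 0) x = b i x" using \<open>i < n\<close> by simp
qed

lemma lincomb_Suc: "lincomb (Suc n) b c = (\<lambda>x. lincomb n b c x + c n *\<^sub>R b n x)"
  by (simp add: lincomb_def)

lemma lincomb_mono: "m \<le> n \<Longrightarrow> range (lincomb m b) \<subseteq> range (lincomb n b)"
proof
  fix u assume "m \<le> n" "u \<in> range (lincomb m b)"
  then obtain c where "u = lincomb m b c" by blast
  also have "\<dots> = lincomb n b (\<lambda>i. if i < m then c i else 0)"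
    unfolding lincomb_def using \<open>m \<le> n\<close> by (intro ext sum.mono_neutral_cong_left) auto
  finally show "u \<in> range (lincomb n b)" by blast
qed

lemma findim_diff: "findim W \<Longrightarrow> u \<in> W \<Longrightarrow> v \<in> W \<Longrightarrow> (\<lambda>x. u x - v x) \<in> W"
  using findim_add[of W u "\<lambda>x. (-1) *\<^sub>R v x"] findim_scale[of W v "-1"] by simp

lemma findim_image:
  fixes W :: "('a \<Rightarrow> 'b::real_vector) set" and L :: "('a \<Rightarrow> 'b) \<Rightarrow> 'c \<Rightarrow> 'd::real_vector"
  assumes W: "findim W" and L: "\<And>x. lin_on W (\<lambda>u. L u x)"
  shows "findim (L ` W)"
proof -
  obtain n b where Wb: "W = range (lincomb n b)" using W by (auto simp: findim_def)
  have bW: "b i \<in> W" if "i < n" for i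
    using rangeI[of "lincomb n b"] lincomb_unit[OF that, of b] unfolding Wb by metis
  have L0: "L (\<lambda>x. 0) y = 0" for y
    by (rule lin_on_zero[OF W L])
  have step: "lincomb m b c \<in> W \<and> L (lincomb m b c) = lincomb m (\<lambda>i. L (b i)) c" if "m \<le> n" for m c
    using that
  proof (induction m)
    case 0 then show ?case using L0 findim_zero[OF W] by (auto simp: lincomb_def)
  next
    case (Suc m)
    have 1: "lincomb m b c \<in> W" and 2: "(\<lambda>x. c m *\<^sub>R b m x) \<in> W"
      using Suc findim_scale[OF W bW] by auto
    have "L (\<lambda>x. lincomb m b c x + c m *\<^sub>R b m x) y = lincomb m (\<lambda>i. L (b i)) c y + c m *\<^sub>R L (b m) y" for y
      using L[of y] 1 2 Suc bW[of m] unfolding lin_on_def by simp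
    then show ?case using findim_add[OF W 1 2] by (simp add: lincomb_Suc)
  qed
  have "L ` W = range (lincomb n (\<lambda>i. L (b i)))"
    unfolding Wb image_image using step[OF order_refl] by simp
  then show ?thesis unfolding findim_def by blast
qed

section \<open>Inner products, Riesz representers and orthogonal projections\<close>

lemma regular_on_scale [intro]: "regular_on X f \<Longrightarrow> regular_on X (\<lambda>x. c *\<^sub>R f x)"
  by (rule regular_on_scaleR[OF regular_on_const])

lemma ip_cong: "(\<And>x. x \<in> X \<Longrightarrow> f x = f' x) \<Longrightarrow> (\<And>x. x \<in> X \<Longrightarrow> g x = g' x) \<Longrightarrow> ip X f g = ip X f' g'"
  unfolding ip_def by (intro integ_cong) simp
lemma ip_commute: "ip X f g = ip X g f" by (simp add: ip_def inner_commute)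
lemma ip_add_left: "cell X \<Longrightarrow> regular_on X f \<Longrightarrow> regular_on X f' \<Longrightarrow> regular_on X g \<Longrightarrow>
    ip X (\<lambda>x. f x + f' x) g = ip X f g + ip X f' g"
  unfolding ip_def inner_add_left by (intro integ_add regular_on_inner)
lemma ip_diff_left: "cell X \<Longrightarrow> regular_on X f \<Longrightarrow> regular_on X f' \<Longrightarrow> regular_on X g \<Longrightarrow>
    ip X (\<lambda>x. f x - f' x) g = ip X f g - ip X f' g"
  unfolding ip_def inner_diff_left by (intro integ_diff regular_on_inner)
lemma ip_scale_left: "ip X (\<lambda>x. c *\<^sub>R f x) g = c * ip X f g"
  unfolding ip_def by (simp add: integ_cmult)
lemma ip_add_right: "cell X \<Longrightarrow> regular_on X f \<Longrightarrow> regular_on X f' \<Longrightarrow> regular_on X g \<Longrightarrow>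
    ip X g (\<lambda>x. f x + f' x) = ip X g f + ip X g f'"
  using ip_add_left by (simp add: ip_commute)
lemma ip_scale_right: "ip X g (\<lambda>x. c *\<^sub>R f x) = c * ip X g f"
  using ip_scale_left by (metis ip_commute)

lemma ip_zero [simp]: "ip X (\<lambda>x. 0) g = 0" "ip X g (\<lambda>x. 0) = 0" by (simp_all add: ip_def)

lemma ip_definite:
  assumes "cell X" "regular_on X f" "\<And>x. x \<notin> X \<Longrightarrow> f x = 0" "ip X f f = 0"
  shows "f = (\<lambda>x. 0)"
proof
  fix x
  show "f x = 0"
  proof (cases "x \<in> X")
    case True
    then have "f x \<bullet> f x = 0"
      using integ_definite[of X "\<lambda>x. f x \<bullet> f x" x] assms unfolding ip_def by auto
    then show ?thesis by simp
  qed (use assms in auto)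
qed

text \<open>Vanishing outside \<open>X\<close> turns equality on \<open>X\<close> into equality of
  functions, so that the definite descriptions in \<open>representer\<close> and \<open>proj\<close>
  are unique.\<close>

definition fields_on :: "point set \<Rightarrow> (point \<Rightarrow> 'b::real_inner) set \<Rightarrow> bool" where
  "fields_on X W \<longleftrightarrow> cell X \<and> findim W \<and> (\<forall>u\<in>W. regular_on X u \<and> (\<forall>x. x \<notin> X \<longrightarrow> u x = 0))"

text \<open>Gram-Schmidt along a spanning family. The functional is generalized in the induction
  because the hypothesis is used twice: for \<open>L\<close>, and for the inner product with the new
  generator, whose representer \<open>q\<close> is the projection of that generator on the previous
  span.\<close>

lemma riesz_exists:
  fixes W :: "(point \<Rightarrow> 'b::real_inner) set"
  assumes W: "fields_on X W" and L: "lin_on W L"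
  shows "\<exists>p\<in>W. \<forall>w\<in>W. ip X p w = L w"
proof -
  have X: "cell X" using W by (simp add: fields_on_def)
  obtain n b where Wn: "W = range (lincomb n b)" using W by (auto simp: fields_on_def findim_def)
  define V where "V = (\<lambda>m. range (lincomb m b))"
  have fV: "findim (V m)" for m unfolding V_def findim_def by blast
  have VW: "V m \<subseteq> W" if "m \<le> n" for m unfolding V_def Wn by (rule lincomb_mono[OF that])
  have "\<exists>p\<in>V m. \<forall>w\<in>V m. ip X p w = L w" if "m \<le> n" "lin_on W L" for m L
    using that
  proof (induction m arbitrary: L)
    case 0
    have "L (\<lambda>x. 0) = 0"
      using 0 lin_on_zero W unfolding fields_on_def by blast
    then show ?case by (simp add: V_def lincomb_def)
  next
    case (Suc m)
    have mn: "m \<le> n" and VS: "V (Suc m) \<subseteq> W" using Suc VW by auto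
    have reg: "regular_on X u" "x \<notin> X \<Longrightarrow> u x = 0" if "u \<in> W" for u x using that W by (auto simp: fields_on_def)
    have bm: "b m \<in> V (Suc m)" unfolding V_def by (metis lessI lincomb_unit rangeI)
    have VV: "V m \<subseteq> V (Suc m)" unfolding V_def by (rule lincomb_mono) simp
    have "lin_on W (ip X (b m))"
      using X reg bm VS unfolding lin_on_def by (auto simp: ip_add_right ip_scale_right)
    from Suc.IH[OF mn this] obtain q where q: "q \<in> V m" "\<forall>w\<in>V m. ip X q w = ip X (b m) w" by blast
    from Suc.IH[OF mn Suc.prems(2)] obtain p where p: "p \<in> V m" "\<forall>w\<in>V m. ip X p w = L w" by blast
    define u where "u = (\<lambda>x. b m x - q x)"
    have uV: "u \<in> V (Suc m)" unfolding u_def using findim_diff[OF fV bm] q VV by blast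
    have orth: "ip X u w = 0" if "w \<in> V m" for w
      unfolding u_def using X reg that q bm VS VV by (subst ip_diff_left) auto
    \<comment> \<open>If the new generator depends on the previous ones, \<open>u\<close> is zero
      and so is the quotient; \<open>au\<close> still holds because \<open>L u\<close> is then
      zero.\<close>
    define a where "a = L u / ip X u u"
    have au: "a * ip X u u = L u"
    proof (cases "ip X u u = 0")
      case True
      then have "u = (\<lambda>x. 0)" using reg subsetD[OF VS uV] by (intro ip_definite[OF X])
      then have "L u = 0"
        using Suc.prems lin_on_zero W unfolding fields_on_def by blast
      then show ?thesis using True by simp
    qed (simp add: a_def)
    show ?case
    proof (intro bexI[of _ "\<lambda>x. p x + a *\<^sub>R u x"] ballI)
      show "(\<lambda>x. p x + a *\<^sub>R u x) \<in> V (Suc m)"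
        using findim_add[OF fV _ findim_scale[OF fV uV]] p VV by blast
      fix w assume "w \<in> V (Suc m)"
      then obtain c where c: "w = (\<lambda>x. lincomb m b c x + c m *\<^sub>R b m x)" by (auto simp: V_def lincomb_Suc)
      \<comment> \<open>Regrouping: the new generator is \<open>u\<close> plus \<open>q\<close>, so
        a vector of the larger span is an element \<open>v\<close> of the previous one plus a
        multiple of the orthogonal vector \<open>u\<close>.\<close>
      define v where "v = (\<lambda>x. lincomb m b c x + c m *\<^sub>R q x)"
      have vV: "v \<in> V m" unfolding v_def
        by (intro findim_add[OF fV _ findim_scale[OF fV q(1)]]) (auto simp: V_def)
      have w: "w = (\<lambda>x. v x + c m *\<^sub>R u x)" by (simp add: c v_def u_def algebra_simps)
      note r = reg(1)[OF subsetD[OF VS uV]] reg(1)[OF subsetD[OF VS subsetD[OF VV p(1)]]] reg(1)[OF subsetD[OF VS subsetD[OF VV vV]]]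
      have "ip X (\<lambda>x. p x + a *\<^sub>R u x) w = ip X p v + c m * ip X p u + a * (ip X u v + c m * ip X u u)"
        unfolding w using r X
        by (simp add: ip_add_left ip_add_right ip_scale_left ip_scale_right regular_on_add regular_on_scale algebra_simps)
      also have "\<dots> = L v + c m * L u"
      proof -
        have "a * (ip X u v + c m * ip X u u) = c m * L u" using orth[OF vV] au[symmetric] by simp
        then show ?thesis using orth[OF p(1)] ip_commute[of X p u] p(2) vV by simp
      qed
      also have "\<dots> = L w"
      proof -
        have m: "v \<in> W" "u \<in> W" using uV vV VS VV by auto
        have "(\<lambda>x. c m *\<^sub>R u x) \<in> W" using findim_scale[OF _ m(2)] W by (auto simp: fields_on_def)
        then have "L (\<lambda>x. v x + c m *\<^sub>R u x) = L v + L (\<lambda>x. c m *\<^sub>R u x)" "L (\<lambda>x. c m *\<^sub>R u x) = c m * L u"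
          using Suc.prems(2) m unfolding lin_on_def by simp_all
        then show ?thesis unfolding w by simp
      qed
      finally show "ip X (\<lambda>x. p x + a *\<^sub>R u x) w = L w" .
    qed
  qed
  from this[OF order_refl L] show ?thesis unfolding V_def Wn .
qed

lemma fields_on_unique:
  assumes W: "fields_on X W" and p: "p \<in> W" "q \<in> W" and eq: "\<And>w. w \<in> W \<Longrightarrow> ip X p w = ip X q w"
  shows "p = q"
proof -
  have d: "(\<lambda>x. p x - q x) \<in> W" using findim_diff W p by (auto simp: fields_on_def)
  have "ip X (\<lambda>x. p x - q x) (\<lambda>x. p x - q x) = 0"
    using W p d eq[OF d] by (subst ip_diff_left) (auto simp: fields_on_def)
  then have "(\<lambda>x. p x - q x) = (\<lambda>x. 0)"
    using W d by (intro ip_definite[of X]) (auto simp: fields_on_def)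
  then show ?thesis by (auto simp: fun_eq_iff)
qed

lemma representer_eqI:
  assumes "fields_on X W" "p \<in> W" "\<And>w. w \<in> W \<Longrightarrow> ip X p w = L w"
  shows "representer X W L = p"
  unfolding representer_def
  by (rule the_equality) (use assms fields_on_unique[OF assms(1)] in auto)

lemma
  assumes "fields_on X W" "lin_on W L"
  shows representer_in: "representer X W L \<in> W"
    and representer_ip: "w \<in> W \<Longrightarrow> ip X (representer X W L) w = L w"
proof -
  obtain p where "p \<in> W" "\<And>w. w \<in> W \<Longrightarrow> ip X p w = L w" using riesz_exists[OF assms] by blast
  then have "representer X W L \<in> W \<and> (\<forall>w\<in>W. ip X (representer X W L) w = L w)"
    using representer_eqI[OF assms(1)] by metis
  then show "representer X W L \<in> W" "w \<in> W \<Longrightarrow> ip X (representer X W L) w = L w" by auto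
qed

lemma lin_on_ip: "fields_on X W \<Longrightarrow> regular_on X f \<Longrightarrow> lin_on W (ip X f)"
  unfolding lin_on_def fields_on_def by (auto simp: ip_add_right ip_scale_right)

lemma
  assumes "fields_on X W" "regular_on X f"
  shows proj_in: "proj X W f \<in> W" and proj_ip: "w \<in> W \<Longrightarrow> ip X (proj X W f) w = ip X f w"
  using representer_in representer_ip assms lin_on_ip[OF assms] unfolding proj_def by blast+

lemma proj_cong: "(\<And>x. x \<in> X \<Longrightarrow> f x = g x) \<Longrightarrow> proj X W f = proj X W g"
  unfolding proj_def by (metis (no_types, lifting) ext ip_cong)

lemma proj_id: "fields_on X W \<Longrightarrow> g \<in> W \<Longrightarrow> (\<And>x. x \<in> X \<Longrightarrow> f x = g x) \<Longrightarrow> proj X W f = g"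
  unfolding proj_def by (rule representer_eqI) (auto intro: ip_cong)

lemma fields_onD:
  assumes "fields_on X W"
  shows "cell X" "findim W" "\<And>u. u \<in> W \<Longrightarrow> regular_on X u" "\<And>u x. u \<in> W \<Longrightarrow> x \<notin> X \<Longrightarrow> u x = 0"
  using assms by (auto simp: fields_on_def)

lemma orth_compl_residual:
  assumes U: "fields_on X U" and W: "fields_on X W" and sub: "W \<subseteq> U" and u: "u \<in> U"
  shows "(\<lambda>x. u x - proj X W u x) \<in> orth_compl X U W"
proof -
  note r = fields_onD[OF U] fields_onD[OF W]
  have p: "proj X W u \<in> W" using proj_in[OF W] r u by blast
  have "ip X (\<lambda>x. u x - proj X W u x) w = 0" if "w \<in> W" for w
    using proj_ip[OF W, of u w] r p u that by (subst ip_diff_left) auto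
  then show ?thesis using findim_diff[OF r(2) u] p sub by (auto simp: orth_compl_def)
qed

text \<open>The complement is the image of \<open>U\<close> under the linear map that subtracts the
  projection on \<open>W\<close>, hence again finitely spanned.\<close>

lemma fields_on_orth_compl:
  assumes U: "fields_on X U" and W: "fields_on X W" and sub: "W \<subseteq> U"
  shows "fields_on X (orth_compl X U W)"
proof -
  note r = fields_onD[OF U] fields_onD[OF W]
  have add: "proj X W (\<lambda>x. u x + v x) = (\<lambda>x. proj X W u x + proj X W v x)" if "u \<in> U" "v \<in> U" for u v
    unfolding proj_def[of X W "\<lambda>x. u x + v x"]
    using that r by (intro representer_eqI[OF W]) (auto simp: findim_add proj_in[OF W] ip_add_left proj_ip[OF W])
  have scale: "proj X W (\<lambda>x. c *\<^sub>R u x) = (\<lambda>x. c *\<^sub>R proj X W u x)" if "u \<in> U" for u c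
    unfolding proj_def[of X W "\<lambda>x. c *\<^sub>R u x"]
    using that r by (intro representer_eqI[OF W]) (auto simp: findim_scale proj_in[OF W] ip_scale_left proj_ip[OF W])
  have eq: "orth_compl X U W = (\<lambda>u x. u x - proj X W u x) ` U"
  proof (intro equalityI subsetI)
    fix u assume "u \<in> orth_compl X U W"
    then have u: "u \<in> U" "\<And>w. w \<in> W \<Longrightarrow> ip X u w = 0" by (auto simp: orth_compl_def)
    have "proj X W u = (\<lambda>x. 0)" unfolding proj_def
      using u(2) findim_zero[OF r(6)] by (intro representer_eqI[OF W]) auto
    then show "u \<in> (\<lambda>u x. u x - proj X W u x) ` U" using u(1) by (auto intro: image_eqI[of _ _ u])
  qed (use orth_compl_residual[OF U W sub] in auto)
  have "lin_on U (\<lambda>u. u x - proj X W u x)" for x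
    unfolding lin_on_def by (auto simp: add scale scaleR_diff_right)
  then have "findim (orth_compl X U W)" unfolding eq by (rule findim_image[OF r(2)])
  then show ?thesis using r by (auto simp: fields_on_def orth_compl_def)
qed

text \<open>Orthogonality makes the sum direct: the difference of two decompositions lies in both
  spaces and is therefore orthogonal to itself.\<close>

lemma component_eq:
  assumes U: "fields_on X U" and W: "fields_on X W" and orth: "\<And>u w. u \<in> U \<Longrightarrow> w \<in> W \<Longrightarrow> ip X u w = 0"
    and uw: "u \<in> U" "w \<in> W" and v: "v = (\<lambda>x. u x + w x)"
  shows "component U W v = u"
  unfolding component_def
proof (rule the_equality)
  show "u \<in> U \<and> (\<exists>w\<in>W. v = (\<lambda>x. u x + w x))" using uw v by auto
next
  note r = fields_onD[OF U] fields_onD[OF W]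
  fix u' assume "u' \<in> U \<and> (\<exists>w\<in>W. v = (\<lambda>x. u' x + w x))"
  then obtain w' where u': "u' \<in> U" and w': "w' \<in> W" and "v = (\<lambda>x. u' x + w' x)" by blast
  then have eq: "(\<lambda>x. u' x - u x) = (\<lambda>x. w x - w' x)"
    unfolding v by (auto simp: fun_eq_iff algebra_simps)
  have d: "(\<lambda>x. u' x - u x) \<in> U" "(\<lambda>x. w x - w' x) \<in> W"
    using findim_diff r u' uw w' by blast+
  have "ip X (\<lambda>x. u' x - u x) (\<lambda>x. u' x - u x) = 0" using orth[OF d] eq by simp
  then have "(\<lambda>x. u' x - u x) = (\<lambda>x. 0)"
    using ip_definite[OF r(1) r(3)[OF d(1)]] r(4)[OF d(1)] by blast
  then show "u' = u" by (auto simp: fun_eq_iff)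
qed

section \<open>Polynomials\<close>

text \<open>The bound is an integer: for negative \<open>l\<close> the set is empty and
  \<open>polys l\<close> contains only zero, the convention for degree -1 that is met when
  \<open>k = 0\<close>.\<close>

definition multidegrees :: "int \<Rightarrow> (3 \<Rightarrow> nat) set" where
  "multidegrees l = {\<alpha>. int (\<Sum>i\<in>UNIV. \<alpha> i) \<le> l}"

definition monomial :: "(3 \<Rightarrow> nat) \<Rightarrow> sfield" where
  "monomial \<alpha> = (\<lambda>x. \<Prod>i\<in>UNIV. (x $ i) ^ \<alpha> i)"

lemma finite_multidegrees: "finite (multidegrees l)"
proof (rule finite_subset)
  show "multidegrees l \<subseteq> PiE UNIV (\<lambda>_. {..nat l})"
  proof
    fix \<alpha> assume a: "\<alpha> \<in> multidegrees l"
    have "\<alpha> i \<le> nat l" for i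
      using member_le_sum[of i UNIV \<alpha>] a by (simp add: multidegrees_def del: of_nat_sum)
    then show "\<alpha> \<in> PiE UNIV (\<lambda>_. {..nat l})" by auto
  qed
qed (auto intro: finite_PiE)

lemma polys_eq: "polys l = {p. \<exists>c. p = (\<lambda>x. \<Sum>\<alpha>\<in>multidegrees l. c \<alpha> * monomial \<alpha> x)}"
  by (simp add: polys_def monomial_def multidegrees_def)

lemma polys_findim: "findim (polys l)"
  unfolding polys_eq using findim_finite_sum[OF finite_multidegrees[of l], of monomial] by simp

lemma polys_add: "p \<in> polys l \<Longrightarrow> q \<in> polys l \<Longrightarrow> (\<lambda>x. p x + q x) \<in> polys l"
  by (rule findim_add[OF polys_findim])
lemma polys_diff: "p \<in> polys l \<Longrightarrow> q \<in> polys l \<Longrightarrow> (\<lambda>x. p x - q x) \<in> polys l"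
  by (rule findim_diff[OF polys_findim])
lemma polys_cmult: "p \<in> polys l \<Longrightarrow> (\<lambda>x. c * p x) \<in> polys l"
  using findim_scale[OF polys_findim, of p l c] by simp
lemma polys_zero: "(\<lambda>x. 0) \<in> polys l"
  by (rule findim_zero[OF polys_findim])
lemma polys_sum: "(\<And>i. i \<in> I \<Longrightarrow> p i \<in> polys l) \<Longrightarrow> (\<lambda>x. \<Sum>i\<in>I. p i x) \<in> polys l"
  by (induction I rule: infinite_finite_induct) (auto simp: polys_zero polys_add)

lemma polys_monomial: "\<alpha> \<in> multidegrees l \<Longrightarrow> monomial \<alpha> \<in> polys l"
  unfolding polys_eq
proof (intro CollectI exI[of _ "\<lambda>\<beta>. if \<beta> = \<alpha> then 1 else 0"] ext)
  fix x assume "\<alpha> \<in> multidegrees l"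
  then show "monomial \<alpha> x = (\<Sum>\<beta>\<in>multidegrees l. (if \<beta> = \<alpha> then 1 else 0) * monomial \<beta> x)"
    using finite_multidegrees[of l] by (simp add: if_distrib[of "\<lambda>a. a * _"] cong: if_cong)
qed

lemma polysE:
  assumes "p \<in> polys l"
  obtains c where "p = (\<lambda>x. \<Sum>\<alpha>\<in>multidegrees l. c \<alpha> * monomial \<alpha> x)"
  using assms unfolding polys_eq by blast

lemma polys_mono: "l \<le> m \<Longrightarrow> polys l \<subseteq> polys m"
proof
  fix p assume "l \<le> m" "p \<in> polys l"
  then obtain c where c: "p = (\<lambda>x. \<Sum>\<alpha>\<in>multidegrees l. c \<alpha> * monomial \<alpha> x)" by (blast elim: polysE)
  show "p \<in> polys m" unfolding c
    by (intro polys_sum polys_cmult polys_monomial) (use \<open>l \<le> m\<close> in \<open>auto simp: multidegrees_def\<close>)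
qed

lemma polys_mult: "p \<in> polys l \<Longrightarrow> q \<in> polys m \<Longrightarrow> (\<lambda>x. p x * q x) \<in> polys (l + m)"
proof -
  assume "p \<in> polys l" "q \<in> polys m"
  then obtain c d where c: "p = (\<lambda>x. \<Sum>\<alpha>\<in>multidegrees l. c \<alpha> * monomial \<alpha> x)"
    and d: "q = (\<lambda>x. \<Sum>\<alpha>\<in>multidegrees m. d \<alpha> * monomial \<alpha> x)" by (blast elim: polysE)
  have mul: "monomial \<alpha> x * monomial \<beta> x = monomial (\<lambda>i. \<alpha> i + \<beta> i) x" for \<alpha> \<beta> x
    by (simp add: monomial_def power_add prod.distrib)
  have "(\<lambda>x. p x * q x) = (\<lambda>x. \<Sum>\<alpha>\<in>multidegrees l. \<Sum>\<beta>\<in>multidegrees m. (c \<alpha> * d \<beta>) * monomial (\<lambda>i. \<alpha> i + \<beta> i) x)"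
    unfolding c d mul[symmetric] by (simp add: sum_product algebra_simps)
  also have "\<dots> \<in> polys (l + m)"
    by (intro polys_sum polys_cmult polys_monomial) (auto simp: sum.distrib multidegrees_def)
  finally show ?thesis .
qed

lemma polys_const: "0 \<le> l \<Longrightarrow> (\<lambda>x. a) \<in> polys l"
proof -
  assume "0 \<le> l"
  then have "monomial (\<lambda>_. 0) \<in> polys l" by (intro polys_monomial) (simp add: multidegrees_def)
  from polys_cmult[OF this, of a] show ?thesis by (simp add: monomial_def)
qed

lemma polys_coord: "(\<lambda>x. x $ i) \<in> polys 1"
proof -
  have "monomial (\<lambda>j. if j = i then 1 else 0) \<in> polys 1"
    by (intro polys_monomial) (simp add: multidegrees_def del: of_nat_sum)
  moreover have "monomial (\<lambda>j. if j = i then 1 else 0) = (\<lambda>x. x $ i)"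
    unfolding monomial_def by (simp add: if_distrib[of "\<lambda>n. _ ^ n"] cong: if_cong)
  ultimately show ?thesis by simp
qed

text \<open>The gradient in the ambient space. Fields on a cell are represented by polynomials on
  the whole space, and \<open>grad X\<close> becomes the tangential projection of
  \<open>pgrad\<close>, see \<open>grad_poly\<close>.\<close>

definition pgrad :: "sfield \<Rightarrow> vfield" where
  "pgrad p x = (\<chi> i. frechet_derivative p (at x) (axis i 1))"

lemma pgrad_eqI: "(p has_derivative (\<lambda>h. g \<bullet> h)) (at x) \<Longrightarrow> pgrad p x = g"
  unfolding pgrad_def by (simp add: frechet_derivative_at[of p "\<lambda>h. g \<bullet> h" x, symmetric] inner_axis vec_eq_iff)

definition vpolys :: "int \<Rightarrow> vfield set" where
  "vpolys l = {v. \<forall>i. (\<lambda>x. v x $ i) \<in> polys l}"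

lemma polys_derivative_exists:
  assumes "p \<in> polys l"
  shows "\<exists>G\<in>vpolys (l - 1). \<forall>x. (p has_derivative (\<lambda>h. G x \<bullet> h)) (at x)"
proof -
  obtain c where c: "p = (\<lambda>x. \<Sum>\<alpha>\<in>multidegrees l. c \<alpha> * monomial \<alpha> x)" using assms by (blast elim: polysE)
  \<comment> \<open>For \<open>\<alpha> i = 0\<close> the truncated subtraction leaves the exponent
    at 0, but the factor in front is zero as well.\<close>
  define D where "D = (\<lambda>\<alpha> x. (\<chi> i. real (\<alpha> i) * monomial (\<alpha>(i := \<alpha> i - 1)) x) :: point)"
  have der: "(monomial \<alpha> has_derivative (\<lambda>h. D \<alpha> x \<bullet> h)) (at x)" for \<alpha> x
  proof -
    have "((\<lambda>x::point. (x $ i) ^ \<alpha> i) has_derivative (\<lambda>h. real (\<alpha> i) * (h $ i) * (x $ i) ^ (\<alpha> i - 1))) (at x)" for i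
      by (intro has_derivative_power bounded_linear_imp_has_derivative bounded_linear_vec_nth)
    then have "(monomial \<alpha> has_derivative (\<lambda>h. \<Sum>i\<in>UNIV. (real (\<alpha> i) * (h $ i) * (x $ i) ^ (\<alpha> i - 1)) * (\<Prod>j\<in>UNIV - {i}. (x $ j) ^ \<alpha> j))) (at x)"
      unfolding monomial_def by (rule has_derivative_prod)
    also have "(\<lambda>h. \<Sum>i\<in>UNIV. (real (\<alpha> i) * (h $ i) * (x $ i) ^ (\<alpha> i - 1)) * (\<Prod>j\<in>UNIV - {i}. (x $ j) ^ \<alpha> j)) = (\<lambda>h. D \<alpha> x \<bullet> h)"
    proof -
      have "monomial (\<alpha>(i := \<alpha> i - 1)) x = (x $ i) ^ (\<alpha> i - 1) * (\<Prod>j\<in>UNIV - {i}. (x $ j) ^ \<alpha> j)" for i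
        unfolding monomial_def by (subst prod.remove[of UNIV i]) (auto intro!: prod.cong)
      then show ?thesis by (auto simp: D_def inner_vec_def fun_eq_iff algebra_simps intro!: sum.cong)
    qed
    finally show ?thesis .
  qed
  have DP: "(\<lambda>x. D \<alpha> x $ i) \<in> polys (l - 1)" if "\<alpha> \<in> multidegrees l" for \<alpha> i
  proof (cases "\<alpha> i = 0")
    case True then show ?thesis by (simp add: D_def polys_zero)
  next
    case False
    have "(\<Sum>j\<in>UNIV. (\<alpha>(i := \<alpha> i - 1)) j) = (\<alpha> i - 1) + (\<Sum>j\<in>UNIV - {i}. \<alpha> j)"
      by (subst sum.remove[of UNIV i]) (auto intro!: sum.cong)
    moreover have "(\<Sum>j\<in>UNIV. \<alpha> j) = \<alpha> i + (\<Sum>j\<in>UNIV - {i}. \<alpha> j)"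
      by (subst sum.remove[of UNIV i]) auto
    ultimately have "\<alpha>(i := \<alpha> i - 1) \<in> multidegrees (l - 1)"
      using that False by (simp add: multidegrees_def del: of_nat_sum fun_upd_apply)
    from polys_cmult[OF polys_monomial[OF this], of "real (\<alpha> i)"] show ?thesis by (simp add: D_def)
  qed
  show ?thesis
  proof (intro bexI[of _ "\<lambda>x. \<Sum>\<alpha>\<in>multidegrees l. c \<alpha> *\<^sub>R D \<alpha> x"] allI)
    show "(\<lambda>x. \<Sum>\<alpha>\<in>multidegrees l. c \<alpha> *\<^sub>R D \<alpha> x) \<in> vpolys (l - 1)"
      unfolding vpolys_def using DP by (auto simp: sum_component intro!: polys_sum polys_cmult)
    fix x
    have "((\<lambda>x. \<Sum>\<alpha>\<in>multidegrees l. c \<alpha> * monomial \<alpha> x) has_derivative (\<lambda>h. \<Sum>\<alpha>\<in>multidegrees l. c \<alpha> * (D \<alpha> x \<bullet> h))) (at x)"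
      using der by (intro has_derivative_sum has_derivative_mult_right)
    then show "(p has_derivative (\<lambda>h. (\<Sum>\<alpha>\<in>multidegrees l. c \<alpha> *\<^sub>R D \<alpha> x) \<bullet> h)) (at x)"
      unfolding c by (simp add: inner_sum_left)
  qed
qed

lemma
  assumes "p \<in> polys l"
  shows polys_has_derivative: "(p has_derivative (\<lambda>h. pgrad p x \<bullet> h)) (at x)"
    and pgrad_vpolys: "pgrad p \<in> vpolys (l - 1)"
proof -
  obtain G where G: "G \<in> vpolys (l - 1)" "\<And>x. (p has_derivative (\<lambda>h. G x \<bullet> h)) (at x)"
    using polys_derivative_exists[OF assms] by blast
  have "pgrad p = G" using pgrad_eqI[OF G(2)] by blast
  then show "(p has_derivative (\<lambda>h. pgrad p x \<bullet> h)) (at x)" "pgrad p \<in> vpolys (l - 1)" using G by simp_all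
qed

lemma pgrad_add: "p \<in> polys l \<Longrightarrow> q \<in> polys m \<Longrightarrow> pgrad (\<lambda>x. p x + q x) x = pgrad p x + pgrad q x"
  by (intro pgrad_eqI) (auto simp: inner_add_left intro!: has_derivative_add polys_has_derivative)
lemma pgrad_cmult: "p \<in> polys l \<Longrightarrow> pgrad (\<lambda>x. c * p x) x = c *\<^sub>R pgrad p x"
  by (intro pgrad_eqI) (auto intro!: has_derivative_mult_right polys_has_derivative)
lemma pgrad_diff: "p \<in> polys l \<Longrightarrow> q \<in> polys m \<Longrightarrow> pgrad (\<lambda>x. p x - q x) x = pgrad p x - pgrad q x"
  by (intro pgrad_eqI) (auto simp: inner_diff_left intro!: has_derivative_diff polys_has_derivative)
lemma pgrad_mult: "p \<in> polys l \<Longrightarrow> q \<in> polys m \<Longrightarrow> pgrad (\<lambda>x. p x * q x) x = p x *\<^sub>R pgrad q x + q x *\<^sub>R pgrad p x"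
  by (intro pgrad_eqI, rule has_derivative_eq_rhs[OF has_derivative_mult[OF polys_has_derivative polys_has_derivative]])
    (auto simp: inner_add_left algebra_simps)

lemma polys_continuous: "p \<in> polys l \<Longrightarrow> continuous_on UNIV p"
  using polys_has_derivative has_derivative_continuous by (metis continuous_at_imp_continuous_on)

lemma vpolys_continuous: "v \<in> vpolys l \<Longrightarrow> continuous_on UNIV v"
proof -
  assume "v \<in> vpolys l"
  then have "continuous_on UNIV (\<lambda>x. \<chi> i. v x $ i)"
    by (intro continuous_on_vec_lambda) (auto simp: vpolys_def intro: polys_continuous)
  then show ?thesis by simp
qed

lemma vpolys_nth: "v \<in> vpolys l \<Longrightarrow> (\<lambda>x. v x $ i) \<in> polys l" by (simp add: vpolys_def)

lemma vpolys_linear: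
  fixes L :: "point \<Rightarrow> point"
  assumes L: "linear L" and v: "v \<in> vpolys l"
  shows "(\<lambda>x. L (v x)) \<in> vpolys l"
  unfolding vpolys_def
proof (intro CollectI allI)
  fix i
  have "L (v x) $ i = (\<Sum>j\<in>UNIV. (L (axis j 1) $ i) * (v x $ j))" for x
  proof -
    have "v x = (\<Sum>j\<in>UNIV. (v x $ j) *\<^sub>R axis j 1)"
      using basis_expansion[of "v x"] by (simp add: scalar_mult_eq_scaleR)
    then have "L (v x) = (\<Sum>j\<in>UNIV. (v x $ j) *\<^sub>R L (axis j 1))"
      by (metis (no_types, lifting) L linear_cmul linear_sum sum.cong)
    then show ?thesis by (simp add: sum_component mult.commute)
  qed
  then show "(\<lambda>x. L (v x) $ i) \<in> polys l"
    using v by (auto intro!: polys_sum polys_cmult vpolys_nth)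
qed

lemma vpolys_inner_const: "v \<in> vpolys l \<Longrightarrow> (\<lambda>x. v x \<bullet> n) \<in> polys l"
  unfolding inner_vec_def using polys_cmult[OF vpolys_nth, of v l _ ] by (auto intro!: polys_sum simp: mult.commute)

lemma vpolys_mono: "l \<le> m \<Longrightarrow> v \<in> vpolys l \<Longrightarrow> v \<in> vpolys m"
  using polys_mono by (auto simp: vpolys_def)

lemma vpolys_add: "v \<in> vpolys l \<Longrightarrow> w \<in> vpolys l \<Longrightarrow> (\<lambda>x. v x + w x) \<in> vpolys l"
  by (simp add: vpolys_def polys_add)

section \<open>Differential operators on cells\<close>

lemma cell_direction: "cell X \<Longrightarrow> subspace (direction X)"
  by (simp add: cell_def subspace_direction)

text \<open>Orthogonal projection on the direction space: the identity on a polyhedron, the map v ->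
  n x (v x n) on a face.\<close>

definition tang :: "point set \<Rightarrow> point \<Rightarrow> point" where
  "tang X v = (THE p. p \<in> direction X \<and> (\<forall>w\<in>direction X. p \<bullet> w = v \<bullet> w))"

lemma tang_eqI:
  assumes X: "cell X" and p: "p \<in> direction X" "\<And>w. w \<in> direction X \<Longrightarrow> p \<bullet> w = v \<bullet> w"
  shows "tang X v = p"
  unfolding tang_def
proof (rule the_equality)
  fix q assume q: "q \<in> direction X \<and> (\<forall>w\<in>direction X. q \<bullet> w = v \<bullet> w)"
  have "q - p \<in> direction X" using q p cell_direction[OF X] by (simp add: subspace_diff)
  then have "(q - p) \<bullet> (q - p) = 0" using q p by (simp add: inner_diff_left)
  then show "q = p" by simp
qed (use p in auto)

lemma
  assumes X: "cell X"
  shows tang_direction: "tang X v \<in> direction X" and tang_inner: "w \<in> direction X \<Longrightarrow> tang X v \<bullet> w = v \<bullet> w"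
proof -
  obtain y z where yz: "y \<in> span (direction X)" "\<And>w. w \<in> span (direction X) \<Longrightarrow> orthogonal z w" "v = y + z"
    using orthogonal_subspace_decomp_exists[of "direction X" v] by blast
  have D: "span (direction X) = direction X" using cell_direction[OF X] by (simp add: span_eq_iff)
  have "y \<bullet> w = v \<bullet> w" if "w \<in> direction X" for w
    using yz(2)[of w] that unfolding yz(3) D by (simp add: inner_add_left orthogonal_def)
  then have "tang X v = y" using yz(1) D by (intro tang_eqI[OF X]) auto
  then show "tang X v \<in> direction X" "w \<in> direction X \<Longrightarrow> tang X v \<bullet> w = v \<bullet> w"
    using yz(1) D \<open>\<And>w. w \<in> direction X \<Longrightarrow> y \<bullet> w = v \<bullet> w\<close> by auto
qed

lemma linear_tang: "cell X \<Longrightarrow> linear (tang X)"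
  using cell_direction by (intro linearI tang_eqI)
    (auto simp: tang_direction tang_inner subspace_add subspace_scale inner_add_left)

lemma tang_id: "cell X \<Longrightarrow> v \<in> direction X \<Longrightarrow> tang X v = v"
  by (rule tang_eqI) auto

lemma cell_line:
  assumes X: "cell X" and x: "x \<in> X" and v: "v \<in> direction X"
  shows "\<forall>\<^sub>F t in nhds (0::real). x + t *\<^sub>R v \<in> X"
proof -
  obtain U where U: "open U" "X = affine hull X \<inter> U" using X by (auto simp: cell_def openin_open)
  have "((\<lambda>t. x + t *\<^sub>R v) \<longlongrightarrow> x + 0 *\<^sub>R v) (nhds (0::real))"
    by (intro tendsto_intros filterlim_ident)
  then have "\<forall>\<^sub>F t in nhds (0::real). x + t *\<^sub>R v \<in> U"
    by (rule topological_tendstoD) (use U x in auto)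
  moreover have "x + t *\<^sub>R v \<in> affine hull X" for t
    using direction_add[OF hull_inc[OF x]] v cell_direction[OF X] by (simp add: subspace_scale)
  ultimately show ?thesis
  proof (elim eventually_mono)
    fix t assume "x + t *\<^sub>R v \<in> U"
    then show "x + t *\<^sub>R v \<in> X"
      using \<open>\<And>t. x + t *\<^sub>R v \<in> affine hull X\<close> by (subst U(2)) simp
  qed
qed

text \<open>Makes the filter at \<open>x\<close> within \<open>X\<close> nontrivial, so that
  \<open>Lim\<close> in \<open>ext\<close> is a genuine limit.\<close>

lemma cell_islimpt:
  assumes X: "cell X" and x: "x \<in> closure X"
  shows "x islimpt X"
proof (cases "x \<in> X")
  case True
  have "aff_dim X \<ge> 1" using X by (auto simp: cell_def)
  then have "X \<noteq> {x}" by auto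
  then obtain y where y: "y \<in> X" "y \<noteq> x" using True by blast
  then have v: "y - x \<in> direction X" using True by (simp add: direction_diff hull_inc)
  have "\<forall>\<^sub>F t in at (0::real). x + t *\<^sub>R (y - x) \<in> X"
    using cell_line[OF X True v] eventually_nhds_conv_at by blast
  moreover have "\<forall>\<^sub>F t in at (0::real). t \<noteq> 0" by (rule eventually_neq_at_within)
  ultimately have ev: "\<forall>\<^sub>F t in at (0::real). x + t *\<^sub>R (y - x) \<in> X - {x}"
    by eventually_elim (use y in auto)
  have "((\<lambda>t. x + t *\<^sub>R (y - x)) \<longlongrightarrow> x + 0 *\<^sub>R (y - x)) (at (0::real))"
    by (intro tendsto_intros)
  then have lim: "((\<lambda>t. x + t *\<^sub>R (y - x)) \<longlongrightarrow> x) (at (0::real))" by simp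
  have "x \<in> closure (X - {x})"
  proof (rule Lim_in_closed_set[OF closed_closure _ _ lim])
    show "\<forall>\<^sub>F t in at (0::real). x + t *\<^sub>R (y - x) \<in> closure (X - {x})"
      using ev by (rule eventually_mono) (rule subsetD[OF closure_subset])
  qed simp
  then show ?thesis by (simp add: islimpt_in_closure)
qed (use x in \<open>auto simp: closure_def\<close>)

text \<open>A derivative within \<open>X\<close> is determined along directions of \<open>X\<close>
  only. Requiring the gradient to lie in \<open>direction X\<close> restores uniqueness, and the
  projection of an ambient gradient is the value.\<close>

lemma grad_eqI:
  assumes X: "cell X" and x: "x \<in> X" and f: "(f has_derivative (\<lambda>h. g \<bullet> h)) (at x)"
    and u: "\<And>y. y \<in> X \<Longrightarrow> u y = f y"
  shows "grad X u x = tang X g"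
proof -
  define p where "p = tang X g"
  have p: "p \<in> direction X" "\<And>w. w \<in> direction X \<Longrightarrow> p \<bullet> w = g \<bullet> w"
    using X by (auto simp: p_def tang_direction tang_inner)
  have der: "(u has_derivative (\<lambda>h. p \<bullet> h)) (at x within X)"
  proof -
    have "(f has_derivative (\<lambda>h. g \<bullet> h)) (at x within X)" using f by (rule has_derivative_at_withinI)
    then have lim: "((\<lambda>y. (1 / norm (y - x)) *\<^sub>R (f y - (f x + g \<bullet> (y - x)))) \<longlongrightarrow> 0) (at x within X)"
      unfolding has_derivative_within by blast
    have "\<forall>\<^sub>F y in at x within X. (1 / norm (y - x)) *\<^sub>R (f y - (f x + g \<bullet> (y - x))) =
        (1 / norm (y - x)) *\<^sub>R (u y - (u x + p \<bullet> (y - x)))"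
      unfolding eventually_at_filter
      by (rule always_eventually) (use x u p direction_diff[of _ X x] hull_inc[of _ X] in auto)
    from Lim_transform_eventually[OF lim this]
    have "((\<lambda>y. (1 / norm (y - x)) *\<^sub>R (u y - (u x + p \<bullet> (y - x)))) \<longlongrightarrow> 0) (at x within X)" .
    then show ?thesis unfolding has_derivative_within using bounded_linear_inner_right by blast
  qed
  have "(THE g. g \<in> direction X \<and> (u has_derivative (\<lambda>h. g \<bullet> h)) (at x within X)) = p"
  proof (rule the_equality)
    fix q assume q: "q \<in> direction X \<and> (u has_derivative (\<lambda>h. q \<bullet> h)) (at x within X)"
    \<comment> \<open>Both candidates give the same derivative along the line in the direction of
      their difference, which stays in \<open>X\<close> for small times; so the difference is
      orthogonal to itself.\<close>
    define v where "v = q - p"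
    have v: "v \<in> direction X" using q p cell_direction[OF X] by (simp add: v_def subspace_diff)
    define S where "S = {t::real. x + t *\<^sub>R v \<in> X}"
    have at0: "at 0 within S = at 0"
    proof -
      obtain U where "open U" "0 \<in> U" "\<And>t. t \<in> U \<Longrightarrow> x + t *\<^sub>R v \<in> X"
        using cell_line[OF X x v] by (auto simp: eventually_nhds)
      then have "0 \<in> interior S" by (auto simp: S_def interior_def)
      then show ?thesis by (rule at_within_interior)
    qed
    have line: "((\<lambda>t. x + t *\<^sub>R v) has_derivative (\<lambda>t. t *\<^sub>R v)) (at 0 within S)"
      by (auto intro!: derivative_eq_intros)
    have img: "(\<lambda>t. x + t *\<^sub>R v) ` S \<subseteq> X" by (auto simp: S_def)
    have along: "((\<lambda>t. u (x + t *\<^sub>R v)) has_derivative (\<lambda>t. D (t *\<^sub>R v))) (at 0)"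
      if "(u has_derivative D) (at x within X)" for D
    proof -
      have "(u has_derivative D) (at (x + 0 *\<^sub>R v) within (\<lambda>t. x + t *\<^sub>R v) ` S)"
        using has_derivative_subset[OF that img] by simp
      from has_derivative_in_compose[OF line this] show ?thesis unfolding at0 .
    qed
    have "((\<lambda>t. u (x + t *\<^sub>R v)) has_derivative (\<lambda>t. q \<bullet> (t *\<^sub>R v))) (at 0)"
      using along q by blast
    moreover have "((\<lambda>t. u (x + t *\<^sub>R v)) has_derivative (\<lambda>t. p \<bullet> (t *\<^sub>R v))) (at 0)"
      using along der by blast
    ultimately have "(\<lambda>t. q \<bullet> (t *\<^sub>R v)) = (\<lambda>t. p \<bullet> (t *\<^sub>R v))" by (rule has_derivative_unique)
    from fun_cong[OF this, of 1] have "v \<bullet> v = 0" by (simp add: v_def inner_diff_left)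
    then show "q = p" by (simp add: v_def)
  qed (use p der in auto)
  then show ?thesis using x by (simp add: grad_def restr_def p_def)
qed

lemma grad_outside: "x \<notin> X \<Longrightarrow> grad X u x = 0"
  by (simp add: grad_def restr_def)

lemma grad_poly:
  assumes "cell X" "p \<in> polys l" "\<And>y. y \<in> X \<Longrightarrow> u y = p y"
  shows "grad X u = restr X (\<lambda>x. tang X (pgrad p x))"
proof
  fix x
  show "grad X u x = restr X (\<lambda>x. tang X (pgrad p x)) x"
    using grad_eqI[OF assms(1) _ polys_has_derivative[OF assms(2)] assms(3)]
    by (cases "x \<in> X") (auto simp: grad_outside restr_def)
qed

lemma ext_eq:
  assumes X: "cell X" and p: "continuous_on UNIV p" and u: "\<And>y. y \<in> X \<Longrightarrow> u y = p y"
  shows "ext X u = restr (closure X) p"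
proof
  fix x
  show "ext X u x = restr (closure X) p x"
  proof (cases "x \<in> closure X")
    case True
    have "(p \<longlongrightarrow> p x) (at x within X)"
      using p by (meson UNIV_I continuous_on_def tendsto_within_subset subset_UNIV)
    moreover have "\<forall>\<^sub>F y in at x within X. p y = u y"
      unfolding eventually_at_filter by (rule always_eventually) (use u in auto)
    ultimately have "(u \<longlongrightarrow> p x) (at x within X)" by (rule Lim_transform_eventually)
    moreover have "\<not> trivial_limit (at x within X)"
      using cell_islimpt[OF X True] by (simp add: trivial_limit_within)
    ultimately have "Lim (at x within X) u = p x" by (intro tendsto_Lim)
    then show ?thesis using True by (simp add: ext_def restr_def)
  qed (simp add: ext_def restr_def)
qed

text \<open>On \<open>W\<close>, \<open>ext\<close> evaluates a chosen continuous extension; sums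
  and multiples of the chosen extensions extend the sums and multiples of the fields.\<close>

lemma lin_on_ext:
  assumes W: "fields_on X W" shows "lin_on W (\<lambda>u. ext X u x)"
proof -
  note r = fields_onD[OF W]
  have "\<exists>f. continuous_on UNIV f \<and> (\<forall>x\<in>X. u x = f x)" if "u \<in> W" for u using r(3)[OF that] by (simp add: regular_on_def)
  then obtain e where e: "\<And>u. u \<in> W \<Longrightarrow> continuous_on UNIV (e u)" "\<And>u x. u \<in> W \<Longrightarrow> x \<in> X \<Longrightarrow> u x = e u x"
    by metis
  have E: "ext X u = restr (closure X) (e u)" if "u \<in> W" for u by (rule ext_eq[OF r(1) e(1)[OF that] e(2)[OF that]])
  have "ext X (\<lambda>x. u x + v x) = restr (closure X) (\<lambda>x. e u x + e v x)" if "u \<in> W" "v \<in> W" for u v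
    using that e by (intro ext_eq[OF r(1)] continuous_intros) auto
  moreover have "ext X (\<lambda>x. c *\<^sub>R u x) = restr (closure X) (\<lambda>x. c *\<^sub>R e u x)" if "u \<in> W" for u c
    using that e by (intro ext_eq[OF r(1)] continuous_intros) auto
  ultimately show ?thesis unfolding lin_on_def by (simp add: E restr_def)
qed

lemma regular_on_polys [intro]: "p \<in> polys l \<Longrightarrow> regular_on X p"
  by (intro regular_onI polys_continuous)
lemma regular_on_vpolys [intro]: "p \<in> vpolys l \<Longrightarrow> regular_on X p"
  by (intro regular_onI vpolys_continuous)
lemma regular_on_restr [intro]: "regular_on X p \<Longrightarrow> regular_on X (restr X p)"
  by (erule regular_on_cong) (simp add: restr_def)

lemma fields_on_pol: "cell X \<Longrightarrow> fields_on X (pol X l)"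
proof -
  assume X: "cell X"
  have "lin_on (polys l) (\<lambda>p. restr X p x)" for x by (simp add: lin_on_def restr_def)
  then have "findim (pol X l)" unfolding pol_def by (rule findim_image[OF polys_findim])
  moreover have "regular_on X u \<and> (\<forall>x. x \<notin> X \<longrightarrow> u x = 0)" if "u \<in> pol X l" for u
  proof -
    obtain p where "p \<in> polys l" "u = restr X p" using \<open>u \<in> pol X l\<close> by (auto simp: pol_def)
    then show ?thesis using regular_on_restr[OF regular_on_polys] by (auto simp: restr_def)
  qed
  ultimately show ?thesis using X by (simp add: fields_on_def)
qed

lemma polE:
  assumes "u \<in> pol X l" obtains p where "p \<in> polys l" "u = restr X p"
  using assms by (auto simp: pol_def)

lemma vpolE:
  assumes "v \<in> vpol X l"
  obtains w where "w \<in> vpolys l" "v = restr X w" "\<And>x. x \<in> X \<Longrightarrow> w x \<in> direction X"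
proof -
  have "\<forall>i. \<exists>p\<in>polys l. (\<lambda>x. v x $ i) = restr X p" using assms by (auto simp: vpol_def pol_def)
  then obtain p where p: "\<And>i. p i \<in> polys l" "\<And>i. (\<lambda>x. v x $ i) = restr X (p i)" by metis
  define w where "w = (\<lambda>x. (\<chi> i. p i x) :: point)"
  have w: "w \<in> vpolys l" using p by (simp add: w_def vpolys_def)
  moreover have v: "v = restr X w"
    using p(2) by (auto simp: fun_eq_iff restr_def w_def vec_eq_iff)
  moreover have "w x \<in> direction X" if "x \<in> X" for x
    using assms v that unfolding vpol_def restr_def by (metis (mono_tags, lifting) mem_Collect_eq)
  ultimately show ?thesis using that by blast
qed

lemma vpolI:
  assumes "cell X" "w \<in> vpolys l" "\<And>x. x \<in> X \<Longrightarrow> w x \<in> direction X"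
  shows "restr X w \<in> vpol X l"
proof -
  have "(\<lambda>x. restr X w x $ i) = restr X (\<lambda>x. w x $ i)" for i by (auto simp: restr_def)
  then show ?thesis
    using assms vpolys_nth[OF assms(2)] subspace_0[OF cell_direction[OF assms(1)]]
    unfolding vpol_def pol_def by (auto simp: restr_def)
qed

text \<open>Fields with polynomial components are spanned by monomials times unit vectors. Those
  with values in the direction space are their image under pointwise tangential projection, which is
  linear and preserves the degree.\<close>

lemma fields_on_vpol: "cell X \<Longrightarrow> fields_on X (vpol X l)"
proof -
  assume X: "cell X"
  define V where "V = {u. \<exists>c. u = (\<lambda>x. \<Sum>a\<in>(UNIV::3 set) \<times> multidegrees l. c a *\<^sub>R (restr X (monomial (snd a)) x *\<^sub>R axis (fst a) (1::real)))}"
  have fV: "findim V" unfolding V_def by (intro findim_finite_sum finite_cartesian_product finite_multidegrees) simp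
  have comp: "(\<Sum>a\<in>(UNIV::3 set) \<times> multidegrees l. c a *\<^sub>R (restr X (monomial (snd a)) x *\<^sub>R axis (fst a) (1::real))) $ i =
      restr X (\<lambda>x. \<Sum>\<alpha>\<in>multidegrees l. c (i, \<alpha>) * monomial \<alpha> x) x" for c x i
  proof -
    have "(\<Sum>a\<in>(UNIV::3 set) \<times> multidegrees l. c a *\<^sub>R (restr X (monomial (snd a)) x *\<^sub>R axis (fst a) (1::real))) $ i =
      (\<Sum>j\<in>UNIV. \<Sum>\<alpha>\<in>multidegrees l. c (j, \<alpha>) * (restr X (monomial \<alpha>) x * (if j = i then 1 else 0)))"
      by (simp add: sum_component sum.cartesian_product axis_def case_prod_beta eq_commute mult.assoc)
    also have "\<dots> = (\<Sum>j\<in>UNIV. if j = i then \<Sum>\<alpha>\<in>multidegrees l. c (j, \<alpha>) * restr X (monomial \<alpha>) x else 0)"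
      by (intro sum.cong) auto
    finally show ?thesis by (simp add: restr_def)
  qed
  have V: "V = {v. \<forall>i. (\<lambda>x. v x $ i) \<in> pol X l}"
  proof (intro equalityI subsetI CollectI allI)
    fix v i assume "v \<in> V"
    then obtain c where "v = (\<lambda>x. \<Sum>a\<in>(UNIV::3 set) \<times> multidegrees l. c a *\<^sub>R (restr X (monomial (snd a)) x *\<^sub>R axis (fst a) (1::real)))"
      unfolding V_def by blast
    then have "(\<lambda>x. v x $ i) = restr X (\<lambda>x. \<Sum>\<alpha>\<in>multidegrees l. c (i, \<alpha>) * monomial \<alpha> x)"
      using comp by simp
    moreover have "(\<lambda>x. \<Sum>\<alpha>\<in>multidegrees l. c (i, \<alpha>) * monomial \<alpha> x) \<in> polys l"
      by (intro polys_sum polys_cmult polys_monomial)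
    ultimately show "(\<lambda>x. v x $ i) \<in> pol X l" by (simp add: pol_def)
  next
    fix v :: vfield assume "v \<in> {v. \<forall>i. (\<lambda>x. v x $ i) \<in> pol X l}"
    then have "\<forall>i. \<exists>c. (\<lambda>x. v x $ i) = restr X (\<lambda>x. \<Sum>\<alpha>\<in>multidegrees l. c \<alpha> * monomial \<alpha> x)"
      unfolding pol_def polys_eq by auto
    from choice[OF this] obtain c
      where *: "\<forall>i. (\<lambda>x. v x $ i) = restr X (\<lambda>x. \<Sum>\<alpha>\<in>multidegrees l. c i \<alpha> * monomial \<alpha> x)" by blast
    have c: "v x $ i = restr X (\<lambda>x. \<Sum>\<alpha>\<in>multidegrees l. c i \<alpha> * monomial \<alpha> x) x" for i x
      using fun_cong[OF spec[OF *, of i], of x] .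
    have "v = (\<lambda>x. \<Sum>a\<in>(UNIV::3 set) \<times> multidegrees l. c (fst a) (snd a) *\<^sub>R (restr X (monomial (snd a)) x *\<^sub>R axis (fst a) (1::real)))"
      unfolding fun_eq_iff vec_eq_iff comp using c by simp
    then show "v \<in> V" unfolding V_def by (intro CollectI exI[of _ "\<lambda>a. c (fst a) (snd a)"])
  qed
  define Q :: "vfield \<Rightarrow> vfield" where "Q = (\<lambda>v x. tang X (v x))"
  have "vpol X l = Q ` V"
  proof (intro equalityI subsetI)
    fix v assume "v \<in> vpol X l"
    then have "v = Q v" "v \<in> V" using X by (auto simp: V vpol_def tang_id Q_def)
    then show "v \<in> Q ` V" by (rule image_eqI)
  next
    fix v assume "v \<in> Q ` V"
    then obtain u where u: "u \<in> V" "v = Q u" by blast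
    have "\<forall>i. \<exists>p\<in>polys l. (\<lambda>x. u x $ i) = restr X p" using u by (auto simp: V pol_def)
    then obtain p where p: "\<And>i. p i \<in> polys l" "\<And>i. (\<lambda>x. u x $ i) = restr X (p i)" by metis
    have "u = restr X (\<lambda>x. \<chi> i. p i x)" using p(2) by (auto simp: fun_eq_iff restr_def vec_eq_iff)
    then have "v = restr X (\<lambda>x. tang X (\<chi> i. p i x))"
      unfolding u(2) Q_def using linear_0[OF linear_tang[OF X]] by (auto simp: restr_def)
    moreover have "(\<lambda>x. tang X (\<chi> i. p i x)) \<in> vpolys l"
      by (rule vpolys_linear[OF linear_tang[OF X]]) (simp add: vpolys_def p)
    ultimately show "v \<in> vpol X l" using vpolI[OF X] tang_direction[OF X] by metis
  qed
  moreover have "lin_on V (\<lambda>v. tang X (v x))" for x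
    using linear_tang[OF X] by (simp add: lin_on_def linear_add linear_cmul)
  ultimately have "findim (vpol X l)" using findim_image[OF fV, of Q] by (simp add: Q_def)
  moreover have "regular_on X v \<and> (\<forall>x. x \<notin> X \<longrightarrow> v x = 0)" if "v \<in> vpol X l" for v
  proof -
    obtain w where "w \<in> vpolys l" "v = restr X w" using \<open>v \<in> vpol X l\<close> by (rule vpolE)
    then show ?thesis using regular_on_restr[OF regular_on_vpolys] by (auto simp: restr_def)
  qed
  ultimately show ?thesis using X by (simp add: fields_on_def)
qed

lemma grad_vpol: "cell X \<Longrightarrow> u \<in> pol X l \<Longrightarrow> grad X u \<in> vpol X (l - 1)"
proof -
  assume X: "cell X" and "u \<in> pol X l"
  then obtain p where p: "p \<in> polys l" "u = restr X p" by (blast elim: polE)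
  have "grad X u = restr X (\<lambda>x. tang X (pgrad p x))" by (rule grad_poly[OF X p(1)]) (simp add: p restr_def)
  then show ?thesis using vpolI[OF X vpolys_linear[OF linear_tang[OF X] pgrad_vpolys[OF p(1)]]] tang_direction[OF X] by simp
qed

lemma lin_on_grad: "cell X \<Longrightarrow> lin_on (pol X l) (\<lambda>u. grad X u x)"
proof -
  assume X: "cell X"
  have g: "grad X u = restr X (\<lambda>x. tang X (pgrad p x))" if "p \<in> polys l" "u = restr X p" for u p
    by (rule grad_poly[OF X that(1)]) (simp add: that restr_def)
  show ?thesis unfolding lin_on_def
  proof (intro conjI ballI allI)
    fix u v assume "u \<in> pol X l" "v \<in> pol X l"
    then obtain p q where *: "p \<in> polys l" "u = restr X p" "q \<in> polys l" "v = restr X q" by (meson polE)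
    have "(\<lambda>x. u x + v x) = restr X (\<lambda>x. p x + q x)" by (auto simp: * restr_def)
    from g[OF polys_add[OF *(1,3)] this] show "grad X (\<lambda>x. u x + v x) x = grad X u x + grad X v x"
      using g[OF *(1,2)] g[OF *(3,4)] linear_tang[OF X] *
      by (simp add: restr_def pgrad_add[OF *(1,3)] linear_add)
  next
    fix u c assume "u \<in> pol X l"
    then obtain p where *: "p \<in> polys l" "u = restr X p" by (meson polE)
    have "(\<lambda>x. c *\<^sub>R u x) = restr X (\<lambda>x. c * p x)" by (auto simp: * restr_def)
    from g[OF polys_cmult[OF *(1)] this] show "grad X (\<lambda>x. c *\<^sub>R u x) x = c *\<^sub>R grad X u x"
      using g[OF *(1,2)] linear_tang[OF X] by (simp add: restr_def pgrad_cmult[OF *(1)] linear_cmul)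
  qed
qed

section \<open>The geometry of a polyhedral element\<close>

lemma mem_affine_hull_iff: "p \<in> affine hull X \<Longrightarrow> x \<in> affine hull X \<longleftrightarrow> x - p \<in> direction X"
  using direction_add[of p X "x - p"] direction_diff[of x X p] by auto

lemma dim_direction: "X \<noteq> {} \<Longrightarrow> int (dim (direction X)) = aff_dim X"
proof -
  assume "X \<noteq> {}"
  then obtain p where p: "p \<in> affine hull X" by (meson all_not_in_conv hull_inc)
  then have "aff_dim (affine hull X) = int (dim ((+) (- p) ` (affine hull X)))"
    by (intro aff_dim_eq_dim) (simp add: hull_hull)
  then show ?thesis using direction_image[OF p] by simp
qed

lemma direction_mono: "affine hull X \<subseteq> affine hull Y \<Longrightarrow> direction X \<subseteq> direction Y"
  by (auto simp: direction_def)

text \<open>A nonempty simplex \<open>S0\<close> of the family has full dimension, hence the affine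
  hull of the union \<open>K\<close>; so its relative interior, and with it \<open>X\<close>, spans
  that hull. The closure of \<open>X\<close> stays in the compact set \<open>K\<close>, so its
  relative interior adds nothing to \<open>X\<close>.\<close>

lemma polytopal_domain_cell:
  assumes "polytopal_domain d X" and d: "d \<in> {1, 2, 3}"
  shows "cell X" "aff_dim X = d" "rel_interior (closure X) \<subseteq> X" "connected X"
proof -
  obtain \<S> where S: "finite \<S>" "\<forall>S\<in>\<S>. d simplex S" "aff_dim (\<Union>\<S>) = d" "X = rel_interior (\<Union>\<S>)"
    and conn: "connected X" using assms by (auto simp: polytopal_domain_def)
  show "connected X" by (rule conn)
  define K where "K = \<Union>\<S>"
  have K: "compact K" unfolding K_def using S compact_simplex by (intro compact_Union) auto
  have "aff_dim (\<Union>\<S>) \<noteq> -1" using S(3) d by auto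
  then have "\<Union>\<S> \<noteq> {}" by (metis aff_dim_empty)
  then obtain S0 where S0: "S0 \<in> \<S>" "S0 \<noteq> {}" by blast
  have simp: "d simplex S0" using S S0 by blast
  have sub: "S0 \<subseteq> K" using S0 K_def by auto
  have aff0: "affine hull S0 = affine hull K"
    using aff_dim_eq_full_gen[OF sub] aff_dim_simplex[OF simp] S(3) by (simp add: K_def)
  have "rel_interior S0 \<subseteq> rel_interior K" by (rule subset_rel_interior[OF sub aff0])
  then have 0: "rel_interior S0 \<subseteq> X" using S(4) by (simp add: K_def)
  have ne: "rel_interior S0 \<noteq> {}" using rel_interior_eq_empty[OF convex_simplex[OF simp]] S0 by simp
  have XK: "X \<subseteq> K" using S(4) rel_interior_subset by (auto simp: K_def)
  have "affine hull (rel_interior S0) = affine hull S0"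
    by (rule rel_interior_same_affine_hull[OF convex_simplex[OF simp]])
  then have aff: "affine hull X = affine hull K"
    using hull_mono[OF 0, of affine] hull_mono[OF XK, of affine] aff0 by auto
  show dim: "aff_dim X = d" using aff aff_dim_affine_hull2 S(3) by (metis K_def)
  show "cell X" unfolding cell_def
  proof (intro conjI)
    show "X \<noteq> {}" using 0 ne by auto
    show "bounded X" using XK K compact_imp_bounded bounded_subset by blast
    show "openin (top_of_set (affine hull X)) X"
      unfolding aff using S(4) openin_rel_interior[of K] by (simp add: K_def)
    show "aff_dim X \<in> {1, 2, 3}" using dim d by simp
  qed
  have "closure X \<subseteq> K" using XK K by (simp add: closure_minimal compact_imp_closed)
  then have "rel_interior (closure X) \<subseteq> rel_interior K"
    by (rule subset_rel_interior) (simp add: aff closure_same_affine_hull)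
  then show "rel_interior (closure X) \<subseteq> X" using S(4) by (simp add: K_def)
qed

lemma cell_rel_interior: "cell X \<Longrightarrow> rel_interior X = X"
  by (simp add: cell_def rel_interior_openin)

lemma cell_closure: "cell X \<Longrightarrow> closure X = X \<union> rel_frontier X"
  using closure_subset by (auto simp: rel_frontier_def cell_rel_interior)

text \<open>The i-th coordinate of a tangential gradient is the derivative in direction
  \<open>e i\<close>, the projection of the i-th unit vector; so the divergence is a sum of
  directional derivatives of components. In the boundary term the projection disappears because the
  normals lie in \<open>direction X\<close>.\<close>

lemma (in hull_boundary) divergence:
  assumes dims: "(aff_dim X = 3 \<and> (\<forall>Y\<in>\<Y>. aff_dim Y = 2)) \<or> (aff_dim X = 2 \<and> (\<forall>Y\<in>\<Y>. aff_dim Y = 1))"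
    and v: "v \<in> vpolys l"
  shows "integ X (dvg X (restr X v)) = (\<Sum>Y\<in>\<Y>. orient Y * integ Y (\<lambda>x. v x \<bullet> \<nu> Y))"
proof -
  note X = cells(1)[OF dims] and Y = cells(2)[OF dims]
  define e where "e = (\<lambda>i::3. tang X (axis i (1::real)))"
  have comp: "(tang X u) $ i = u \<bullet> e i" for u i
  proof -
    have "tang X u \<bullet> axis i 1 = tang X u \<bullet> e i"
      using tang_inner[OF X tang_direction[OF X], of "axis i 1" u] by (simp add: e_def inner_commute)
    also have "\<dots> = u \<bullet> e i" unfolding e_def by (rule tang_inner[OF X tang_direction[OF X]])
    finally show ?thesis by (simp add: inner_axis)
  qed
  have vi: "(\<lambda>x. v x $ i) \<in> polys l" for i using v by (rule vpolys_nth)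
  have "integ X (dvg X (restr X v)) = integ X (\<lambda>x. \<Sum>i\<in>UNIV. pgrad (\<lambda>y. v y $ i) x \<bullet> e i)"
  proof (rule integ_cong)
    fix x assume x: "x \<in> X"
    have "grad X (\<lambda>y. restr X v y $ i) x = tang X (pgrad (\<lambda>y. v y $ i) x)" for i
      using grad_eqI[OF X x polys_has_derivative[OF vi]] by (simp add: restr_def)
    then show "dvg X (restr X v) x = (\<Sum>i\<in>UNIV. pgrad (\<lambda>y. v y $ i) x \<bullet> e i)"
      by (simp add: dvg_def comp)
  qed
  also have "\<dots> = (\<Sum>i\<in>UNIV. integ X (\<lambda>x. pgrad (\<lambda>y. v y $ i) x \<bullet> e i))"
    by (intro integ_sum[OF X] regular_on_inner regular_on_const regular_on_vpolys[OF pgrad_vpolys[OF vi]])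
  also have "\<dots> = (\<Sum>i\<in>UNIV. \<Sum>Y\<in>\<Y>. orient Y * (\<nu> Y \<bullet> e i) * integ Y (\<lambda>x. v x $ i))"
    using tang_direction[OF X]
    by (intro sum.cong refl directional_divergence[OF dims polys_has_derivative[OF vi] vpolys_continuous[OF pgrad_vpolys[OF vi]]])
      (simp add: e_def)
  also have "\<dots> = (\<Sum>Y\<in>\<Y>. \<Sum>i\<in>UNIV. orient Y * (\<nu> Y \<bullet> e i) * integ Y (\<lambda>x. v x $ i))"
    by (rule sum.swap)
  also have "\<dots> = (\<Sum>Y\<in>\<Y>. orient Y * integ Y (\<lambda>x. v x \<bullet> \<nu> Y))"
  proof (rule sum.cong[OF refl])
    fix Z assume Z: "Z \<in> \<Y>"
    have \<nu>i: "\<nu> Z \<bullet> e i = \<nu> Z $ i" for i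
      using comp[of "\<nu> Z" i] tang_id[OF X nu_direction[OF Z]] by simp
    have "integ Z (\<lambda>x. v x \<bullet> \<nu> Z) = integ Z (\<lambda>x. \<Sum>i\<in>UNIV. (\<nu> Z $ i) * (v x $ i))"
      by (intro integ_cong) (simp add: inner_vec_def mult.commute)
    also have "\<dots> = (\<Sum>i\<in>UNIV. integ Z (\<lambda>x. (\<nu> Z $ i) * (v x $ i)))"
      by (intro integ_sum[OF Y[OF Z]] regular_on_mult regular_on_const regular_on_polys[OF vi])
    finally show "(\<Sum>i\<in>UNIV. orient Z * (\<nu> Z \<bullet> e i) * integ Z (\<lambda>x. v x $ i)) = orient Z * integ Z (\<lambda>x. v x \<bullet> \<nu> Z)"
      by (simp add: \<nu>i integ_cmult sum_distrib_left mult.assoc)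
  qed
  finally show ?thesis .
qed

section \<open>Polynomials along an edge\<close>

lemma open_segment_param:
  fixes \<psi> :: "real \<Rightarrow> point"
  assumes \<psi>: "\<forall>x y. dist (\<psi> x) (\<psi> y) = dist x y" and ab: "\<alpha> < \<beta>"
  shows "\<psi> s \<in> open_segment (\<psi> \<alpha>) (\<psi> \<beta>) \<longleftrightarrow> s \<in> {\<alpha><..<\<beta>}"
proof -
  obtain A where A: "linear A" "\<And>x. norm (A x) = norm x" "\<And>x. \<psi> x = \<psi> 0 + A x"
    using isometry_affine[OF \<psi>] by metis
  have inj: "\<psi> x = \<psi> y \<longleftrightarrow> x = y" for x y using \<psi> by (metis dist_eq_0_iff)
  have comb: "(1 - u) *\<^sub>R \<psi> \<alpha> + u *\<^sub>R \<psi> \<beta> = \<psi> ((1 - u) * \<alpha> + u * \<beta>)" for u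
  proof -
    have "\<psi> ((1 - u) * \<alpha> + u * \<beta>) = \<psi> 0 + ((1 - u) *\<^sub>R A \<alpha> + u *\<^sub>R A \<beta>)"
      using A(3)[of "(1 - u) * \<alpha> + u * \<beta>"] linear_add[OF A(1), of "(1 - u) * \<alpha>" "u * \<beta>"]
        linear_cmul[OF A(1), of "1 - u" \<alpha>] linear_cmul[OF A(1), of u \<beta>] by simp
    also have "\<dots> = (1 - u) *\<^sub>R (\<psi> 0 + A \<alpha>) + u *\<^sub>R (\<psi> 0 + A \<beta>)" by (simp add: algebra_simps)
    finally show ?thesis using A(3) by metis
  qed
  have "\<psi> s \<in> open_segment (\<psi> \<alpha>) (\<psi> \<beta>) \<longleftrightarrow> s \<in> open_segment \<alpha> \<beta>"
    by (simp add: in_segment(2) comb inj)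
  then show ?thesis using ab by (simp add: open_segment_eq_real_ivl)
qed

text \<open>With equal values at the ends the fundamental theorem of calculus gives 0 whichever way
  the edge is run through, so the parametrization may be oriented freely.\<close>

lemma edge_integral_derivative:
  assumes E: "E = open_segment a b" "a \<noteq> b" and t: "t \<in> direction E" and cE: "cell E" "aff_dim E = 1"
    and p: "p \<in> polys l" and ends: "p a = p b"
  shows "integ E (\<lambda>x. pgrad p x \<bullet> t) = 0"
proof -
  obtain \<psi> :: "real \<Rightarrow> point" where par: "hull_param E \<psi>" using hull_param_1[OF cE(2)] by blast
  then have iso: "\<forall>x y. dist (\<psi> x) (\<psi> y) = dist x y" and rng: "range \<psi> = affine hull E" by (auto simp: hull_param_def)
  obtain A where A: "linear A" "\<And>x. norm (A x) = norm x" "\<And>x. \<psi> x = \<psi> 0 + A x"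
    using isometry_affine[OF iso] by metis
  define u where "u = A 1"
  have Au: "\<psi> s = \<psi> 0 + s *\<^sub>R u" for s
    using A(3)[of s] linear_cmul[OF A(1), of s 1] by (simp add: u_def)
  have "a \<in> affine hull E" "b \<in> affine hull E" using E by (auto simp: hull_inc)
  then obtain \<alpha>' \<beta>' where ab: "a = \<psi> \<alpha>'" "b = \<psi> \<beta>'" using rng by blast
  define \<alpha> \<beta> where "\<alpha> = min \<alpha>' \<beta>'" and "\<beta> = max \<alpha>' \<beta>'"
  have "\<alpha>' \<noteq> \<beta>'" using ab E by auto
  then have lt: "\<alpha> < \<beta>" by (auto simp: \<alpha>_def \<beta>_def)
  have Eseg: "E = open_segment (\<psi> \<alpha>) (\<psi> \<beta>)"
    using E ab open_segment_commute by (auto simp: \<alpha>_def \<beta>_def min_def max_def)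
  have ends': "p (\<psi> \<alpha>) = p (\<psi> \<beta>)" using ends ab by (auto simp: \<alpha>_def \<beta>_def min_def max_def)
  have cont: "continuous_on UNIV \<psi>" by (rule isometry_continuous[OF iso])
  have cg: "continuous_on UNIV (\<lambda>x. pgrad p x \<bullet> w)" for w
    using vpolys_continuous[OF pgrad_vpolys[OF p]] by (intro continuous_intros)
  have zero: "integ E (\<lambda>x. pgrad p x \<bullet> u) = 0"
  proof -
    define g where "g = (\<lambda>s. pgrad p (\<psi> s) \<bullet> u)"
    have der: "((\<lambda>s. p (\<psi> s)) has_real_derivative g s) (at s within S)" for s S
    proof -
      have "(\<psi> has_derivative (\<lambda>h. h *\<^sub>R u)) (at s within S)"
      proof -
        have "\<psi> = (\<lambda>s. \<psi> 0 + s *\<^sub>R u)" using Au by blast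
        moreover have "((\<lambda>s. \<psi> 0 + s *\<^sub>R u) has_derivative (\<lambda>h. h *\<^sub>R u)) (at s within S)"
          by (auto intro!: derivative_eq_intros)
        ultimately show ?thesis by simp
      qed
      from has_derivative_compose[OF this polys_has_derivative[OF p]]
      show ?thesis unfolding has_field_derivative_def g_def by (simp add: mult_commute_abs)
    qed
    have cgs: "continuous_on S g" for S
      unfolding g_def using continuous_on_compose2[OF cg cont] continuous_on_subset by blast
    have "(g has_integral p (\<psi> \<beta>) - p (\<psi> \<alpha>)) {\<alpha>..\<beta>}"
      using lt der by (intro fundamental_theorem_of_calculus) (auto simp: has_real_derivative_iff_has_vector_derivative[symmetric])
    then have 0: "integral {\<alpha>..\<beta>} g = 0" using ends' by (simp add: integral_unique)
    have "set_integrable lborel {\<alpha>..\<beta>} g"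
      unfolding set_integrable_def by (rule borel_integrable_compact) (auto intro: cgs)
    from set_borel_integral_eq_integral(2)[OF this] 0 have "(LINT s:{\<alpha>..\<beta>}|lborel. g s) = 0" by simp
    moreover have "integ E (\<lambda>x. pgrad p x \<bullet> u) = (LINT s|lborel. indicator E (\<psi> s) * g s)"
      unfolding g_def by (rule cell_integrable_param(3)[OF cE(1) par cg])
    moreover have "(LINT s|lborel. indicator E (\<psi> s) * g s) = (LINT s:{\<alpha>..\<beta>}|lborel. g s)"
      unfolding set_lebesgue_integral_def
    proof (rule integral_cong_AE)
      have [measurable]: "\<psi> \<in> borel_measurable borel" "g \<in> borel_measurable borel"
        using cont cgs by (auto intro: borel_measurable_continuous_onI)
      note [measurable] = cell_borel[OF cE(1)]
      show "(\<lambda>s. indicator E (\<psi> s) * g s) \<in> borel_measurable lborel" "(\<lambda>s. indicator {\<alpha>..\<beta>} s *\<^sub>R g s) \<in> borel_measurable lborel"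
        by measurable
      have "AE s in lborel. s \<noteq> \<alpha> \<and> s \<noteq> \<beta>" using AE_lborel_singleton[of \<alpha>] AE_lborel_singleton[of \<beta>] by eventually_elim simp
      then show "AE s in lborel. indicator E (\<psi> s) * g s = indicator {\<alpha>..\<beta>} s *\<^sub>R g s"
      proof eventually_elim
        case (elim s)
        have "\<psi> s \<in> E \<longleftrightarrow> s \<in> {\<alpha><..<\<beta>}" unfolding Eseg by (rule open_segment_param[OF iso lt])
        then show ?case using elim by (auto simp: indicator_def)
      qed
    qed
    ultimately show ?thesis by simp
  qed
  obtain x y where xy: "t = x - y" "x \<in> affine hull E" "y \<in> affine hull E" using t by (auto simp: direction_def)
  then obtain r s where "x = \<psi> r" "y = \<psi> s" using rng by blast
  then have "t = (\<psi> 0 + r *\<^sub>R u) - (\<psi> 0 + s *\<^sub>R u)" using xy(1) Au by metis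
  then have tu: "t = (r - s) *\<^sub>R u" by (simp add: algebra_simps)
  have "integ E (\<lambda>x. pgrad p x \<bullet> t) = integ E (\<lambda>x. (r - s) * (pgrad p x \<bullet> u))" by (simp add: tu)
  then show ?thesis using zero integ_cmult[of E "r - s"] by simp
qed

text \<open>Unisolvence of the edge data: end values and moments up to degree l - 1 determine a
  polynomial of degree l + 1. The integral of (p p')' is zero; its term p p'' vanishes by
  orthogonality, p'' having degree l - 1, and leaves the integral of the square of p'.\<close>

lemma edge_poly_zero:
  assumes E: "E = open_segment a b" "a \<noteq> b" and t: "t \<in> direction E" "norm t = 1" and cE: "cell E" "aff_dim E = 1"
    and p: "p \<in> polys (l + 1)" and ends: "p a = 0" "p b = 0"
    and orth: "\<And>w. w \<in> polys (l - 1) \<Longrightarrow> integ E (\<lambda>x. p x * w x) = 0" and l: "l \<ge> 0" and x: "x \<in> E"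
  shows "p x = 0"
proof -
  define d where "d = (\<lambda>x. pgrad p x \<bullet> t)"
  have d: "d \<in> polys l" unfolding d_def using vpolys_inner_const[OF pgrad_vpolys[OF p]] by simp
  have d': "(\<lambda>x. pgrad d x \<bullet> t) \<in> polys (l - 1)" by (rule vpolys_inner_const[OF pgrad_vpolys[OF d]])
  have tt: "t \<bullet> t = 1" using t(2) by (simp add: norm_eq_1)
  have "integ E (\<lambda>x. pgrad (\<lambda>x. p x * d x) x \<bullet> t) = 0"
    by (rule edge_integral_derivative[OF E t(1) cE polys_mult[OF p d]]) (simp add: ends)
  moreover have "(\<lambda>x. pgrad (\<lambda>x. p x * d x) x \<bullet> t) = (\<lambda>x. p x * (pgrad d x \<bullet> t) + d x * d x)"
  proof
    have "pgrad p y \<bullet> t = d y" for y by (simp add: d_def)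
    then show "pgrad (\<lambda>x. p x * d x) y \<bullet> t = p y * (pgrad d y \<bullet> t) + d y * d y" for y
      by (simp add: pgrad_mult[OF p d] inner_add_left)
  qed
  ultimately have "integ E (\<lambda>x. p x * (pgrad d x \<bullet> t)) + integ E (\<lambda>x. d x * d x) = 0"
    using integ_add[OF cE(1), of "\<lambda>x. p x * (pgrad d x \<bullet> t)" "\<lambda>x. d x * d x"]
      regular_on_mult[OF regular_on_polys[OF p] regular_on_polys[OF d']] regular_on_mult[OF regular_on_polys[OF d] regular_on_polys[OF d]] by simp
  then have "integ E (\<lambda>x. d x * d x) = 0" using orth[OF d'] by simp
  then have "d y * d y = 0" if "y \<in> E" for y
    using integ_definite[OF cE(1) regular_on_mult[OF regular_on_polys[OF d] regular_on_polys[OF d]] _ _ that] by simp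
  then have d0: "d y = 0" if "y \<in> E" for y using that by simp
  \<comment> \<open>\<open>p\<^sup>2 s\<close> vanishes at the ends and has derivative \<open>p\<^sup>2\<close> along the edge, \<open>p\<close> being constant there.\<close>
  define s where "s = (\<lambda>x. x \<bullet> t)"
  have s: "s \<in> polys 1"
    unfolding s_def by (rule vpolys_inner_const) (simp add: vpolys_def polys_coord)
  have gs: "pgrad s y = t" for y
    unfolding s_def by (rule pgrad_eqI) (auto intro!: derivative_eq_intros simp: inner_commute)
  have pp: "(\<lambda>x. p x * p x) \<in> polys ((l + 1) + (l + 1))" by (rule polys_mult[OF p p])
  have "integ E (\<lambda>x. pgrad (\<lambda>x. (p x * p x) * s x) x \<bullet> t) = 0"
    by (rule edge_integral_derivative[OF E t(1) cE polys_mult[OF pp s]]) (simp add: ends)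
  moreover have "pgrad (\<lambda>x. (p x * p x) * s x) y \<bullet> t = p y * p y" if "y \<in> E" for y
  proof -
    have "pgrad p y \<bullet> t = 0" using d0[OF that] by (simp add: d_def)
    then have "pgrad (\<lambda>x. p x * p x) y \<bullet> t = 0"
      unfolding pgrad_mult[OF p p] inner_add_left inner_scaleR_left by simp
    then show ?thesis by (simp add: pgrad_mult[OF pp s] gs tt inner_add_left)
  qed
  then have "integ E (\<lambda>x. pgrad (\<lambda>x. (p x * p x) * s x) x \<bullet> t) = integ E (\<lambda>x. p x * p x)" by (rule integ_cong)
  ultimately have "integ E (\<lambda>x. p x * p x) = 0" by simp
  then have "p x * p x = 0"
    using integ_definite[OF cE(1) regular_on_mult[OF regular_on_polys[OF p] regular_on_polys[OF p]] _ _ x] by simp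
  then show ?thesis by simp
qed

section \<open>Faces, edges and vertices of a polyhedron, and its divergence theorems\<close>

locale polyhedral_element =
  fixes T :: element
  assumes polyhedral: "polyhedral T"
begin

abbreviation "\<Omega> \<equiv> body T"

lemma T_facts:
  "polytopal_domain 3 \<Omega>" "finite (faces T)" "finite (edges T)"
  "disjoint (faces T \<union> edges T \<union> (\<lambda>V. {V}) ` vertices (edges T))"
  "frontier \<Omega> = (\<Union>F\<in>faces T. closure F)"
  using polyhedral unfolding polyhedral_def by blast+

lemma F_facts:
  assumes "F \<in> faces T"
  shows "polytopal_domain 2 F" "rel_frontier F = skeleton (face_edges T F)" "norm (normal T F) = 1"
    "\<And>v. v \<in> direction F \<Longrightarrow> normal T F \<bullet> v = 0"
  using polyhedral assms unfolding polyhedral_def by blast+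

lemma E_facts:
  assumes "E \<in> edges T"
  shows "\<exists>a b. a \<noteq> b \<and> E = open_segment a b" "norm (tangent T E) = 1" "tangent T E \<in> direction E"
  using polyhedral assms unfolding polyhedral_def by blast+

lemma \<Omega>_cell: "cell \<Omega>" "aff_dim \<Omega> = 3" "rel_interior (closure \<Omega>) \<subseteq> \<Omega>"
  using polytopal_domain_cell[OF T_facts(1)] by auto

lemma \<Omega>_hull: "affine hull \<Omega> = UNIV"
proof -
  have "aff_dim \<Omega> = int DIM(point)" using \<Omega>_cell(2) by simp
  then show ?thesis by (simp only: aff_dim_eq_full)
qed

lemma \<Omega>_direction: "direction \<Omega> = UNIV"
proof -
  have "v = v - 0" for v :: point by simp
  then show ?thesis unfolding direction_def \<Omega>_hull by blast
qed

lemma F_cell: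
  assumes "F \<in> faces T"
  shows "cell F" "aff_dim F = 2" "rel_interior (closure F) \<subseteq> F" "connected F"
  using polytopal_domain_cell[OF F_facts(1)[OF assms]] by auto

lemma F_direction:
  assumes F: "F \<in> faces T" shows "direction F = {v. normal T F \<bullet> v = 0}"
proof (rule subspace_dim_equal)
  have n: "normal T F \<noteq> 0" using F_facts(3)[OF F] by auto
  have ne: "F \<noteq> {}" using F_cell(1)[OF F] by (simp add: cell_def)
  show "subspace (direction F)" by (rule subspace_direction[OF ne])
  show "subspace {v. normal T F \<bullet> v = 0}" by (rule subspace_hyperplane)
  show "direction F \<subseteq> {v. normal T F \<bullet> v = 0}" using F_facts(4)[OF F] by auto
  have "dim {v. normal T F \<bullet> v = 0} = 2" using dim_hyperplane[OF n] by simp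
  moreover have "dim (direction F) = 2" using dim_direction[OF ne] F_cell(2)[OF F] by simp
  ultimately show "dim {v. normal T F \<bullet> v = 0} \<le> dim (direction F)" by simp
qed

lemma F_hull:
  assumes F: "F \<in> faces T" and p: "p \<in> affine hull F"
  shows "affine hull F = {x. (x - p) \<bullet> normal T F = 0}"
  using mem_affine_hull_iff[OF p] F_direction[OF F] by (auto simp: inner_commute)

lemma E_cell:
  assumes "E \<in> edges T" shows "cell E" "aff_dim E = 1" "infinite E"
proof -
  obtain a b where ab: "a \<noteq> b" "E = open_segment a b" using E_facts(1)[OF assms] by blast
  have "affine hull E = affine hull {a, b}" using ab by simp
  then have "aff_dim E = aff_dim {a, b}" by (rule aff_dim_affine_hull2)
  then show d: "aff_dim E = 1" using ab by (simp add: aff_dim_2)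
  have "rel_interior E = E" using ab by (simp add: rel_interior_open_segment)
  then have "openin (top_of_set (affine hull E)) E" using openin_rel_interior[of E] by simp
  then show "cell E" using ab d by (auto simp: cell_def bounded_open_segment)
  show "infinite E"
  proof
    assume "finite E"
    then have "closure E = E" using finite_imp_closed closure_closed by blast
    moreover have "a \<in> closure E" using ab by simp
    ultimately show False using ab by (simp add: open_segment_def)
  qed
qed

lemma E_closure:
  assumes "E \<in> edges T"
  obtains a b where "a \<noteq> b" "E = open_segment a b" "closure E = closed_segment a b" "closure E - E = {a, b}"
proof -
  obtain a b where ab: "a \<noteq> b" "E = open_segment a b" using E_facts(1)[OF assms] by blast
  then have "closure E = closed_segment a b" by simp
  moreover from this have "closure E - E = {a, b}" using ends_in_segment[of a b] unfolding ab(2) by (auto simp only: open_segment_def)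
  ultimately show thesis using that ab by blast
qed

lemma E_direction:
  assumes E: "E \<in> edges T" shows "direction E = {c *\<^sub>R tangent T E | c. True}"
proof -
  have ne: "E \<noteq> {}" using E_cell(1)[OF E] by (simp add: cell_def)
  have t: "tangent T E \<noteq> 0" using E_facts(2)[OF E] by auto
  have eq: "{c *\<^sub>R tangent T E | c. True} = span {tangent T E}" by (auto simp: span_singleton)
  have "span {tangent T E} = direction E"
  proof (rule subspace_dim_equal)
    show "span {tangent T E} \<subseteq> direction E"
      using E_facts(3)[OF E] subspace_direction[OF ne] by (simp add: span_minimal)
    show "dim (direction E) \<le> dim (span {tangent T E})"
      using dim_direction[OF ne] E_cell(2)[OF E] t by (simp add: dim_insert del: span_singleton)
  qed (use subspace_direction[OF ne] in auto)
  then show ?thesis using eq by simp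
qed

lemma FE_D: "E \<in> face_edges T F \<Longrightarrow> E \<in> edges T" "E \<in> face_edges T F \<Longrightarrow> E \<subseteq> rel_frontier F"
  by (auto simp: face_edges_def)

lemma finite_FE: "finite (face_edges T F)"
  using T_facts(3) by (auto simp: face_edges_def)

lemma disjnt_cells:
  assumes "A \<in> faces T \<union> edges T \<union> (\<lambda>V. {V}) ` vertices (edges T)" "B \<in> faces T \<union> edges T \<union> (\<lambda>V. {V}) ` vertices (edges T)" "A \<noteq> B"
  shows "A \<inter> B = {}"
  using T_facts(4) assms by (auto simp: pairwise_def disjnt_def)

lemma F_neq_E: "F \<in> faces T \<Longrightarrow> E \<in> edges T \<Longrightarrow> F \<noteq> E" using F_cell(2) E_cell(2) by fastforce
lemma F_neq_V: "F \<in> faces T \<Longrightarrow> F \<noteq> {V}" using F_cell(2) by fastforce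
lemma E_neq_V: "E \<in> edges T \<Longrightarrow> E \<noteq> {V}" using E_cell(3) by fastforce

lemma skeleton_cases:
  assumes "\<E> \<subseteq> edges T" "x \<in> skeleton \<E>"
  shows "(\<exists>E\<in>\<E>. x \<in> E) \<or> x \<in> vertices \<E>"
  using assms by (auto simp: skeleton_def vertices_def)

lemma F_closure:
  assumes F: "F \<in> faces T" shows "closure F = F \<union> skeleton (face_edges T F)"
  using cell_closure[OF F_cell(1)[OF F]] F_facts(2)[OF F] by simp

lemma FE_vertices: "vertices (face_edges T F) \<subseteq> vertices (edges T)"
  using FE_D by (auto simp: vertices_def)

text \<open>The closure of a face consists of the face, edges and vertices, all members of one
  disjoint family. A face differs as a set from every edge and every vertex by its dimension, which
  makes that disjointness applicable.\<close>

lemma F_disjoint: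
  assumes F: "F \<in> faces T" "F' \<in> faces T" "F \<noteq> F'" shows "F \<inter> closure F' = {}"
proof -
  have "x \<notin> F" if "x \<in> skeleton (face_edges T F')" for x
  proof -
    have "(\<exists>E\<in>face_edges T F'. x \<in> E) \<or> x \<in> vertices (face_edges T F')"
      using skeleton_cases[of "face_edges T F'"] FE_D that by blast
    then show ?thesis
    proof
      assume "\<exists>E\<in>face_edges T F'. x \<in> E"
      then obtain E where E: "E \<in> edges T" "x \<in> E" using FE_D by blast
      then show ?thesis using disjnt_cells[of F E] F F_neq_E by blast
    next
      assume "x \<in> vertices (face_edges T F')"
      then have "x \<in> vertices (edges T)" using FE_vertices by blast
      then show ?thesis using disjnt_cells[of F "{x}"] F F_neq_V by blast
    qed
  qed
  then show ?thesis using F_closure[OF F(2)] disjnt_cells[of F F'] F by blast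
qed

lemma E_disjoint:
  assumes E: "E \<in> edges T" "E' \<in> edges T" "E \<noteq> E'" shows "E \<inter> closure E' = {}"
proof -
  have "x \<notin> E" if "x \<in> closure E'" for x
  proof (cases "x \<in> E'")
    case True then show ?thesis using disjnt_cells[of E E'] E by blast
  next
    case False
    then have "x \<in> vertices (edges T)" using that E by (auto simp: vertices_def)
    then show ?thesis using disjnt_cells[of E "{x}"] E E_neq_V by blast
  qed
  then show ?thesis by blast
qed

lemma finite_vertices: "\<E> \<subseteq> edges T \<Longrightarrow> finite (vertices \<E>)"
proof -
  assume sub: "\<E> \<subseteq> edges T"
  have "finite (closure E - E)" if "E \<in> edges T" for E
    using that by (rule E_closure) simp
  then show ?thesis unfolding vertices_def using sub finite_subset[OF sub T_facts(3)] by blast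
qed

lemma F_hull_mono: "F \<in> faces T \<Longrightarrow> closure F \<subseteq> closure \<Omega>"
  using T_facts(5) frontier_def by blast

lemma FE_closure: "E \<in> face_edges T F \<Longrightarrow> closure E \<subseteq> closure F"
proof -
  assume "E \<in> face_edges T F"
  then have "E \<subseteq> closure F" using FE_D(2) by (auto simp: rel_frontier_def)
  then show ?thesis by (simp add: closure_minimal)
qed

lemma FE_hull: "E \<in> face_edges T F \<Longrightarrow> affine hull E \<subseteq> affine hull F"
  using FE_closure closure_subset closure_affine_hull by (metis hull_minimal affine_affine_hull subset_trans)

lemma FE_tangent: "E \<in> face_edges T F \<Longrightarrow> tangent T E \<in> direction F"
  using direction_mono[OF FE_hull] E_facts(3) FE_D(1) by blast

text \<open>Tangent, conormal and normal form an orthonormal frame. For the last clause, what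
  remains of \<open>v\<close> after removing its tangential part is orthogonal to the tangent, the
  normal and their cross product; the triple product expansion then makes it zero.\<close>

lemma frame:
  assumes F: "F \<in> faces T" and E: "E \<in> face_edges T F"
  shows "norm (edge_normal T F E) = 1" "edge_normal T F E \<bullet> normal T F = 0" "edge_normal T F E \<bullet> tangent T E = 0"
    "\<And>v. v \<bullet> normal T F = 0 \<Longrightarrow> v \<bullet> edge_normal T F E = 0 \<Longrightarrow> v = (v \<bullet> tangent T E) *\<^sub>R tangent T E"
proof -
  let ?n = "normal T F" and ?t = "tangent T E"
  have nt: "?n \<bullet> ?t = 0" using F_facts(4)[OF F FE_tangent[OF E]] .
  have n1: "norm ?n = 1" and t1: "norm ?t = 1" using F_facts(3)[OF F] E_facts(2)[OF FE_D(1)[OF E]] by auto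
  have "(norm (cross3 ?n ?t))\<^sup>2 = 1" using norm_cross[of ?n ?t] nt n1 t1 by simp
  then show n: "norm (edge_normal T F E) = 1" by (simp add: edge_normal_def power2_eq_1_iff)
       (smt (verit) norm_ge_zero)
  show "edge_normal T F E \<bullet> ?n = 0" "edge_normal T F E \<bullet> ?t = 0"
    by (simp_all add: edge_normal_def dot_cross_self inner_commute)
  fix v assume v: "v \<bullet> ?n = 0" "v \<bullet> edge_normal T F E = 0"
  define w where "w = v - (v \<bullet> ?t) *\<^sub>R ?t"
  have tt: "?t \<bullet> ?t = 1" using t1 by (simp add: norm_eq_1)
  have w: "w \<bullet> ?n = 0" "w \<bullet> ?t = 0" "w \<bullet> cross3 ?n ?t = 0"
    using v nt tt dot_cross_self[of ?t ?n] by (simp_all add: w_def inner_diff_left edge_normal_def inner_commute[of ?t ?n])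
  have "cross3 w (cross3 ?n ?t) = (w \<bullet> ?t) *\<^sub>R ?n - (w \<bullet> ?n) *\<^sub>R ?t" by (rule Lagrange)
  then have "cross3 w (cross3 ?n ?t) = 0" using w by simp
  then have "w = 0 \<or> cross3 ?n ?t = 0" using w(3) norm_and_cross_eq_0[of w "cross3 ?n ?t"] by simp
  then have "w = 0" using n by (auto simp: edge_normal_def)
  then show "v = (v \<bullet> ?t) *\<^sub>R ?t" by (simp add: w_def)
qed

text \<open>The exceptional affine sets are the lines of the edges; in the planar analogue for a
  face they are single vertices.\<close>

lemma hull_boundary_\<Omega>: "hull_boundary \<Omega> (faces T) (normal T) ((hull) affine ` edges T)"
proof
  show "bounded \<Omega>" "\<Omega> \<noteq> {}" "openin (top_of_set (affine hull \<Omega>)) \<Omega>" using \<Omega>_cell by (auto simp: cell_def)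
  show "rel_interior (closure \<Omega>) \<subseteq> \<Omega>" by (rule \<Omega>_cell)
  show "rel_frontier \<Omega> = (\<Union>Y\<in>faces T. closure Y)"
    using T_facts(5) by (simp add: rel_frontier_def frontier_def rel_interior_interior[OF \<Omega>_hull])
  show "finite (faces T)" "finite ((hull) affine ` edges T)" using T_facts by auto
  fix A assume "A \<in> (hull) affine ` edges T"
  then show "affine A \<and> aff_dim A + 2 \<le> aff_dim \<Omega>" using E_cell(2) \<Omega>_cell by auto
next
  fix F assume F: "F \<in> faces T"
  show "connected F" "F \<noteq> {}" "openin (top_of_set (affine hull F)) F" "norm (normal T F) = 1" "normal T F \<in> direction \<Omega>"
    using F_cell[OF F] F_facts[OF F] \<Omega>_direction by (auto simp: cell_def)
  show "affine hull F = {x \<in> affine hull \<Omega>. (x - p) \<bullet> normal T F = 0}" if "p \<in> F" for p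
    using F_hull[OF F hull_inc[OF that]] \<Omega>_hull by simp
  show "F \<inter> closure F' = {}" if "F' \<in> faces T" "F \<noteq> F'" for F' using F_disjoint F that by blast
  show "closure F - F \<subseteq> \<Union> ((hull) affine ` edges T)"
  proof
    fix x assume "x \<in> closure F - F"
    then obtain E where "E \<in> face_edges T F" "x \<in> closure E" using F_closure[OF F] by (auto simp: skeleton_def)
    then show "x \<in> \<Union> ((hull) affine ` edges T)" using FE_D(1) closure_affine_hull by blast
  qed
qed

lemma hull_boundary_F:
  assumes F: "F \<in> faces T"
  shows "hull_boundary F (face_edges T F) (edge_normal T F) ((\<lambda>V. {V}) ` vertices (face_edges T F))"
proof
  show "bounded F" "F \<noteq> {}" "openin (top_of_set (affine hull F)) F" using F_cell[OF F] by (auto simp: cell_def)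
  show "rel_interior (closure F) \<subseteq> F" by (rule F_cell[OF F])
  show "rel_frontier F = (\<Union>Y\<in>face_edges T F. closure Y)" using F_facts(2)[OF F] by (simp add: skeleton_def)
  show "finite (face_edges T F)" by (rule finite_FE)
  show "finite ((\<lambda>V. {V}) ` vertices (face_edges T F))" using finite_vertices FE_D by (intro finite_imageI) blast
  show "affine A \<and> aff_dim A + 2 \<le> aff_dim F" if "A \<in> (\<lambda>V. {V}) ` vertices (face_edges T F)" for A
    using that F_cell(2)[OF F] by auto
next
  fix E assume E: "E \<in> face_edges T F"
  note ET = FE_D(1)[OF E]
  obtain a b where ab: "a \<noteq> b" "E = open_segment a b" using E_facts(1)[OF ET] by blast
  show "connected E" using ab by (simp add: convex_connected)
  show "E \<noteq> {}" "openin (top_of_set (affine hull E)) E" using E_cell(1)[OF ET] by (auto simp: cell_def)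
  show "norm (edge_normal T F E) = 1" by (rule frame[OF F E])
  show "edge_normal T F E \<in> direction F" using frame(2)[OF F E] F_direction[OF F] by (simp add: inner_commute)
  show "affine hull E = {x \<in> affine hull F. (x - p) \<bullet> edge_normal T F E = 0}" if p: "p \<in> E" for p
  proof -
    have pE: "p \<in> affine hull E" using p by (rule hull_inc)
    then have pF: "p \<in> affine hull F" using FE_hull[OF E] by blast
    have "x - p \<in> direction E \<longleftrightarrow> x - p \<in> direction F \<and> (x - p) \<bullet> edge_normal T F E = 0" for x
    proof
      assume "x - p \<in> direction E"
      moreover from this have "x - p \<in> direction F" using direction_mono[OF FE_hull[OF E]] by blast
      ultimately show "x - p \<in> direction F \<and> (x - p) \<bullet> edge_normal T F E = 0"
        using frame(3)[OF F E] E_direction[OF ET] by (auto simp: inner_commute)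
    next
      assume "x - p \<in> direction F \<and> (x - p) \<bullet> edge_normal T F E = 0"
      then have "x - p = ((x - p) \<bullet> tangent T E) *\<^sub>R tangent T E"
        using F_direction[OF F] by (intro frame(4)[OF F E]) (auto simp: inner_commute)
      then show "x - p \<in> direction E" using E_direction[OF ET] by blast
    qed
    then show ?thesis using mem_affine_hull_iff[OF pE] mem_affine_hull_iff[OF pF] by blast
  qed
  show "E \<inter> closure E' = {}" if "E' \<in> face_edges T F" "E \<noteq> E'" for E'
    using E_disjoint[OF ET FE_D(1)] that by blast
  show "closure E - E \<subseteq> \<Union> ((\<lambda>V. {V}) ` vertices (face_edges T F))" using E by (auto simp: vertices_def)
qed

lemma divergence_\<Omega>:
  assumes "v \<in> vpolys l"
  shows "integ \<Omega> (dvg \<Omega> (restr \<Omega> v)) = (\<Sum>F\<in>faces T. \<omega>\<^sub>T T F * integ F (\<lambda>x. v x \<bullet> normal T F))"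
proof -
  interpret hull_boundary \<Omega> "faces T" "normal T" "(hull) affine ` edges T" by (rule hull_boundary_\<Omega>)
  have "\<omega>\<^sub>T T F = orient F" for F by (simp add: \<omega>\<^sub>T_def orient_def)
  then show ?thesis using divergence[OF _ assms] \<Omega>_cell F_cell by simp
qed

lemma divergence_F:
  assumes F: "F \<in> faces T" and "v \<in> vpolys l"
  shows "integ F (dvg F (restr F v)) = (\<Sum>E\<in>face_edges T F. \<omega>\<^sub>F T F E * integ E (\<lambda>x. v x \<bullet> edge_normal T F E))"
proof -
  interpret hull_boundary F "face_edges T F" "edge_normal T F" "(\<lambda>V. {V}) ` vertices (face_edges T F)" by (rule hull_boundary_F[OF F])
  have "\<omega>\<^sub>F T F E = orient E" for E
  proof -
    \<comment> \<open>Travelling against the tangent, one has the direction n x t on the right,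
      which is \<open>edge_normal\<close>; thus \<open>\<omega>\<^sub>F\<close> tests whether that
      normal points out of the face.\<close>
    have "cross3 (- tangent T E) (normal T F) = edge_normal T F E"
      unfolding edge_normal_def by (subst cross_skew) simp
    then show ?thesis by (simp add: \<omega>\<^sub>F_def orient_def counterclockwise_def)
  qed
  then show ?thesis using divergence[OF _ assms(2)] F_cell[OF F] E_cell FE_D by simp
qed

end

section \<open>Green formulas\<close>

text \<open>Composition rules for functionals of the test field. They show the right-hand sides of
  the discrete operators to be linear, as the existence of a representer requires.\<close>

lemma lin_on_add: "lin_on W A \<Longrightarrow> lin_on W B \<Longrightarrow> lin_on W (\<lambda>w. A w + B w)"
  by (simp add: lin_on_def scaleR_add_right)
lemma lin_on_diff: "lin_on W A \<Longrightarrow> lin_on W B \<Longrightarrow> lin_on W (\<lambda>w. A w - B w)"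
  by (simp add: lin_on_def scaleR_diff_right)
lemma lin_on_sum: "(\<And>i. i \<in> I \<Longrightarrow> lin_on W (A i)) \<Longrightarrow> lin_on W (\<lambda>w. \<Sum>i\<in>I. A i w)"
  by (simp add: lin_on_def sum.distrib scaleR_sum_right)
lemma lin_on_mult: "lin_on W A \<Longrightarrow> lin_on W (\<lambda>w. c * A w :: real)"
  by (simp add: lin_on_def distrib_left)
lemma lin_on_uminus: "lin_on W A \<Longrightarrow> lin_on W (\<lambda>w. - A w)"
  by (simp add: lin_on_def)
lemma lin_on_inner: "lin_on W A \<Longrightarrow> lin_on W (\<lambda>w. A w \<bullet> c)"
  by (simp add: lin_on_def inner_add_left)
lemma lin_on_inner': "lin_on W A \<Longrightarrow> lin_on W (\<lambda>w. c \<bullet> A w)"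
  by (simp add: lin_on_def inner_add_right)
lemma lin_on_cross: "lin_on W A \<Longrightarrow> lin_on W (\<lambda>w. cross3 (A w) c)"
  by (simp add: lin_on_def cross_add_left cross_mult_left)
lemma lin_on_nth: "lin_on W A \<Longrightarrow> lin_on W (\<lambda>w. A w $ i)"
  by (simp add: lin_on_def)

lemma lin_on_integ:
  assumes "cell X" "\<And>w. w \<in> W \<Longrightarrow> regular_on X (B w)" "\<And>x. x \<in> X \<Longrightarrow> lin_on W (\<lambda>w. B w x)"
  shows "lin_on W (\<lambda>w. integ X (B w))"
  unfolding lin_on_def
proof (intro conjI ballI allI)
  fix u v assume "u \<in> W" "v \<in> W"
  then have "integ X (B (\<lambda>x. u x + v x)) = integ X (\<lambda>x. B u x + B v x)"
    using assms(3) by (intro integ_cong) (simp add: lin_on_def)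
  then show "integ X (B (\<lambda>x. u x + v x)) = integ X (B u) + integ X (B v)"
    using assms \<open>u \<in> W\<close> \<open>v \<in> W\<close> by (simp add: integ_add)
next
  fix u c assume "u \<in> W"
  then have "integ X (B (\<lambda>x. c *\<^sub>R u x)) = integ X (\<lambda>x. c * B u x)"
    using assms(3) by (intro integ_cong) (simp add: lin_on_def)
  then show "integ X (B (\<lambda>x. c *\<^sub>R u x)) = c *\<^sub>R integ X (B u)" by (simp add: integ_cmult)
qed

lemma lin_on_ip_op:
  assumes "cell X" "regular_on X f" "\<And>w. w \<in> W \<Longrightarrow> regular_on X (B w)" "\<And>x. x \<in> X \<Longrightarrow> lin_on W (\<lambda>w. B w x)"
  shows "lin_on W (\<lambda>w. ip X f (B w))"
  unfolding ip_def using assms by (intro lin_on_integ regular_on_inner lin_on_inner') auto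

lemma restr_in [simp]: "x \<in> X \<Longrightarrow> restr X f x = f x"
  and restr_out: "x \<notin> X \<Longrightarrow> restr X f x = 0"
  by (simp_all add: restr_def)

lemma restr_cong: "(\<And>x. x \<in> X \<Longrightarrow> f x = g x) \<Longrightarrow> restr X f = restr X g"
  by (auto simp: restr_def)

lemma pol_mono: "l \<le> m \<Longrightarrow> pol X l \<subseteq> pol X m"
  unfolding pol_def using polys_mono by blast

lemma vpol_mono: "l \<le> m \<Longrightarrow> vpol X l \<subseteq> vpol X m"
  using pol_mono unfolding vpol_def by blast

lemma vpol_nth: "v \<in> vpol X l \<Longrightarrow> (\<lambda>x. v x $ i) \<in> pol X l"
  by (simp add: vpol_def)

lemma polI: "p \<in> polys l \<Longrightarrow> restr X p \<in> pol X l"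
  by (simp add: pol_def)

lemma dvg_poly:
  assumes X: "cell X" and w: "w \<in> vpolys l" and u: "\<And>y. y \<in> X \<Longrightarrow> u y = w y" and x: "x \<in> X"
  shows "dvg X u x = (\<Sum>i\<in>UNIV. tang X (pgrad (\<lambda>y. w y $ i) x) $ i)"
proof -
  have "grad X (\<lambda>y. u y $ i) x = tang X (pgrad (\<lambda>y. w y $ i) x)" for i
    using u by (intro grad_eqI[OF X x polys_has_derivative[OF vpolys_nth[OF w]]]) simp
  then show ?thesis by (simp add: dvg_def)
qed

lemma dvg_pol:
  assumes X: "cell X" and w: "w \<in> vpolys l" and u: "\<And>y. y \<in> X \<Longrightarrow> u y = w y"
  shows "dvg X u \<in> pol X (l - 1)"
proof -
  have "dvg X u = restr X (\<lambda>x. \<Sum>i\<in>UNIV. tang X (pgrad (\<lambda>y. w y $ i) x) $ i)"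
  proof
    fix x show "dvg X u x = restr X (\<lambda>x. \<Sum>i\<in>UNIV. tang X (pgrad (\<lambda>y. w y $ i) x) $ i) x"
      using dvg_poly[OF X w u] by (cases "x \<in> X") (simp_all add: restr_out dvg_def grad_outside)
  qed
  moreover have "(\<lambda>x. \<Sum>i\<in>UNIV. tang X (pgrad (\<lambda>y. w y $ i) x) $ i) \<in> polys (l - 1)"
    by (intro polys_sum vpolys_nth vpolys_linear[OF linear_tang[OF X]] pgrad_vpolys vpolys_nth[OF w])
  ultimately show ?thesis by (simp add: polI)
qed

lemma dvg_vpol: "cell X \<Longrightarrow> v \<in> vpol X l \<Longrightarrow> dvg X v \<in> pol X (l - 1)"
proof -
  assume "cell X" "v \<in> vpol X l"
  then obtain w where "w \<in> vpolys l" "v = restr X w" by (blast elim: vpolE)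
  then show ?thesis using dvg_pol[OF \<open>cell X\<close>, of w l v] by simp
qed

lemma lin_on_comp_nth:
  assumes "lin_on (pol X l) A" shows "lin_on (vpol X l) (\<lambda>v. A (\<lambda>x. v x $ i))"
  using assms by (auto simp: lin_on_def vpol_nth)

lemma lin_on_dvg: "cell X \<Longrightarrow> lin_on (vpol X l) (\<lambda>w. dvg X w x)"
  unfolding dvg_def by (intro lin_on_sum lin_on_nth lin_on_comp_nth lin_on_grad)

lemma lin_on_curl: "cell X \<Longrightarrow> lin_on (vpol X l) (\<lambda>w. curl X w x)"
proof -
  assume "cell X"
  then have "lin_on (vpol X l) (\<lambda>w. grad X (\<lambda>y. w y $ j) x $ i)" for i j
    by (intro lin_on_nth lin_on_comp_nth lin_on_grad)
  then show ?thesis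
    unfolding curl_def Let_def lin_on_def by (simp add: vec_eq_iff forall_3 algebra_simps)
qed

definition pcurl :: "vfield \<Rightarrow> vfield" where
  "pcurl w = (\<lambda>x. let D = (\<lambda>i j. pgrad (\<lambda>y. w y $ j) x $ i)
     in vector [D 2 3 - D 3 2, D 3 1 - D 1 3, D 1 2 - D 2 1])"

lemma pcurl_vpolys: "w \<in> vpolys l \<Longrightarrow> pcurl w \<in> vpolys (l - 1)"
proof -
  assume w: "w \<in> vpolys l"
  have "(\<lambda>x. pgrad (\<lambda>y. w y $ j) x $ i) \<in> polys (l - 1)" for i j
    by (intro vpolys_nth pgrad_vpolys vpolys_nth[OF w])
  then show ?thesis
    unfolding vpolys_def pcurl_def Let_def by (simp add: forall_3 polys_diff)
qed

lemma dvg_mult: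
  assumes X: "cell X" and p: "p \<in> polys l" and w: "w \<in> vpolys m" and x: "x \<in> X"
  shows "dvg X (restr X (\<lambda>x. p x *\<^sub>R w x)) x = tang X (pgrad p x) \<bullet> w x + p x * dvg X (restr X w) x"
proof -
  have pw: "(\<lambda>x. p x *\<^sub>R w x) \<in> vpolys (l + m)"
    using polys_mult[OF p vpolys_nth[OF w]] by (simp add: vpolys_def)
  have "dvg X (restr X (\<lambda>x. p x *\<^sub>R w x)) x =
      (\<Sum>i\<in>UNIV. tang X (pgrad (\<lambda>y. p y * (w y $ i)) x) $ i)"
    using dvg_poly[OF X pw _ x] by simp
  also have "\<dots> = (\<Sum>i\<in>UNIV. p x * tang X (pgrad (\<lambda>y. w y $ i) x) $ i + (w x $ i) * tang X (pgrad p x) $ i)"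
    using linear_tang[OF X] by (intro sum.cong) (simp_all add: pgrad_mult[OF p vpolys_nth[OF w]] linear_add linear_cmul)
  also have "\<dots> = tang X (pgrad p x) \<bullet> w x + p x * (\<Sum>i\<in>UNIV. tang X (pgrad (\<lambda>y. w y $ i) x) $ i)"
    by (simp add: sum.distrib inner_vec_def sum_distrib_left algebra_simps)
  also have "(\<Sum>i\<in>UNIV. tang X (pgrad (\<lambda>y. w y $ i) x) $ i) = dvg X (restr X w) x"
    using dvg_poly[OF X w _ x] by simp
  finally show ?thesis .
qed

lemma vpolys_scaleR: "p \<in> polys l \<Longrightarrow> w \<in> vpolys m \<Longrightarrow> (\<lambda>x. p x *\<^sub>R w x) \<in> vpolys (l + m)"
  by (simp add: vpolys_def polys_mult)

lemma vpolys_cross: "v \<in> vpolys l \<Longrightarrow> w \<in> vpolys m \<Longrightarrow> (\<lambda>x. cross3 (v x) (w x)) \<in> vpolys (l + m)"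
  unfolding vpolys_def by (simp add: forall_3 cross3_def polys_mult polys_diff)

text \<open>The divergence formula applied to the product of \<open>p\<close> and \<open>w\<close>.
  It is an assumption here, so that one proof serves the polyhedron with its faces and the face with
  its edges.\<close>

lemma integ_mult_dvg:
  assumes X: "cell X" and p: "p \<in> polys l" and w: "w \<in> vpolys m"
    and div: "\<And>v n. v \<in> vpolys n \<Longrightarrow> integ X (dvg X (restr X v)) = (\<Sum>Y\<in>\<Y>. \<omega> Y * integ Y (\<lambda>x. v x \<bullet> \<nu> Y))"
  shows "integ X (\<lambda>x. p x * dvg X (restr X w) x) =
    (\<Sum>Y\<in>\<Y>. \<omega> Y * integ Y (\<lambda>x. p x * (w x \<bullet> \<nu> Y))) - integ X (\<lambda>x. tang X (pgrad p x) \<bullet> w x)"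
proof -
  have r1: "regular_on X (\<lambda>x. tang X (pgrad p x) \<bullet> w x)"
    by (intro regular_on_inner regular_on_vpolys[OF w] regular_on_vpolys[OF vpolys_linear[OF linear_tang[OF X] pgrad_vpolys[OF p]]])
  have "dvg X (restr X w) \<in> pol X (m - 1)" by (rule dvg_pol[OF X w]) simp
  then have "regular_on X (dvg X (restr X w))" using fields_onD(3)[OF fields_on_pol[OF X]] by blast
  then have r2: "regular_on X (\<lambda>x. p x * dvg X (restr X w) x)" using p by (intro regular_on_mult) auto
  have "integ X (\<lambda>x. tang X (pgrad p x) \<bullet> w x + p x * dvg X (restr X w) x) =
      (\<Sum>Y\<in>\<Y>. \<omega> Y * integ Y (\<lambda>x. p x * (w x \<bullet> \<nu> Y)))"
    using div[OF vpolys_scaleR[OF p w]] dvg_mult[OF X p w] by (simp cong: integ_cong)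
  then show ?thesis using integ_add[OF X r1 r2] by simp
qed

context polyhedral_element
begin

lemma tang_\<Omega>: "tang \<Omega> v = v"
  by (rule tang_id[OF \<Omega>_cell(1)]) (simp add: \<Omega>_direction)

lemma tang_F: "F \<in> faces T \<Longrightarrow> tang F v = v - (v \<bullet> normal T F) *\<^sub>R normal T F"
proof (rule tang_eqI)
  assume F: "F \<in> faces T"
  have n: "normal T F \<bullet> normal T F = 1" using F_facts(3)[OF F] by (simp add: norm_eq_1)
  show "cell F" by (rule F_cell[OF F])
  show "v - (v \<bullet> normal T F) *\<^sub>R normal T F \<in> direction F"
    using F_direction[OF F] n by (simp add: inner_diff_right inner_commute)
  show "(v - (v \<bullet> normal T F) *\<^sub>R normal T F) \<bullet> w = v \<bullet> w" if "w \<in> direction F" for w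
    using F_facts(4)[OF F that] by (simp add: inner_diff_left)
qed

lemma tang_E: "E \<in> edges T \<Longrightarrow> tang E v \<bullet> tangent T E = v \<bullet> tangent T E"
  by (rule tang_inner[OF E_cell(1) E_facts(3)])

lemma tang_F_cross: "F \<in> faces T \<Longrightarrow> tang F v = cross3 (normal T F) (cross3 v (normal T F))"
  using F_facts(3)[of F] by (simp add: tang_F Lagrange norm_eq_1 inner_commute)

lemma curl_\<Omega>:
  assumes w: "w \<in> vpolys l" and v: "\<And>y. y \<in> \<Omega> \<Longrightarrow> v y = w y"
  shows "curl \<Omega> v = restr \<Omega> (pcurl w)"
proof
  fix x
  show "curl \<Omega> v x = restr \<Omega> (pcurl w) x"
  proof (cases "x \<in> \<Omega>")
    case True
    have "grad \<Omega> (\<lambda>y. v y $ i) x = pgrad (\<lambda>y. w y $ i) x" for i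
      using v grad_eqI[OF \<Omega>_cell(1) True polys_has_derivative[OF vpolys_nth[OF w]], of "\<lambda>y. v y $ i"] by (simp add: tang_\<Omega>)
    then show ?thesis using True by (simp add: curl_def pcurl_def)
  next
    case False
    then show ?thesis by (simp add: curl_def grad_outside restr_out vec_eq_iff forall_3)
  qed
qed

lemma grad_\<Omega>: "p \<in> polys l \<Longrightarrow> (\<And>y. y \<in> \<Omega> \<Longrightarrow> u y = p y) \<Longrightarrow> grad \<Omega> u = restr \<Omega> (pgrad p)"
  using grad_poly[OF \<Omega>_cell(1)] by (simp add: tang_\<Omega>)

text \<open>The cross product with the normal kills the normal component of the gradient, so the
  ambient gradient of a polynomial representative may be used.\<close>

lemma rot_poly:
  assumes F: "F \<in> faces T" and p: "p \<in> polys l" and r: "\<And>y. y \<in> F \<Longrightarrow> r y = p y"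
  shows "rot T F r = restr F (\<lambda>x. cross3 (pgrad p x) (normal T F))"
proof
  fix x
  have c: "cross3 (tang F g) (normal T F) = cross3 g (normal T F)" for g
    by (simp add: tang_F[OF F] Cross3.left_diff_distrib cross_mult_left)
  have g: "grad F r = restr F (\<lambda>x. tang F (pgrad p x))"
    by (rule grad_poly[OF F_cell(1)[OF F] p]) (rule r)
  show "rot T F r x = restr F (\<lambda>x. cross3 (pgrad p x) (normal T F)) x"
    by (simp add: rot_def g restr_def c)
qed

lemma vpol_\<Omega>: "w \<in> vpolys l \<Longrightarrow> restr \<Omega> w \<in> vpol \<Omega> l"
  by (rule vpolI[OF \<Omega>_cell(1)]) (simp_all add: \<Omega>_direction)

lemma cross_vpol_F:
  assumes F: "F \<in> faces T" and w: "w \<in> vpolys l"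
  shows "restr F (\<lambda>x. cross3 (w x) (normal T F)) \<in> vpol F l"
proof (rule vpolI[OF F_cell(1)[OF F]])
  have "linear (\<lambda>v. cross3 v (normal T F))" by (intro linearI) (simp_all add: cross_add_left cross_mult_left)
  from vpolys_linear[OF this w] show "(\<lambda>x. cross3 (w x) (normal T F)) \<in> vpolys l" .
  show "cross3 (w x) (normal T F) \<in> direction F" for x
    by (simp add: F_direction[OF F] dot_cross_self)
qed

lemma R\<^sub>T_sub: "R\<^sub>T T l \<subseteq> vpol \<Omega> l"
proof
  fix u assume "u \<in> R\<^sub>T T l"
  then obtain v where "v \<in> vpol \<Omega> (l + 1)" "u = curl \<Omega> v" by (auto simp: R\<^sub>T_def)
  then obtain w where w: "w \<in> vpolys (l + 1)" "u = curl \<Omega> (restr \<Omega> w)" by (blast elim: vpolE)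
  then have "u = restr \<Omega> (pcurl w)" using curl_\<Omega>[OF w(1)] by simp
  then show "u \<in> vpol \<Omega> l" using vpol_\<Omega>[OF pcurl_vpolys[OF w(1)]] by simp
qed

lemma G\<^sub>T_sub: "G\<^sub>T T l \<subseteq> vpol \<Omega> l"
  unfolding G\<^sub>T_def using grad_vpol[OF \<Omega>_cell(1), of _ "l + 1"] by auto

lemma R\<^sub>F_sub:
  assumes F: "F \<in> faces T" shows "R\<^sub>F T F l \<subseteq> vpol F l"
proof
  fix u assume "u \<in> R\<^sub>F T F l"
  then obtain p where p: "p \<in> polys (l + 1)" "u = rot T F (restr F p)" by (auto simp: R\<^sub>F_def pol_def)
  then have "u = restr F (\<lambda>x. cross3 (pgrad p x) (normal T F))" using rot_poly[OF F p(1)] by simp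
  then show "u \<in> vpol F l" using cross_vpol_F[OF F pgrad_vpolys[OF p(1)]] by simp
qed

lemma fields_on_subspace:
  assumes "fields_on X V" "cell X" "findim W" "W \<subseteq> V" shows "fields_on X W"
  using assms by (auto simp: fields_on_def)

lemma lin_on_rot: "F \<in> faces T \<Longrightarrow> lin_on (pol F l) (\<lambda>r. rot T F r x)"
  unfolding rot_def by (intro lin_on_cross lin_on_grad F_cell)

lemma fields_R\<^sub>T: "fields_on \<Omega> (R\<^sub>T T l)"
  by (rule fields_on_subspace[OF fields_on_vpol[OF \<Omega>_cell(1)] \<Omega>_cell(1) _ R\<^sub>T_sub])
    (simp add: R\<^sub>T_def findim_image[OF fields_onD(2)[OF fields_on_vpol[OF \<Omega>_cell(1)]] lin_on_curl[OF \<Omega>_cell(1)]])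

lemma fields_G\<^sub>T: "fields_on \<Omega> (G\<^sub>T T l)"
  by (rule fields_on_subspace[OF fields_on_vpol[OF \<Omega>_cell(1)] \<Omega>_cell(1) _ G\<^sub>T_sub])
    (simp add: G\<^sub>T_def findim_image[OF fields_onD(2)[OF fields_on_pol[OF \<Omega>_cell(1)]] lin_on_grad[OF \<Omega>_cell(1)]])

lemma fields_R\<^sub>F: "F \<in> faces T \<Longrightarrow> fields_on F (R\<^sub>F T F l)"
  by (rule fields_on_subspace[OF fields_on_vpol[OF F_cell(1)] F_cell(1) _ R\<^sub>F_sub])
    (simp_all add: R\<^sub>F_def findim_image[OF fields_onD(2)[OF fields_on_pol[OF F_cell(1)]] lin_on_rot])

lemma fields_R\<^sub>T_perp: "fields_on \<Omega> (R\<^sub>T_perp T l)"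
  unfolding R\<^sub>T_perp_def by (rule fields_on_orth_compl[OF fields_on_vpol[OF \<Omega>_cell(1)] fields_R\<^sub>T R\<^sub>T_sub])
lemma fields_G\<^sub>T_perp: "fields_on \<Omega> (G\<^sub>T_perp T l)"
  unfolding G\<^sub>T_perp_def by (rule fields_on_orth_compl[OF fields_on_vpol[OF \<Omega>_cell(1)] fields_G\<^sub>T G\<^sub>T_sub])
lemma fields_R\<^sub>F_perp: "F \<in> faces T \<Longrightarrow> fields_on F (R\<^sub>F_perp T F l)"
  unfolding R\<^sub>F_perp_def by (rule fields_on_orth_compl[OF fields_on_vpol[OF F_cell(1)] fields_R\<^sub>F R\<^sub>F_sub])

lemma R\<^sub>T_mono: "l \<le> m \<Longrightarrow> R\<^sub>T T l \<subseteq> R\<^sub>T T m"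
  unfolding R\<^sub>T_def by (intro image_mono vpol_mono) simp
lemma G\<^sub>T_mono: "l \<le> m \<Longrightarrow> G\<^sub>T T l \<subseteq> G\<^sub>T T m"
  unfolding G\<^sub>T_def by (intro image_mono pol_mono) simp
lemma R\<^sub>F_mono: "l \<le> m \<Longrightarrow> R\<^sub>F T F l \<subseteq> R\<^sub>F T F m"
  unfolding R\<^sub>F_def by (intro image_mono pol_mono) simp

lemma R\<^sub>F_orth: "l \<le> m \<Longrightarrow> u \<in> R\<^sub>F T F l \<Longrightarrow> w \<in> R\<^sub>F_perp T F m \<Longrightarrow> ip F u w = 0"
  using R\<^sub>F_mono[of l m F] by (auto simp: R\<^sub>F_perp_def orth_compl_def ip_commute[of F u w])

lemma div_identity:
  assumes V: "V \<in> vpolys l" and W: "W \<in> vpolys m" and x: "x \<in> \<Omega>"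
  shows "dvg \<Omega> (restr \<Omega> (\<lambda>x. cross3 (V x) (W x))) x = pcurl V x \<bullet> W x - V x \<bullet> pcurl W x"
proof -
  have c: "cross3 (V y) (W y) $ 1 = V y $ 2 * W y $ 3 - V y $ 3 * W y $ 2"
    "cross3 (V y) (W y) $ 2 = V y $ 3 * W y $ 1 - V y $ 1 * W y $ 3"
    "cross3 (V y) (W y) $ 3 = V y $ 1 * W y $ 2 - V y $ 2 * W y $ 1" for y
    by (simp_all add: cross3_def)
  note vw = vpolys_nth[OF V] vpolys_nth[OF W]
  have g: "pgrad (\<lambda>y. V y $ i * W y $ j - V y $ i' * W y $ j') x =
     V x $ i *\<^sub>R pgrad (\<lambda>y. W y $ j) x + W x $ j *\<^sub>R pgrad (\<lambda>y. V y $ i) x -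
     (V x $ i' *\<^sub>R pgrad (\<lambda>y. W y $ j') x + W x $ j' *\<^sub>R pgrad (\<lambda>y. V y $ i') x)" for i j i' j'
    by (simp add: pgrad_diff[OF polys_mult[OF vw] polys_mult[OF vw]] pgrad_mult[OF vw])
  have gc: "pgrad (\<lambda>y. cross3 (V y) (W y) $ 1) x = V x $ 2 *\<^sub>R pgrad (\<lambda>y. W y $ 3) x + W x $ 3 *\<^sub>R pgrad (\<lambda>y. V y $ 2) x -
     (V x $ 3 *\<^sub>R pgrad (\<lambda>y. W y $ 2) x + W x $ 2 *\<^sub>R pgrad (\<lambda>y. V y $ 3) x)"
    "pgrad (\<lambda>y. cross3 (V y) (W y) $ 2) x = V x $ 3 *\<^sub>R pgrad (\<lambda>y. W y $ 1) x + W x $ 1 *\<^sub>R pgrad (\<lambda>y. V y $ 3) x -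
     (V x $ 1 *\<^sub>R pgrad (\<lambda>y. W y $ 3) x + W x $ 3 *\<^sub>R pgrad (\<lambda>y. V y $ 1) x)"
    "pgrad (\<lambda>y. cross3 (V y) (W y) $ 3) x = V x $ 1 *\<^sub>R pgrad (\<lambda>y. W y $ 2) x + W x $ 2 *\<^sub>R pgrad (\<lambda>y. V y $ 1) x -
     (V x $ 2 *\<^sub>R pgrad (\<lambda>y. W y $ 1) x + W x $ 1 *\<^sub>R pgrad (\<lambda>y. V y $ 2) x)"
    by (simp_all only: c g)
  have "dvg \<Omega> (restr \<Omega> (\<lambda>x. cross3 (V x) (W x))) x = (\<Sum>i\<in>UNIV. pgrad (\<lambda>y. cross3 (V y) (W y) $ i) x $ i)"
    using dvg_poly[OF \<Omega>_cell(1) vpolys_cross[OF V W] _ x] by (simp add: tang_\<Omega>)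
  also have "\<dots> = pcurl V x \<bullet> W x - V x \<bullet> pcurl W x"
    by (simp add: sum_3 gc pcurl_def inner_vec_def) (simp add: algebra_simps)
  finally show ?thesis .
qed

text \<open>The divergence theorem for V x W; in the boundary term the triple product is permuted so
  that \<open>V\<close> stands against the rotated trace of \<open>W\<close>, as in
  \<open>full_curl\<close>.\<close>

lemma green_\<Omega>:
  assumes V: "V \<in> vpolys l" and W: "W \<in> vpolys m"
  shows "integ \<Omega> (\<lambda>x. pcurl V x \<bullet> W x) = integ \<Omega> (\<lambda>x. V x \<bullet> pcurl W x) +
    (\<Sum>F\<in>faces T. \<omega>\<^sub>T T F * integ F (\<lambda>x. V x \<bullet> cross3 (W x) (normal T F)))"
proof -
  have r: "regular_on \<Omega> (\<lambda>x. pcurl V x \<bullet> W x)" "regular_on \<Omega> (\<lambda>x. V x \<bullet> pcurl W x)"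
    using V W pcurl_vpolys[OF V] pcurl_vpolys[OF W] by auto
  have "integ \<Omega> (\<lambda>x. pcurl V x \<bullet> W x) - integ \<Omega> (\<lambda>x. V x \<bullet> pcurl W x) =
      integ \<Omega> (dvg \<Omega> (restr \<Omega> (\<lambda>x. cross3 (V x) (W x))))"
    using integ_diff[OF \<Omega>_cell(1) r] div_identity[OF V W] by (simp cong: integ_cong)
  also have "\<dots> = (\<Sum>F\<in>faces T. \<omega>\<^sub>T T F * integ F (\<lambda>x. cross3 (V x) (W x) \<bullet> normal T F))"
    by (rule divergence_\<Omega>[OF vpolys_cross[OF V W]])
  finally show ?thesis
    using cross_triple[of "V _" "W _" "normal T _"] by (simp add: inner_commute[of "cross3 (W _) (normal T _)"])
qed

text \<open>The planar divergence theorem for r W with W = n x V. This rotation turns the tangential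
  divergence into minus the normal component of the curl, and the conormal component of
  \<open>W\<close> into the tangential component of \<open>V\<close>.\<close>

lemma green_F:
  assumes F: "F \<in> faces T" and V: "V \<in> vpolys l" and r: "r \<in> polys m"
  shows "integ F (\<lambda>x. V x \<bullet> cross3 (pgrad r x) (normal T F)) =
    integ F (\<lambda>x. (pcurl V x \<bullet> normal T F) * r x) +
    (\<Sum>E\<in>face_edges T F. \<omega>\<^sub>F T F E * integ E (\<lambda>x. (V x \<bullet> tangent T E) * r x))"
proof -
  let ?n = "normal T F"
  define W where "W = (\<lambda>x. cross3 ?n (V x))"
  have cn: "cell F" by (rule F_cell[OF F])
  have nn: "?n \<bullet> ?n = 1" using F_facts(3)[OF F] by (simp add: norm_eq_1)
  have lin: "linear (cross3 ?n)" by (intro linearI) (simp_all add: cross_add_right cross_mult_right)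
  have W: "W \<in> vpolys l" unfolding W_def by (rule vpolys_linear[OF lin V])
  note vp = vpolys_nth[OF V]
  have g: "pgrad (\<lambda>y. a * V y $ i - b * V y $ j) x = a *\<^sub>R pgrad (\<lambda>y. V y $ i) x - b *\<^sub>R pgrad (\<lambda>y. V y $ j) x" for a b i j x
    by (simp add: pgrad_diff[OF polys_cmult[OF vp] polys_cmult[OF vp]] pgrad_cmult[OF vp])
  have Wc: "W y $ 1 = ?n $ 2 * V y $ 3 - ?n $ 3 * V y $ 2" "W y $ 2 = ?n $ 3 * V y $ 1 - ?n $ 1 * V y $ 3"
    "W y $ 3 = ?n $ 1 * V y $ 2 - ?n $ 2 * V y $ 1" for y by (simp_all add: W_def cross3_def)
  have gW: "pgrad (\<lambda>y. W y $ 1) x = ?n $ 2 *\<^sub>R pgrad (\<lambda>y. V y $ 3) x - ?n $ 3 *\<^sub>R pgrad (\<lambda>y. V y $ 2) x"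
    "pgrad (\<lambda>y. W y $ 2) x = ?n $ 3 *\<^sub>R pgrad (\<lambda>y. V y $ 1) x - ?n $ 1 *\<^sub>R pgrad (\<lambda>y. V y $ 3) x"
    "pgrad (\<lambda>y. W y $ 3) x = ?n $ 1 *\<^sub>R pgrad (\<lambda>y. V y $ 2) x - ?n $ 2 *\<^sub>R pgrad (\<lambda>y. V y $ 1) x" for x
    by (simp_all only: Wc g)
  have dW: "dvg F (restr F W) x = - (pcurl V x \<bullet> ?n)" if x: "x \<in> F" for x
  proof -
    have "dvg F (restr F W) x = (\<Sum>i\<in>UNIV. tang F (pgrad (\<lambda>y. W y $ i) x) $ i)"
      using dvg_poly[OF cn W _ x] by simp
    also have "\<dots> = - (pcurl V x \<bullet> ?n)"
      by (simp add: tang_F[OF F] sum_3 gW pcurl_def inner_vec_def) (simp add: algebra_simps)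
    finally show ?thesis .
  qed
  have bd: "W x \<bullet> edge_normal T F E = V x \<bullet> tangent T E" if E: "E \<in> face_edges T F" for E x
    using F_facts(4)[OF F FE_tangent[OF E]] nn by (simp add: W_def edge_normal_def dot_cross)
  have gr: "tang F (pgrad r x) \<bullet> W x = V x \<bullet> cross3 (pgrad r x) ?n" for x
  proof -
    have "W x \<in> direction F" by (simp add: F_direction[OF F] W_def dot_cross_self)
    then have "tang F (pgrad r x) \<bullet> W x = pgrad r x \<bullet> W x" by (rule tang_inner[OF cn])
    also have "\<dots> = V x \<bullet> cross3 (pgrad r x) ?n"
      unfolding W_def by (metis cross_triple inner_commute)
    finally show ?thesis .
  qed
  have "integ F (\<lambda>x. r x * dvg F (restr F W) x) =
    (\<Sum>E\<in>face_edges T F. \<omega>\<^sub>F T F E * integ E (\<lambda>x. r x * (W x \<bullet> edge_normal T F E))) - integ F (\<lambda>x. tang F (pgrad r x) \<bullet> W x)"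
    by (rule integ_mult_dvg[OF cn r W]) (rule divergence_F[OF F])
  moreover have "integ F (\<lambda>x. r x * dvg F (restr F W) x) = - integ F (\<lambda>x. (pcurl V x \<bullet> ?n) * r x)"
    unfolding integ_uminus[symmetric] by (intro integ_cong) (simp add: dW)
  ultimately show ?thesis by (simp add: bd gr mult.commute)
qed

end

section \<open>Gluing, interpolation on the skeleton and tangential traces\<close>

lemma glue_in:
  assumes "finite \<X>" "disjoint \<X>" "X \<in> \<X>" "x \<in> X"
  shows "glue \<X> f x = f X x"
proof -
  have "restr Y (f Y) x = 0" if "Y \<in> \<X> - {X}" for Y
    using that assms by (intro restr_out) (auto simp: pairwise_def disjnt_def)
  then have "(\<Sum>Y\<in>\<X> - {X}. restr Y (f Y) x) = 0" by simp
  then show ?thesis using sum.remove[OF assms(1,3), of "\<lambda>Y. restr Y (f Y) x"] assms(4) by (simp add: glue_def)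
qed

lemma glue_out: "x \<notin> \<Union>\<X> \<Longrightarrow> glue \<X> f x = 0"
  unfolding glue_def by (intro sum.neutral) (auto intro: restr_out)

lemma glue_cong: "(\<And>X x. X \<in> \<X> \<Longrightarrow> x \<in> X \<Longrightarrow> f X x = g X x) \<Longrightarrow> glue \<X> f = glue \<X> g"
  unfolding glue_def by (intro ext sum.cong refl) (simp add: restr_def)

lemma restr_glue:
  assumes "finite \<X>" "disjoint \<X>" "X \<in> \<X>" and f: "f X \<in> pol X l"
  shows "restr X (glue \<X> f) = f X"
proof
  fix x show "restr X (glue \<X> f) x = f X x"
    using glue_in[OF assms(1-3)] f by (cases "x \<in> X") (auto simp: pol_def restr_out)
qed

lemma glue_pw_pol:
  assumes "finite \<X>" "disjoint \<X>" "\<And>X. X \<in> \<X> \<Longrightarrow> f X \<in> pol X l"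
  shows "glue \<X> f \<in> pw_pol \<X> l"
  unfolding pw_pol_def
proof (intro CollectI conjI ballI allI impI)
  fix X assume X: "X \<in> \<X>"
  then show "restr X (glue \<X> f) \<in> pol X l"
    using restr_glue[OF assms(1,2) X, of f l] assms(3)[OF X] by simp
qed (rule glue_out)

lemma continuous_agree_closure:
  fixes f g :: "point \<Rightarrow> real"
  assumes "continuous_on (closure S) f" "continuous_on UNIV g" "\<And>x. x \<in> S \<Longrightarrow> f x = g x" "x \<in> closure S"
  shows "f x = g x"
proof -
  have "continuous_on (closure S) (\<lambda>x. f x - g x)"
    using assms(1,2) continuous_on_subset by (intro continuous_on_diff) blast+
  from continuous_constant_on_closure[OF this _ assms(4), of 0] show ?thesis using assms(3) by simp
qed

text \<open>Only the tangential part of the gradient vanishes; but differences of points of a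
  relative ball are tangential, so \<open>p\<close> is constant on such convex balls, and
  connectedness propagates the value.\<close>

lemma connected_cell_const:
  assumes X: "cell X" "connected X" and p: "p \<in> polys l" and g: "\<And>x. x \<in> X \<Longrightarrow> tang X (pgrad p x) = 0"
    and ab: "a \<in> X" "b \<in> X"
  shows "p a = p b"
proof (rule connected_local_const[OF X(2) ab], rule ballI)
  fix x assume x: "x \<in> X"
  obtain U where U: "open U" "X = affine hull X \<inter> U" using X by (auto simp: cell_def openin_open)
  then obtain r where r: "r > 0" "ball x r \<subseteq> U" using x open_contains_ball by blast
  define B where "B = affine hull X \<inter> ball x r"
  have BX: "B \<subseteq> X" using r U(2) by (auto simp: B_def)
  have xB: "x \<in> B" using x r by (auto simp: B_def hull_inc)
  have conv: "convex B" unfolding B_def by (intro convex_Int affine_imp_convex affine_affine_hull convex_ball)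
  have "\<exists>c. \<forall>y\<in>B. p y = c"
  proof (rule has_derivative_zero_constant[OF conv])
    fix y assume y: "y \<in> B"
    have yX: "y \<in> X" using y BX by auto
    have lim: "((\<lambda>z. (1 / norm (z - y)) *\<^sub>R (p z - (p y + pgrad p y \<bullet> (z - y)))) \<longlongrightarrow> 0) (at y within B)"
      using has_derivative_at_withinI[OF polys_has_derivative[OF p, of y], of B] unfolding has_derivative_within by blast
    have "\<forall>\<^sub>F z in at y within B. (1 / norm (z - y)) *\<^sub>R (p z - (p y + pgrad p y \<bullet> (z - y))) = (1 / norm (z - y)) *\<^sub>R (p z - (p y + 0))"
      unfolding eventually_at_filter
    proof (rule always_eventually, intro allI impI)
      fix z assume "z \<in> B"
      then have "z - y \<in> direction X" using y by (intro direction_diff) (auto simp: B_def)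
      then have "pgrad p y \<bullet> (z - y) = 0" using tang_inner[OF X(1), of "z - y" "pgrad p y"] g[OF yX] by simp
      then show "(1 / norm (z - y)) *\<^sub>R (p z - (p y + pgrad p y \<bullet> (z - y))) = (1 / norm (z - y)) *\<^sub>R (p z - (p y + 0))" by simp
    qed
    from Lim_transform_eventually[OF lim this] show "(p has_derivative (\<lambda>h. 0)) (at y within B)"
      unfolding has_derivative_within by (simp add: bounded_linear_zero)
  qed
  then obtain c where c: "\<And>y. y \<in> B \<Longrightarrow> p y = c" by blast
  have "\<forall>\<^sub>F y in at x within X. y \<in> ball x r"
    using r(1) by (intro eventually_at_in_open'[THEN filter_leD[OF at_le[OF subset_UNIV]]]) auto
  moreover have "\<forall>\<^sub>F y in at x within X. y \<in> X" by (simp add: eventually_at_filter)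
  ultimately show "\<forall>\<^sub>F y in at x within X. p x = p y"
  proof eventually_elim
    case (elim y)
    then have "y \<in> B" by (simp add: B_def hull_inc)
    then show ?case using c xB by metis
  qed
qed

context polyhedral_element
begin

lemma disjoint_faces: "disjoint (faces T)" and disjoint_edges: "disjoint (edges T)"
  using T_facts(4) by (auto simp: pairwise_def)

lemma F_subset: "F \<in> faces T \<Longrightarrow> F \<subseteq> closure \<Omega>"
  using F_hull_mono closure_subset by blast

lemma FE_subset: "E \<in> face_edges T F \<Longrightarrow> E \<subseteq> closure F"
  using FE_closure closure_subset by blast

lemma E_in_face:
  assumes "E \<in> edges T" obtains F where "F \<in> faces T" "E \<in> face_edges T F"
proof -
  have "card {F \<in> faces T. E \<in> face_edges T F} = 2"
    using polyhedral assms unfolding polyhedral_def by blast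
  then have "{F \<in> faces T. E \<in> face_edges T F} \<noteq> {}" by (metis card.empty zero_neq_numeral)
  then show thesis using that by blast
qed

lemma E_closure_subset: "E \<in> edges T \<Longrightarrow> closure E \<subseteq> closure \<Omega>"
  by (metis E_in_face FE_closure F_hull_mono order_trans)

lemma skeleton_subset: "skeleton (edges T) \<subseteq> closure \<Omega>"
  using E_closure_subset by (auto simp: skeleton_def)

lemma ext_\<Omega>: "continuous_on UNIV V \<Longrightarrow> x \<in> closure \<Omega> \<Longrightarrow> ext \<Omega> (restr \<Omega> V) x = V x"
  using ext_eq[OF \<Omega>_cell(1), of V "restr \<Omega> V"] by simp

lemma ext_F: "F \<in> faces T \<Longrightarrow> continuous_on UNIV V \<Longrightarrow> x \<in> closure F \<Longrightarrow> ext F (restr F V) x = V x"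
  using ext_eq[OF F_cell(1), of F V "restr F V"] by simp

text \<open>The restriction of \<open>p\<close> has all the prescribed data. A competitor is
  polynomial on each edge and, by continuity, on its closure; its difference with \<open>p\<close>
  vanishes there by unisolvence, see \<open>edge_poly_zero\<close>.\<close>

lemma skeleton_interp_poly:
  assumes sub: "\<E> \<subseteq> edges T" and p: "p \<in> polys (int k + 1)" and q: "\<And>x. x \<in> skeleton \<E> \<Longrightarrow> q x = p x"
  shows "skeleton_interp \<E> k q = restr (skeleton \<E>) p"
proof -
  have cont: "continuous_on UNIV p" by (rule polys_continuous[OF p])
  have sk: "E \<subseteq> skeleton \<E>" "closure E \<subseteq> skeleton \<E>" if "E \<in> \<E>" for E
    using that closure_subset by (auto simp: skeleton_def)
  have vert: "V \<in> skeleton \<E>" if "V \<in> vertices \<E>" for V using that by (auto simp: vertices_def skeleton_def)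
  show ?thesis unfolding skeleton_interp_def
  proof (rule the_equality)
    let ?p = "restr (skeleton \<E>) p"
    have rE: "restr E ?p = restr E p" if "E \<in> \<E>" for E
      using sk[OF that] by (intro restr_cong) auto
    have "?p \<in> cont_pol \<E> (int k + 1)"
      unfolding cont_pol_def
    proof (intro CollectI conjI ballI allI impI)
      show "restr E ?p \<in> pol E (int k + 1)" if "E \<in> \<E>" for E using rE[OF that] polI[OF p] by simp
      show "continuous_on (skeleton \<E>) ?p"
        using continuous_on_subset[OF cont, of "skeleton \<E>"] by (subst continuous_on_cong[OF refl]) auto
    qed (simp add: restr_out)
    moreover have "proj E (pol E (int k - 1)) (restr E ?p) = proj E (pol E (int k - 1)) (restr E q)" if "E \<in> \<E>" for E
      using q sk[OF that] by (intro proj_cong) auto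
    ultimately show "?p \<in> cont_pol \<E> (int k + 1) \<and>
      (\<forall>E\<in>\<E>. proj E (pol E (int k - 1)) (restr E ?p) = proj E (pol E (int k - 1)) (restr E q)) \<and>
      (\<forall>V\<in>vertices \<E>. ?p V = q V)" using vert q by simp
  next
    fix s assume s: "s \<in> cont_pol \<E> (int k + 1) \<and>
      (\<forall>E\<in>\<E>. proj E (pol E (int k - 1)) (restr E s) = proj E (pol E (int k - 1)) (restr E q)) \<and>
      (\<forall>V\<in>vertices \<E>. s V = q V)"
    have "s x = p x" if E: "E \<in> \<E>" and x: "x \<in> closure E" for E x
    proof -
      have ET: "E \<in> edges T" using E sub by blast
      note cE = E_cell[OF ET]
      obtain g where g: "g \<in> polys (int k + 1)" "restr E s = restr E g"
        using s E by (auto simp: cont_pol_def pol_def)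
      have sg: "s y = g y" if "y \<in> E" for y using fun_cong[OF g(2), of y] that by simp
      have "continuous_on (closure E) s"
        using s sk(2)[OF E] continuous_on_subset by (auto simp: cont_pol_def)
      then have sgc: "s y = g y" if "y \<in> closure E" for y
        by (rule continuous_agree_closure[OF _ polys_continuous[OF g(1)] sg that])
      obtain a b where ab: "a \<noteq> b" "E = open_segment a b" "closure E = closed_segment a b" "closure E - E = {a, b}"
        by (rule E_closure[OF ET])
      define d where "d = (\<lambda>x. g x - p x)"
      have d: "d \<in> polys (int k + 1)" unfolding d_def by (rule polys_diff[OF g(1) p])
      have ends: "d V = 0" if V: "V \<in> {a, b}" for V
      proof -
        have "V \<in> closure E - E" using V ab by blast
        then have "V \<in> vertices \<E>" "V \<in> closure E" using E by (auto simp: vertices_def)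
        then show ?thesis using s q vert sgc[of V] by (simp add: d_def)
      qed
      have f: "fields_on E (pol E (int k - 1))" by (rule fields_on_pol[OF cE(1)])
      have orth: "integ E (\<lambda>x. d x * w x) = 0" if w: "w \<in> polys (int k - 1)" for w
      proof -
        have rs: "regular_on E (restr E s)" using g by auto
        have "regular_on E (restr E p)" using p by auto
        then have rq: "regular_on E (restr E q)" by (rule regular_on_cong) (use q sk[OF E] in auto)
        have W: "restr E w \<in> pol E (int k - 1)" by (rule polI[OF w])
        have "proj E (pol E (int k - 1)) (restr E s) = proj E (pol E (int k - 1)) (restr E q)" using s E by blast
        then have "ip E (restr E s) (restr E w) = ip E (restr E q) (restr E w)"
          using proj_ip[OF f rs W] proj_ip[OF f rq W] by simp
        moreover have "ip E (restr E s) (restr E w) = integ E (\<lambda>x. g x * w x)"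
          unfolding ip_def by (intro integ_cong) (simp add: sg)
        moreover have "ip E (restr E q) (restr E w) = integ E (\<lambda>x. p x * w x)"
          unfolding ip_def using q sk[OF E] by (intro integ_cong) auto
        moreover have "integ E (\<lambda>x. d x * w x) = integ E (\<lambda>x. g x * w x) - integ E (\<lambda>x. p x * w x)"
          unfolding d_def left_diff_distrib using g p w by (intro integ_diff cE) auto
        ultimately show ?thesis by simp
      qed
      have "d y = 0" if "y \<in> E" for y
        by (rule edge_poly_zero[OF ab(2,1) E_facts(3,2)[OF ET] cE(1,2) d ends ends orth _ that]) auto
      then show ?thesis
        using x ends ab(4) sgc[OF x] by (cases "x \<in> E") (auto simp: d_def)
    qed
    then show "s = restr (skeleton \<E>) p"
      using s by (auto simp: fun_eq_iff restr_def skeleton_def cont_pol_def)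
  qed
qed

section \<open>Existence and uniqueness of the tangential trace\<close>

lemma rot_vpol: "F \<in> faces T \<Longrightarrow> r \<in> pol F l \<Longrightarrow> rot T F r \<in> R\<^sub>F T F (l - 1)"
  by (simp add: R\<^sub>F_def)

text \<open>A vanishing rotated gradient makes the polynomial constant on the connected face;
  together with the zero average this makes its square integrate to zero.\<close>

lemma rot_pol0_inj:
  assumes F: "F \<in> faces T" and r: "r \<in> pol0 F l" and 0: "rot T F r = (\<lambda>x. 0)"
  shows "r = (\<lambda>x. 0)"
proof -
  note cF = F_cell[OF F]
  obtain p where p: "p \<in> polys l" "r = restr F p" using r by (auto simp: pol0_def pol_def)
  have rot: "rot T F r = restr F (\<lambda>x. cross3 (pgrad p x) (normal T F))"
    using rot_poly[OF F p(1)] p(2) by simp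
  have n1: "normal T F \<bullet> normal T F = 1" using F_facts(3)[OF F] by (simp add: norm_eq_1)
  have "tang F (pgrad p x) = 0" if "x \<in> F" for x
  proof -
    have "cross3 (pgrad p x) (normal T F) = 0" using fun_cong[OF rot, of x] 0 that by simp
    then show ?thesis by (simp add: tang_F_cross[OF F])
  qed
  then have const: "p a = p b" if "a \<in> F" "b \<in> F" for a b
    by (rule connected_cell_const[OF cF(1,4) p(1) _ that])
  obtain a where a: "a \<in> F" using cF(1) by (auto simp: cell_def)
  have i0: "integ F r = 0" using r by (simp add: pol0_def)
  have "integ F (\<lambda>x. r x * r x) = integ F (\<lambda>x. p a * r x)"
    by (intro integ_cong) (simp add: p(2) const[OF _ a])
  also have "\<dots> = 0" by (simp add: integ_cmult i0)
  finally have "ip F r r = 0" by (simp add: ip_def)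
  moreover have "regular_on F r" using p by auto
  ultimately show ?thesis by (intro ip_definite[OF cF(1)]) (auto simp: p(2) restr_out)
qed

text \<open>Subtracting the mean value leaves the rotated gradient unchanged; constants are
  available because \<open>l\<close> is nonnegative.\<close>

lemma rot_pol0_surj:
  assumes F: "F \<in> faces T" and l: "l \<ge> 0" and r: "r \<in> pol F l"
  shows "\<exists>r0\<in>pol0 F l. rot T F r0 = rot T F r"
proof -
  note cF = F_cell[OF F]
  obtain p where p: "p \<in> polys l" "r = restr F p" using r by (auto simp: pol_def)
  have one: "(\<lambda>x. 1) \<in> polys l" by (rule polys_const[OF l])
  obtain a where a: "a \<in> F" using cF(1) by (auto simp: cell_def)
  have m: "integ F (\<lambda>x. 1) \<noteq> 0"
    using integ_definite[OF cF(1), of "\<lambda>x. 1" a] a by auto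
  define c where "c = integ F p / integ F (\<lambda>x. 1)"
  have pc: "(\<lambda>x. p x - c * 1) \<in> polys l" using polys_diff[OF p(1) polys_cmult[OF one]] .
  define r0 where "r0 = restr F (\<lambda>x. p x - c * 1)"
  have "integ F r0 = integ F (\<lambda>x. p x - c * 1)" unfolding r0_def by (intro integ_cong) simp
  also have "\<dots> = integ F p - integ F (\<lambda>x. c * 1)"
    using p(1) by (intro integ_diff cF) auto
  also have "\<dots> = 0" unfolding integ_cmult using m by (simp add: c_def)
  finally have "r0 \<in> pol0 F l" using polI[OF pc] by (simp add: pol0_def r0_def)
  moreover have "rot T F r0 = rot T F r"
  proof -
    have "pgrad (\<lambda>x. 1) x = 0" for x by (rule pgrad_eqI) simp
    then have "pgrad (\<lambda>x. p x - c * 1) x = pgrad p x" for x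
      by (simp only: pgrad_diff[OF p(1) polys_cmult[OF one]] pgrad_cmult[OF one]) simp
    then show ?thesis using rot_poly[OF F pc, of r0] rot_poly[OF F p(1), of r] p(2) by (simp add: r0_def)
  qed
  ultimately show ?thesis by blast
qed

text \<open>A test field of degree k splits into the rotated gradient of a zero-average polynomial
  and an element of the orthogonal complement, the two kinds of test fields in the definition of the
  trace.\<close>

lemma trace_unique:
  assumes F: "F \<in> faces T" and g: "g \<in> vpol F (int k)" "g' \<in> vpol F (int k)"
    and rot: "\<And>r. r \<in> pol0 F (int k + 1) \<Longrightarrow> ip F g (rot T F r) = ip F g' (rot T F r)"
    and perp: "\<And>w. w \<in> R\<^sub>F_perp T F (int k) \<Longrightarrow> ip F g w = ip F g' w"
  shows "g = g'"
proof (rule fields_on_unique[OF fields_on_vpol[OF F_cell(1)[OF F]] g])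
  fix v assume v: "v \<in> vpol F (int k)"
  note cF = F_cell[OF F]
  note fV = fields_onD[OF fields_on_vpol[OF cF(1)]]
  note fR = fields_R\<^sub>F[OF F, of "int k"]
  define u where "u = proj F (R\<^sub>F T F (int k)) v"
  have u: "u \<in> R\<^sub>F T F (int k)" unfolding u_def using proj_in[OF fR fV(3)[OF v]] .
  have w: "(\<lambda>x. v x - u x) \<in> R\<^sub>F_perp T F (int k)"
    unfolding u_def R\<^sub>F_perp_def by (rule orth_compl_residual[OF fields_on_vpol[OF cF(1)] fR R\<^sub>F_sub[OF F] v])
  obtain r where "r \<in> pol F (int k + 1)" "u = rot T F r" using u by (auto simp: R\<^sub>F_def)
  then obtain r0 where r0: "r0 \<in> pol0 F (int k + 1)" "u = rot T F r0" using rot_pol0_surj[OF F, of "int k + 1" r] by auto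
  have ru: "regular_on F u" using fields_onD(3)[OF fR u] .
  have rw: "regular_on F (\<lambda>x. v x - u x)" using fields_onD(3)[OF fields_R\<^sub>F_perp[OF F] w] .
  have split: "ip F h v = ip F h (\<lambda>x. v x - u x) + ip F h u" if "h \<in> vpol F (int k)" for h
    using ip_add_right[OF cF(1) rw ru fV(3)[OF that]] by simp
  show "ip F g v = ip F g' v" unfolding split[OF g(1)] split[OF g(2)] using perp[OF w] rot[OF r0(1)] r0(2) by simp
qed

text \<open>On zero-average polynomials the rotated gradient is a bijection onto its range;
  composing \<open>M\<close> with the inverse \<open>J\<close> gives a functional on that range,
  whose representer \<open>g1\<close> meets the first condition. Adding \<open>w0\<close> does not
  disturb it, by orthogonality, and supplies the second.\<close>

lemma trace_exists:
  assumes F: "F \<in> faces T" and M: "lin_on (pol F (int k + 1)) M" and w0: "w0 \<in> R\<^sub>F_perp T F (int k)"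
  shows "\<exists>g\<in>vpol F (int k). (\<forall>r\<in>pol0 F (int k + 1). ip F g (rot T F r) = M r) \<and>
    (\<forall>w\<in>R\<^sub>F_perp T F (int k). ip F g w = ip F w0 w)"
proof -
  note cF = F_cell[OF F]
  let ?R = "R\<^sub>F T F (int k)" and ?P = "pol0 F (int k + 1)"
  note fp = fields_onD[OF fields_on_pol[OF cF(1)]]
  note fR = fields_R\<^sub>F[OF F, of "int k"]
  note fW = fields_R\<^sub>F_perp[OF F, of "int k"]
  have P_sub: "?P \<subseteq> pol F (int k + 1)" by (auto simp: pol0_def)
  have P_add: "(\<lambda>x. r x + s x) \<in> ?P" if "r \<in> ?P" "s \<in> ?P" for r s
    using that integ_add[OF cF(1) fp(3) fp(3)] findim_add[OF fp(2)] by (auto simp: pol0_def)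
  have P_scale: "(\<lambda>x. c *\<^sub>R r x) \<in> ?P" if "r \<in> ?P" for r c
    using that findim_scale[OF fp(2)] by (auto simp: pol0_def integ_cmult)
  have rot_add: "rot T F (\<lambda>x. r x + s x) = (\<lambda>x. rot T F r x + rot T F s x)" if "r \<in> ?P" "s \<in> ?P" for r s
    using lin_on_rot[OF F, of "int k + 1"] that P_sub unfolding lin_on_def by blast
  have rot_scale: "rot T F (\<lambda>x. c *\<^sub>R r x) = (\<lambda>x. c *\<^sub>R rot T F r x)" if "r \<in> ?P" for r c
    using lin_on_rot[OF F, of "int k + 1"] that P_sub unfolding lin_on_def by blast
  have inj: "r = s" if r: "r \<in> ?P" "s \<in> ?P" and eq: "rot T F r = rot T F s" for r s
  proof -
    have d: "(\<lambda>x. r x + (-1) *\<^sub>R s x) \<in> ?P" using P_add[OF r(1) P_scale[OF r(2)]] .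
    have "rot T F (\<lambda>x. r x + (-1) *\<^sub>R s x) = (\<lambda>x. rot T F r x + rot T F (\<lambda>x. (-1) *\<^sub>R s x) x)"
      by (rule rot_add[OF r(1) P_scale[OF r(2)]])
    also have "\<dots> = (\<lambda>x. 0)" by (simp only: rot_scale[OF r(2)] eq) simp
    finally have "(\<lambda>x. r x + (-1) *\<^sub>R s x) = (\<lambda>x. 0)" by (rule rot_pol0_inj[OF F d])
    then show ?thesis by (auto simp: fun_eq_iff)
  qed
  have surj: "\<exists>r\<in>?P. rot T F r = u" if "u \<in> ?R" for u
    using that rot_pol0_surj[OF F, of "int k + 1"] by (fastforce simp: R\<^sub>F_def)
  define J where "J = (\<lambda>u. SOME r. r \<in> ?P \<and> rot T F r = u)"
  have J: "J u \<in> ?P" "rot T F (J u) = u" if "u \<in> ?R" for u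
    using someI_ex[of "\<lambda>r. r \<in> ?P \<and> rot T F r = u"] surj[OF that] unfolding J_def by blast+
  have Jrot: "J (rot T F r) = r" if "r \<in> ?P" for r
  proof (rule inj)
    have "rot T F r \<in> ?R" using that P_sub rot_vpol[OF F, of r "int k + 1"] by auto
    then show "J (rot T F r) \<in> ?P" "rot T F (J (rot T F r)) = rot T F r" using J by auto
  qed (rule that)
  have linL: "lin_on ?R (\<lambda>u. M (J u))"
    unfolding lin_on_def
  proof (intro conjI ballI allI)
    fix u v assume uv: "u \<in> ?R" "v \<in> ?R"
    have "J (\<lambda>x. u x + v x) = (\<lambda>x. J u x + J v x)"
      using Jrot[OF P_add[OF J(1)[OF uv(1)] J(1)[OF uv(2)]]] rot_add[OF J(1)[OF uv(1)] J(1)[OF uv(2)]] J(2) uv by simp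
    then show "M (J (\<lambda>x. u x + v x)) = M (J u) + M (J v)"
      using M subsetD[OF P_sub J(1)[OF uv(1)]] subsetD[OF P_sub J(1)[OF uv(2)]] by (simp add: lin_on_def)
  next
    fix u c assume u: "u \<in> ?R"
    have "J (\<lambda>x. c *\<^sub>R u x) = (\<lambda>x. c *\<^sub>R J u x)"
      using Jrot[OF P_scale[OF J(1)[OF u]]] rot_scale[OF J(1)[OF u]] J(2) u by simp
    then show "M (J (\<lambda>x. c *\<^sub>R u x)) = c *\<^sub>R M (J u)"
      using M subsetD[OF P_sub J(1)[OF u]] by (simp add: lin_on_def)
  qed
  define g1 where "g1 = representer F ?R (\<lambda>u. M (J u))"
  have g1: "g1 \<in> ?R" "\<And>u. u \<in> ?R \<Longrightarrow> ip F g1 u = M (J u)"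
    unfolding g1_def using representer_in[OF fR linL] representer_ip[OF fR linL] by auto
  have g1V: "g1 \<in> vpol F (int k)" using g1 R\<^sub>F_sub[OF F] by blast
  have w0V: "w0 \<in> vpol F (int k)" using w0 by (simp add: R\<^sub>F_perp_def orth_compl_def)
  note r1 = fields_onD(3)[OF fR g1(1)] and r0 = fields_onD(3)[OF fW w0]
  show ?thesis
  proof (intro bexI[of _ "\<lambda>x. g1 x + w0 x"] conjI ballI)
    show "(\<lambda>x. g1 x + w0 x) \<in> vpol F (int k)"
      by (rule findim_add[OF fields_onD(2)[OF fields_on_vpol[OF cF(1)]] g1V w0V])
    fix r assume r: "r \<in> ?P"
    have R: "rot T F r \<in> ?R" using r P_sub rot_vpol[OF F, of r "int k + 1"] by auto
    have "ip F w0 (rot T F r) = 0" using w0 R by (simp add: R\<^sub>F_perp_def orth_compl_def)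
    then show "ip F (\<lambda>x. g1 x + w0 x) (rot T F r) = M r"
      using g1(2)[OF R] Jrot[OF r] by (simp add: ip_add_left[OF cF(1) r1 r0 fields_onD(3)[OF fR R]])
  next
    fix w assume w: "w \<in> R\<^sub>F_perp T F (int k)"
    have "ip F g1 w = 0" by (rule R\<^sub>F_orth[OF order_refl g1(1) w])
    then show "ip F (\<lambda>x. g1 x + w0 x) w = ip F w0 w"
      by (simp add: ip_add_left[OF cF(1) r1 r0 fields_onD(3)[OF fW w]])
  qed
qed

end

section \<open>The commuting diagram\<close>

lemma coord_vpolys: "(\<lambda>x. x - c) \<in> vpolys 1"
  unfolding vpolys_def by (simp add: polys_diff[OF polys_coord polys_const])

context polyhedral_element
begin

text \<open>The third property is the gain in degree: on an edge, t x (x - c) equals t x (x0 - c)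
  for a fixed point x0, so the second summand contributes the product of a constant vector with a
  field of degree k.\<close>

lemma NedelecE:
  assumes "v \<in> Nedelec T k"
  obtains V where "V \<in> vpolys (int k + 1)" "v = restr \<Omega> V"
    "\<forall>E\<in>edges T. \<exists>P\<in>polys (int k). \<forall>x\<in>E. V x \<bullet> tangent T E = P x"
proof -
  define c where "c = centroid \<Omega>"
  obtain v0 w0 where v: "v = (\<lambda>x. v0 x + cross3 (x - c) (w0 x))" "v0 \<in> vpol \<Omega> (int k)" "w0 \<in> vpol \<Omega> (int k)"
    using assms by (auto simp: Nedelec_def c_def)
  obtain a where a: "a \<in> vpolys (int k)" "v0 = restr \<Omega> a" using v(2) by (rule vpolE)
  obtain w where w: "w \<in> vpolys (int k)" "w0 = restr \<Omega> w" using v(3) by (rule vpolE)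
  define V where "V = (\<lambda>x. a x + cross3 (x - c) (w x))"
  have "(\<lambda>x. cross3 (x - c) (w x)) \<in> vpolys (1 + int k)" by (rule vpolys_cross[OF coord_vpolys w(1)])
  then have 1: "V \<in> vpolys (int k + 1)"
    unfolding V_def by (intro vpolys_add vpolys_mono[OF _ a(1)]) (simp_all add: add.commute)
  have 2: "v = restr \<Omega> V" by (auto simp: v a w V_def restr_def fun_eq_iff)
  have 3: "\<exists>P\<in>polys (int k). \<forall>x\<in>E. V x \<bullet> tangent T E = P x" if E: "E \<in> edges T" for E
  proof -
    let ?t = "tangent T E"
    obtain x0 where x0: "x0 \<in> E" using E_cell(1)[OF E] by (auto simp: cell_def)
    have "(\<lambda>x. a x \<bullet> ?t + w x \<bullet> cross3 ?t (x0 - c)) \<in> polys (int k)"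
      by (intro polys_add vpolys_inner_const a(1) w(1))
    moreover have "V x \<bullet> ?t = a x \<bullet> ?t + w x \<bullet> cross3 ?t (x0 - c)" if x: "x \<in> E" for x
    proof -
      have "x - x0 \<in> direction E" using x x0 by (intro direction_diff hull_inc)
      then obtain s where s: "x - x0 = s *\<^sub>R ?t" using E_direction[OF E] by blast
      have "cross3 ?t (x - x0) = 0" by (simp add: s cross_mult_right)
      then have "cross3 ?t (x - c) = cross3 ?t (x0 - c)"
        using cross_add_right[of ?t "x - x0" "x0 - c"] by simp
      moreover have "cross3 (x - c) (w x) \<bullet> ?t = w x \<bullet> cross3 ?t (x - c)"
        using cross_triple[of ?t "x - c" "w x"] by (simp only: inner_commute[of "w x"])
      ultimately show ?thesis by (simp add: V_def inner_add_left)
    qed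
    ultimately show ?thesis by (intro bexI[of _ "\<lambda>x. a x \<bullet> ?t + w x \<bullet> cross3 ?t (x0 - c)"]) auto
  qed
  show thesis using that[OF 1 2] 3 by blast
qed

lemma RTNE:
  assumes "v \<in> RTN T k"
  obtains V where "V \<in> vpolys (int k + 1)" "v = restr \<Omega> V"
proof -
  define c where "c = centroid \<Omega>"
  obtain v0 r0 where v: "v = (\<lambda>x. v0 x + r0 x *\<^sub>R (x - c))" "v0 \<in> vpol \<Omega> (int k)" "r0 \<in> pol \<Omega> (int k)"
    using assms by (auto simp: RTN_def c_def)
  obtain a where a: "a \<in> vpolys (int k)" "v0 = restr \<Omega> a" using v(2) by (rule vpolE)
  obtain r where r: "r \<in> polys (int k)" "r0 = restr \<Omega> r" using v(3) by (rule polE)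
  have "(\<lambda>x. a x + r x *\<^sub>R (x - c)) \<in> vpolys (int k + 1)"
    by (intro vpolys_add vpolys_scaleR coord_vpolys r(1) vpolys_mono[OF _ a(1)]) simp
  moreover have "v = restr \<Omega> (\<lambda>x. a x + r x *\<^sub>R (x - c))" by (auto simp: v a r restr_def fun_eq_iff)
  ultimately show thesis using that by blast
qed

lemma vpol_Nedelec: "v \<in> vpol \<Omega> (int k) \<Longrightarrow> v \<in> Nedelec T k"
  using findim_zero[OF fields_onD(2)[OF fields_on_vpol[OF \<Omega>_cell(1)]], of "int k"]
  unfolding Nedelec_def by (intro CollectI exI[of _ v] exI[of _ "\<lambda>x. 0"]) simp

lemma vpol_RTN: "v \<in> vpol \<Omega> (int k) \<Longrightarrow> v \<in> RTN T k"
  using findim_zero[OF fields_onD(2)[OF fields_on_pol[OF \<Omega>_cell(1)]], of "int k"]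
  unfolding RTN_def by (intro CollectI exI[of _ v] exI[of _ "\<lambda>x. 0"]) simp

lemma curl_Nedelec: "v \<in> Nedelec T k \<Longrightarrow> curl \<Omega> v \<in> vpol \<Omega> (int k)"
proof -
  assume "v \<in> Nedelec T k"
  then obtain V where V: "V \<in> vpolys (int k + 1)" "v = restr \<Omega> V" by (rule NedelecE)
  then show ?thesis using curl_\<Omega>[OF V(1), of v] vpol_\<Omega>[OF pcurl_vpolys[OF V(1)]] by simp
qed

lemma regular_ext:
  "V \<in> vpolys l \<Longrightarrow> X \<subseteq> closure \<Omega> \<Longrightarrow> regular_on X (ext \<Omega> (restr \<Omega> V))"
  by (rule regular_on_cong[OF regular_on_vpolys, of V l]) (auto simp: ext_\<Omega> vpolys_continuous subset_iff)

lemma \<Omega>_subset: "\<Omega> \<subseteq> closure \<Omega>" by (rule closure_subset)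

subsection \<open>The gradient\<close>

lemma I_grad_poly:
  assumes p: "p \<in> polys (int k + 1)"
  shows "I_grad T k (ext \<Omega> (restr \<Omega> p)) = (proj \<Omega> (pol \<Omega> (int k - 1)) (restr \<Omega> p),
    glue (faces T) (\<lambda>F. proj F (pol F (int k - 1)) (restr F p)), restr (skeleton (edges T)) p)"
proof -
  have e: "ext \<Omega> (restr \<Omega> p) x = p x" if "x \<in> closure \<Omega>" for x
    by (rule ext_\<Omega>[OF polys_continuous[OF p] that])
  have "proj \<Omega> (pol \<Omega> (int k - 1)) (ext \<Omega> (restr \<Omega> p)) = proj \<Omega> (pol \<Omega> (int k - 1)) (restr \<Omega> p)"
    using e \<Omega>_subset by (intro proj_cong) auto
  moreover have "glue (faces T) (\<lambda>F. proj F (pol F (int k - 1)) (restr F (ext \<Omega> (restr \<Omega> p)))) =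
      glue (faces T) (\<lambda>F. proj F (pol F (int k - 1)) (restr F p))"
  proof (rule glue_cong)
    fix F x assume "F \<in> faces T"
    then have "restr F (ext \<Omega> (restr \<Omega> p)) = restr F p" using e F_subset by (intro restr_cong) blast
    then show "proj F (pol F (int k - 1)) (restr F (ext \<Omega> (restr \<Omega> p))) x = proj F (pol F (int k - 1)) (restr F p) x" by simp
  qed
  moreover have "skeleton_interp (edges T) k (ext \<Omega> (restr \<Omega> p)) = restr (skeleton (edges T)) p"
    using e skeleton_subset by (intro skeleton_interp_poly[OF order_refl p]) blast
  ultimately show ?thesis by (simp add: I_grad_def)
qed

lemma proj_pol: "cell X \<Longrightarrow> regular_on X f \<Longrightarrow> proj X (pol X l) f \<in> pol X l"
  by (rule proj_in[OF fields_on_pol])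

lemma I_grad_X_grad:
  assumes p: "p \<in> polys (int k + 1)"
  shows "I_grad T k (ext \<Omega> (restr \<Omega> p)) \<in> X_grad T k"
  unfolding I_grad_poly[OF p] X_grad_def
proof (intro SigmaI)
  show "proj \<Omega> (pol \<Omega> (int k - 1)) (restr \<Omega> p) \<in> pol \<Omega> (int k - 1)"
    using p by (intro proj_pol[OF \<Omega>_cell(1)]) auto
  show "glue (faces T) (\<lambda>F. proj F (pol F (int k - 1)) (restr F p)) \<in> pw_pol (faces T) (int k - 1)"
    using p by (intro glue_pw_pol T_facts disjoint_faces proj_pol F_cell) auto
  show "restr (skeleton (edges T)) p \<in> cont_pol (edges T) (int k + 1)"
    unfolding cont_pol_def
  proof (intro CollectI conjI ballI allI impI)
    fix E assume "E \<in> edges T"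
    then have "E \<subseteq> skeleton (edges T)" using closure_subset by (auto simp: skeleton_def)
    then have "restr E (restr (skeleton (edges T)) p) = restr E p" by (intro restr_cong) auto
    then show "restr E (restr (skeleton (edges T)) p) \<in> pol E (int k + 1)" using polI[OF p] by simp
  next
    show "continuous_on (skeleton (edges T)) (restr (skeleton (edges T)) p)"
      using continuous_on_subset[OF polys_continuous[OF p], of "skeleton (edges T)"]
      by (subst continuous_on_cong[OF refl]) auto
  qed (simp add: restr_out)
qed

lemma FE_skeleton: "rel_frontier F = skeleton (face_edges T F) \<Longrightarrow> rel_frontier F \<subseteq> skeleton (edges T)"
  using FE_D(1) by (auto simp: skeleton_def)

text \<open>The face part of the global interpolate is the interpolate on the face. This makes the
  reproduction property of the scalar traces applicable in the volume gradient.\<close>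

lemma face_restr_I_grad:
  assumes F: "F \<in> faces T" and p: "p \<in> polys (int k + 1)"
  shows "face_restr_grad T F (I_grad T k (ext \<Omega> (restr \<Omega> p))) =
      (proj F (pol F (int k - 1)) (restr F p), restr (skeleton (face_edges T F)) p)"
    and "I_grad\<^sub>F T k F (ext F (restr F p)) =
      (proj F (pol F (int k - 1)) (restr F p), restr (skeleton (face_edges T F)) p)"
proof -
  have "restr F (glue (faces T) (\<lambda>F. proj F (pol F (int k - 1)) (restr F p))) = proj F (pol F (int k - 1)) (restr F p)"
  proof (rule restr_glue[OF T_facts(2) disjoint_faces F])
    show "proj F (pol F (int k - 1)) (restr F p) \<in> pol F (int k - 1)"
      using p by (intro proj_pol F_cell[OF F]) auto
  qed
  moreover have "restr (rel_frontier F) (restr (skeleton (edges T)) p) = restr (skeleton (face_edges T F)) p"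
    unfolding F_facts(2)[OF F] using FE_skeleton[OF F_facts(2)[OF F]] F_facts(2)[OF F] by (intro restr_cong) auto
  ultimately show "face_restr_grad T F (I_grad T k (ext \<Omega> (restr \<Omega> p))) =
      (proj F (pol F (int k - 1)) (restr F p), restr (skeleton (face_edges T F)) p)"
    by (simp add: I_grad_poly[OF p] face_restr_grad_def)
  have e: "ext F (restr F p) x = p x" if "x \<in> closure F" for x
    by (rule ext_F[OF F polys_continuous[OF p] that])
  have "proj F (pol F (int k - 1)) (ext F (restr F p)) = proj F (pol F (int k - 1)) (restr F p)"
    using e closure_subset by (intro proj_cong) auto
  moreover have "skeleton_interp (face_edges T F) k (ext F (restr F p)) = restr (skeleton (face_edges T F)) p"
  proof (rule skeleton_interp_poly[OF _ p])
    show "face_edges T F \<subseteq> edges T" using FE_D(1) by blast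
    show "ext F (restr F p) x = p x" if "x \<in> skeleton (face_edges T F)" for x
      using e that F_closure[OF F] by blast
  qed
  ultimately show "I_grad\<^sub>F T k F (ext F (restr F p)) =
      (proj F (pol F (int k - 1)) (restr F p), restr (skeleton (face_edges T F)) p)"
    by (simp add: I_grad\<^sub>F_def)
qed

lemma face_restr_grad_mem:
  assumes F: "F \<in> faces T" and q: "q \<in> X_grad T k"
  shows "face_restr_grad T F q \<in> X_grad\<^sub>F T k F"
proof -
  obtain a b c where q': "q = (a, b, c)" "b \<in> pw_pol (faces T) (int k - 1)" "c \<in> cont_pol (edges T) (int k + 1)"
    using q by (auto simp: X_grad_def)
  note sk = FE_skeleton[OF F_facts(2)[OF F]]
  have "restr F b \<in> pol F (int k - 1)" using q'(2) F by (simp add: pw_pol_def)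
  moreover have "restr (rel_frontier F) c \<in> cont_pol (face_edges T F) (int k + 1)"
    unfolding cont_pol_def F_facts(2)[OF F, symmetric]
  proof (intro CollectI conjI ballI allI impI)
    fix E assume E: "E \<in> face_edges T F"
    have "restr E (restr (rel_frontier F) c) = restr E c" using FE_D(2)[OF E] by (intro restr_cong) auto
    then show "restr E (restr (rel_frontier F) c) \<in> pol E (int k + 1)"
      using q'(3) FE_D(1)[OF E] by (simp add: cont_pol_def)
  next
    have "continuous_on (rel_frontier F) c" using q'(3) sk continuous_on_subset by (auto simp: cont_pol_def)
    then show "continuous_on (rel_frontier F) (restr (rel_frontier F) c)"
      by (subst continuous_on_cong[OF refl]) auto
  qed (simp add: restr_out)
  ultimately show ?thesis by (simp add: q' face_restr_grad_def X_grad\<^sub>F_def)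
qed

lemma lin_on_ext_eval: "cell X \<Longrightarrow> lin_on (pol X l) (\<lambda>w. ext X w x)" "cell X \<Longrightarrow> lin_on (vpol X l) (\<lambda>w. ext X w x)"
  by (simp_all add: lin_on_ext fields_on_pol fields_on_vpol)

lemma regular_ext_vpol: "w \<in> vpol \<Omega> l \<Longrightarrow> Y \<subseteq> closure \<Omega> \<Longrightarrow> regular_on Y (ext \<Omega> w)"
  by (erule vpolE) (simp add: regular_ext)

lemma regular_ext_pol: "r \<in> pol \<Omega> l \<Longrightarrow> Y \<subseteq> closure \<Omega> \<Longrightarrow> regular_on Y (ext \<Omega> r)"
  by (erule polE) (auto intro!: regular_on_cong[OF regular_on_polys] simp: ext_\<Omega>[OF polys_continuous] subset_iff)

lemma regular_ext_vpol_F: "F \<in> faces T \<Longrightarrow> w \<in> vpol F l \<Longrightarrow> Y \<subseteq> closure F \<Longrightarrow> regular_on Y (ext F w)"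
  by (erule vpolE) (auto intro!: regular_on_cong[OF regular_on_vpolys] simp: ext_F[OF _ vpolys_continuous] subset_iff)

lemma regular_ext_pol_F: "F \<in> faces T \<Longrightarrow> r \<in> pol F l \<Longrightarrow> Y \<subseteq> closure F \<Longrightarrow> regular_on Y (ext F r)"
  by (erule polE) (auto intro!: regular_on_cong[OF regular_on_polys] simp: ext_F[OF _ polys_continuous] subset_iff)

lemmas regular_pol = fields_onD(3)[OF fields_on_pol]
lemmas regular_vpol = fields_onD(3)[OF fields_on_vpol]

text \<open>The definite description in \<open>representer\<close> denotes an element of the space
  because the functional is linear in the test field. The traces in it are polynomial since the
  restricted data lie in the face space.\<close>

lemma full_grad_vpol:
  assumes q: "q \<in> X_grad T k" and \<gamma>: "\<And>F. F \<in> faces T \<Longrightarrow> scalar_trace T k F (\<gamma> F)"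
  shows "full_grad T k \<gamma> q \<in> vpol \<Omega> (int k)"
  unfolding full_grad_def
proof (rule representer_in[OF fields_on_vpol[OF \<Omega>_cell(1)]])
  have a: "regular_on \<Omega> (fst q)" using q regular_pol[OF \<Omega>_cell(1)] by (auto simp: X_grad_def)
  have b: "regular_on F (\<gamma> F (face_restr_grad T F q))" if F: "F \<in> faces T" for F
    using \<gamma>[OF F] face_restr_grad_mem[OF F q] regular_pol[OF F_cell(1)[OF F]] by (auto simp: scalar_trace_def)
  show "lin_on (vpol \<Omega> (int k)) (\<lambda>v. - integ \<Omega> (\<lambda>x. fst q x * dvg \<Omega> v x) +
     (\<Sum>F\<in>faces T. \<omega>\<^sub>T T F * integ F (\<lambda>x. \<gamma> F (face_restr_grad T F q) x * (ext \<Omega> v x \<bullet> normal T F))))"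
  proof (intro lin_on_add lin_on_uminus lin_on_sum lin_on_mult lin_on_integ)
    show "regular_on \<Omega> (\<lambda>x. fst q x * dvg \<Omega> w x)" if "w \<in> vpol \<Omega> (int k)" for w
      by (intro regular_on_mult a regular_pol[OF \<Omega>_cell(1) dvg_vpol[OF \<Omega>_cell(1) that]])
    show "regular_on F (\<lambda>x. \<gamma> F (face_restr_grad T F q) x * (ext \<Omega> w x \<bullet> normal T F))"
      if "F \<in> faces T" "w \<in> vpol \<Omega> (int k)" for F w
      by (intro regular_on_mult regular_on_inner regular_on_const b that(1) regular_ext_vpol[OF that(2) F_subset[OF that(1)]])
  qed (intro \<Omega>_cell F_cell lin_on_dvg lin_on_inner lin_on_ext_eval; assumption)+
qed

lemma full_grad\<^sub>F_vpol:
  assumes q: "q \<in> X_grad T k" and F: "F \<in> faces T"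
  shows "full_grad\<^sub>F T k F (face_restr_grad T F q) \<in> vpol F (int k)"
proof -
  obtain a b where ab: "face_restr_grad T F q = (a, b)" by (cases "face_restr_grad T F q")
  then have m: "a \<in> pol F (int k - 1)" "b \<in> cont_pol (face_edges T F) (int k + 1)"
    using face_restr_grad_mem[OF F q] by (auto simp: X_grad\<^sub>F_def)
  note cF = F_cell(1)[OF F]
  have b: "regular_on E b" if E: "E \<in> face_edges T F" for E
  proof -
    have "restr E b \<in> pol E (int k + 1)" using m(2) E by (simp add: cont_pol_def)
    from regular_pol[OF E_cell(1)[OF FE_D(1)[OF E]] this] show ?thesis by (rule regular_on_cong) simp
  qed
  show ?thesis unfolding full_grad\<^sub>F_def ab prod.case
  proof (rule representer_in[OF fields_on_vpol[OF cF]], intro lin_on_add lin_on_uminus lin_on_sum lin_on_mult lin_on_integ)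
    show "regular_on F (\<lambda>x. a x * dvg F w x)" if "w \<in> vpol F (int k)" for w
      by (intro regular_on_mult regular_pol[OF cF m(1)] regular_pol[OF cF dvg_vpol[OF cF that]])
    show "regular_on E (\<lambda>x. b x * (ext F w x \<bullet> edge_normal T F E))" if "E \<in> face_edges T F" "w \<in> vpol F (int k)" for E w
      by (intro regular_on_mult regular_on_inner regular_on_const b that(1)
          regular_ext_vpol_F[OF F that(2) FE_subset[OF that(1)]])
  qed (intro cF E_cell FE_D lin_on_dvg lin_on_inner lin_on_ext_eval; assumption)+
qed

lemma edge_grad_pol:
  assumes E: "E \<in> edges T" and q: "q \<in> X_grad T k"
  shows "edge_grad T E q \<in> pol E (int k)"
proof -
  obtain a b c where q': "q = (a, b, c)" "c \<in> cont_pol (edges T) (int k + 1)" using q by (auto simp: X_grad_def)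
  then have "restr E c \<in> pol E (int k + 1)" using E by (simp add: cont_pol_def)
  then have "grad E (restr E c) \<in> vpol E (int k)" using grad_vpol[OF E_cell(1)[OF E], of "restr E c" "int k + 1"] by simp
  then obtain W where W: "W \<in> vpolys (int k)" "grad E (restr E c) = restr E W" by (rule vpolE)
  have "edge_grad T E q = restr E (\<lambda>x. W x \<bullet> tangent T E)"
  proof
    show "edge_grad T E q x = restr E (\<lambda>x. W x \<bullet> tangent T E) x" for x
      by (cases "x \<in> E") (simp_all add: edge_grad_def q' W restr_out)
  qed
  then show ?thesis using polI[OF vpolys_inner_const[OF W(1)]] by simp
qed

lemma sum_space_T_R:
  "regular_on \<Omega> f \<Longrightarrow> (\<lambda>x. proj \<Omega> (R\<^sub>T T (int k - 1)) f x + proj \<Omega> (R\<^sub>T_perp T (int k)) f x) \<in> sum_space (R\<^sub>T T (int k - 1)) (R\<^sub>T_perp T (int k))"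
  using proj_in[OF fields_R\<^sub>T] proj_in[OF fields_R\<^sub>T_perp] unfolding sum_space_def by blast

lemma sum_space_T_G:
  "regular_on \<Omega> f \<Longrightarrow> (\<lambda>x. proj \<Omega> (G\<^sub>T T (int k - 1)) f x + proj \<Omega> (G\<^sub>T_perp T (int k)) f x) \<in> sum_space (G\<^sub>T T (int k - 1)) (G\<^sub>T_perp T (int k))"
  using proj_in[OF fields_G\<^sub>T] proj_in[OF fields_G\<^sub>T_perp] unfolding sum_space_def by blast

lemma sum_space_F:
  "F \<in> faces T \<Longrightarrow> regular_on F f \<Longrightarrow> (\<lambda>x. proj F (R\<^sub>F T F (int k - 1)) f x + proj F (R\<^sub>F_perp T F (int k)) f x) \<in> sum_space (R\<^sub>F T F (int k - 1)) (R\<^sub>F_perp T F (int k))"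
  using proj_in[OF fields_R\<^sub>F] proj_in[OF fields_R\<^sub>F_perp] unfolding sum_space_def by blast

lemma discrete_grad_mem:
  assumes q: "q \<in> X_grad T k" and \<gamma>: "\<And>F. F \<in> faces T \<Longrightarrow> scalar_trace T k F (\<gamma> F)"
  shows "discrete_grad T k \<gamma> q \<in> X_curl T k"
  unfolding discrete_grad_def X_curl_def
proof (intro SigmaI)
  show "(\<lambda>x. proj \<Omega> (R\<^sub>T T (int k - 1)) (full_grad T k \<gamma> q) x + proj \<Omega> (R\<^sub>T_perp T (int k)) (full_grad T k \<gamma> q) x)
    \<in> sum_space (R\<^sub>T T (int k - 1)) (R\<^sub>T_perp T (int k))"
    by (rule sum_space_T_R[OF regular_vpol[OF \<Omega>_cell(1) full_grad_vpol[OF q \<gamma>]]])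
  show "(\<lambda>F\<in>faces T. \<lambda>x. proj F (R\<^sub>F T F (int k - 1)) (full_grad\<^sub>F T k F (face_restr_grad T F q)) x +
        proj F (R\<^sub>F_perp T F (int k)) (full_grad\<^sub>F T k F (face_restr_grad T F q)) x)
     \<in> (\<Pi>\<^sub>E F\<in>faces T. sum_space (R\<^sub>F T F (int k - 1)) (R\<^sub>F_perp T F (int k)))"
    unfolding restrict_PiE_iff
    by (intro ballI sum_space_F) (auto intro: regular_vpol[OF F_cell(1) full_grad\<^sub>F_vpol[OF q]])
  show "glue (edges T) (\<lambda>E. edge_grad T E q) \<in> pw_pol (edges T) (int k)"
    by (intro glue_pw_pol T_facts disjoint_edges edge_grad_pol q)
qed

text \<open>Each full gradient of the interpolate is the true (tangential) gradient of
  \<open>p\<close>, recognized by testing: the bulk projection is invisible to divergences, the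
  boundary terms carry \<open>p\<close> itself, and integration by parts concludes. All further
  projections then act on equal fields.\<close>

lemma grad_commutes:
  assumes p: "p \<in> polys (int k + 1)" and \<gamma>: "\<And>F. F \<in> faces T \<Longrightarrow> scalar_trace T k F (\<gamma> F)"
  shows "discrete_grad T k \<gamma> (I_grad T k (ext \<Omega> (restr \<Omega> p))) = I_curl T k (ext \<Omega> (grad \<Omega> (restr \<Omega> p)))"
proof -
  define q where "q = I_grad T k (ext \<Omega> (restr \<Omega> p))"
  have g: "pgrad p \<in> vpolys (int k)" using pgrad_vpolys[OF p] by simp
  have gr: "grad \<Omega> (restr \<Omega> p) = restr \<Omega> (pgrad p)" by (rule grad_\<Omega>[OF p]) simp
  have e: "ext \<Omega> (restr \<Omega> (pgrad p)) x = pgrad p x" if "x \<in> closure \<Omega>" for x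
    by (rule ext_\<Omega>[OF vpolys_continuous[OF g] that])
  have full: "full_grad T k \<gamma> q = restr \<Omega> (pgrad p)"
    unfolding full_grad_def
  proof (rule representer_eqI[OF fields_on_vpol[OF \<Omega>_cell(1)] vpol_\<Omega>[OF g]])
    fix w assume "w \<in> vpol \<Omega> (int k)"
    then obtain W where W: "W \<in> vpolys (int k)" "w = restr \<Omega> W" by (rule vpolE)
    have dw: "dvg \<Omega> w \<in> pol \<Omega> (int k - 1)" using dvg_pol[OF \<Omega>_cell(1) W(1), of w] W(2) by simp
    have rp: "regular_on \<Omega> (restr \<Omega> p)" using p by auto
    have "integ \<Omega> (\<lambda>x. fst q x * dvg \<Omega> w x) = ip \<Omega> (proj \<Omega> (pol \<Omega> (int k - 1)) (restr \<Omega> p)) (dvg \<Omega> w)"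
      by (simp add: q_def I_grad_poly[OF p] ip_def)
    \<comment> \<open>The divergence of a test field of degree k has degree k - 1, so the projection
      on that degree may be dropped.\<close>
    also have "\<dots> = ip \<Omega> (restr \<Omega> p) (dvg \<Omega> w)" by (rule proj_ip[OF fields_on_pol[OF \<Omega>_cell(1)] rp dw])
    also have "\<dots> = integ \<Omega> (\<lambda>x. p x * dvg \<Omega> (restr \<Omega> W) x)"
      unfolding ip_def W(2) by (intro integ_cong) simp
    also have "\<dots> = (\<Sum>F\<in>faces T. \<omega>\<^sub>T T F * integ F (\<lambda>x. p x * (W x \<bullet> normal T F))) - integ \<Omega> (\<lambda>x. pgrad p x \<bullet> W x)"
      using integ_mult_dvg[OF \<Omega>_cell(1) p W(1) divergence_\<Omega>] by (simp add: tang_\<Omega>)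
    finally have 1: "integ \<Omega> (\<lambda>x. fst q x * dvg \<Omega> w x) =
      (\<Sum>F\<in>faces T. \<omega>\<^sub>T T F * integ F (\<lambda>x. p x * (W x \<bullet> normal T F))) - integ \<Omega> (\<lambda>x. pgrad p x \<bullet> W x)" .
    have 2: "integ F (\<lambda>x. \<gamma> F (face_restr_grad T F q) x * (ext \<Omega> w x \<bullet> normal T F)) = integ F (\<lambda>x. p x * (W x \<bullet> normal T F))"
      if F: "F \<in> faces T" for F
    proof (rule integ_cong)
      fix x assume x: "x \<in> F"
      \<comment> \<open>Polynomials of degree k + 1 are reproduced by the scalar trace, so the face
        terms contain \<open>p\<close> and not a projection of it.\<close>
      have "\<gamma> F (I_grad\<^sub>F T k F (ext F (restr F p))) = restr F p"
        using \<gamma>[OF F] polI[OF p, of F] by (auto simp: scalar_trace_def)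
      then have "\<gamma> F (face_restr_grad T F q) = restr F p" unfolding q_def face_restr_I_grad[OF F p] .
      moreover have "ext \<Omega> w x = W x" unfolding W(2) using F_subset[OF F] x by (intro ext_\<Omega> vpolys_continuous[OF W(1)]) auto
      ultimately show "\<gamma> F (face_restr_grad T F q) x * (ext \<Omega> w x \<bullet> normal T F) = p x * (W x \<bullet> normal T F)" using x by simp
    qed
    have "ip \<Omega> (restr \<Omega> (pgrad p)) w = integ \<Omega> (\<lambda>x. pgrad p x \<bullet> W x)"
      unfolding ip_def W(2) by (intro integ_cong) simp
    then show "ip \<Omega> (restr \<Omega> (pgrad p)) w = - integ \<Omega> (\<lambda>x. fst q x * dvg \<Omega> w x) +
     (\<Sum>F\<in>faces T. \<omega>\<^sub>T T F * integ F (\<lambda>x. \<gamma> F (face_restr_grad T F q) x * (ext \<Omega> w x \<bullet> normal T F)))"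
      unfolding 1 using 2 by simp
  qed
  have tg: "(\<lambda>x. tang F (pgrad p x)) \<in> vpolys (int k)" if F: "F \<in> faces T" for F
    by (rule vpolys_linear[OF linear_tang[OF F_cell(1)[OF F]] g])
  have fullF: "full_grad\<^sub>F T k F (face_restr_grad T F q) = restr F (\<lambda>x. tang F (pgrad p x))" if F: "F \<in> faces T" for F
    unfolding full_grad\<^sub>F_def q_def face_restr_I_grad(1)[OF F p] prod.case
  proof (rule representer_eqI[OF fields_on_vpol[OF F_cell(1)[OF F]] vpolI[OF F_cell(1)[OF F] tg[OF F]]])
    note cF = F_cell(1)[OF F]
    show "tang F (pgrad p x) \<in> direction F" for x by (rule tang_direction[OF cF])
    fix w assume "w \<in> vpol F (int k)"
    then obtain W where W: "W \<in> vpolys (int k)" "w = restr F W" by (rule vpolE)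
    have dw: "dvg F w \<in> pol F (int k - 1)" using dvg_pol[OF cF W(1), of w] W(2) by simp
    have rp: "regular_on F (restr F p)" using p by auto
    have "integ F (\<lambda>x. proj F (pol F (int k - 1)) (restr F p) x * dvg F w x) = ip F (proj F (pol F (int k - 1)) (restr F p)) (dvg F w)"
      by (simp add: ip_def)
    also have "\<dots> = ip F (restr F p) (dvg F w)" by (rule proj_ip[OF fields_on_pol[OF cF] rp dw])
    also have "\<dots> = integ F (\<lambda>x. p x * dvg F (restr F W) x)"
      unfolding ip_def W(2) by (intro integ_cong) simp
    also have "\<dots> = (\<Sum>E\<in>face_edges T F. \<omega>\<^sub>F T F E * integ E (\<lambda>x. p x * (W x \<bullet> edge_normal T F E))) - integ F (\<lambda>x. tang F (pgrad p x) \<bullet> W x)"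
      by (rule integ_mult_dvg[OF cF p W(1) divergence_F[OF F]])
    finally have 1: "integ F (\<lambda>x. proj F (pol F (int k - 1)) (restr F p) x * dvg F w x) =
      (\<Sum>E\<in>face_edges T F. \<omega>\<^sub>F T F E * integ E (\<lambda>x. p x * (W x \<bullet> edge_normal T F E))) - integ F (\<lambda>x. tang F (pgrad p x) \<bullet> W x)" .
    have 2: "integ E (\<lambda>x. restr (skeleton (face_edges T F)) p x * (ext F w x \<bullet> edge_normal T F E)) = integ E (\<lambda>x. p x * (W x \<bullet> edge_normal T F E))"
      if E: "E \<in> face_edges T F" for E
    proof (rule integ_cong)
      fix x assume x: "x \<in> E"
      have "x \<in> skeleton (face_edges T F)" using x E closure_subset by (auto simp: skeleton_def)
      moreover have "ext F w x = W x" unfolding W(2) using FE_subset[OF E] x by (intro ext_F[OF F] vpolys_continuous[OF W(1)]) auto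
      ultimately show "restr (skeleton (face_edges T F)) p x * (ext F w x \<bullet> edge_normal T F E) = p x * (W x \<bullet> edge_normal T F E)" by simp
    qed
    have "ip F (restr F (\<lambda>x. tang F (pgrad p x))) w = integ F (\<lambda>x. tang F (pgrad p x) \<bullet> W x)"
      unfolding ip_def W(2) by (intro integ_cong) simp
    then show "ip F (restr F (\<lambda>x. tang F (pgrad p x))) w = - integ F (\<lambda>x. proj F (pol F (int k - 1)) (restr F p) x * dvg F w x) +
     (\<Sum>E\<in>face_edges T F. \<omega>\<^sub>F T F E * integ E (\<lambda>x. restr (skeleton (face_edges T F)) p x * (ext F w x \<bullet> edge_normal T F E)))"
      unfolding 1 using 2 by simp
  qed
  \<comment> \<open>The double cross product with the normal in the interpolator is the tangential
    projection.\<close>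
  have tp: "restr F (\<lambda>x. tang F (pgrad p x)) = tangential_part T F (ext \<Omega> (restr \<Omega> (pgrad p)))" if F: "F \<in> faces T" for F
    unfolding tangential_part_def using e F_subset[OF F] by (intro restr_cong) (auto simp: tang_F_cross[OF F] subset_iff)
  have edge: "edge_grad T E q = proj E (pol E (int k)) (restr E (\<lambda>x. ext \<Omega> (restr \<Omega> (pgrad p)) x \<bullet> tangent T E))"
    if E: "E \<in> edges T" for E
  proof -
    note cE = E_cell(1)[OF E]
    have sk: "E \<subseteq> skeleton (edges T)" "E \<subseteq> closure \<Omega>" using E E_closure_subset[OF E] closure_subset by (auto simp: skeleton_def)
    have "restr E (restr (skeleton (edges T)) p) = restr E p" using sk by (intro restr_cong) auto
    then have "edge_grad T E q = (\<lambda>x. grad E (restr E p) x \<bullet> tangent T E)"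
      by (simp add: edge_grad_def q_def I_grad_poly[OF p])
    also have "\<dots> = restr E (\<lambda>x. pgrad p x \<bullet> tangent T E)"
      using grad_poly[OF cE p, of "restr E p"] tang_E[OF E] by (simp add: restr_def fun_eq_iff)
    also have "\<dots> = proj E (pol E (int k)) (restr E (\<lambda>x. ext \<Omega> (restr \<Omega> (pgrad p)) x \<bullet> tangent T E))"
      using e sk by (intro proj_id[symmetric] fields_on_pol cE polI vpolys_inner_const g) auto
    finally show ?thesis .
  qed
  have pc: "proj \<Omega> W (full_grad T k \<gamma> q) = proj \<Omega> W (ext \<Omega> (restr \<Omega> (pgrad p)))" for W
    unfolding full using e \<Omega>_subset by (intro proj_cong) auto
  have "glue (edges T) (\<lambda>E. edge_grad T E q) = glue (edges T) (\<lambda>E. proj E (pol E (int k)) (restr E (\<lambda>x. ext \<Omega> (restr \<Omega> (pgrad p)) x \<bullet> tangent T E)))"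
    by (rule glue_cong) (simp add: edge)
  then show ?thesis
    unfolding discrete_grad_def I_curl_def gr q_def[symmetric] pc by (simp add: fullF tp cong: restrict_cong)
qed

subsection \<open>The curl\<close>

lemma tangential_part_regular: "F \<in> faces T \<Longrightarrow> V \<in> vpolys l \<Longrightarrow> regular_on F (tangential_part T F (ext \<Omega> (restr \<Omega> V)))"
  unfolding tangential_part_def
  by (intro regular_on_restr regular_on_cross regular_on_const regular_ext F_subset)

lemma tangential_part_eq:
  assumes F: "F \<in> faces T" and V: "V \<in> vpolys l" and x: "x \<in> F"
  shows "tangential_part T F (ext \<Omega> (restr \<Omega> V)) x = tang F (V x)"
proof -
  have "ext \<Omega> (restr \<Omega> V) x = V x" using F_subset[OF F] x by (intro ext_\<Omega> vpolys_continuous[OF V]) auto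
  then show ?thesis using x by (simp add: tangential_part_def tang_F_cross[OF F])
qed

lemma I_curl_mem:
  assumes v: "v \<in> Nedelec T k" shows "I_curl T k (ext \<Omega> v) \<in> X_curl T k"
proof -
  obtain V where V: "V \<in> vpolys (int k + 1)" "v = restr \<Omega> V" by (rule NedelecE[OF v])
  show ?thesis unfolding I_curl_def X_curl_def V(2)
  proof (intro SigmaI)
    let ?v = "ext \<Omega> (restr \<Omega> V)"
    show "(\<lambda>x. proj \<Omega> (R\<^sub>T T (int k - 1)) ?v x + proj \<Omega> (R\<^sub>T_perp T (int k)) ?v x) \<in> sum_space (R\<^sub>T T (int k - 1)) (R\<^sub>T_perp T (int k))"
      by (rule sum_space_T_R[OF regular_ext[OF V(1) \<Omega>_subset]])
    show "(\<lambda>F\<in>faces T. \<lambda>x. proj F (R\<^sub>F T F (int k - 1)) (tangential_part T F ?v) x +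
        proj F (R\<^sub>F_perp T F (int k)) (tangential_part T F ?v) x)
     \<in> (\<Pi>\<^sub>E F\<in>faces T. sum_space (R\<^sub>F T F (int k - 1)) (R\<^sub>F_perp T F (int k)))"
      unfolding restrict_PiE_iff by (intro ballI sum_space_F tangential_part_regular[OF _ V(1)])
    have "regular_on E (restr E (\<lambda>x. ?v x \<bullet> tangent T E))" if "E \<in> edges T" for E
      by (intro regular_on_restr regular_on_inner regular_on_const regular_ext[OF V(1)]
          order_trans[OF closure_subset E_closure_subset[OF that]])
    then show "glue (edges T) (\<lambda>E. proj E (pol E (int k)) (restr E (\<lambda>x. ?v x \<bullet> tangent T E))) \<in> pw_pol (edges T) (int k)"
      by (intro glue_pw_pol T_facts disjoint_edges proj_pol E_cell)
  qed
qed

lemma face_restr_curl_mem: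
  assumes v: "v \<in> X_curl T k" and F: "F \<in> faces T"
  obtains u w b where "face_restr_curl T F v = ((\<lambda>x. u x + w x), b)" "u \<in> R\<^sub>F T F (int k - 1)" "w \<in> R\<^sub>F_perp T F (int k)"
    "\<forall>E\<in>face_edges T F. regular_on E b"
proof -
  obtain v1 vF s where v': "v = (v1, vF, s)" "vF \<in> (\<Pi>\<^sub>E F\<in>faces T. sum_space (R\<^sub>F T F (int k - 1)) (R\<^sub>F_perp T F (int k)))"
    "s \<in> pw_pol (edges T) (int k)" using v by (auto simp: X_curl_def)
  have "vF F \<in> sum_space (R\<^sub>F T F (int k - 1)) (R\<^sub>F_perp T F (int k))" using v'(2) F by auto
  then obtain u w where uw: "vF F = (\<lambda>x. u x + w x)" "u \<in> R\<^sub>F T F (int k - 1)" "w \<in> R\<^sub>F_perp T F (int k)"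
    by (auto simp: sum_space_def)
  have "regular_on E (restr (\<Union>(face_edges T F)) s)" if E: "E \<in> face_edges T F" for E
  proof -
    have "restr E s \<in> pol E (int k)" using v'(3) FE_D(1)[OF E] by (simp add: pw_pol_def)
    from regular_pol[OF E_cell(1)[OF FE_D(1)[OF E]] this] show ?thesis
      by (rule regular_on_cong) (use E in \<open>auto simp: restr_def\<close>)
  qed
  then show thesis using that[OF _ uw(2,3)] uw(1) by (simp add: v' face_restr_curl_def)
qed

text \<open>Both orders are needed: \<open>curl\<^sub>F\<close> reads the first component,
  \<open>tangential_trace\<close> the second. Orthogonality holds although the degrees differ, as
  rotated gradients of degree k - 1 are among those of degree k.\<close>

lemma component_R:
  assumes F: "F \<in> faces T" and u: "u \<in> R\<^sub>F T F (int k - 1)" and w: "w \<in> R\<^sub>F_perp T F (int k)"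
  shows "component (R\<^sub>F T F (int k - 1)) (R\<^sub>F_perp T F (int k)) (\<lambda>x. u x + w x) = u"
    "component (R\<^sub>F_perp T F (int k)) (R\<^sub>F T F (int k - 1)) (\<lambda>x. u x + w x) = w"
proof -
  have o: "ip F u w = 0" if "u \<in> R\<^sub>F T F (int k - 1)" "w \<in> R\<^sub>F_perp T F (int k)" for u w
    by (rule R\<^sub>F_orth[OF _ that]) simp
  show "component (R\<^sub>F T F (int k - 1)) (R\<^sub>F_perp T F (int k)) (\<lambda>x. u x + w x) = u"
    by (rule component_eq[OF fields_R\<^sub>F[OF F] fields_R\<^sub>F_perp[OF F] o u w refl])
  show "component (R\<^sub>F_perp T F (int k)) (R\<^sub>F T F (int k - 1)) (\<lambda>x. u x + w x) = w"
  proof (rule component_eq[OF fields_R\<^sub>F_perp[OF F] fields_R\<^sub>F[OF F] _ w u])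
    show "ip F w u = 0" if "w \<in> R\<^sub>F_perp T F (int k)" "u \<in> R\<^sub>F T F (int k - 1)" for u w
      using o[OF that(2,1)] ip_commute by metis
  qed (simp add: add.commute)
qed

lemma lin_on_edge_sum:
  assumes F: "F \<in> faces T" and b: "\<And>E. E \<in> face_edges T F \<Longrightarrow> regular_on E b"
  shows "lin_on (pol F l) (\<lambda>r. \<Sum>E\<in>face_edges T F. \<omega>\<^sub>F T F E * integ E (\<lambda>x. b x * ext F r x))"
proof (intro lin_on_sum lin_on_mult lin_on_integ)
  show "regular_on E (\<lambda>x. b x * ext F w x)" if "E \<in> face_edges T F" "w \<in> pol F l" for E w
    by (intro regular_on_mult b that(1) regular_ext_pol_F[OF F that(2) FE_subset[OF that(1)]])
qed (intro E_cell FE_D lin_on_ext_eval F_cell F; assumption)+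

lemma regular_rot: "F \<in> faces T \<Longrightarrow> r \<in> pol F l \<Longrightarrow> regular_on F (rot T F r)"
  using fields_onD(3)[OF fields_R\<^sub>F rot_vpol] by blast

lemma curl\<^sub>F_pol:
  assumes v: "v \<in> X_curl T k" and F: "F \<in> faces T"
  shows "curl\<^sub>F T k F (face_restr_curl T F v) \<in> pol F (int k)"
proof -
  obtain u w b where uw: "face_restr_curl T F v = ((\<lambda>x. u x + w x), b)" "u \<in> R\<^sub>F T F (int k - 1)" "w \<in> R\<^sub>F_perp T F (int k)"
    and b0: "\<forall>E\<in>face_edges T F. regular_on E b" by (rule face_restr_curl_mem[OF v F])
  note b = bspec[OF b0]
  note cF = F_cell(1)[OF F]
  have "lin_on (pol F (int k)) (\<lambda>r. ip F u (rot T F r))"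
    by (rule lin_on_ip_op[OF cF fields_onD(3)[OF fields_R\<^sub>F[OF F] uw(2)] regular_rot[OF F] lin_on_rot[OF F]])
  then show ?thesis unfolding curl\<^sub>F_def uw(1) prod.case component_R[OF F uw(2,3)]
    by (intro representer_in fields_on_pol cF lin_on_diff lin_on_edge_sum F b)
qed

text \<open>For arbitrary discrete data the conditions on the trace are those of
  \<open>trace_exists\<close>, with \<open>M\<close> collecting the face curl and the edge
  terms.\<close>

lemma tangential_trace_vpol:
  assumes v: "v \<in> X_curl T k" and F: "F \<in> faces T"
  shows "tangential_trace T k F (face_restr_curl T F v) \<in> vpol F (int k)"
proof -
  obtain u w b where uw: "face_restr_curl T F v = ((\<lambda>x. u x + w x), b)" "u \<in> R\<^sub>F T F (int k - 1)" "w \<in> R\<^sub>F_perp T F (int k)"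
    and b0: "\<forall>E\<in>face_edges T F. regular_on E b" by (rule face_restr_curl_mem[OF v F])
  note b = bspec[OF b0]
  note cF = F_cell(1)[OF F]
  define C where "C = curl\<^sub>F T k F ((\<lambda>x. u x + w x), b)"
  have "C \<in> pol F (int k)" using curl\<^sub>F_pol[OF v F] by (simp add: C_def uw(1))
  then have rC: "regular_on F C" by (rule regular_pol[OF cF])
  define M where "M = (\<lambda>r. ip F C r + (\<Sum>E\<in>face_edges T F. \<omega>\<^sub>F T F E * integ E (\<lambda>x. b x * ext F r x)))"
  have M: "lin_on (pol F (int k + 1)) M"
    unfolding M_def by (intro lin_on_add lin_on_edge_sum F b lin_on_ip fields_on_pol cF rC)
  define P where "P = (\<lambda>g. g \<in> vpol F (int k) \<and> (\<forall>r\<in>pol0 F (int k + 1). ip F g (rot T F r) = M r) \<and>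
    (\<forall>z\<in>R\<^sub>F_perp T F (int k). ip F g z = ip F w z))"
  have "\<exists>g. P g" using trace_exists[OF F M uw(3)] unfolding P_def by blast
  then obtain g where g: "P g" by blast
  have "h = g" if "P h" for h using g that unfolding P_def by (intro trace_unique[OF F, of h k g]) auto
  then have "P (THE g. P g)" using g by (metis theI)
  moreover have "tangential_trace T k F (face_restr_curl T F v) = (THE g. P g)"
    unfolding tangential_trace_def uw(1) prod.case component_R[OF F uw(2,3)] P_def M_def C_def ..
  ultimately show ?thesis by (simp add: P_def)
qed

lemma full_curl_vpol:
  assumes v: "v \<in> X_curl T k" shows "full_curl T k v \<in> vpol \<Omega> (int k)"
  unfolding full_curl_def
proof (rule representer_in[OF fields_on_vpol[OF \<Omega>_cell(1)]], intro lin_on_add lin_on_sum lin_on_mult)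
  obtain u w where uw: "fst v = (\<lambda>x. u x + w x)" "u \<in> R\<^sub>T T (int k - 1)" "w \<in> R\<^sub>T_perp T (int k)"
    using v by (auto simp: X_curl_def sum_space_def)
  have r1: "regular_on \<Omega> (fst v)" unfolding uw(1)
    by (intro regular_on_add fields_onD(3)[OF fields_R\<^sub>T uw(2)] fields_onD(3)[OF fields_R\<^sub>T_perp uw(3)])
  have r2: "regular_on \<Omega> (curl \<Omega> w)" if "w \<in> vpol \<Omega> (int k)" for w
  proof -
    have "curl \<Omega> w \<in> R\<^sub>T T (int k - 1)" using that by (simp add: R\<^sub>T_def)
    then show ?thesis by (rule fields_onD(3)[OF fields_R\<^sub>T])
  qed
  show "lin_on (vpol \<Omega> (int k)) (\<lambda>w. ip \<Omega> (fst v) (curl \<Omega> w))"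
    by (rule lin_on_ip_op[OF \<Omega>_cell(1) r1 r2 lin_on_curl[OF \<Omega>_cell(1)]])
  fix F assume F: "F \<in> faces T"
  show "lin_on (vpol \<Omega> (int k)) (\<lambda>w. ip F (tangential_trace T k F (face_restr_curl T F v)) (\<lambda>x. cross3 (ext \<Omega> w x) (normal T F)))"
  proof (rule lin_on_ip_op[OF F_cell(1)[OF F]])
    show "regular_on F (tangential_trace T k F (face_restr_curl T F v))"
      by (rule regular_vpol[OF F_cell(1)[OF F] tangential_trace_vpol[OF v F]])
    show "regular_on F (\<lambda>x. cross3 (ext \<Omega> w x) (normal T F))" if "w \<in> vpol \<Omega> (int k)" for w
      by (intro regular_on_cross regular_on_const regular_ext_vpol[OF that F_subset[OF F]])
    show "lin_on (vpol \<Omega> (int k)) (\<lambda>w. cross3 (ext \<Omega> w x) (normal T F))" for x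
      by (intro lin_on_cross lin_on_ext_eval \<Omega>_cell)
  qed
qed

lemma discrete_curl_mem:
  assumes v: "v \<in> X_curl T k" shows "discrete_curl T k v \<in> X_div T k"
  unfolding discrete_curl_def X_div_def
proof (intro SigmaI)
  show "(\<lambda>x. proj \<Omega> (G\<^sub>T T (int k - 1)) (full_curl T k v) x + proj \<Omega> (G\<^sub>T_perp T (int k)) (full_curl T k v) x)
    \<in> sum_space (G\<^sub>T T (int k - 1)) (G\<^sub>T_perp T (int k))"
    by (rule sum_space_T_G[OF regular_vpol[OF \<Omega>_cell(1) full_curl_vpol[OF v]]])
  show "glue (faces T) (\<lambda>F. curl\<^sub>F T k F (face_restr_curl T F v)) \<in> pw_pol (faces T) (int k)"
    by (intro glue_pw_pol T_facts disjoint_faces curl\<^sub>F_pol v)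
qed

text \<open>The identity \<open>green\<close> on a face yields both the face curl and the first
  condition on the trace; once the trace is known, the Green formula in the volume yields the full
  curl.\<close>

lemma curl_commutes:
  assumes v: "v \<in> Nedelec T k"
  shows "discrete_curl T k (I_curl T k (ext \<Omega> v)) = I_div T k (ext \<Omega> (curl \<Omega> v))"
proof -
  obtain V where V: "V \<in> vpolys (int k + 1)" "v = restr \<Omega> V"
    and VE: "\<forall>E\<in>edges T. \<exists>P\<in>polys (int k). \<forall>x\<in>E. V x \<bullet> tangent T E = P x"
    by (rule NedelecE[OF v])
  define I where "I = I_curl T k (ext \<Omega> (restr \<Omega> V))"
  have I_mem: "I \<in> X_curl T k" unfolding I_def using I_curl_mem[OF v] V(2) by simp
  have C: "pcurl V \<in> vpolys (int k)" using pcurl_vpolys[OF V(1)] by simp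
  have cv: "curl \<Omega> v = restr \<Omega> (pcurl V)" by (rule curl_\<Omega>[OF V(1)]) (simp add: V(2))
  have e: "ext \<Omega> (restr \<Omega> V) x = V x" "ext \<Omega> (restr \<Omega> (pcurl V)) x = pcurl V x" if "x \<in> closure \<Omega>" for x
    using that by (intro ext_\<Omega> vpolys_continuous[OF V(1)] vpolys_continuous[OF C]; assumption)+
  define tp where "tp = (\<lambda>F. tangential_part T F (ext \<Omega> (restr \<Omega> V)))"
  have rtp: "regular_on F (tp F)" if "F \<in> faces T" for F unfolding tp_def by (rule tangential_part_regular[OF that V(1)])
  have tp_inner: "tp F x \<bullet> h = V x \<bullet> h" if "F \<in> faces T" "x \<in> F" "h \<in> direction F" for F x h
    unfolding tp_def tangential_part_eq[OF that(1) V(1) that(2)] by (rule tang_inner[OF F_cell(1)[OF that(1)] that(3)])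
  define bd where "bd = (\<lambda>F. restr (\<Union>(face_edges T F)) (glue (edges T) (\<lambda>E. proj E (pol E (int k)) (restr E (\<lambda>x. ext \<Omega> (restr \<Omega> V) x \<bullet> tangent T E)))))"
  have fr: "face_restr_curl T F I = (\<lambda>x. proj F (R\<^sub>F T F (int k - 1)) (tp F) x + proj F (R\<^sub>F_perp T F (int k)) (tp F) x, bd F)"
    if "F \<in> faces T" for F
    using that by (simp add: I_def I_curl_def face_restr_curl_def tp_def bd_def)
  \<comment> \<open>The edge projection is exact, because along an edge the tangential component of
    a Nedelec field has degree k.\<close>
  have bd: "bd F x = V x \<bullet> tangent T E" if "E \<in> face_edges T F" "x \<in> E" for F E x
  proof -
    have ET: "E \<in> edges T" by (rule FE_D(1)[OF that(1)])
    obtain P where P: "P \<in> polys (int k)" "\<forall>x\<in>E. V x \<bullet> tangent T E = P x" using VE ET by blast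
    have sub: "E \<subseteq> closure \<Omega>" using E_closure_subset[OF ET] closure_subset by blast
    have "proj E (pol E (int k)) (restr E (\<lambda>x. ext \<Omega> (restr \<Omega> V) x \<bullet> tangent T E)) = restr E P"
      using P(2) e sub by (intro proj_id fields_on_pol E_cell ET polI P(1)) auto
    then have "glue (edges T) (\<lambda>E. proj E (pol E (int k)) (restr E (\<lambda>x. ext \<Omega> (restr \<Omega> V) x \<bullet> tangent T E))) x = P x"
      using glue_in[OF T_facts(3) disjoint_edges ET that(2)] that(2) by simp
    then show ?thesis using that P(2) by (auto simp: bd_def restr_def)
  qed
  have rot_dir: "rot T F r x \<in> direction F" if "F \<in> faces T" for F r x
    by (simp add: rot_def F_direction[OF that] dot_cross_self)
  have green: "ip F (tp F) (rot T F r) = ip F (restr F (\<lambda>x. pcurl V x \<bullet> normal T F)) r +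
      (\<Sum>E\<in>face_edges T F. \<omega>\<^sub>F T F E * integ E (\<lambda>x. bd F x * ext F r x))"
    if F: "F \<in> faces T" and r: "r \<in> pol F l" for F r l
  proof -
    obtain p where p: "p \<in> polys l" "r = restr F p" using r by (rule polE)
    have rp: "rot T F r = restr F (\<lambda>x. cross3 (pgrad p x) (normal T F))" by (rule rot_poly[OF F p(1)]) (simp add: p(2))
    have "ip F (tp F) (rot T F r) = integ F (\<lambda>x. V x \<bullet> cross3 (pgrad p x) (normal T F))"
      unfolding ip_def
    proof (rule integ_cong)
      fix x assume x: "x \<in> F"
      show "tp F x \<bullet> rot T F r x = V x \<bullet> cross3 (pgrad p x) (normal T F)"
        using tp_inner[OF F x rot_dir[OF F], of r x] x unfolding rp by simp
    qed
    also have "\<dots> = integ F (\<lambda>x. (pcurl V x \<bullet> normal T F) * p x) +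
      (\<Sum>E\<in>face_edges T F. \<omega>\<^sub>F T F E * integ E (\<lambda>x. (V x \<bullet> tangent T E) * p x))"
      by (rule green_F[OF F V(1) p(1)])
    also have "integ F (\<lambda>x. (pcurl V x \<bullet> normal T F) * p x) = ip F (restr F (\<lambda>x. pcurl V x \<bullet> normal T F)) r"
      unfolding ip_def p(2) by (intro integ_cong) simp
    also have "(\<Sum>E\<in>face_edges T F. \<omega>\<^sub>F T F E * integ E (\<lambda>x. (V x \<bullet> tangent T E) * p x)) =
      (\<Sum>E\<in>face_edges T F. \<omega>\<^sub>F T F E * integ E (\<lambda>x. bd F x * ext F r x))"
    proof (rule sum.cong[OF refl])
      fix E assume E: "E \<in> face_edges T F"
      have "integ E (\<lambda>x. (V x \<bullet> tangent T E) * p x) = integ E (\<lambda>x. bd F x * ext F r x)"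
      proof (rule integ_cong)
        fix x assume x: "x \<in> E"
        have "ext F r x = p x" unfolding p(2) using FE_subset[OF E] x by (intro ext_F[OF F] polys_continuous[OF p(1)]) auto
        then show "V x \<bullet> tangent T E * p x = bd F x * ext F r x" by (simp add: bd[OF E x])
      qed
      then show "\<omega>\<^sub>F T F E * integ E (\<lambda>x. (V x \<bullet> tangent T E) * p x) = \<omega>\<^sub>F T F E * integ E (\<lambda>x. bd F x * ext F r x)" by simp
    qed
    finally show ?thesis .
  qed
  have pR: "proj F (R\<^sub>F T F (int k - 1)) (tp F) \<in> R\<^sub>F T F (int k - 1)" "proj F (R\<^sub>F_perp T F (int k)) (tp F) \<in> R\<^sub>F_perp T F (int k)"
    if "F \<in> faces T" for F
    using proj_in[OF fields_R\<^sub>F rtp] proj_in[OF fields_R\<^sub>F_perp rtp] that by blast+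
  have Cn: "restr F (\<lambda>x. pcurl V x \<bullet> normal T F) \<in> pol F (int k)" for F by (rule polI[OF vpolys_inner_const[OF C]])
  have curlF: "curl\<^sub>F T k F (face_restr_curl T F I) = restr F (\<lambda>x. pcurl V x \<bullet> normal T F)" if F: "F \<in> faces T" for F
    unfolding fr[OF F] curl\<^sub>F_def prod.case component_R[OF F pR[OF F]]
  proof (rule representer_eqI[OF fields_on_pol[OF F_cell(1)[OF F]] Cn])
    fix r assume r: "r \<in> pol F (int k)"
    \<comment> \<open>For \<open>r\<close> of degree k the rotated gradient lies in the space of
      degree k - 1 on which the interpolator projects.\<close>
    have "ip F (proj F (R\<^sub>F T F (int k - 1)) (tp F)) (rot T F r) = ip F (tp F) (rot T F r)"
      by (rule proj_ip[OF fields_R\<^sub>F[OF F] rtp[OF F] rot_vpol[OF F r]])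
    then show "ip F (restr F (\<lambda>x. pcurl V x \<bullet> normal T F)) r = ip F (proj F (R\<^sub>F T F (int k - 1)) (tp F)) (rot T F r) -
       (\<Sum>E\<in>face_edges T F. \<omega>\<^sub>F T F E * integ E (\<lambda>x. bd F x * ext F r x))"
      using green[OF F r] by simp
  qed
  txt \<open>The tangential part of \<open>V\<close> may have degree \<open>k + 1\<close>. The trace only recovers its projection on degree \<open>k\<close>, but
    in the definition of the full curl it is tested against fields of degree \<open>k\<close>.\<close>
  have trace: "tangential_trace T k F (face_restr_curl T F I) = proj F (vpol F (int k)) (tp F)" if F: "F \<in> faces T" for F
  proof -
    let ?g = "proj F (vpol F (int k)) (tp F)"
    let ?P = "\<lambda>g. g \<in> vpol F (int k) \<and>
     (\<forall>r\<in>pol0 F (int k + 1). ip F g (rot T F r) = ip F (restr F (\<lambda>x. pcurl V x \<bullet> normal T F)) r +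
        (\<Sum>E\<in>face_edges T F. \<omega>\<^sub>F T F E * integ E (\<lambda>x. bd F x * ext F r x))) \<and>
     (\<forall>w\<in>R\<^sub>F_perp T F (int k). ip F g w = ip F (proj F (R\<^sub>F_perp T F (int k)) (tp F)) w)"
    note fv = fields_on_vpol[OF F_cell(1)[OF F]]
    have rotm: "rot T F r \<in> vpol F (int k)" "r \<in> pol F (int k + 1)" if "r \<in> pol0 F (int k + 1)" for r
      using that rot_vpol[OF F, of r "int k + 1"] R\<^sub>F_sub[OF F] by (auto simp: pol0_def)
    have Pg: "?P ?g"
    proof (intro conjI ballI)
      show "?g \<in> vpol F (int k)" by (rule proj_in[OF fv rtp[OF F]])
      \<comment> \<open>Here \<open>r\<close> has degree k + 1, one more than in the face curl, and
        its rotated gradient is still a test field of degree k.\<close>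
      show "ip F ?g (rot T F r) = ip F (restr F (\<lambda>x. pcurl V x \<bullet> normal T F)) r +
        (\<Sum>E\<in>face_edges T F. \<omega>\<^sub>F T F E * integ E (\<lambda>x. bd F x * ext F r x))" if "r \<in> pol0 F (int k + 1)" for r
        using proj_ip[OF fv rtp[OF F] rotm(1)[OF that]] green[OF F rotm(2)[OF that]] by simp
      show "ip F ?g w = ip F (proj F (R\<^sub>F_perp T F (int k)) (tp F)) w" if w: "w \<in> R\<^sub>F_perp T F (int k)" for w
      proof -
        have "w \<in> vpol F (int k)" using w by (simp add: R\<^sub>F_perp_def orth_compl_def)
        then show ?thesis
          using proj_ip[OF fv rtp[OF F]] proj_ip[OF fields_R\<^sub>F_perp[OF F] rtp[OF F] w] by simp
      qed
    qed
    have "tangential_trace T k F (face_restr_curl T F I) = (THE g. ?P g)"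
      using curlF[OF F] unfolding fr[OF F] tangential_trace_def prod.case component_R[OF F pR[OF F]] by simp
    also have "\<dots> = ?g"
    proof (rule the_equality[of ?P, OF Pg])
      fix g assume g: "?P g"
      show "g = ?g" by (rule trace_unique[OF F, of g k ?g]) (use g Pg in auto)
    qed
    finally show ?thesis .
  qed
  have full: "full_curl T k I = restr \<Omega> (pcurl V)"
    unfolding full_curl_def
  proof (rule representer_eqI[OF fields_on_vpol[OF \<Omega>_cell(1)] vpol_\<Omega>[OF C]])
    fix w assume w: "w \<in> vpol \<Omega> (int k)"
    then obtain W where W: "W \<in> vpolys (int k)" "w = restr \<Omega> W" by (rule vpolE)
    have cw: "curl \<Omega> w \<in> R\<^sub>T T (int k - 1)" using w by (simp add: R\<^sub>T_def)
    have cw': "curl \<Omega> w \<in> R\<^sub>T T (int k)" using cw R\<^sub>T_mono[of "int k - 1" "int k"] by auto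
    have rv: "regular_on \<Omega> (ext \<Omega> (restr \<Omega> V))" by (rule regular_ext[OF V(1) \<Omega>_subset])
    note p1 = proj_in[OF fields_R\<^sub>T rv, of "int k - 1"] and p2 = proj_in[OF fields_R\<^sub>T_perp rv, of "int k"]
    have "ip \<Omega> (fst I) (curl \<Omega> w) = ip \<Omega> (proj \<Omega> (R\<^sub>T T (int k - 1)) (ext \<Omega> (restr \<Omega> V))) (curl \<Omega> w) +
        ip \<Omega> (proj \<Omega> (R\<^sub>T_perp T (int k)) (ext \<Omega> (restr \<Omega> V))) (curl \<Omega> w)"
      unfolding I_def I_curl_def fst_conv
      by (rule ip_add_left[OF \<Omega>_cell(1) fields_onD(3)[OF fields_R\<^sub>T p1] fields_onD(3)[OF fields_R\<^sub>T_perp p2] fields_onD(3)[OF fields_R\<^sub>T cw]])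
    \<comment> \<open>The curl of the test field has degree k - 1, so it lies in the curl space of
      degree k as well, to which the second component is orthogonal.\<close>
    also have "ip \<Omega> (proj \<Omega> (R\<^sub>T_perp T (int k)) (ext \<Omega> (restr \<Omega> V))) (curl \<Omega> w) = 0"
      using p2 cw' by (simp add: R\<^sub>T_perp_def orth_compl_def)
    also have "ip \<Omega> (proj \<Omega> (R\<^sub>T T (int k - 1)) (ext \<Omega> (restr \<Omega> V))) (curl \<Omega> w) = ip \<Omega> (ext \<Omega> (restr \<Omega> V)) (curl \<Omega> w)"
      by (rule proj_ip[OF fields_R\<^sub>T rv cw])
    also have "\<dots> = integ \<Omega> (\<lambda>x. V x \<bullet> pcurl W x)"
      unfolding ip_def using e \<Omega>_subset curl_\<Omega>[OF W(1), of w] W(2) by (intro integ_cong) (simp add: subset_iff)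
    finally have 1: "ip \<Omega> (fst I) (curl \<Omega> w) = integ \<Omega> (\<lambda>x. V x \<bullet> pcurl W x)" by simp
    have 2: "ip F (tangential_trace T k F (face_restr_curl T F I)) (\<lambda>x. cross3 (ext \<Omega> w x) (normal T F)) =
        integ F (\<lambda>x. V x \<bullet> cross3 (W x) (normal T F))" if F: "F \<in> faces T" for F
    proof -
      have ew: "ext \<Omega> w x = W x" if "x \<in> F" for x
        unfolding W(2) using F_subset[OF F] that by (intro ext_\<Omega> vpolys_continuous[OF W(1)]) auto
      have "ip F (tangential_trace T k F (face_restr_curl T F I)) (\<lambda>x. cross3 (ext \<Omega> w x) (normal T F)) =
        ip F (proj F (vpol F (int k)) (tp F)) (restr F (\<lambda>x. cross3 (W x) (normal T F)))"
        unfolding trace[OF F] using ew by (intro ip_cong) auto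
      \<comment> \<open>The rotated trace of the test field is a tangent polynomial field of degree
        k, so the face projection disappears.\<close>
      also have "\<dots> = ip F (tp F) (restr F (\<lambda>x. cross3 (W x) (normal T F)))"
        by (rule proj_ip[OF fields_on_vpol[OF F_cell(1)[OF F]] rtp[OF F] cross_vpol_F[OF F W(1)]])
      also have "\<dots> = integ F (\<lambda>x. V x \<bullet> cross3 (W x) (normal T F))"
        unfolding ip_def
      proof (rule integ_cong)
        fix x assume x: "x \<in> F"
        have "cross3 (W x) (normal T F) \<in> direction F" by (simp add: F_direction[OF F] dot_cross_self)
        from tp_inner[OF F x this] x show "tp F x \<bullet> restr F (\<lambda>x. cross3 (W x) (normal T F)) x = V x \<bullet> cross3 (W x) (normal T F)"
          by simp
      qed
      finally show ?thesis .
    qed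
    have "ip \<Omega> (restr \<Omega> (pcurl V)) w = integ \<Omega> (\<lambda>x. pcurl V x \<bullet> W x)"
      unfolding ip_def W(2) by (intro integ_cong) simp
    then show "ip \<Omega> (restr \<Omega> (pcurl V)) w = ip \<Omega> (fst I) (curl \<Omega> w) +
     (\<Sum>F\<in>faces T. \<omega>\<^sub>T T F * ip F (tangential_trace T k F (face_restr_curl T F I)) (\<lambda>x. cross3 (ext \<Omega> w x) (normal T F)))"
      unfolding 1 using 2 green_\<Omega>[OF V(1) W(1)] by simp
  qed
  have pc: "proj \<Omega> W (full_curl T k I) = proj \<Omega> W (ext \<Omega> (restr \<Omega> (pcurl V)))" for W
    unfolding full using e \<Omega>_subset by (intro proj_cong) auto
  have face: "curl\<^sub>F T k F (face_restr_curl T F I) = proj F (pol F (int k)) (restr F (\<lambda>x. ext \<Omega> (restr \<Omega> (pcurl V)) x \<bullet> normal T F))"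
    if F: "F \<in> faces T" for F
    unfolding curlF[OF F] using e F_subset[OF F]
    by (intro proj_id[symmetric] fields_on_pol F_cell F Cn) auto
  have "glue (faces T) (\<lambda>F. curl\<^sub>F T k F (face_restr_curl T F I)) =
    glue (faces T) (\<lambda>F. proj F (pol F (int k)) (restr F (\<lambda>x. ext \<Omega> (restr \<Omega> (pcurl V)) x \<bullet> normal T F)))"
    by (rule glue_cong) (simp add: face)
  then show ?thesis
    unfolding discrete_curl_def I_div_def cv unfolding V(2) I_def[symmetric] pc by simp
qed

subsection \<open>The divergence\<close>

lemma I_div_mem:
  assumes v: "v \<in> RTN T k" shows "I_div T k (ext \<Omega> v) \<in> X_div T k"
proof -
  obtain V where V: "V \<in> vpolys (int k + 1)" "v = restr \<Omega> V" by (rule RTNE[OF v])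
  show ?thesis unfolding I_div_def X_div_def V(2)
  proof (intro SigmaI)
    let ?v = "ext \<Omega> (restr \<Omega> V)"
    show "(\<lambda>x. proj \<Omega> (G\<^sub>T T (int k - 1)) ?v x + proj \<Omega> (G\<^sub>T_perp T (int k)) ?v x) \<in> sum_space (G\<^sub>T T (int k - 1)) (G\<^sub>T_perp T (int k))"
      by (rule sum_space_T_G[OF regular_ext[OF V(1) \<Omega>_subset]])
    have "regular_on F (restr F (\<lambda>x. ?v x \<bullet> normal T F))" if "F \<in> faces T" for F
      by (intro regular_on_restr regular_on_inner regular_on_const regular_ext[OF V(1) F_subset[OF that]])
    then show "glue (faces T) (\<lambda>F. proj F (pol F (int k)) (restr F (\<lambda>x. ?v x \<bullet> normal T F))) \<in> pw_pol (faces T) (int k)"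
      by (intro glue_pw_pol T_facts disjoint_faces proj_pol F_cell)
  qed
qed

lemma discrete_div_mem:
  assumes v: "v \<in> X_div T k" shows "discrete_div T k v \<in> pol \<Omega> (int k)"
proof -
  obtain a b where ab: "v = (a, b)" "b \<in> pw_pol (faces T) (int k)"
    and "a \<in> sum_space (G\<^sub>T T (int k - 1)) (G\<^sub>T_perp T (int k))" using v by (auto simp: X_div_def)
  then obtain u w where uw: "a = (\<lambda>x. u x + w x)" "u \<in> G\<^sub>T T (int k - 1)" "w \<in> G\<^sub>T_perp T (int k)"
    by (auto simp: sum_space_def)
  have ra: "regular_on \<Omega> a" unfolding uw(1)
    by (intro regular_on_add fields_onD(3)[OF fields_G\<^sub>T uw(2)] fields_onD(3)[OF fields_G\<^sub>T_perp uw(3)])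
  have rb: "regular_on F (restr F b)" if "F \<in> faces T" for F
    using ab(2) that regular_pol[OF F_cell(1)[OF that]] by (auto simp: pw_pol_def)
  show ?thesis unfolding discrete_div_def ab(1) prod.case
  proof (rule representer_in[OF fields_on_pol[OF \<Omega>_cell(1)]], intro lin_on_add lin_on_uminus lin_on_sum lin_on_mult lin_on_integ)
    show "lin_on (pol \<Omega> (int k)) (\<lambda>q. ip \<Omega> a (grad \<Omega> q))"
      using regular_vpol[OF \<Omega>_cell(1) grad_vpol[OF \<Omega>_cell(1)]]
      by (intro lin_on_ip_op[OF \<Omega>_cell(1) ra _ lin_on_grad[OF \<Omega>_cell(1)]])
    show "regular_on F (\<lambda>x. restr F b x * ext \<Omega> q x)" if "F \<in> faces T" "q \<in> pol \<Omega> (int k)" for F q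
      by (intro regular_on_mult rb that(1) regular_ext_pol[OF that(2) F_subset[OF that(1)]])
  qed (intro F_cell lin_on_ext_eval \<Omega>_cell; assumption)+
qed

text \<open>Gradients of test polynomials of degree k see only the projection on gradients of degree
  k - 1, and the face projections are tested against degree k; what remains is integration by parts
  for \<open>V\<close>.\<close>

lemma div_commutes:
  assumes v: "v \<in> RTN T k"
  shows "discrete_div T k (I_div T k (ext \<Omega> v)) = dvg \<Omega> v" and "dvg \<Omega> v \<in> pol \<Omega> (int k)"
proof -
  obtain V where V: "V \<in> vpolys (int k + 1)" "v = restr \<Omega> V" by (rule RTNE[OF v])
  show dv: "dvg \<Omega> v \<in> pol \<Omega> (int k)" using dvg_pol[OF \<Omega>_cell(1) V(1), of v] V(2) by simp
  have e: "ext \<Omega> v x = V x" if "x \<in> closure \<Omega>" for x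
    unfolding V(2) using that by (intro ext_\<Omega> vpolys_continuous[OF V(1)])
  have rv: "regular_on \<Omega> (ext \<Omega> v)" unfolding V(2) by (rule regular_ext[OF V(1) \<Omega>_subset])
  show "discrete_div T k (I_div T k (ext \<Omega> v)) = dvg \<Omega> v"
    unfolding discrete_div_def I_div_def prod.case
  proof (rule representer_eqI[OF fields_on_pol[OF \<Omega>_cell(1)] dv])
    fix q assume q: "q \<in> pol \<Omega> (int k)"
    then obtain p where p: "p \<in> polys (int k)" "q = restr \<Omega> p" by (rule polE)
    have gq: "grad \<Omega> q \<in> G\<^sub>T T (int k - 1)" using q by (simp add: G\<^sub>T_def)
    have gq': "grad \<Omega> q \<in> G\<^sub>T T (int k)" using gq G\<^sub>T_mono[of "int k - 1" "int k"] by auto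
    note p1 = proj_in[OF fields_G\<^sub>T rv, of "int k - 1"] and p2 = proj_in[OF fields_G\<^sub>T_perp rv, of "int k"]
    have "ip \<Omega> (\<lambda>x. proj \<Omega> (G\<^sub>T T (int k - 1)) (ext \<Omega> v) x + proj \<Omega> (G\<^sub>T_perp T (int k)) (ext \<Omega> v) x) (grad \<Omega> q) =
        ip \<Omega> (proj \<Omega> (G\<^sub>T T (int k - 1)) (ext \<Omega> v)) (grad \<Omega> q) + ip \<Omega> (proj \<Omega> (G\<^sub>T_perp T (int k)) (ext \<Omega> v)) (grad \<Omega> q)"
      by (rule ip_add_left[OF \<Omega>_cell(1) fields_onD(3)[OF fields_G\<^sub>T p1] fields_onD(3)[OF fields_G\<^sub>T_perp p2] fields_onD(3)[OF fields_G\<^sub>T gq]])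
    also have "ip \<Omega> (proj \<Omega> (G\<^sub>T_perp T (int k)) (ext \<Omega> v)) (grad \<Omega> q) = 0"
      using p2 gq' by (simp add: G\<^sub>T_perp_def orth_compl_def)
    also have "ip \<Omega> (proj \<Omega> (G\<^sub>T T (int k - 1)) (ext \<Omega> v)) (grad \<Omega> q) = ip \<Omega> (ext \<Omega> v) (grad \<Omega> q)"
      by (rule proj_ip[OF fields_G\<^sub>T rv gq])
    also have "\<dots> = integ \<Omega> (\<lambda>x. pgrad p x \<bullet> V x)"
      unfolding ip_def using e \<Omega>_subset grad_\<Omega>[OF p(1), of q] p(2)
      by (intro integ_cong) (simp add: subset_iff inner_commute)
    finally have 1: "ip \<Omega> (\<lambda>x. proj \<Omega> (G\<^sub>T T (int k - 1)) (ext \<Omega> v) x + proj \<Omega> (G\<^sub>T_perp T (int k)) (ext \<Omega> v) x) (grad \<Omega> q) =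
      integ \<Omega> (\<lambda>x. pgrad p x \<bullet> V x)" by simp
    have 2: "integ F (\<lambda>x. restr F (glue (faces T) (\<lambda>F. proj F (pol F (int k)) (restr F (\<lambda>x. ext \<Omega> v x \<bullet> normal T F)))) x * ext \<Omega> q x) =
        integ F (\<lambda>x. p x * (V x \<bullet> normal T F))" if F: "F \<in> faces T" for F
    proof -
      note cF = F_cell(1)[OF F]
      let ?f = "restr F (\<lambda>x. ext \<Omega> v x \<bullet> normal T F)"
      have rf: "regular_on F ?f" unfolding V(2)
        by (intro regular_on_restr regular_on_inner regular_on_const regular_ext[OF V(1) F_subset[OF F]])
      have "restr F (glue (faces T) (\<lambda>F. proj F (pol F (int k)) (restr F (\<lambda>x. ext \<Omega> v x \<bullet> normal T F)))) = proj F (pol F (int k)) ?f"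
        by (rule restr_glue[OF T_facts(2) disjoint_faces F]) (rule proj_pol[OF cF rf])
      moreover have eq: "ext \<Omega> q x = p x" if "x \<in> F" for x
        unfolding p(2) using F_subset[OF F] that by (intro ext_\<Omega> polys_continuous[OF p(1)]) auto
      ultimately have "integ F (\<lambda>x. restr F (glue (faces T) (\<lambda>F. proj F (pol F (int k)) (restr F (\<lambda>x. ext \<Omega> v x \<bullet> normal T F)))) x * ext \<Omega> q x) =
        ip F (proj F (pol F (int k)) ?f) (restr F p)"
        unfolding ip_def by (intro integ_cong) simp
      also have "\<dots> = ip F ?f (restr F p)" by (rule proj_ip[OF fields_on_pol[OF cF] rf polI[OF p(1)]])
      also have "\<dots> = integ F (\<lambda>x. p x * (V x \<bullet> normal T F))"
        unfolding ip_def using e F_subset[OF F] by (intro integ_cong) (simp add: subset_iff)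
      finally show ?thesis .
    qed
    have "ip \<Omega> (dvg \<Omega> v) q = integ \<Omega> (\<lambda>x. p x * dvg \<Omega> (restr \<Omega> V) x)"
      unfolding ip_def V(2) p(2) by (intro integ_cong) simp
    also have "\<dots> = (\<Sum>F\<in>faces T. \<omega>\<^sub>T T F * integ F (\<lambda>x. p x * (V x \<bullet> normal T F))) - integ \<Omega> (\<lambda>x. pgrad p x \<bullet> V x)"
      using integ_mult_dvg[OF \<Omega>_cell(1) p(1) V(1) divergence_\<Omega>] by (simp add: tang_\<Omega>)
    finally show "ip \<Omega> (dvg \<Omega> v) q =
       - ip \<Omega> (\<lambda>x. proj \<Omega> (G\<^sub>T T (int k - 1)) (ext \<Omega> v) x + proj \<Omega> (G\<^sub>T_perp T (int k)) (ext \<Omega> v) x) (grad \<Omega> q) +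
       (\<Sum>F\<in>faces T. \<omega>\<^sub>T T F * integ F (\<lambda>x. restr F (glue (faces T) (\<lambda>F. proj F (pol F (int k)) (restr F (\<lambda>x. ext \<Omega> v x \<bullet> normal T F)))) x * ext \<Omega> q x))"
      unfolding 1 using 2 by simp
  qed
qed

end

text \<open>Fields on the polyhedron are extended by zero, while the interpolators read values on
  faces, edges and vertices; hence they are applied to the continuous extension \<open>ext\<close>.
  The membership statements make the three equations those of a diagram between the given
  spaces.\<close>

theorem theorem26:
  fixes T :: element and k :: nat
    and \<gamma> :: "point set \<Rightarrow> sfield \<times> sfield \<Rightarrow> sfield"
  assumes "polyhedral T"
    and "\<And>F. F \<in> faces T \<Longrightarrow> scalar_trace T k F (\<gamma> F)"
  shows
    "grad (body T) \<in> pol (body T) (int k + 1) \<rightarrow> Nedelec T k \<and>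
     curl (body T) \<in> Nedelec T k \<rightarrow> RTN T k \<and>
     dvg (body T) \<in> RTN T k \<rightarrow> pol (body T) (int k) \<and>
     (\<lambda>q. I_grad T k (ext (body T) q)) \<in> pol (body T) (int k + 1) \<rightarrow> X_grad T k \<and>
     (\<lambda>v. I_curl T k (ext (body T) v)) \<in> Nedelec T k \<rightarrow> X_curl T k \<and>
     (\<lambda>v. I_div T k (ext (body T) v)) \<in> RTN T k \<rightarrow> X_div T k \<and>
     discrete_grad T k \<gamma> \<in> X_grad T k \<rightarrow> X_curl T k \<and>
     discrete_curl T k \<in> X_curl T k \<rightarrow> X_div T k \<and>
     discrete_div T k \<in> X_div T k \<rightarrow> pol (body T) (int k) \<and>
     (\<forall>q \<in> pol (body T) (int k + 1).
        discrete_grad T k \<gamma> (I_grad T k (ext (body T) q)) =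
        I_curl T k (ext (body T) (grad (body T) q))) \<and>
     (\<forall>v \<in> Nedelec T k.
        discrete_curl T k (I_curl T k (ext (body T) v)) =
        I_div T k (ext (body T) (curl (body T) v))) \<and>
     (\<forall>v \<in> RTN T k.
        discrete_div T k (I_div T k (ext (body T) v)) = id (dvg (body T) v))"
proof -
  interpret polyhedral_element T by unfold_locales (rule assms(1))
  have "grad \<Omega> q \<in> Nedelec T k" if "q \<in> pol \<Omega> (int k + 1)" for q
    using vpol_Nedelec grad_vpol[OF \<Omega>_cell(1) that] by simp
  moreover have "curl \<Omega> v \<in> RTN T k" if "v \<in> Nedelec T k" for v
    using vpol_RTN curl_Nedelec that by blast
  moreover have "I_grad T k (ext \<Omega> q) \<in> X_grad T k" if "q \<in> pol \<Omega> (int k + 1)" for q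
    using that I_grad_X_grad by (auto elim: polE)
  moreover have "discrete_grad T k \<gamma> (I_grad T k (ext \<Omega> q)) = I_curl T k (ext \<Omega> (grad \<Omega> q))"
    if "q \<in> pol \<Omega> (int k + 1)" for q
    using that grad_commutes assms(2) by (auto elim!: polE)
  moreover have "discrete_grad T k \<gamma> q \<in> X_curl T k" if "q \<in> X_grad T k" for q
    using discrete_grad_mem[OF that assms(2)] .
  ultimately show ?thesis
    using I_curl_mem I_div_mem discrete_curl_mem discrete_div_mem curl_commutes div_commutes by simp
qed

end
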